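(* Let $(x_{i,j},y_{i,j})$ ($i=1,\dots,m$, $j=1,\dots,n$) be i.i.d. samples with $x_{i,j}\in\mathcal X\subset\mathbb R^d$, $\sup_{x\in\mathcal X}\|x\|_2\le B<\infty$, $y_{i,j}\in\{-1,1\}$. Let $\gamma>0$, let $\varphi_p$ be the smoothed hinge loss defined in the context with $p=2+\log(1/\gamma)$ (where $p\ge3$ as required in the definition), let $$\ell(w)=\frac1{mn}\sum_{i=1}^m\sum_{j=1}^n\varphi_p(y_{i,j}w^Tx_{i,j})+\frac\gamma2\|w\|_2^2,$$ and let $f=\eta\ell$ with $\eta=\dfrac{(p-2)^2B^{2+\frac4{p-2}}}{4\gamma^{1+\frac2{p-2}}}$. Suppose the minimizer $w_\star$ of $f$ satisfies $\mathbb E[\|w_\star\|_2^2]\le D^2$ for some constant $D>0$. Then the total number $T$ of communication rounds required by DiSCO (see context), applied to $f$, to find an $\epsilon$-optimal solution ($f(\widehat w)-f(w_\star)\le\epsilon$) is bounded by $$\mathbb E[T]=\widetilde{\mathcal O}\left(\Bigl(\log(1/\epsilon)+\frac{B^3D}{\gamma n^{1/2}}\Bigr)\Bigl(1+\frac{Bd^{1/4}}{\gamma^{1/2}n^{1/4}}\Bigr)\right),$$ where the expectation is over the randomness in generating the i.i.d. data, and $\widetilde{\mathcal O}$ ignores numerical constants and logarithmic terms.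
   Context: Smoothed hinge loss, $p\ge3$: $$\varphi_p(t)=\begin{cases}\frac32-\frac{p-2}{p-1}-t,& t<-\frac{p-3}{p-1},\\ \frac32-\frac{p-2}{p-1}-t+\frac{(t+(p-3)/(p-1))^p}{p(p-1)},&-\frac{p-3}{p-1}\le t<1-\frac{p-3}{p-1},\\ \frac{p+1}{p(p-1)}-\frac t{p-1}+\frac12(1-t)^2,&1-\frac{p-3}{p-1}\le t<1,\\ \frac{(2-t)^p}{p(p-1)},&1\le t<2,\\ 0,&t\ge2.\end{cases}$$ Write $f=\frac1m\sum_if_i$ with $f_i(w)=\frac1n\sum_j\eta\varphi_p(y_{i,j}w^Tx_{i,j})+\frac\lambda2\|w\|_2^2$, $\lambda=\eta\gamma$. Constants: $V_0=\eta$, $G=\eta B$, $L=\eta(B^2+\gamma)$, $M=\eta(p-2)B^3$. DiSCO inputs: the precision $\epsilon$, $\rho=\frac{\sqrt6G}{\sqrt nD}$ and $\mu=\min\bigl\{L,\sqrt{32L^2d/n}\,\sqrt{\log(1+rM\sqrt{2n}/L)+\log(md/\delta)/d}\bigr\}$ with $r=\bigl(\frac{2V_0}\lambda+\frac{2G}\lambda\sqrt{2V_0/\lambda}\bigr)^{1/2}$ and $\delta=\frac{GD}{\sqrt n}\cdot\frac{\sqrt{\lambda/(4L)}}{4V_0+2G^2/\lambda}$. Setting: there are $m$ machines; $f_i$ can be evaluated only locally at machine $i$; machine 1 is the master. In one round of communication the master broadcasts a message of $O(d)$ bits to all machines, and every machine processes the message and sends a message of $O(d)$ bits back to the master, where these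 are aggregated (summed or averaged). $T$ counts all communication rounds (initialization plus all PCG calls). DiSCO algorithm. Input: parameters $\rho,\mu\ge0$ and precision $\epsilon>0$. Initialization (one round): $w_0=\frac1m\sum_{i=1}^m\widehat w_i$ with $\widehat w_i=\arg\min_w\{f_i(w)+\frac\rho2\|w\|_2^2\}$. Repeat for $k=0,1,2,\dots$: (1) run distributed PCG (below), given $w_k$ and $\mu$, to compute $v_k$ and $\delta_k$; (2) update $w_{k+1}=w_k-\frac1{1+\delta_k}v_k$; until $\delta_k\le(1-\beta)\sqrt\epsilon$. Output $\widehat w=w_{k+1}$. Distributed PCG at $w_k$: let $H=f''(w_k)$, $P=f_1''(w_k)+\mu I$, $\epsilon_k=\beta(\lambda/L)^{1/2}\|f'(w_k)\|_2$ with $\beta=1/20$. One round forms $f'(w_k)$. Set $v^{(0)}=0$, $r^{(0)}=f'(w_k)$, $s^{(0)}=P^{-1}r^{(0)}$, $u^{(0)}=s^{(0)}$. Repeat for $t=0,1,2,\dots$, each iteration using one round (to form $Hu^{(t)}$ and $Hv^{(t)}$): $\alpha_t=\frac{\langle r^{(t)},s^{(t)}\rangle}{\langle u^{(t)},Hu^{(t)}\rangle}$, $v^{(t+1)}=v^{(t)}+\alpha_tu^{(t)}$, $r^{(t+1)}=r^{(t)}-\alpha_tHu^{(t)}$, $s^{(t+1)}=P^{-1}r^{(t+1)}$, $\beta_t=\frac{\langle r^{(t+1)},s^{(t+1)}\rangle}{\langle r^{(t)},s^{(t)}\rangle}$, $u^{(t+1)}=s^{(t+1)}+\beta_tu^{(t)}$;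 until $\|r^{(t+1)}\|_2\le\epsilon_k$. Return $v_k=v^{(t+1)}$ and $\delta_k=\sqrt{v_k^THv_k}$.
   Formalization: The hidden constant may depend on an upper bound for B^{4/(p-2)} (a purely numerical constant is false); log(1/ε) is read as max(1, log(1/ε)); ε-optimality of the output is claimed for ε ≤ 1/e; a negative argument of the root in μ is set to 0; B > 0. *)

theory Defs
  imports
    "HOL-Probability.Probability"
    "Jordan_Normal_Form.Matrix"
    "Jordan_Normal_Form.Gauss_Jordan_Elimination"
begin

unbundle no vec_syntax

(* Vectors of R^d are elements of carrier_vec d in the type "real Matrix.vec", so that the
   dimension d is a term and constants can be quantified uniformly in d. *)

type_synonym rvec = "real Matrix.vec"
type_synonym rmat = "real Matrix.mat"

definition norm2 :: "rvec \<Rightarrow> real" where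
  "norm2 v = sqrt (v \<bullet> v)"

definition gradient :: "nat \<Rightarrow> (rvec \<Rightarrow> real) \<Rightarrow> rvec \<Rightarrow> rvec" where
  "gradient d F w = Matrix.vec d (\<lambda>k. deriv (\<lambda>t. F (w + t \<cdot>\<^sub>v unit_vec d k)) 0)"

definition hessian :: "nat \<Rightarrow> (rvec \<Rightarrow> real) \<Rightarrow> rvec \<Rightarrow> rmat" where
  "hessian d F w =
     Matrix.mat d d (\<lambda>(k, l). deriv (\<lambda>t. gradient d F (w + t \<cdot>\<^sub>v unit_vec d l) $ k) 0)"

(* The Borel sigma-algebra of R^d, transported to carrier_vec d by taking coordinates. *)
definition borel_vec :: "nat \<Rightarrow> rvec measure" where
  "borel_vec d =
     vimage_algebra (carrier_vec d) (\<lambda>v. \<lambda>k\<in>{..<d}. v $ k) (Pi\<^sub>M {..<d} (\<lambda>_. borel))"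


section \<open>Regularized empirical smoothed hinge loss\<close>

definition smoothed_hinge :: "real \<Rightarrow> real \<Rightarrow> real" where
  "smoothed_hinge p t =
    (if t < - ((p - 3) / (p - 1)) then 3/2 - (p - 2) / (p - 1) - t
     else if t < 1 - (p - 3) / (p - 1) then
       3/2 - (p - 2) / (p - 1) - t + (t + (p - 3) / (p - 1)) powr p / (p * (p - 1))
     else if t < 1 then (p + 1) / (p * (p - 1)) - t / (p - 1) + (1 - t)\<^sup>2 / 2
     else if t < 2 then (2 - t) powr p / (p * (p - 1))
     else 0)"

(* z (i, j) = (x_ij, y_ij); machines and samples are numbered from 0. *)
type_synonym dataset = "nat \<times> nat \<Rightarrow> rvec \<times> real"

definition emp_loss :: "nat \<Rightarrow> nat \<Rightarrow> real \<Rightarrow> real \<Rightarrow> dataset \<Rightarrow> rvec \<Rightarrow> real" where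
  "emp_loss m n p \<gamma> z w =
     1 / (real m * real n) *
       (\<Sum>i<m. \<Sum>j<n. smoothed_hinge p (snd (z (i, j)) * (w \<bullet> fst (z (i, j)))))
     + \<gamma> / 2 * (norm2 w)\<^sup>2"

definition local_loss ::
    "nat \<Rightarrow> real \<Rightarrow> real \<Rightarrow> real \<Rightarrow> dataset \<Rightarrow> nat \<Rightarrow> rvec \<Rightarrow> real" where
  "local_loss n p \<eta> lam z i w =
     1 / real n * (\<Sum>j<n. \<eta> * smoothed_hinge p (snd (z (i, j)) * (w \<bullet> fst (z (i, j)))))
     + lam / 2 * (norm2 w)\<^sup>2"


section \<open>Preconditioned conjugate gradient\<close>

(* H is the matrix of the system, Q the inverse of the preconditioner, g the right-hand side;
   the state is (v, r, s, u). *)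
primrec pcg :: "rmat \<Rightarrow> rmat \<Rightarrow> rvec \<Rightarrow> nat \<Rightarrow> rvec \<times> rvec \<times> rvec \<times> rvec" where
  "pcg H Q g 0 = (0\<^sub>v (dim_vec g), g, Q *\<^sub>v g, Q *\<^sub>v g)"
| "pcg H Q g (Suc t) =
    (let (v, r, s, u) = pcg H Q g t;
         \<alpha> = (r \<bullet> s) / (u \<bullet> (H *\<^sub>v u));
         v' = v + \<alpha> \<cdot>\<^sub>v u;
         r' = r - \<alpha> \<cdot>\<^sub>v (H *\<^sub>v u);
         s' = Q *\<^sub>v r';
         \<beta> = (r' \<bullet> s') / (r \<bullet> s);
         u' = s' + \<beta> \<cdot>\<^sub>v u
     in (v', r', s', u'))"

definition pcg_sol :: "rmat \<Rightarrow> rmat \<Rightarrow> rvec \<Rightarrow> nat \<Rightarrow> rvec" where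
  "pcg_sol H Q g t = fst (pcg H Q g t)"

definition pcg_res :: "rmat \<Rightarrow> rmat \<Rightarrow> rvec \<Rightarrow> nat \<Rightarrow> rvec" where
  "pcg_res H Q g t = fst (snd (pcg H Q g t))"

definition pcg_stops :: "rmat \<Rightarrow> rmat \<Rightarrow> rvec \<Rightarrow> real \<Rightarrow> nat \<Rightarrow> bool" where
  "pcg_stops H Q g tol t \<longleftrightarrow> norm2 (pcg_res H Q g (Suc t)) \<le> tol"


section \<open>DiSCO\<close>

(* F i is the objective held by machine i; machine 0 is the master. *)

definition average :: "nat \<Rightarrow> (nat \<Rightarrow> rvec \<Rightarrow> real) \<Rightarrow> rvec \<Rightarrow> real" where
  "average m F w = 1 / real m * (\<Sum>i<m. F i w)"

definition disco_beta :: real where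
  "disco_beta = 1 / 20"

definition disco_hess :: "nat \<Rightarrow> nat \<Rightarrow> (nat \<Rightarrow> rvec \<Rightarrow> real) \<Rightarrow> rvec \<Rightarrow> rmat" where
  "disco_hess d m F w = hessian d (average m F) w"

definition disco_precond_inv ::
    "nat \<Rightarrow> (nat \<Rightarrow> rvec \<Rightarrow> real) \<Rightarrow> real \<Rightarrow> rvec \<Rightarrow> rmat" where
  "disco_precond_inv d F \<mu> w = the (mat_inverse (hessian d (F 0) w + \<mu> \<cdot>\<^sub>m 1\<^sub>m d))"

definition disco_pcg_stops ::
    "nat \<Rightarrow> nat \<Rightarrow> (nat \<Rightarrow> rvec \<Rightarrow> real) \<Rightarrow> real \<Rightarrow> real \<Rightarrow> real \<Rightarrow> rvec \<Rightarrow> nat \<Rightarrow> bool" where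
  "disco_pcg_stops d m F \<mu> lam L w t \<longleftrightarrow>
     pcg_stops (disco_hess d m F w) (disco_precond_inv d F \<mu> w) (gradient d (average m F) w)
       (disco_beta * sqrt (lam / L) * norm2 (gradient d (average m F) w)) t"

(* One round for the gradient and one per iteration t = 0, ..., t*, where t* is the first
   iteration after which the stopping test holds; infinite if there is none. *)
definition disco_pcg_rounds ::
    "nat \<Rightarrow> nat \<Rightarrow> (nat \<Rightarrow> rvec \<Rightarrow> real) \<Rightarrow> real \<Rightarrow> real \<Rightarrow> real \<Rightarrow> rvec \<Rightarrow> enat" where
  "disco_pcg_rounds d m F \<mu> lam L w =
     (if \<exists>t. disco_pcg_stops d m F \<mu> lam L w t
      then enat (1 + Suc (LEAST t. disco_pcg_stops d m F \<mu> lam L w t)) else \<infinity>)"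

definition disco_dir ::
    "nat \<Rightarrow> nat \<Rightarrow> (nat \<Rightarrow> rvec \<Rightarrow> real) \<Rightarrow> real \<Rightarrow> real \<Rightarrow> real \<Rightarrow> rvec \<Rightarrow> rvec" where
  "disco_dir d m F \<mu> lam L w =
     pcg_sol (disco_hess d m F w) (disco_precond_inv d F \<mu> w) (gradient d (average m F) w)
       (Suc (LEAST t. disco_pcg_stops d m F \<mu> lam L w t))"

definition disco_decr ::
    "nat \<Rightarrow> nat \<Rightarrow> (nat \<Rightarrow> rvec \<Rightarrow> real) \<Rightarrow> real \<Rightarrow> real \<Rightarrow> real \<Rightarrow> rvec \<Rightarrow> real" where
  "disco_decr d m F \<mu> lam L w =
     sqrt (disco_dir d m F \<mu> lam L w \<bullet> (disco_hess d m F w *\<^sub>v disco_dir d m F \<mu> lam L w))"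

definition disco_init :: "nat \<Rightarrow> nat \<Rightarrow> (nat \<Rightarrow> rvec \<Rightarrow> real) \<Rightarrow> real \<Rightarrow> rvec" where
  "disco_init d m F \<rho> = Matrix.vec d (\<lambda>k. 1 / real m *
     (\<Sum>i<m. arg_min_on (\<lambda>w. F i w + \<rho> / 2 * (norm2 w)\<^sup>2) (carrier_vec d) $ k))"

primrec disco_iter ::
    "nat \<Rightarrow> nat \<Rightarrow> (nat \<Rightarrow> rvec \<Rightarrow> real) \<Rightarrow> real \<Rightarrow> real \<Rightarrow> real \<Rightarrow> real \<Rightarrow> nat \<Rightarrow> rvec" where
  "disco_iter d m F \<rho> \<mu> lam L 0 = disco_init d m F \<rho>"
| "disco_iter d m F \<rho> \<mu> lam L (Suc k) =
    (let w = disco_iter d m F \<rho> \<mu> lam L k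
     in w - (1 / (1 + disco_decr d m F \<mu> lam L w)) \<cdot>\<^sub>v disco_dir d m F \<mu> lam L w)"

definition disco_stops ::
    "nat \<Rightarrow> nat \<Rightarrow> (nat \<Rightarrow> rvec \<Rightarrow> real) \<Rightarrow> real \<Rightarrow> real \<Rightarrow> real \<Rightarrow> real \<Rightarrow> real \<Rightarrow> nat \<Rightarrow> bool" where
  "disco_stops d m F \<rho> \<mu> lam L \<epsilon> k \<longleftrightarrow>
     disco_decr d m F \<mu> lam L (disco_iter d m F \<rho> \<mu> lam L k) \<le> (1 - disco_beta) * sqrt \<epsilon>"

definition disco_output ::
    "nat \<Rightarrow> nat \<Rightarrow> (nat \<Rightarrow> rvec \<Rightarrow> real) \<Rightarrow> real \<Rightarrow> real \<Rightarrow> real \<Rightarrow> real \<Rightarrow> real \<Rightarrow> rvec" where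
  "disco_output d m F \<rho> \<mu> lam L \<epsilon> =
     disco_iter d m F \<rho> \<mu> lam L (Suc (LEAST k. disco_stops d m F \<rho> \<mu> lam L \<epsilon> k))"

(* Total number of communication rounds; infinite if the outer loop or one of the executed
   inner loops does not terminate. *)
definition disco_rounds ::
    "nat \<Rightarrow> nat \<Rightarrow> (nat \<Rightarrow> rvec \<Rightarrow> real) \<Rightarrow> real \<Rightarrow> real \<Rightarrow> real \<Rightarrow> real \<Rightarrow> real \<Rightarrow> enat" where
  "disco_rounds d m F \<rho> \<mu> lam L \<epsilon> =
     (if \<exists>k. disco_stops d m F \<rho> \<mu> lam L \<epsilon> k
      then 1 + (\<Sum>k\<le>(LEAST k. disco_stops d m F \<rho> \<mu> lam L \<epsilon> k).
                  disco_pcg_rounds d m F \<mu> lam L (disco_iter d m F \<rho> \<mu> lam L k))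
      else \<infinity>)"


section \<open>Choice of the parameters\<close>

definition disco_rho :: "nat \<Rightarrow> real \<Rightarrow> real \<Rightarrow> real" where
  "disco_rho n G D = sqrt 6 * G / (sqrt (real n) * D)"

definition disco_radius :: "real \<Rightarrow> real \<Rightarrow> real \<Rightarrow> real" where
  "disco_radius V0 G lam = sqrt (2 * V0 / lam + 2 * G / lam * sqrt (2 * V0 / lam))"

definition disco_delta :: "nat \<Rightarrow> real \<Rightarrow> real \<Rightarrow> real \<Rightarrow> real \<Rightarrow> real \<Rightarrow> real" where
  "disco_delta n V0 G L lam D =
     G * D / sqrt (real n) * (sqrt (lam / (4 * L)) / (4 * V0 + 2 * G\<^sup>2 / lam))"

(* The argument of the square root can be negative only for delta > 1, i.e. very large D;
   clipping it at 0 keeps the input mu of the algorithm nonnegative in that case. *)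
definition disco_mu :: "nat \<Rightarrow> nat \<Rightarrow> nat \<Rightarrow> real \<Rightarrow> real \<Rightarrow> real \<Rightarrow> real \<Rightarrow> real" where
  "disco_mu d m n L M r \<delta> =
     min L (sqrt (32 * L\<^sup>2 * real d / real n) *
            sqrt (max 0 (ln (1 + r * M * sqrt (2 * real n) / L)
                         + ln (real m * real d / \<delta>) / real d)))"

(* Total size of the logarithms of the problem parameters, deliberately without the
   precision, whose logarithm appears explicitly in the bound. A soft-O bound is stated as a
   constant times a fixed power of this quantity times the main term. The scaling eta contains
   the factor B powr (4 / (p - 2)), which is neither polylogarithmic nor bounded uniformly over
   all (B, gamma); the constant may depend on an upper bound for this factor. *)
definition log_terms :: "nat \<Rightarrow> nat \<Rightarrow> nat \<Rightarrow> real \<Rightarrow> real \<Rightarrow> real \<Rightarrow> real" where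
  "log_terms d m n B \<gamma> D =
     1 + ln (real d) + ln (real m) + ln (real n) + \<bar>ln B\<bar> + \<bar>ln \<gamma>\<bar> + \<bar>ln D\<bar>"

end

theory Submission imports Defs "Jordan_Normal_Form.Determinant" begin

text \<open>
  The factor \<open>\<eta>\<close> makes the loss standard self-concordant, so that an inexact damped Newton method
  with relative accuracy \<open>1/20\<close> stops after \<open>O(\<Delta> + ln (1/\<epsilon>))\<close> steps, where \<open>\<Delta>\<close> is the initial
  suboptimality. Exchanging a sample of one machine with a sample of another shows that the averaged
  local minimizers satisfy \<open>E \<Delta> = O(\<rho> D\<^sup>2 + \<eta>\<^sup>2 B\<^sup>2 / (n \<rho>))\<close>. A Newton step costs as many
  rounds as conjugate gradients need, which is governed by the condition number of the
  preconditioned Hessian. By Hoeffding's inequality on a grid, the local and the global Hessian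
  differ by \<open>O(\<mu>)\<close>, uniformly over a ball containing all iterates, outside an event of probability
  \<open>O((B\<^sup>2 / \<gamma>) powr - 4)\<close>; there the condition number is \<open>O(1 + \<mu> / \<lambda>)\<close> up to logarithms. On the
  exceptional event the crude bounds on \<open>\<Delta>\<close> and on the condition number, polynomial in \<open>B\<^sup>2 / \<gamma>\<close>,
  are absorbed by the probability.
\<close>

text \<open>The main obstacle is that the prescribed \<open>\<mu>\<close> need not dominate the
  deviation of the local Hessian: for very large \<open>D\<close> the logarithm inside it is
  negative and the clipped value may vanish. The proof fixes its own deviation level
  \<open>\<sigma>\<close> and separates three regimes, with \<open>\<kappa> = B^2 / \<gamma>\<close>
  and \<open>A\<close> the quantity under the second square root of \<open>\<mu>\<close>. If
  \<open>\<kappa> < 1\<close>, the crude condition number suffices. If \<open>A < 1/4\<close>, the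
  dimension is logarithmic in the parameters and finite termination of conjugate gradients suffices.
  Otherwise \<open>\<mu>\<close> is at least \<open>L * min 1 \<theta>\<close>, which absorbs the
  deviation up to the factor \<open>2 * t + 4\<close>. The second obstacle is smoothness: the second
  derivative of the loss is only Lipschitz, so self-concordance is expressed as a Lipschitz bound on
  the reciprocal local norm along lines and obtained by integrating across finitely many
  breakpoints.\<close>

unbundle no inner_syntax

section \<open>Preconditioned conjugate gradient\<close>

locale rvec_space =
  fixes d :: nat
begin

abbreviation V :: "rvec set" where "V \<equiv> carrier_vec d"

lemma dimV [simp]: "x \<in> V \<Longrightarrow> dim_vec x = d"
  by (rule carrier_vecD)

lemma dim_rowV [simp]: "A \<in> carrier_mat d d \<Longrightarrow> dim_row A = d"
  by (rule carrier_matD)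

lemma vecV_eqI: "x \<in> V \<Longrightarrow> y \<in> V \<Longrightarrow> (\<And>i. i < d \<Longrightarrow> x $ i = y $ i) \<Longrightarrow> x = y"
  by (intro eq_vecI) auto

lemma ip_add_right [simp]: "x \<in> V \<Longrightarrow> y \<in> V \<Longrightarrow> z \<in> V \<Longrightarrow> x \<bullet> (y + z) = x \<bullet> y + x \<bullet> z"
  by (rule scalar_prod_add_distrib)

lemma ip_add_left [simp]: "x \<in> V \<Longrightarrow> y \<in> V \<Longrightarrow> z \<in> V \<Longrightarrow> (x + y) \<bullet> z = x \<bullet> z + y \<bullet> z"
  by (rule add_scalar_prod_distrib)

lemma ip_minus_right [simp]: "x \<in> V \<Longrightarrow> y \<in> V \<Longrightarrow> z \<in> V \<Longrightarrow> x \<bullet> (y - z) = x \<bullet> y - x \<bullet> z"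
  by (rule scalar_prod_minus_distrib)

lemma ip_minus_left [simp]: "x \<in> V \<Longrightarrow> y \<in> V \<Longrightarrow> z \<in> V \<Longrightarrow> (x - y) \<bullet> z = x \<bullet> z - y \<bullet> z"
  by (rule minus_scalar_prod_distrib)

lemma ip_comm: "x \<in> V \<Longrightarrow> y \<in> V \<Longrightarrow> x \<bullet> y = y \<bullet> x"
  by (rule comm_scalar_prod)

lemma ip_sum: "x \<in> V \<Longrightarrow> y \<in> V \<Longrightarrow> x \<bullet> y = (\<Sum>k<d. x $ k * y $ k)"
  by (simp add: scalar_prod_def atLeast0LessThan)

lemma ip_ge_0 [simp]: "x \<in> V \<Longrightarrow> 0 \<le> x \<bullet> x"
  by (simp add: ip_sum sum_nonneg)

lemma ip_eq_0 [simp]: "x \<in> V \<Longrightarrow> x \<bullet> x = 0 \<longleftrightarrow> x = 0\<^sub>v d"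
  by (auto simp: ip_sum sum_nonneg_eq_0_iff intro!: eq_vecI)

lemma norm2_sq: "x \<in> V \<Longrightarrow> (norm2 x)\<^sup>2 = x \<bullet> x"
  by (simp add: norm2_def)

lemma norm2_ge_0 [simp]: "x \<in> V \<Longrightarrow> 0 \<le> norm2 x"
  by (simp add: norm2_def)

lemma norm2_smult: "x \<in> V \<Longrightarrow> norm2 (c \<cdot>\<^sub>v x) = \<bar>c\<bar> * norm2 x"
  by (simp add: norm2_def real_sqrt_mult mult.assoc[symmetric])

lemma cauchy_schwarz_sq: "x \<in> V \<Longrightarrow> y \<in> V \<Longrightarrow> (x \<bullet> y)\<^sup>2 \<le> (x \<bullet> x) * (y \<bullet> y)"
  using Cauchy_Schwarz_ineq_sum[of "\<lambda>k. x $ k" "\<lambda>k. y $ k" "{..<d}"]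
  by (simp add: ip_sum power2_eq_square)

lemma cauchy_schwarz: "x \<in> V \<Longrightarrow> y \<in> V \<Longrightarrow> \<bar>x \<bullet> y\<bar> \<le> norm2 x * norm2 y"
  using cauchy_schwarz_sq[of x y]
  by - (rule power2_le_imp_le, auto simp: power_mult_distrib norm2_sq)

lemma mv_carrier [simp]: "A \<in> carrier_mat d d \<Longrightarrow> A *\<^sub>v x \<in> V"
  by (rule carrier_vecI) (metis carrier_matD(1) dim_mult_mat_vec)

lemma mv_add [simp]:
  "A \<in> carrier_mat d d \<Longrightarrow> x \<in> V \<Longrightarrow> y \<in> V \<Longrightarrow> A *\<^sub>v (x + y) = A *\<^sub>v x + A *\<^sub>v y"
  by (rule mult_add_distrib_mat_vec)

lemma mv_minus [simp]:
  "A \<in> carrier_mat d d \<Longrightarrow> x \<in> V \<Longrightarrow> y \<in> V \<Longrightarrow> A *\<^sub>v (x - y) = A *\<^sub>v x - A *\<^sub>v y"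
  by (rule mult_minus_distrib_mat_vec)

lemma mv_smult [simp]:
  "A \<in> carrier_mat d d \<Longrightarrow> x \<in> V \<Longrightarrow> A *\<^sub>v (c \<cdot>\<^sub>v x) = c \<cdot>\<^sub>v (A *\<^sub>v x)"
  by (rule mult_mat_vec)

lemma mv_zero [simp]: "(A :: rmat) \<in> carrier_mat d d \<Longrightarrow> A *\<^sub>v 0\<^sub>v d = 0\<^sub>v d"
  by (intro vecV_eqI) auto

end

section \<open>Symmetric positive definite matrices\<close>

locale spd = rvec_space +
  fixes A :: rmat
  assumes A_carrier [simp]: "A \<in> carrier_mat d d"
    and A_sym: "\<And>x y. x \<in> V \<Longrightarrow> y \<in> V \<Longrightarrow> x \<bullet> (A *\<^sub>v y) = y \<bullet> (A *\<^sub>v x)"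
    and A_pos: "\<And>x. x \<in> V \<Longrightarrow> x \<noteq> 0\<^sub>v d \<Longrightarrow> 0 < x \<bullet> (A *\<^sub>v x)"
begin

lemma A_nonneg [simp]: "x \<in> V \<Longrightarrow> 0 \<le> x \<bullet> (A *\<^sub>v x)"
  using A_pos[of x] by (cases "x = 0\<^sub>v d") (auto simp: less_imp_le)

text \<open>The algorithm applies \<open>the\<close> to \<open>mat_inverse\<close>, so the option
  must be known to be \<open>Some\<close>. A kernel vector would contradict \<open>A_pos\<close>,
  hence the determinant is nonzero.\<close>

lemma inverse_some:
  obtains B where "mat_inverse A = Some B" "B \<in> carrier_mat d d" "A * B = 1\<^sub>m d" "B * A = 1\<^sub>m d"
proof -
  have "Determinant.det A \<noteq> 0"
    using A_pos by (force simp: det_0_iff_vec_prod_zero_field[OF A_carrier])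
  hence "A \<in> Units (ring_mat TYPE(real) d ())"
    by (rule det_non_zero_imp_unit[OF A_carrier])
  hence "mat_inverse A \<noteq> None"
    using mat_inverse(1)[OF A_carrier, where b = "()"] by blast
  then obtain B where "mat_inverse A = Some B" by blast
  with mat_inverse(2)[OF A_carrier this] show thesis using that by blast
qed

lemma quad_cauchy_schwarz:
  assumes "x \<in> V" "y \<in> V"
  shows "(x \<bullet> (A *\<^sub>v y))\<^sup>2 \<le> (x \<bullet> (A *\<^sub>v x)) * (y \<bullet> (A *\<^sub>v y))"
proof (cases "y = 0\<^sub>v d")
  case True thus ?thesis using assms by simp
next
  case False
  define c where "c = x \<bullet> (A *\<^sub>v y)"
  define Y where "Y = y \<bullet> (A *\<^sub>v y)"
  have Y: "Y > 0" unfolding Y_def using A_pos assms False by simp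
  \<comment> \<open>The usual minimizing combination multiplied by \<open>Y\<close>, so that no
    division occurs before the last line.\<close>
  have "0 \<le> (Y \<cdot>\<^sub>v x - c \<cdot>\<^sub>v y) \<bullet> (A *\<^sub>v (Y \<cdot>\<^sub>v x - c \<cdot>\<^sub>v y))"
    using assms by (intro A_nonneg) auto
  also have "\<dots> = Y * (Y * (x \<bullet> (A *\<^sub>v x)) - c\<^sup>2)"
    using assms A_sym[of y x]
    by (simp add: Y_def[symmetric] c_def[symmetric] algebra_simps power2_eq_square)
  finally show ?thesis using Y by (simp add: zero_le_mult_iff c_def Y_def mult.commute)
qed

text \<open>Cauchy-Schwarz in the form of \<open>A\<close>, applied to the pair \<open>A x\<close>,
  \<open>x\<close>, has the square of \<open>|A x|^2\<close> on its left; the form at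
  \<open>A x\<close> on its right is at most \<open>l |A x|^2\<close>, and one factor
  cancels.\<close>

lemma norm_mv_le:
  assumes le: "\<And>x. x \<in> V \<Longrightarrow> x \<bullet> (A *\<^sub>v x) \<le> l * (x \<bullet> x)" and x: "x \<in> V"
  shows "(A *\<^sub>v x) \<bullet> (A *\<^sub>v x) \<le> l * (x \<bullet> (A *\<^sub>v x))"
proof -
  let ?y = "A *\<^sub>v x"
  have y: "?y \<in> V" by simp
  have "(?y \<bullet> ?y)\<^sup>2 \<le> (?y \<bullet> (A *\<^sub>v ?y)) * (x \<bullet> (A *\<^sub>v x))"
    using quad_cauchy_schwarz[OF y x] by simp
  also have "\<dots> \<le> (l * (?y \<bullet> ?y)) * (x \<bullet> (A *\<^sub>v x))"
    using le[OF y] x by (intro mult_right_mono) auto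
  finally have "(?y \<bullet> ?y) * (?y \<bullet> ?y) \<le> (?y \<bullet> ?y) * (l * (x \<bullet> (A *\<^sub>v x)))"
    by (simp add: power2_eq_square mult_ac)
  moreover have "0 \<le> ?y \<bullet> ?y" using y by (rule ip_ge_0)
  moreover have "0 \<le> l * (x \<bullet> (A *\<^sub>v x))" if "?y \<bullet> ?y = 0"
    using that y by simp (use x in simp)
  ultimately show ?thesis by (cases "?y \<bullet> ?y = 0") auto
qed

end

section \<open>Krylov spaces and finite termination\<close>

locale pcg_system = rvec_space +
  fixes H P Q :: rmat and g vs :: rvec
  assumes H: "spd d H" and P: "spd d P" and Q [simp]: "Q \<in> carrier_mat d d"
    and PQ: "\<And>x. x \<in> V \<Longrightarrow> P *\<^sub>v (Q *\<^sub>v x) = x"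
    and g [simp]: "g \<in> V" and vs [simp]: "vs \<in> V" and H_vs: "H *\<^sub>v vs = g"
begin

sublocale H: spd d H by (rule H)
sublocale P: spd d P by (rule P)

definition v where "v t = fst (pcg H Q g t)"
definition r where "r t = fst (snd (pcg H Q g t))"
definition s where "s t = fst (snd (snd (pcg H Q g t)))"
definition u where "u t = snd (snd (snd (pcg H Q g t)))"
definition al where "al t = (r t \<bullet> s t) / (u t \<bullet> (H *\<^sub>v u t))"
definition be where "be t = (r (Suc t) \<bullet> s (Suc t)) / (r t \<bullet> s t)"

lemma pcg_0: "v 0 = 0\<^sub>v d" "r 0 = g" "s 0 = Q *\<^sub>v g" "u 0 = Q *\<^sub>v g"
  using g by (auto simp: v_def r_def s_def u_def)

lemma pcg_Suc:
  "v (Suc t) = v t + al t \<cdot>\<^sub>v u t"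
  "r (Suc t) = r t - al t \<cdot>\<^sub>v (H *\<^sub>v u t)"
  "s (Suc t) = Q *\<^sub>v r (Suc t)"
  "u (Suc t) = s (Suc t) + be t \<cdot>\<^sub>v u t"
proof -
  obtain v' r' s' u' where t: "pcg H Q g t = (v', r', s', u')" by (cases "pcg H Q g t")
  have al: "al t = (r' \<bullet> s') / (u' \<bullet> (H *\<^sub>v u'))" by (simp add: al_def r_def s_def u_def t)
  have Suc: "pcg H Q g (Suc t) = (let r'' = r' - al t \<cdot>\<^sub>v (H *\<^sub>v u'); s'' = Q *\<^sub>v r''
    in (v' + al t \<cdot>\<^sub>v u', r'', s'', s'' + ((r'' \<bullet> s'') / (r' \<bullet> s')) \<cdot>\<^sub>v u'))"
    unfolding pcg.simps t al by (simp only: Let_def prod.case)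
  show "v (Suc t) = v t + al t \<cdot>\<^sub>v u t" "r (Suc t) = r t - al t \<cdot>\<^sub>v (H *\<^sub>v u t)"
    "s (Suc t) = Q *\<^sub>v r (Suc t)"
    by (simp_all only: v_def r_def s_def u_def Suc Let_def fst_conv snd_conv t)
  show "u (Suc t) = s (Suc t) + be t \<cdot>\<^sub>v u t"
    by (simp only: be_def r_def s_def u_def Suc Let_def fst_conv snd_conv t)
qed

lemma s_eq: "s t = Q *\<^sub>v r t"
  by (cases t) (simp_all add: pcg_0 pcg_Suc)

lemma pcg_carrier [simp]: "v t \<in> V" "r t \<in> V" "s t \<in> V" "u t \<in> V"
proof -
  have "v t \<in> V \<and> r t \<in> V \<and> u t \<in> V"
    by (induction t) (auto simp: pcg_0 pcg_Suc)
  thus "v t \<in> V" "r t \<in> V" "s t \<in> V" "u t \<in> V" by (auto simp: s_eq)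
qed

lemma r_eq: "r t = g - H *\<^sub>v v t"
proof (induction t)
  case 0 show ?case by (intro vecV_eqI) (auto simp: pcg_0)
next
  case (Suc t)
  have "r (Suc t) = (g - H *\<^sub>v v t) - al t \<cdot>\<^sub>v (H *\<^sub>v u t)" by (simp add: pcg_Suc Suc)
  also have "\<dots> = g - H *\<^sub>v v (Suc t)"
    by (simp add: pcg_Suc) (intro vecV_eqI, auto)
  finally show ?case .
qed

text \<open>\<open>Q\<close> is only assumed to be a right inverse of \<open>P\<close>; writing both
  vectors as images under \<open>P\<close> transfers symmetry from \<open>P\<close> to
  \<open>Q\<close>, and \<open>Q_pos\<close> transfers definiteness in the same way.\<close>

lemma Q_sym: "x \<in> V \<Longrightarrow> y \<in> V \<Longrightarrow> x \<bullet> (Q *\<^sub>v y) = y \<bullet> (Q *\<^sub>v x)"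
  using P.A_sym[of "Q *\<^sub>v x" "Q *\<^sub>v y"] by (simp add: PQ ip_comm[of y] ip_comm[of x])

lemma Q_pos: "x \<in> V \<Longrightarrow> x \<noteq> 0\<^sub>v d \<Longrightarrow> 0 < x \<bullet> (Q *\<^sub>v x)"
  using P.A_pos[of "Q *\<^sub>v x"] PQ[of x] by (cases "Q *\<^sub>v x = 0\<^sub>v d") (auto simp: ip_comm[of x])

text \<open>The span of the first \<open>t\<close> search directions. Adding one direction at a time
  lets every statement about it be proved by peeling off the newest direction.\<close>

primrec Kry :: "nat \<Rightarrow> rvec set" where
  "Kry 0 = {0\<^sub>v d}"
| "Kry (Suc t) = {k + c \<cdot>\<^sub>v u t | k c. k \<in> Kry t}"

declare Kry.simps(2) [simp del]

lemma Kry_SucI: "k \<in> Kry t \<Longrightarrow> k + c \<cdot>\<^sub>v u t \<in> Kry (Suc t)"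
  by (auto simp: Kry.simps(2))

lemma Kry_SucE:
  assumes "k \<in> Kry (Suc t)"
  obtains k' c where "k = k' + c \<cdot>\<^sub>v u t" "k' \<in> Kry t"
  using assms by (auto simp: Kry.simps(2))

lemma Kry_carrier: "k \<in> Kry t \<Longrightarrow> k \<in> V"
  by (induction t arbitrary: k) (auto elim!: Kry_SucE)

lemma Kry_mono: "Kry t \<subseteq> Kry (Suc t)"
proof
  fix k assume k: "k \<in> Kry t"
  hence "k = k + 0 \<cdot>\<^sub>v u t" using Kry_carrier[OF k] by (intro vecV_eqI) auto
  with k show "k \<in> Kry (Suc t)" using Kry_SucI[OF k, of 0] by simp
qed

lemma Kry_mono': "t \<le> t' \<Longrightarrow> Kry t \<subseteq> Kry t'"
  by (rule lift_Suc_mono_le[of Kry, OF Kry_mono])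

lemma u_in_Kry: "u t \<in> Kry (Suc t)"
proof -
  have "0\<^sub>v d \<in> Kry t" using Kry_mono'[of 0 t] by simp
  moreover have "u t = 0\<^sub>v d + 1 \<cdot>\<^sub>v u t" by (intro vecV_eqI) (auto)
  ultimately show ?thesis using Kry_SucI[of "0\<^sub>v d" t 1] by simp
qed

lemma Kry_zero: "0\<^sub>v d \<in> Kry t"
  using Kry_mono'[of 0 t] by auto

lemma Kry_add: "k \<in> Kry t \<Longrightarrow> l \<in> Kry t \<Longrightarrow> k + l \<in> Kry t"
proof (induction t arbitrary: k l)
  case (Suc t)
  obtain k' c where k: "k = k' + c \<cdot>\<^sub>v u t" "k' \<in> Kry t" using Suc.prems(1) by (rule Kry_SucE)
  obtain l' c' where l: "l = l' + c' \<cdot>\<^sub>v u t" "l' \<in> Kry t" using Suc.prems(2) by (rule Kry_SucE)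
  have "k + l = (k' + l') + (c + c') \<cdot>\<^sub>v u t"
    using Kry_carrier[OF k(2)] Kry_carrier[OF l(2)]
    by (intro vecV_eqI) (auto simp: k l algebra_simps)
  moreover have "k' + l' \<in> Kry t" using Suc.IH k l by blast
  ultimately show ?case using Kry_SucI by simp
qed auto

lemma Kry_smult: "k \<in> Kry t \<Longrightarrow> a \<cdot>\<^sub>v k \<in> Kry t"
proof (induction t arbitrary: k)
  case (Suc t)
  from Suc.prems obtain k' c where k: "k = k' + c \<cdot>\<^sub>v u t" "k' \<in> Kry t" by (rule Kry_SucE)
  have "a \<cdot>\<^sub>v k = (a \<cdot>\<^sub>v k') + (a * c) \<cdot>\<^sub>v u t"
    using Kry_carrier[OF k(2)] by (intro vecV_eqI) (auto simp: k algebra_simps)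
  moreover have "a \<cdot>\<^sub>v k' \<in> Kry t" using Suc.IH k by blast
  ultimately show ?case using Kry_SucI by simp
qed auto

lemma Kry_minus: "k \<in> Kry t \<Longrightarrow> l \<in> Kry t \<Longrightarrow> k - l \<in> Kry t"
proof -
  assume k: "k \<in> Kry t" and l: "l \<in> Kry t"
  have "k - l = k + (-1) \<cdot>\<^sub>v l" using Kry_carrier[OF k] Kry_carrier[OF l] by (intro vecV_eqI) auto
  thus ?thesis using Kry_add[OF k Kry_smult[OF l]] by simp
qed

lemma s_in_Kry: "s t \<in> Kry (Suc t)"
proof (cases t)
  case 0 thus ?thesis using u_in_Kry[of 0] by (simp add: pcg_0)
next
  case (Suc t')
  have "s t = u t - be t' \<cdot>\<^sub>v u t'" unfolding Suc by (simp add: pcg_Suc(4)) (intro vecV_eqI, auto)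
  moreover have "u t' \<in> Kry (Suc t)" using u_in_Kry[of t'] Kry_mono[of t] Suc by auto
  ultimately show ?thesis using Kry_minus[OF u_in_Kry Kry_smult] by simp
qed

lemma v_in_Kry: "v t \<in> Kry t"
  by (induction t) (auto simp: pcg_0 pcg_Suc intro: Kry_SucI)

text \<open>The four facts support each other and must be proved in one induction: orthogonality of
  the new residual uses conjugacy of the old direction, and conjugacy of the new direction uses
  orthogonality together with the inclusion of \<open>Q H\<close> images in the next space. Nonzero
  earlier residuals keep all step lengths positive.\<close>

lemma krylov_invariant:
  assumes "\<And>j. j < t \<Longrightarrow> r j \<noteq> 0\<^sub>v d"
  shows "(\<forall>k\<in>Kry t. r t \<bullet> k = 0) \<and> (\<forall>k\<in>Kry t. u t \<bullet> (H *\<^sub>v k) = 0) \<and>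
    (\<forall>k\<in>Kry t. Q *\<^sub>v (H *\<^sub>v k) \<in> Kry (Suc t)) \<and> r t \<bullet> u t = r t \<bullet> s t"
  using assms
proof (induction t)
  case 0 thus ?case using Kry_zero[of "Suc 0"] by (auto simp: pcg_0)
next
  case (Suc t)
  note IH = Suc.IH[OF Suc.prems[OF less_SucI]]
  have orth: "r t \<bullet> k = 0" and conj: "u t \<bullet> (H *\<^sub>v k) = 0" and QH: "Q *\<^sub>v (H *\<^sub>v k) \<in> Kry (Suc t)"
    if "k \<in> Kry t" for k using that IH by blast+
  have ru: "r t \<bullet> u t = r t \<bullet> s t" using IH by blast
  have rs: "r t \<bullet> s t > 0" using Suc.prems[of t] Q_pos by (simp add: s_eq)
  have u0: "u t \<noteq> 0\<^sub>v d" using rs ru by auto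
  hence uHu: "u t \<bullet> (H *\<^sub>v u t) > 0" by (intro H.A_pos) auto
  have al: "al t > 0" unfolding al_def using rs uHu by simp
  have aluHu: "al t * (u t \<bullet> (H *\<^sub>v u t)) = r t \<bullet> s t" unfolding al_def using uHu by simp
  \<comment> \<open>Since the step length is nonzero, \<open>H u\<close> can be read off from two
    consecutive residuals, which puts \<open>Q H u\<close> into the span of \<open>s t\<close> and
    \<open>s (Suc t)\<close>.\<close>
  have Hu: "H *\<^sub>v u t = (1 / al t) \<cdot>\<^sub>v (r t - r (Suc t))"
    using al by (simp add: pcg_Suc) (intro vecV_eqI, auto)
  have QHu: "Q *\<^sub>v (H *\<^sub>v u t) = (1 / al t) \<cdot>\<^sub>v (s t - s (Suc t))"
    unfolding Hu s_eq by simp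
  have orth': "r (Suc t) \<bullet> k = 0" if "k \<in> Kry (Suc t)" for k
  proof -
    obtain k' c where k: "k = k' + c \<cdot>\<^sub>v u t" "k' \<in> Kry t" using \<open>k \<in> Kry (Suc t)\<close> by (rule Kry_SucE)
    note k' = Kry_carrier[OF k(2)]
    have "(H *\<^sub>v u t) \<bullet> k' = 0" using conj[OF k(2)] H.A_sym[OF _ k', of "u t"] ip_comm[OF k', of "H *\<^sub>v u t"] by simp
    moreover have "(H *\<^sub>v u t) \<bullet> u t = u t \<bullet> (H *\<^sub>v u t)" by (intro ip_comm) auto
    ultimately show ?thesis using k' orth[OF k(2)] ru aluHu
      by (simp add: k(1) pcg_Suc(2) algebra_simps)
  qed
  have QH': "Q *\<^sub>v (H *\<^sub>v k) \<in> Kry (Suc (Suc t))" if "k \<in> Kry (Suc t)" for k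
  proof -
    obtain k' c where k: "k = k' + c \<cdot>\<^sub>v u t" "k' \<in> Kry t" using \<open>k \<in> Kry (Suc t)\<close> by (rule Kry_SucE)
    note k' = Kry_carrier[OF k(2)]
    have "Q *\<^sub>v (H *\<^sub>v k) = Q *\<^sub>v (H *\<^sub>v k') + c \<cdot>\<^sub>v (Q *\<^sub>v (H *\<^sub>v u t))" using k' by (simp add: k(1))
    moreover have "Q *\<^sub>v (H *\<^sub>v k') \<in> Kry (Suc (Suc t))" using QH[OF k(2)] Kry_mono by blast
    moreover have "Q *\<^sub>v (H *\<^sub>v u t) \<in> Kry (Suc (Suc t))"
      unfolding QHu using s_in_Kry[of t] s_in_Kry[of "Suc t"] Kry_mono[of "Suc t"]
      by (intro Kry_smult Kry_minus) auto
    ultimately show ?thesis using Kry_add Kry_smult by simp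
  qed
  \<comment> \<open>Conjugacy to older directions is automatic, because \<open>Q H k'\<close> lies
    in a space orthogonal to the new residual. Only the newest direction needs the coefficient
    \<open>be t\<close>.\<close>
  have conj': "u (Suc t) \<bullet> (H *\<^sub>v k) = 0" if "k \<in> Kry (Suc t)" for k
  proof -
    obtain k' c where k: "k = k' + c \<cdot>\<^sub>v u t" "k' \<in> Kry t" using \<open>k \<in> Kry (Suc t)\<close> by (rule Kry_SucE)
    note k' = Kry_carrier[OF k(2)]
    have s_Q: "s (Suc t) \<bullet> y = r (Suc t) \<bullet> (Q *\<^sub>v y)" if "y \<in> V" for y
      unfolding s_eq using Q_sym[OF that, of "r (Suc t)"] ip_comm[OF that, of "Q *\<^sub>v r (Suc t)"] by simp
    have 1: "u (Suc t) \<bullet> (H *\<^sub>v k') = 0"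
      using conj[OF k(2)] orth'[OF QH[OF k(2)]] k' by (simp add: pcg_Suc(4) s_Q)
    have "s (Suc t) \<bullet> (H *\<^sub>v u t) = r (Suc t) \<bullet> (Q *\<^sub>v (H *\<^sub>v u t))" by (simp add: s_Q)
    also have "\<dots> = (1 / al t) * (r (Suc t) \<bullet> s t - r (Suc t) \<bullet> s (Suc t))" by (simp add: QHu)
    also have "\<dots> = - (r (Suc t) \<bullet> s (Suc t)) / al t" by (simp add: orth'[OF s_in_Kry])
    finally have 2: "s (Suc t) \<bullet> (H *\<^sub>v u t) = - (r (Suc t) \<bullet> s (Suc t)) / al t" .
    have uH: "u t \<bullet> (H *\<^sub>v u t) = (r t \<bullet> s t) / al t" using aluHu al by (simp add: field_simps)
    have "u (Suc t) \<bullet> (H *\<^sub>v u t) = s (Suc t) \<bullet> (H *\<^sub>v u t) + be t * (u t \<bullet> (H *\<^sub>v u t))"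
      by (simp add: pcg_Suc(4))
    hence "u (Suc t) \<bullet> (H *\<^sub>v u t) = 0" unfolding uH 2 be_def using rs by simp
    with 1 show ?thesis using k' by (simp add: k(1))
  qed
  have "r (Suc t) \<bullet> u (Suc t) = r (Suc t) \<bullet> s (Suc t)"
    using orth'[OF u_in_Kry] by (simp add: pcg_Suc(4))
  with orth' conj' QH' show ?case by blast
qed

lemma r_Q_orth:
  assumes "\<And>j. j < t \<Longrightarrow> r j \<noteq> 0\<^sub>v d" and "i < t"
  shows "r i \<bullet> (Q *\<^sub>v r t) = 0"
proof -
  have "s i \<in> Kry t" using s_in_Kry[of i] Kry_mono'[of "Suc i" t] assms(2) by auto
  hence "r t \<bullet> s i = 0" using krylov_invariant[OF assms(1)] by blast
  thus ?thesis using Q_sym[of "r i" "r t"] by (simp add: s_eq)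
qed

text \<open>Otherwise there are \<open>d + 1\<close> nonzero residuals that are mutually orthogonal
  in the form of \<open>Q\<close>. The matrix \<open>R\<close> with the first \<open>d\<close> of
  them as rows kills \<open>Q r d\<close>, hence is singular, so its rows are linearly dependent;
  pairing the dependence with \<open>Q r j\<close> isolates its \<open>j\<close>-th coefficient and
  shows that it is zero.\<close>

lemma finite_termination: "\<exists>t\<le>d. r t = 0\<^sub>v d"
proof (rule ccontr)
  assume "\<not> (\<exists>t\<le>d. r t = 0\<^sub>v d)"
  hence nz: "\<And>t. t \<le> d \<Longrightarrow> r t \<noteq> 0\<^sub>v d" by blast
  have orth: "r i \<bullet> (Q *\<^sub>v r j) = 0" if "i < j" "j \<le> d" for i j
    using that nz by (intro r_Q_orth) auto
  define R where "R = Matrix.mat d d (\<lambda>(i, j). r i $ j)"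
  have Rc: "R \<in> carrier_mat d d" by (simp add: R_def)
  have row: "Matrix.row R i = r i" if "i < d" for i
    using that pcg_carrier(2)[of i] unfolding R_def by (intro vecV_eqI) (auto simp: carrier_vecI)
  have "R *\<^sub>v (Q *\<^sub>v r d) = 0\<^sub>v d"
    using Rc by (intro vecV_eqI) (auto simp: row orth)
  moreover have "Q *\<^sub>v r d \<noteq> 0\<^sub>v d" using Q_pos[of "r d"] nz[of d] by auto
  ultimately have "Determinant.det R = 0"
    using det_0_iff_vec_prod_zero_field[OF Rc] mv_carrier[OF Q] by blast
  hence "Determinant.det (R\<^sup>T) = 0" using det_transpose[OF Rc] by simp
  then obtain c where c: "c \<in> V" "c \<noteq> 0\<^sub>v d" "R\<^sup>T *\<^sub>v c = 0\<^sub>v d"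
    using det_0_iff_vec_prod_zero_field[of "R\<^sup>T" d] Rc by auto
  have "c $ j = 0" if "j < d" for j
  proof -
    have "0 = (R\<^sup>T *\<^sub>v c) \<bullet> (Q *\<^sub>v r j)" using c by simp
    also have "\<dots> = c \<bullet> (R *\<^sub>v (Q *\<^sub>v r j))"
      using transpose_vec_mult_scalar[OF Rc, of "Q *\<^sub>v r j" c] c by simp
    also have "\<dots> = (\<Sum>i<d. c $ i * (r i \<bullet> (Q *\<^sub>v r j)))"
      using Rc c by (simp add: ip_sum[of c "R *\<^sub>v (Q *\<^sub>v r j)"] row)
    also have "\<dots> = (\<Sum>i<d. if i = j then c $ j * (r j \<bullet> (Q *\<^sub>v r j)) else 0)"
    proof (intro sum.cong refl)
      fix i assume "i \<in> {..<d}"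
      thus "c $ i * (r i \<bullet> (Q *\<^sub>v r j)) = (if i = j then c $ j * (r j \<bullet> (Q *\<^sub>v r j)) else 0)"
        using orth[of i j] orth[of j i] Q_sym[of "r i" "r j"] that by (cases i j rule: linorder_cases) auto
    qed
    also have "\<dots> = c $ j * (r j \<bullet> (Q *\<^sub>v r j))" using that by simp
    finally show ?thesis using Q_pos[of "r j"] nz[of j] that by auto
  qed
  hence "c = 0\<^sub>v d" using c(1) by (intro vecV_eqI) auto
  with c(2) show False by simp
qed

end

section \<open>Square-root convergence rate of conjugate gradients\<close>

locale pcg_bounds = pcg_system +
  fixes a b :: real
  assumes a: "0 < a"
    and lower: "\<And>x. x \<in> V \<Longrightarrow> a * (x \<bullet> (P *\<^sub>v x)) \<le> x \<bullet> (H *\<^sub>v x)"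
    and upper: "\<And>x. x \<in> V \<Longrightarrow> x \<bullet> (H *\<^sub>v x) \<le> b * (x \<bullet> (P *\<^sub>v x))"
    and ab: "a \<le> b"
begin

definition th where "th = sqrt (a / b)"

lemma th: "0 < th" "th \<le> 1" "th\<^sup>2 = a / b"
  using a ab by (auto simp: th_def)

text \<open>Nesterov's accelerated gradient method in the norm of the preconditioner. Its iterates
  lie in the same Krylov spaces, over which conjugate gradients are optimal, so its Lyapunov
  function yields the square-root rate without Chebyshev polynomials.\<close>

primrec nest :: "nat \<Rightarrow> rvec \<times> rvec" where
  "nest 0 = (0\<^sub>v d, 0\<^sub>v d)"
| "nest (Suc t) =
    (let (x, z) = nest t; y = (1 / (1 + th)) \<cdot>\<^sub>v (x + th \<cdot>\<^sub>v z); D = Q *\<^sub>v (H *\<^sub>v y - g)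
     in (y - (1 / b) \<cdot>\<^sub>v D, ((1 - th) \<cdot>\<^sub>v z + th \<cdot>\<^sub>v y) - (th / a) \<cdot>\<^sub>v D))"

text \<open>All vectors are taken relative to the solution, so the system is homogeneous. The
  gradient step gains \<open>N / b\<close>; the step length \<open>th / a\<close> of the second
  sequence makes it lose exactly the same amount, because \<open>th\<^sup>2 / a = 1 / b\<close>.
  What remains is convexity of the two quadratic forms.\<close>

lemma nest_step:
  assumes X: "X \<in> V" and Z: "Z \<in> V"
    and Y: "Y = (1 / (1 + th)) \<cdot>\<^sub>v (X + th \<cdot>\<^sub>v Z)" and D: "D = Q *\<^sub>v (H *\<^sub>v Y)"
    and X': "X' = Y - (1 / b) \<cdot>\<^sub>v D" and Z': "Z' = ((1 - th) \<cdot>\<^sub>v Z + th \<cdot>\<^sub>v Y) - (th / a) \<cdot>\<^sub>v D"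
  shows "X' \<bullet> (H *\<^sub>v X') + a * (Z' \<bullet> (P *\<^sub>v Z'))
    \<le> (1 - th) * (X \<bullet> (H *\<^sub>v X) + a * (Z \<bullet> (P *\<^sub>v Z)))"
proof -
  have b: "b > 0" using a ab by simp
  note t = th
  have t1: "1 + th \<noteq> 0" using t by simp
  have Yc: "Y \<in> V" using X Z by (simp add: Y)
  have Dc: "D \<in> V" by (simp add: D)
  have PD: "P *\<^sub>v D = H *\<^sub>v Y" by (simp add: D PQ)
  define W where "W = (1 - th) \<cdot>\<^sub>v Z + th \<cdot>\<^sub>v Y"
  have Wc: "W \<in> V" using Z Yc by (simp add: W_def)
  define N where "N = D \<bullet> (H *\<^sub>v Y)"
  define hY where "hY = Y \<bullet> (H *\<^sub>v Y)"
  define hX where "hX = X \<bullet> (H *\<^sub>v X)"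
  define pZ where "pZ = Z \<bullet> (P *\<^sub>v Z)"
  define hXY where "hXY = X \<bullet> (H *\<^sub>v Y)"
  have N': "Y \<bullet> (H *\<^sub>v D) = N" using H.A_sym[OF Yc Dc] by (simp add: N_def)
  have "D \<bullet> (H *\<^sub>v D) \<le> b * N" using upper[OF Dc] by (simp add: PD N_def)
  hence "(1 / b * (1 / b)) * (D \<bullet> (H *\<^sub>v D)) \<le> (1 / b * (1 / b)) * (b * N)"
    using b by (intro mult_left_mono) auto
  also have "\<dots> = N / b" using b by simp
  finally have DD: "(1 / b * (1 / b)) * (D \<bullet> (H *\<^sub>v D)) \<le> N / b" .
  have "X' \<bullet> (H *\<^sub>v X') = hY - 2 / b * N + (1 / b * (1 / b)) * (D \<bullet> (H *\<^sub>v D))"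
    using Yc Dc N' by (simp add: X' hY_def N_def[symmetric] algebra_simps)
  hence A1: "X' \<bullet> (H *\<^sub>v X') \<le> hY - N / b" using DD by simp
  \<comment> \<open>The weights defining \<open>Y\<close> are made for this identity: it eliminates
    \<open>Z\<close> from the cross term with \<open>H Y\<close>.\<close>
  have thY: "th \<cdot>\<^sub>v W = Y - (1 - th) \<cdot>\<^sub>v X"
  proof (rule eq_vecI)
    fix i assume "i < dim_vec (Y - (1 - th) \<cdot>\<^sub>v X)"
    hence i: "i < d" using X by simp
    have "(1 + th) * Y $ i = X $ i + th * Z $ i" using X Z i t1 by (simp add: Y)
    hence thZ: "th * Z $ i = (1 + th) * Y $ i - X $ i" by simp
    have "th * ((1 - th) * Z $ i + th * Y $ i) = (1 - th) * (th * Z $ i) + th * th * Y $ i"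
      by (simp add: algebra_simps)
    also have "\<dots> = Y $ i - (1 - th) * X $ i" unfolding thZ by (simp add: algebra_simps)
    finally have "th * ((1 - th) * Z $ i + th * Y $ i) = Y $ i - (1 - th) * X $ i" .
    thus "(th \<cdot>\<^sub>v W) $ i = (Y - (1 - th) \<cdot>\<^sub>v X) $ i" using X Z Yc i by (simp add: W_def)
  qed (use X Wc Yc in auto)
  have WY: "th * (W \<bullet> (H *\<^sub>v Y)) = hY - (1 - th) * hXY"
  proof -
    have "th * (W \<bullet> (H *\<^sub>v Y)) = (th \<cdot>\<^sub>v W) \<bullet> (H *\<^sub>v Y)" using Wc by simp
    thus ?thesis unfolding thY using X Yc by (simp add: hY_def hXY_def)
  qed
  have pWD: "W \<bullet> (P *\<^sub>v D) = W \<bullet> (H *\<^sub>v Y)" "D \<bullet> (P *\<^sub>v W) = W \<bullet> (H *\<^sub>v Y)" "D \<bullet> (P *\<^sub>v D) = N"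
    using P.A_sym[OF Dc Wc] by (simp_all add: PD N_def)
  have ZW: "Z' = W - (th / a) \<cdot>\<^sub>v D" by (simp add: Z' W_def)
  have "Z' \<bullet> (P *\<^sub>v Z') = W \<bullet> (P *\<^sub>v W) - 2 * (th / a) * (W \<bullet> (H *\<^sub>v Y)) + (th / a)\<^sup>2 * N"
    using Wc Dc pWD unfolding ZW by (simp add: algebra_simps power2_eq_square)
  hence "a * (Z' \<bullet> (P *\<^sub>v Z')) = a * (W \<bullet> (P *\<^sub>v W)) - 2 * (th * (W \<bullet> (H *\<^sub>v Y))) + th\<^sup>2 / a * N"
    using a by (simp add: field_simps power2_eq_square)
  also have "th\<^sup>2 / a * N = N / b" using a t(3) by simp
  finally have A2: "a * (Z' \<bullet> (P *\<^sub>v Z')) = a * (W \<bullet> (P *\<^sub>v W)) - 2 * (hY - (1 - th) * hXY) + N / b"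
    unfolding WY .
  define pY where "pY = Y \<bullet> (P *\<^sub>v Y)"
  have "0 \<le> (Z - Y) \<bullet> (P *\<^sub>v (Z - Y))" using Z Yc by (intro P.A_nonneg) auto
  hence pZY: "2 * (Z \<bullet> (P *\<^sub>v Y)) \<le> pZ + pY"
    using Z Yc P.A_sym[of Y Z] by (simp add: pZ_def pY_def algebra_simps)
  have "W \<bullet> (P *\<^sub>v W) = (1 - th)\<^sup>2 * pZ + th * (1 - th) * (2 * (Z \<bullet> (P *\<^sub>v Y))) + th\<^sup>2 * pY"
    using Z Yc P.A_sym[of Y Z] by (simp add: W_def pZ_def pY_def algebra_simps power2_eq_square)
  also have "\<dots> \<le> (1 - th)\<^sup>2 * pZ + th * (1 - th) * (pZ + pY) + th\<^sup>2 * pY"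
    using t(1,2) pZY by (intro add_mono mult_left_mono) auto
  also have "\<dots> = (1 - th) * pZ + th * pY" by (simp add: algebra_simps power2_eq_square)
  finally have "a * (W \<bullet> (P *\<^sub>v W)) \<le> a * ((1 - th) * pZ + th * pY)" using a by simp
  also have "\<dots> = (1 - th) * (a * pZ) + th * (a * pY)" by (simp add: algebra_simps)
  also have "\<dots> \<le> (1 - th) * (a * pZ) + th * hY"
    using lower[OF Yc] t by (intro add_left_mono mult_left_mono) (auto simp: pY_def hY_def)
  finally have A3: "a * (W \<bullet> (P *\<^sub>v W)) \<le> (1 - th) * (a * pZ) + th * hY" .
  have "0 \<le> (X - Y) \<bullet> (H *\<^sub>v (X - Y))" using X Yc by (intro H.A_nonneg) auto
  hence "2 * hXY \<le> hX + hY"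
    using X Yc H.A_sym[of Y X] by (simp add: hX_def hY_def hXY_def algebra_simps)
  hence "(1 - th) * (2 * hXY) \<le> (1 - th) * (hX + hY)" using t by (intro mult_left_mono) auto
  hence "X' \<bullet> (H *\<^sub>v X') + a * (Z' \<bullet> (P *\<^sub>v Z')) \<le> (1 - th) * (hX + a * pZ)"
    using A1 A2 A3 by (simp add: algebra_simps)
  thus ?thesis by (simp add: hX_def pZ_def)
qed

lemma nest_carrier: "fst (nest t) \<in> V \<and> snd (nest t) \<in> V"
  by (induction t) (auto simp: Let_def case_prod_beta)

lemma nest_rate:
  "(fst (nest t) - vs) \<bullet> (H *\<^sub>v (fst (nest t) - vs)) + a * ((snd (nest t) - vs) \<bullet> (P *\<^sub>v (snd (nest t) - vs)))
    \<le> 2 * (1 - th) ^ t * (vs \<bullet> (H *\<^sub>v vs))"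
proof (induction t)
  case 0
  have "0\<^sub>v d - vs = (-1) \<cdot>\<^sub>v vs" by (intro vecV_eqI) auto
  hence "(0\<^sub>v d - vs) \<bullet> (H *\<^sub>v (0\<^sub>v d - vs)) = vs \<bullet> (H *\<^sub>v vs)"
    "(0\<^sub>v d - vs) \<bullet> (P *\<^sub>v (0\<^sub>v d - vs)) = vs \<bullet> (P *\<^sub>v vs)" by simp_all
  \<comment> \<open>The factor 2 of the claim: each of the two parts of the Lyapunov function is
    initially at most the energy of \<open>vs\<close>, the second one by
    \<open>lower\<close>.\<close>
  thus ?case using lower[OF vs] by simp
next
  case (Suc t)
  obtain x z where xz: "nest t = (x, z)" by (cases "nest t")
  have c: "x \<in> V" "z \<in> V" using nest_carrier[of t] xz by auto
  define y where "y = (1 / (1 + th)) \<cdot>\<^sub>v (x + th \<cdot>\<^sub>v z)"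
  define D where "D = Q *\<^sub>v (H *\<^sub>v y - g)"
  have yc: "y \<in> V" using c by (simp add: y_def)
  have n: "nest (Suc t) = (y - (1 / b) \<cdot>\<^sub>v D, ((1 - th) \<cdot>\<^sub>v z + th \<cdot>\<^sub>v y) - (th / a) \<cdot>\<^sub>v D)"
    by (simp add: xz y_def D_def Let_def)
  have t1: "1 + th \<noteq> 0" using th by simp
  have Y: "y - vs = (1 / (1 + th)) \<cdot>\<^sub>v ((x - vs) + th \<cdot>\<^sub>v (z - vs))"
  proof (rule vecV_eqI)
    fix i assume i: "i < d"
    have "y $ i = (x $ i + th * z $ i) / (1 + th)" using c i by (simp add: y_def)
    thus "(y - vs) $ i = ((1 / (1 + th)) \<cdot>\<^sub>v ((x - vs) + th \<cdot>\<^sub>v (z - vs))) $ i"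
      using c i t1 by (simp add: field_simps)
  qed (use c yc in auto)
  have D: "D = Q *\<^sub>v (H *\<^sub>v (y - vs))" using yc H_vs by (simp add: D_def)
  have Dc: "D \<in> V" by (simp add: D_def)
  have X': "fst (nest (Suc t)) - vs = (y - vs) - (1 / b) \<cdot>\<^sub>v D"
    using yc Dc by (intro vecV_eqI) (auto simp: n simp del: nest.simps)
  have Z': "snd (nest (Suc t)) - vs = ((1 - th) \<cdot>\<^sub>v (z - vs) + th \<cdot>\<^sub>v (y - vs)) - (th / a) \<cdot>\<^sub>v D"
    using yc Dc c by (intro vecV_eqI) (auto simp: n algebra_simps simp del: nest.simps)
  have "(fst (nest (Suc t)) - vs) \<bullet> (H *\<^sub>v (fst (nest (Suc t)) - vs)) +
      a * ((snd (nest (Suc t)) - vs) \<bullet> (P *\<^sub>v (snd (nest (Suc t)) - vs)))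
    \<le> (1 - th) * ((x - vs) \<bullet> (H *\<^sub>v (x - vs)) + a * ((z - vs) \<bullet> (P *\<^sub>v (z - vs))))"
    using c by (intro nest_step[OF _ _ Y D X' Z']) auto
  also have "\<dots> \<le> (1 - th) * (2 * (1 - th) ^ t * (vs \<bullet> (H *\<^sub>v vs)))"
    using Suc xz th by (intro mult_left_mono) auto
  finally show ?case by (simp only: power_Suc mult_ac)
qed

text \<open>The method starts at zero and only ever adds multiples of \<open>Q g\<close> and
  \<open>Q H y\<close>. The latter stay in the growing span by \<open>krylov_invariant\<close>,
  which is valid as long as no residual has vanished.\<close>

lemma nest_in_Kry:
  assumes "\<And>j. j < t \<Longrightarrow> r j \<noteq> 0\<^sub>v d"
  shows "fst (nest t) \<in> Kry t \<and> snd (nest t) \<in> Kry t"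
  using assms
proof (induction t)
  case (Suc t)
  obtain x z where xz: "nest t = (x, z)" by (cases "nest t")
  have k: "x \<in> Kry t" "z \<in> Kry t" using Suc xz by auto
  define y where "y = (1 / (1 + th)) \<cdot>\<^sub>v (x + th \<cdot>\<^sub>v z)"
  define D where "D = Q *\<^sub>v (H *\<^sub>v y - g)"
  have y: "y \<in> Kry t" unfolding y_def using k by (intro Kry_add Kry_smult)
  have yc: "y \<in> V" using Kry_carrier[OF y] .
  have Qg: "Q *\<^sub>v g \<in> Kry (Suc t)"
    using u_in_Kry[of 0] Kry_mono'[of "Suc 0" "Suc t"] by (auto simp: pcg_0)
  have QHy: "Q *\<^sub>v (H *\<^sub>v y) \<in> Kry (Suc t)" using krylov_invariant[of t] Suc.prems y by auto
  have D: "D \<in> Kry (Suc t)" unfolding D_def using yc Kry_minus[OF QHy Qg] by simp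
  have n: "nest (Suc t) = (y - (1 / b) \<cdot>\<^sub>v D, ((1 - th) \<cdot>\<^sub>v z + th \<cdot>\<^sub>v y) - (th / a) \<cdot>\<^sub>v D)"
    by (simp add: xz y_def D_def Let_def)
  have "y \<in> Kry (Suc t)" "z \<in> Kry (Suc t)" using y k Kry_mono by blast+
  thus ?case unfolding n fst_conv snd_conv using D by (intro conjI Kry_minus Kry_add Kry_smult)
qed simp

text \<open>The image under \<open>H\<close> of the error is the residual, which is orthogonal to
  the Krylov space. By Pythagoras in the energy norm the iterate is therefore the best approximation
  from that space, in particular no worse than the accelerated gradient iterate.\<close>

lemma pcg_rate:
  assumes "\<And>j. j < t \<Longrightarrow> r j \<noteq> 0\<^sub>v d"
  shows "(vs - v t) \<bullet> (H *\<^sub>v (vs - v t)) \<le> 2 * (1 - th) ^ t * (vs \<bullet> (H *\<^sub>v vs))"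
proof -
  define x where "x = fst (nest t)"
  have x: "x \<in> Kry t" using nest_in_Kry[OF assms] by (simp add: x_def)
  have xc: "x \<in> V" using Kry_carrier[OF x] .
  define e where "e = vs - v t"
  define k where "k = v t - x"
  have k: "k \<in> Kry t" unfolding k_def using v_in_Kry x by (intro Kry_minus)
  have ec: "e \<in> V" and kc: "k \<in> V" using Kry_carrier[OF k] by (auto simp: e_def)
  have He: "H *\<^sub>v e = r t" by (simp add: e_def r_eq H_vs)
  have ke: "k \<bullet> (H *\<^sub>v e) = 0" using krylov_invariant[OF assms] k ip_comm[OF kc, of "r t"] by (simp add: He)
  have ek: "e \<bullet> (H *\<^sub>v k) = 0" using H.A_sym[OF ec kc] ke by simp
  have xe: "x - vs = (-1) \<cdot>\<^sub>v (e + k)" using xc by (intro vecV_eqI) (auto simp: e_def k_def)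
  have "e \<bullet> (H *\<^sub>v e) \<le> e \<bullet> (H *\<^sub>v e) + k \<bullet> (H *\<^sub>v k)" using kc by simp
  also have "\<dots> = (x - vs) \<bullet> (H *\<^sub>v (x - vs))" unfolding xe using ec kc ke ek by simp
  also have "\<dots> \<le> 2 * (1 - th) ^ t * (vs \<bullet> (H *\<^sub>v vs))"
  proof -
    have "0 \<le> a * ((snd (nest t) - vs) \<bullet> (P *\<^sub>v (snd (nest t) - vs)))"
      using a nest_carrier[of t] by (intro mult_nonneg_nonneg P.A_nonneg) auto
    thus ?thesis using nest_rate[of t] by (simp add: x_def)
  qed
  finally show ?thesis by (simp add: e_def)
qed

text \<open>The rate is in the energy norm while the stopping test is Euclidean. Changing norms for
  the error costs a factor \<open>L\<close>, and for the right-hand side a factor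
  \<open>1 / l\<close>.\<close>

lemma residual_bound:
  assumes nz: "\<And>j. j < t \<Longrightarrow> r j \<noteq> 0\<^sub>v d" and l: "0 < l"
    and Hl: "\<And>x. x \<in> V \<Longrightarrow> l * (x \<bullet> x) \<le> x \<bullet> (H *\<^sub>v x)"
    and HL: "\<And>x. x \<in> V \<Longrightarrow> x \<bullet> (H *\<^sub>v x) \<le> L * (x \<bullet> x)" and L: "0 < L"
  shows "r t \<bullet> r t \<le> 2 * L / l * (1 - th) ^ t * (g \<bullet> g)"
proof -
  have re: "r t = H *\<^sub>v (vs - v t)" by (simp add: r_eq H_vs)
  have "(vs \<bullet> g)\<^sup>2 \<le> (vs \<bullet> vs) * (g \<bullet> g)" by (rule cauchy_schwarz_sq) auto
  also have "\<dots> \<le> ((vs \<bullet> g) / l) * (g \<bullet> g)"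
    using Hl[OF vs] l by (intro mult_right_mono) (auto simp: H_vs field_simps)
  finally have "(vs \<bullet> g) * (vs \<bullet> g) \<le> (vs \<bullet> g) * ((g \<bullet> g) / l)" by (simp add: power2_eq_square)
  moreover have "0 \<le> vs \<bullet> g" using H.A_nonneg[OF vs] by (simp add: H_vs)
  moreover have "0 \<le> g \<bullet> g / l" using l by simp
  ultimately have vg: "vs \<bullet> g \<le> (g \<bullet> g) / l" by (cases "vs \<bullet> g = 0") (auto simp del: times_divide_eq_right)
  have "r t \<bullet> r t \<le> L * ((vs - v t) \<bullet> (H *\<^sub>v (vs - v t)))"
    unfolding re using HL by (intro H.norm_mv_le) auto
  also have "\<dots> \<le> L * (2 * (1 - th) ^ t * (vs \<bullet> (H *\<^sub>v vs)))"
    using pcg_rate[OF nz] L by (intro mult_left_mono) auto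
  also have "\<dots> \<le> L * (2 * (1 - th) ^ t * ((g \<bullet> g) / l))"
    using vg L th by (intro mult_left_mono) (auto simp: H_vs)
  finally show ?thesis by (simp add: field_simps)
qed

end

section \<open>The smoothed hinge loss\<close>

text \<open>With this clipped piecewise linear function the five cases of the second derivative of
  the loss become one power, whose Lipschitz constant can be read off.\<close>

definition trapezoid :: "real \<Rightarrow> real \<Rightarrow> real" where
  "trapezoid p t = max 0 (min 1 (min (t + (p - 3) / (p - 1)) (2 - t)))"

text \<open>Five cases become three, because clipping the base of the power at zero absorbs the two
  outer linear pieces.\<close>

definition smoothed_hinge1 :: "real \<Rightarrow> real \<Rightarrow> real" where
  "smoothed_hinge1 p t =
    (if t < 1 - (p - 3) / (p - 1) then - 1 + max 0 (t + (p - 3) / (p - 1)) powr (p - 1) / (p - 1)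
     else if t < 1 then - 1 / (p - 1) - (1 - t)
     else - (max 0 (2 - t) powr (p - 1) / (p - 1)))"

definition smoothed_hinge2 :: "real \<Rightarrow> real \<Rightarrow> real" where
  "smoothed_hinge2 p t = trapezoid p t powr (p - 2)"

lemma trapezoid_range: "0 \<le> trapezoid p t" "trapezoid p t \<le> 1"
  by (auto simp: trapezoid_def)

lemma trapezoid_lipschitz: "\<bar>trapezoid p s - trapezoid p t\<bar> \<le> \<bar>s - t\<bar>"
  by (auto simp: trapezoid_def max_def min_def)

lemma has_real_derivative_split:
  fixes f g h :: "real \<Rightarrow> real"
  assumes g: "(g has_real_derivative D) (at c)" and h: "(h has_real_derivative D) (at c)"
    and e: "e > 0"
    and fg: "\<And>t. c - e < t \<Longrightarrow> t \<le> c \<Longrightarrow> f t = g t" and fh: "\<And>t. c \<le> t \<Longrightarrow> t < c + e \<Longrightarrow> f t = h t"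
  shows "(f has_real_derivative D) (at c)"
proof -
  have "(f has_real_derivative D) (at c within {..c})"
    using e by (intro has_field_derivative_transform_within[OF has_field_derivative_at_within[OF g]])
      (auto simp: fg dist_real_def)
  moreover have "(f has_real_derivative D) (at c within {c..})"
    using e by (intro has_field_derivative_transform_within[OF has_field_derivative_at_within[OF h]])
      (auto simp: fh dist_real_def)
  ultimately have "(f has_real_derivative D) (at c within ({..c} \<union> {c..}))"
    by (auto simp: has_field_derivative_iff intro: Lim_Un)
  moreover have "{..c} \<union> {c..} = (UNIV :: real set)" by auto
  ultimately show ?thesis by simp
qed

lemma has_real_derivative_local:
  fixes f g :: "real \<Rightarrow> real"
  assumes "(g has_real_derivative D) (at c)" "e > 0" "\<And>t. \<bar>t - c\<bar> < e \<Longrightarrow> f t = g t"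
  shows "(f has_real_derivative D) (at c)"
  using assms by (intro has_real_derivative_split[of g D c g e f]) auto

text \<open>Only the origin is delicate: there the difference quotient is at most
  \<open>max 0 h powr (k - 1)\<close>, which tends to zero since the exponent is positive.\<close>

lemma has_real_derivative_pos_part_powr:
  fixes k t :: real
  assumes k: "k > 1"
  shows "((\<lambda>t. max 0 t powr k) has_real_derivative (k * max 0 t powr (k - 1))) (at t)"
proof (cases t "0 :: real" rule: linorder_cases)
  case less
  show ?thesis
  proof (rule has_real_derivative_local)
    show "((\<lambda>t. 0) has_real_derivative (k * max 0 t powr (k - 1))) (at t)"
      using less by (auto intro!: derivative_eq_intros)
    show "- t > 0" using less by simp
  qed auto
next
  case greater
  show ?thesis
  proof (rule has_real_derivative_local)
    show "((\<lambda>t. t powr k) has_real_derivative (k * max 0 t powr (k - 1))) (at t)"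
      using greater by (auto intro!: derivative_eq_intros)
    show "t > 0" by fact
  qed auto
next
  case equal
  have "(\<lambda>h::real. max 0 h powr k / h) \<midarrow>0\<rightarrow> 0"
  proof (rule Lim_null_comparison)
    show "\<forall>\<^sub>F h in at 0. norm (max 0 h powr k / h) \<le> max 0 h powr (k - 1)"
    proof (rule always_eventually, rule allI)
      fix h :: real
      show "norm (max 0 h powr k / h) \<le> max 0 h powr (k - 1)"
        by (cases "h > 0") (auto simp: powr_diff)
    qed
    have "isCont (\<lambda>h::real. max 0 h powr (k - 1)) 0"
      using k by (intro continuous_intros) auto
    thus "((\<lambda>h::real. max 0 h powr (k - 1)) \<longlongrightarrow> 0) (at 0)"
      using k by (simp add: isCont_def)
  qed
  thus ?thesis using equal k by (simp add: DERIV_def)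
qed

section \<open>First and second derivative of the loss across the breakpoints\<close>

context
  fixes p :: real
  assumes p: "p \<ge> 3"
begin

lemma breakpoint_range: "0 \<le> (p - 3) / (p - 1)" "(p - 3) / (p - 1) < 1"
  using p by (auto simp: field_simps)

text \<open>Each formula is extended to the closed interval, that is, the pieces are matched at the
  breakpoint \<open>2 / (p - 1)\<close>. For \<open>p = 3\<close> this breakpoint coincides with 1
  and the middle piece degenerates, hence the extra case \<open>t = 1\<close>.\<close>

lemma smoothed_hinge_left:
  assumes "t \<le> 1 - (p - 3) / (p - 1)"
  shows "smoothed_hinge p t =
    3/2 - (p - 2) / (p - 1) - t + max 0 (t + (p - 3) / (p - 1)) powr p / (p * (p - 1))"
proof (cases "t = 1 - (p - 3) / (p - 1)")
  case True
  have t1: "t = 2 / (p - 1)" using p True by (simp add: field_simps)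
  have "smoothed_hinge p t = (p + 1) / (p * (p - 1)) - t / (p - 1) + (1 - t)\<^sup>2 / 2 \<or> t = 1"
    using True breakpoint_range unfolding smoothed_hinge_def by (smt (verit))
  moreover have "(p + 1) / (p * (p - 1)) - t / (p - 1) + (1 - t)\<^sup>2 / 2
      = 3/2 - (p - 2) / (p - 1) - t + 1 / (p * (p - 1))"
  proof -
    define i where "i = 1 / (p - 1)"
    define X where "X = 1 / (p * (p - 1))"
    have "(p + 1) / (p * (p - 1)) = i + X" using p by (simp add: i_def X_def add_divide_distrib)
    moreover have "(p - 2) / (p - 1) = 1 - i" using p by (simp add: i_def field_simps)
    moreover have "t / (p - 1) = t * i" by (simp add: i_def)
    moreover have "t = 2 * i" by (simp add: t1 i_def)
    moreover have "(i + X) - 2 * i * i + (1 - 2 * i)\<^sup>2 / 2 = 3/2 - (1 - i) - 2 * i + X"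
      by (simp add: power2_eq_square field_simps)
    ultimately show ?thesis unfolding X_def[symmetric] by metis
  qed
  moreover have "smoothed_hinge p t = 3/2 - (p - 2) / (p - 1) - t + 1 / (p * (p - 1))" if "t = 1"
  proof -
    have "p = 3" using that t1 p by (simp add: field_simps)
    thus ?thesis using that by (simp add: smoothed_hinge_def)
  qed
  ultimately show ?thesis using True by auto
next
  case False
  with assms p show ?thesis by (auto simp: smoothed_hinge_def max_def)
qed

lemma smoothed_hinge_mid:
  assumes "1 - (p - 3) / (p - 1) \<le> t" "t \<le> 1"
  shows "smoothed_hinge p t = (p + 1) / (p * (p - 1)) - t / (p - 1) + (1 - t)\<^sup>2 / 2"
proof (cases "t = 1")
  case True
  have "smoothed_hinge p 1 = 1 / (p * (p - 1))"
    unfolding smoothed_hinge_def using breakpoint_range by auto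
  also have "\<dots> = (p + 1) / (p * (p - 1)) - 1 / (p - 1)"
    using p by (simp add: add_divide_distrib)
  finally show ?thesis using True by simp
next
  case False
  with assms p show ?thesis by (auto simp: smoothed_hinge_def)
qed

lemma smoothed_hinge_right:
  assumes "1 \<le> t"
  shows "smoothed_hinge p t = max 0 (2 - t) powr p / (p * (p - 1))"
proof -
  show ?thesis using assms p breakpoint_range unfolding smoothed_hinge_def by (smt (verit) powr_zero_eq_one powr_0 divide_eq_0_iff)
qed

lemma smoothed_hinge1_left:
  assumes "t \<le> 1 - (p - 3) / (p - 1)"
  shows "smoothed_hinge1 p t = - 1 + max 0 (t + (p - 3) / (p - 1)) powr (p - 1) / (p - 1)"
proof (cases "t = 1 - (p - 3) / (p - 1)")
  case True
  show ?thesis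
  proof (cases "t = 1")
    case t: True
    hence "p = 3" using True p by (simp add: field_simps)
    thus ?thesis using t by (simp add: smoothed_hinge1_def)
  next
    case False
    hence "smoothed_hinge1 p t = - 1 / (p - 1) - (1 - t)"
      using True breakpoint_range unfolding smoothed_hinge1_def by (smt (verit))
    also have "\<dots> = - 1 + 1 / (p - 1)" unfolding True using p by (simp add: field_simps)
    finally show ?thesis using True by simp
  qed
next
  case False
  with assms p show ?thesis by (auto simp: smoothed_hinge1_def)
qed

lemma smoothed_hinge1_mid:
  assumes "1 - (p - 3) / (p - 1) \<le> t" "t \<le> 1"
  shows "smoothed_hinge1 p t = - 1 / (p - 1) - (1 - t)"
proof (cases "t = 1")
  case True
  show ?thesis using True breakpoint_range unfolding smoothed_hinge1_def by (smt (verit) powr_one_eq_one minus_divide_left)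
next
  case False
  with assms p show ?thesis by (auto simp: smoothed_hinge1_def)
qed

lemma smoothed_hinge1_right:
  assumes "1 \<le> t"
  shows "smoothed_hinge1 p t = - (max 0 (2 - t) powr (p - 1) / (p - 1))"
proof -
  show ?thesis using assms breakpoint_range unfolding smoothed_hinge1_def by (smt (verit))
qed

lemma trapezoid_left: "t \<le> 1 - (p - 3) / (p - 1) \<Longrightarrow> trapezoid p t = max 0 (t + (p - 3) / (p - 1))"
  using breakpoint_range unfolding trapezoid_def by (smt (verit))

lemma trapezoid_mid: "1 - (p - 3) / (p - 1) \<le> t \<Longrightarrow> t \<le> 1 \<Longrightarrow> trapezoid p t = 1"
  unfolding trapezoid_def by (smt (verit))

lemma trapezoid_right: "1 \<le> t \<Longrightarrow> trapezoid p t = max 0 (2 - t)"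
  using breakpoint_range unfolding trapezoid_def by (smt (verit))

text \<open>The case \<open>c = c'\<close> must be allowed because of \<open>p = 3\<close>; there
  the two outer pieces are glued directly.\<close>

lemma three_piece_derivative:
  fixes f g h k :: "real \<Rightarrow> real"
  assumes c: "c \<le> c'"
    and fg: "\<And>t. t \<le> c \<Longrightarrow> f t = g t" and fh: "\<And>t. c \<le> t \<Longrightarrow> t \<le> c' \<Longrightarrow> f t = h t"
    and fk: "\<And>t. c' \<le> t \<Longrightarrow> f t = k t"
    and g: "\<And>t. t \<le> c \<Longrightarrow> (g has_real_derivative D t) (at t)"
    and h: "\<And>t. c \<le> t \<Longrightarrow> t \<le> c' \<Longrightarrow> (h has_real_derivative D t) (at t)"
    and k: "\<And>t. c' \<le> t \<Longrightarrow> (k has_real_derivative D t) (at t)"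
  shows "(f has_real_derivative D t) (at t)"
proof -
  consider "t < c" | "c = c'" "t = c" | "c < c'" "t = c" | "c < t" "t < c'" | "c < c'" "t = c'" | "c' < t"
    using c by linarith
  thus ?thesis
  proof cases
    case 1
    show ?thesis
    proof (rule has_real_derivative_local)
      show "(g has_real_derivative D t) (at t)" using 1 g by simp
      show "c - t > 0" using 1 by simp
      show "f s = g s" if "\<bar>s - t\<bar> < c - t" for s
        using that by (intro fg) (simp_all add: abs_less_iff)
    qed
  next
    case 2
    have "(f has_real_derivative D c) (at c)"
    proof (rule has_real_derivative_split)
      show "(g has_real_derivative D c) (at c)" using 2 by (intro g) simp_all
      show "(k has_real_derivative D c) (at c)" using 2 by (intro k) simp_all
      show "0 < (1::real)" using 2 by simp
      show "f s = g s" if "c - 1 < s" "s \<le> c" for s using 2 that by (intro fg) simp_all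
      show "f s = k s" if "c \<le> s" "s < c + 1" for s using 2 that by (intro fk) simp_all
    qed
    thus ?thesis using 2 by simp
  next
    case 3
    have "(f has_real_derivative D c) (at c)"
    proof (rule has_real_derivative_split)
      show "(g has_real_derivative D c) (at c)" using 3 by (intro g) simp_all
      show "(h has_real_derivative D c) (at c)" using 3 by (intro h) simp_all
      show "0 < (c' - c)" using 3 by simp
      show "f s = g s" if "c - (c' - c) < s" "s \<le> c" for s using 3 that by (intro fg) simp_all
      show "f s = h s" if "c \<le> s" "s < c + (c' - c)" for s using 3 that by (intro fh) simp_all
    qed
    thus ?thesis using 3 by simp
  next
    case 4
    show ?thesis
    proof (rule has_real_derivative_local)
      show "(h has_real_derivative D t) (at t)" using 4 h by simp
      show "min (t - c) (c' - t) > 0" using 4 by simp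
      show "f s = h s" if "\<bar>s - t\<bar> < min (t - c) (c' - t)" for s
        using that by (intro fh) (simp_all add: abs_less_iff)
    qed
  next
    case 5
    have "(f has_real_derivative D c') (at c')"
    proof (rule has_real_derivative_split)
      show "(h has_real_derivative D c') (at c')" using 5 by (intro h) simp_all
      show "(k has_real_derivative D c') (at c')" using 5 by (intro k) simp_all
      show "0 < (c' - c)" using 5 by simp
      show "f s = h s" if "c' - (c' - c) < s" "s \<le> c'" for s using 5 that by (intro fh) simp_all
      show "f s = k s" if "c' \<le> s" "s < c' + (c' - c)" for s using 5 that by (intro fk) simp_all
    qed
    thus ?thesis using 5 by simp
  next
    case 6
    show ?thesis
    proof (rule has_real_derivative_local)
      show "(k has_real_derivative D t) (at t)" using 6 k by simp
      show "t - c' > 0" using 6 by simp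
      show "f s = k s" if "\<bar>s - t\<bar> < t - c'" for s
        using that by (intro fk) (simp_all add: abs_less_iff)
    qed
  qed
qed

lemma has_real_derivative_pos_part_powr':
  fixes f :: "real \<Rightarrow> real"
  assumes "k > 1" "(f has_real_derivative D) (at t)"
  shows "((\<lambda>t. max 0 (f t) powr k) has_real_derivative (k * max 0 (f t) powr (k - 1) * D)) (at t)"
  using DERIV_chain2[OF has_real_derivative_pos_part_powr[OF assms(1)] assms(2)] .

lemma smoothed_hinge_deriv: "(smoothed_hinge p has_real_derivative smoothed_hinge1 p t) (at t)"
proof (rule three_piece_derivative[where c = "1 - (p - 3) / (p - 1)" and c' = 1])
  show "1 - (p - 3) / (p - 1) \<le> 1" using p by simp
  show "((\<lambda>t. 3/2 - (p - 2) / (p - 1) - t + max 0 (t + (p - 3) / (p - 1)) powr p / (p * (p - 1)))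
      has_real_derivative smoothed_hinge1 p t) (at t)" if "t \<le> 1 - (p - 3) / (p - 1)" for t
  proof -
    have "((\<lambda>t. max 0 (t + (p - 3) / (p - 1)) powr p) has_real_derivative
        p * max 0 (t + (p - 3) / (p - 1)) powr (p - 1) * 1) (at t)"
      using p by (intro has_real_derivative_pos_part_powr') (auto intro!: derivative_eq_intros)
    moreover have "((\<lambda>t. 3/2 - (p - 2) / (p - 1) - t) has_real_derivative - 1) (at t)"
      by (auto intro!: derivative_eq_intros)
    ultimately show ?thesis using p that DERIV_add[of "\<lambda>t. 3/2 - (p - 2) / (p - 1) - t" "- 1" t UNIV, OF _ DERIV_cdivide[of _ _ _ _ "p * (p - 1)"]]
      by (force simp: smoothed_hinge1_left)
  qed
  show "((\<lambda>t. (p + 1) / (p * (p - 1)) - t / (p - 1) + (1 - t)\<^sup>2 / 2)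
      has_real_derivative smoothed_hinge1 p t) (at t)" if "1 - (p - 3) / (p - 1) \<le> t" "t \<le> 1" for t
    using p that by (auto simp: smoothed_hinge1_mid intro!: derivative_eq_intros)
  show "((\<lambda>t. max 0 (2 - t) powr p / (p * (p - 1))) has_real_derivative smoothed_hinge1 p t) (at t)"
    if "1 \<le> t" for t
  proof -
    have "((\<lambda>t. max 0 (2 - t) powr p) has_real_derivative p * max 0 (2 - t) powr (p - 1) * (- 1)) (at t)"
      using p by (intro has_real_derivative_pos_part_powr') (auto intro!: derivative_eq_intros)
    from DERIV_cdivide[OF this, of "p * (p - 1)"]
    show ?thesis using p that by (simp add: smoothed_hinge1_right)
  qed
qed (auto simp: smoothed_hinge_left smoothed_hinge_mid smoothed_hinge_right)

lemma smoothed_hinge1_deriv: "(smoothed_hinge1 p has_real_derivative smoothed_hinge2 p t) (at t)"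
proof (rule three_piece_derivative[where c = "1 - (p - 3) / (p - 1)" and c' = 1])
  show "1 - (p - 3) / (p - 1) \<le> 1" using p by simp
  show "((\<lambda>t. - 1 + max 0 (t + (p - 3) / (p - 1)) powr (p - 1) / (p - 1))
      has_real_derivative smoothed_hinge2 p t) (at t)" if "t \<le> 1 - (p - 3) / (p - 1)" for t
  proof -
    have "((\<lambda>t. max 0 (t + (p - 3) / (p - 1)) powr (p - 1)) has_real_derivative
        (p - 1) * max 0 (t + (p - 3) / (p - 1)) powr (p - 1 - 1) * 1) (at t)"
      using p by (intro has_real_derivative_pos_part_powr') (auto intro!: derivative_eq_intros)
    from DERIV_add[OF DERIV_const[of "- 1"] DERIV_cdivide[OF this, of "p - 1"]]
    show ?thesis using p that by (simp add: smoothed_hinge2_def trapezoid_left)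
  qed
  show "((\<lambda>t. - 1 / (p - 1) - (1 - t)) has_real_derivative smoothed_hinge2 p t) (at t)"
    if "1 - (p - 3) / (p - 1) \<le> t" "t \<le> 1" for t
    using p that by (auto simp: smoothed_hinge2_def trapezoid_mid intro!: derivative_eq_intros)
  show "((\<lambda>t. - (max 0 (2 - t) powr (p - 1) / (p - 1))) has_real_derivative smoothed_hinge2 p t) (at t)"
    if "1 \<le> t" for t
  proof -
    have "((\<lambda>t. max 0 (2 - t) powr (p - 1)) has_real_derivative
        (p - 1) * max 0 (2 - t) powr (p - 1 - 1) * (- 1)) (at t)"
      using p by (intro has_real_derivative_pos_part_powr') (auto intro!: derivative_eq_intros)
    from DERIV_minus[OF DERIV_cdivide[OF this, of "p - 1"]]
    show ?thesis using p that by (simp add: smoothed_hinge2_def trapezoid_right)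
  qed
qed (auto simp: smoothed_hinge1_left smoothed_hinge1_mid smoothed_hinge1_right)

lemma smoothed_hinge2_range: "0 \<le> smoothed_hinge2 p t" "smoothed_hinge2 p t \<le> 1"
  using p trapezoid_range[of p t] by (auto simp: smoothed_hinge2_def intro!: powr_le1)

text \<open>Mean value theorem for the power of the positive part, so that an endpoint at zero does
  no harm. The exponent 1, which occurs for \<open>p = 3\<close>, is treated apart because the
  derivative at zero requires an exponent above 1.\<close>

lemma powr_lipschitz_unit:
  fixes x y q :: real
  assumes "1 \<le> q" "0 \<le> x" "x \<le> 1" "0 \<le> y" "y \<le> 1"
  shows "\<bar>x powr q - y powr q\<bar> \<le> q * \<bar>x - y\<bar>"
  using assms
proof (induction x y rule: linorder_wlog)
  case (le x y)
  show ?case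
  proof (cases "x = y \<or> q = 1")
    case False
    hence xy: "x < y" using le by simp
    have "\<exists>z>x. z < y \<and> max 0 y powr q - max 0 x powr q = (y - x) * (q * z powr (q - 1))"
    proof (rule MVT2[OF xy])
      fix z assume z: "x \<le> z" "z \<le> y"
      have "((\<lambda>t. max 0 t powr q) has_real_derivative q * max 0 z powr (q - 1)) (at z)"
        using False le by (intro has_real_derivative_pos_part_powr) auto
      thus "((\<lambda>t. max 0 t powr q) has_real_derivative q * z powr (q - 1)) (at z)"
        using z le by simp
    qed
    then obtain z where z: "x < z" "z < y" "y powr q - x powr q = (y - x) * (q * z powr (q - 1))"
      using le by auto
    have xy': "x powr q \<le> y powr q" using le by (intro powr_mono2) auto
    have "z powr (q - 1) \<le> 1" using z le by (intro powr_le1) auto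
    hence "(y - x) * (q * z powr (q - 1)) \<le> (y - x) * (q * 1)" using le by (intro mult_left_mono) auto
    moreover have "0 \<le> (y - x) * (q * z powr (q - 1))" using le by simp
    ultimately show ?thesis using z le by (simp add: mult_ac abs_if) (use xy' in \<open>simp add: mult_ac\<close>)
  qed (use le in auto)
next
  case (sym a b) thus ?case by (simp add: abs_minus_commute)
qed

lemma smoothed_hinge2_lipschitz: "\<bar>smoothed_hinge2 p s - smoothed_hinge2 p t\<bar> \<le> (p - 2) * \<bar>s - t\<bar>"
proof -
  have "\<bar>smoothed_hinge2 p s - smoothed_hinge2 p t\<bar> \<le> (p - 2) * \<bar>trapezoid p s - trapezoid p t\<bar>"
    unfolding smoothed_hinge2_def using p trapezoid_range by (intro powr_lipschitz_unit) auto
  also have "\<dots> \<le> (p - 2) * \<bar>s - t\<bar>" using p trapezoid_lipschitz by (intro mult_left_mono) auto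
  finally show ?thesis .
qed

text \<open>The derivative is monotone because the second derivative is nonnegative, so it suffices
  to look at one point far to the left and one far to the right.\<close>

lemma smoothed_hinge1_range: "- 1 \<le> smoothed_hinge1 p t" "smoothed_hinge1 p t \<le> 0"
proof -
  have mono: "smoothed_hinge1 p s \<le> smoothed_hinge1 p t" if "s \<le> t" for s t
    by (rule DERIV_nonneg_imp_nondecreasing[OF that])
      (use smoothed_hinge1_deriv smoothed_hinge2_range in blast)
  have "min (- 1) t \<le> 1 - (p - 3) / (p - 1)" using breakpoint_range by (smt (verit))
  hence "- 1 \<le> smoothed_hinge1 p (min (- 1) t)" using p by (simp add: smoothed_hinge1_left)
  also have "\<dots> \<le> smoothed_hinge1 p t" by (rule mono) simp
  finally show "- 1 \<le> smoothed_hinge1 p t" .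
  have "smoothed_hinge1 p t \<le> smoothed_hinge1 p (max t 2)" by (rule mono) simp
  also have "\<dots> = 0" by (subst smoothed_hinge1_right) auto
  finally show "smoothed_hinge1 p t \<le> 0" .
qed

lemma smoothed_hinge_antimono: "s \<le> t \<Longrightarrow> smoothed_hinge p t \<le> smoothed_hinge p s"
  by (rule DERIV_nonpos_imp_nonincreasing) (use smoothed_hinge_deriv smoothed_hinge1_range in blast)+

lemma smoothed_hinge_nonneg: "0 \<le> smoothed_hinge p t"
proof -
  have "0 = smoothed_hinge p (max t 2)" by (subst smoothed_hinge_right) auto
  also have "\<dots> \<le> smoothed_hinge p t" by (rule smoothed_hinge_antimono) simp
  finally show ?thesis .
qed

lemma smoothed_hinge_lipschitz: "\<bar>smoothed_hinge p s - smoothed_hinge p t\<bar> \<le> \<bar>s - t\<bar>"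
proof (induction s t rule: linorder_wlog)
  case (le s t)
  show ?case
  proof (cases "s = t")
    case False
    then obtain z where z: "s < z" "z < t"
      "smoothed_hinge p t - smoothed_hinge p s = (t - s) * smoothed_hinge1 p z"
      using MVT2[of s t "smoothed_hinge p" "smoothed_hinge1 p"] smoothed_hinge_deriv le by auto
    have "\<bar>(t - s) * smoothed_hinge1 p z\<bar> \<le> \<bar>t - s\<bar> * 1"
      unfolding abs_mult using smoothed_hinge1_range[of z] by (intro mult_left_mono) auto
    thus ?thesis using z le by simp
  qed simp
next
  case (sym a b) thus ?case by (simp add: abs_minus_commute)
qed

text \<open>With \<open>x = (p - 3) / (p - 1)\<close> the value at zero is \<open>1 - x / 2\<close>
  plus a power term that is at most \<open>x / 2\<close>. This is the source of the constant
  \<open>V0 = \<eta>\<close>.\<close>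

lemma smoothed_hinge_0_le: "smoothed_hinge p 0 \<le> 1"
proof -
  have a: "0 \<le> (p - 3) / (p - 1)" "(p - 3) / (p - 1) \<le> 1" using p by (auto simp: field_simps)
  show ?thesis
  proof (cases "p = 3")
    case True thus ?thesis by (simp add: smoothed_hinge_def)
  next
    case False
    define x where "x = (p - 3) / (p - 1)"
    have x: "0 \<le> x" "x \<le> 1" using a by (auto simp: x_def)
    have "x powr p \<le> x powr 1" using x p by (intro powr_mono') auto
    hence "x powr p / (p * (p - 1)) \<le> x / (p * (p - 1))" using x p by (intro divide_right_mono) auto
    also have "1 * 2 \<le> p * (p - 1)" using p by (intro mult_mono) auto
    hence "x / (p * (p - 1)) \<le> x / 2" using x p by (intro divide_left_mono) auto
    finally have "x powr p / (p * (p - 1)) \<le> x / 2" .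
    moreover have "smoothed_hinge p 0 = 3/2 - (p - 2) / (p - 1) + x powr p / (p * (p - 1))"
      using smoothed_hinge_left[of 0] a x by (simp add: x_def)
    moreover have "(p - 2) / (p - 1) = (1 + x) / 2" using p by (simp add: x_def field_simps)
    ultimately show ?thesis by argo
  qed
qed

end

section \<open>Third derivative of the loss away from the breakpoints\<close>

context
  fixes p :: real
  assumes p: "p \<ge> 3"
begin

text \<open>The clause about zeros serves the next lemma: the chain rule for \<open>powr\<close>
  fails at base zero, but off the breakpoints a zero of the trapezoid is surrounded by
  zeros.\<close>

lemma trapezoid_deriv:
  assumes "t \<notin> {- ((p - 3) / (p - 1)), 1 - (p - 3) / (p - 1), 1, 2}"
  shows "\<exists>D. (trapezoid p has_real_derivative D) (at t) \<and> \<bar>D\<bar> \<le> 1 \<and> (trapezoid p t = 0 \<longrightarrow> eventually (\<lambda>s. trapezoid p s = 0) (nhds t))"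
proof -
  define x where "x = (p - 3) / (p - 1)"
  have x: "0 \<le> x" "x < 1" using breakpoint_range[OF p] by (simp_all add: x_def)
  have t: "t \<noteq> - x" "t \<noteq> 1 - x" "t \<noteq> 1" "t \<noteq> 2" using assms by (simp_all add: x_def)
  have tr: "trapezoid p s = max 0 (min 1 (min (s + x) (2 - s)))" for s by (simp add: trapezoid_def x_def)
  have *: "\<exists>D. (trapezoid p has_real_derivative D) (at t) \<and> \<bar>D\<bar> \<le> 1 \<and> (trapezoid p t = 0 \<longrightarrow> eventually (\<lambda>s. trapezoid p s = 0) (nhds t))"
    if "open U" "t \<in> U" "(g has_real_derivative D) (at t)" "\<bar>D\<bar> \<le> 1"
      "\<And>s. s \<in> U \<Longrightarrow> trapezoid p s = g s" "(\<forall>s\<in>U. g s = 0) \<or> (\<forall>s\<in>U. g s \<noteq> 0)" for g D U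
  proof -
    have "(trapezoid p has_real_derivative D) (at t)"
      using DERIV_cong_ev[of t t "trapezoid p" g D D] that(1-3,5) by (auto simp: eventually_nhds)
    moreover have "trapezoid p t = 0 \<longrightarrow> eventually (\<lambda>s. trapezoid p s = 0) (nhds t)"
      using that(1,2,5,6) unfolding eventually_nhds by auto
    ultimately show ?thesis using that(4) by blast
  qed
  consider "t < - x" | "- x < t" "t < 1 - x" | "1 - x < t" "t < 1" | "1 < t" "t < 2" | "2 < t"
    using t x by linarith
  thus ?thesis
  proof cases
    case 1 show ?thesis
      by (rule *[of "{..<- x}" "\<lambda>_. 0" 0]) (use 1 x in \<open>auto simp: tr\<close>)
  next
    case 2 show ?thesis
      by (rule *[of "{- x<..<1 - x}" "\<lambda>s. s + x" 1]) (use 2 x in \<open>auto simp: tr intro!: derivative_eq_intros\<close>)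
  next
    case 3 show ?thesis
      by (rule *[of "{1 - x<..<1}" "\<lambda>_. 1" 0]) (use 3 x in \<open>auto simp: tr\<close>)
  next
    case 4 show ?thesis
      by (rule *[of "{1<..<2}" "\<lambda>s. 2 - s" "- 1"]) (use 4 x in \<open>auto simp: tr intro!: derivative_eq_intros\<close>)
  next
    case 5 show ?thesis
      by (rule *[of "{2<..}" "\<lambda>_. 0" 0]) (use 5 x in \<open>auto simp: tr\<close>)
  qed
qed

lemma smoothed_hinge2_deriv:
  assumes "t \<notin> {- ((p - 3) / (p - 1)), 1 - (p - 3) / (p - 1), 1, 2}"
  shows "\<exists>D. (smoothed_hinge2 p has_real_derivative D) (at t) \<and> \<bar>D\<bar> \<le> (p - 2) * trapezoid p t powr (p - 3)"
proof -
  obtain D where D: "(trapezoid p has_real_derivative D) (at t)" "\<bar>D\<bar> \<le> 1"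
    "trapezoid p t = 0 \<longrightarrow> eventually (\<lambda>s. trapezoid p s = 0) (nhds t)"
    using trapezoid_deriv[OF assms] by blast
  have eq: "smoothed_hinge2 p = (\<lambda>s. trapezoid p s powr (p - 2))" by (simp add: fun_eq_iff smoothed_hinge2_def)
  show ?thesis
  proof (cases "trapezoid p t = 0")
    case True
    hence "eventually (\<lambda>s. smoothed_hinge2 p s = 0) (nhds t)"
      using D(3) by (auto elim!: eventually_mono simp: smoothed_hinge2_def)
    hence "(smoothed_hinge2 p has_real_derivative 0) (at t)"
      using DERIV_cong_ev[of t t "smoothed_hinge2 p" "\<lambda>_. 0" 0 0] by simp
    thus ?thesis using p by (intro exI[of _ 0]) simp
  next
    case False
    hence pos: "trapezoid p t > 0" using trapezoid_range(1)[of p t] by simp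
    have "((\<lambda>s. trapezoid p s powr (p - 2)) has_real_derivative (p - 2) * trapezoid p t powr (p - 2 - of_nat 1) * D) (at t)"
      using DERIV_fun_powr[OF D(1) pos, of "p - 2"] by simp
    moreover have "\<bar>(p - 2) * trapezoid p t powr (p - 3) * D\<bar> \<le> (p - 2) * trapezoid p t powr (p - 3) * 1"
      unfolding abs_mult using p D(2) by (intro mult_mono) auto
    ultimately show ?thesis unfolding eq by (intro exI conjI) (auto simp: algebra_simps)
  qed
qed

end

section \<open>Real analysis of self-concordant functions\<close>

text \<open>Young's inequality with a free scale \<open>\<tau>\<close>, in a form that includes
  \<open>q = 1\<close>. It lets a sum with exponent \<open>q - 1\<close> be controlled by one with
  exponent \<open>q\<close>.\<close>

lemma young_powr:
  fixes x \<tau> q :: real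
  assumes x: "0 \<le> x" and t: "0 < \<tau>" and q: "1 \<le> q"
  shows "x powr (q - 1) \<le> (q - 1) / q * (x powr q / \<tau>) + \<tau> powr (q - 1) / q"
proof (cases "x = 0")
  case True thus ?thesis using t q by simp
next
  case False
  hence x: "x > 0" using x by simp
  \<comment> \<open>In logarithmic coordinates the claim is convexity of \<open>exp\<close> between
    0 and \<open>q * s\<close> with weight \<open>(q - 1) / q\<close>.\<close>
  define s where "s = ln (x / \<tau>)"
  have "exp ((1 - (q - 1) / q) *\<^sub>R 0 + ((q - 1) / q) *\<^sub>R (q * s))
      \<le> (1 - (q - 1) / q) * exp 0 + ((q - 1) / q) * exp (q * s)"
    using q by (intro convex_onD[OF exp_convex]) (auto simp: field_simps)
  moreover have "(1 - (q - 1) / q) *\<^sub>R 0 + ((q - 1) / q) *\<^sub>R (q * s) = (q - 1) * s" using q by simp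
  moreover have "1 - (q - 1) / q = 1 / q" using q by (simp add: field_simps)
  ultimately have "exp ((q - 1) * s) \<le> 1 / q + (q - 1) / q * exp (q * s)" by simp
  moreover have "exp ((q - 1) * s) = x powr (q - 1) / \<tau> powr (q - 1)"
    using x t by (simp add: s_def powr_def ln_div algebra_simps exp_diff[symmetric])
  moreover have "exp (q * s) = x powr q / \<tau> powr q"
    using x t by (simp add: s_def powr_def ln_div algebra_simps exp_diff[symmetric])
  ultimately have "x powr (q - 1) / \<tau> powr (q - 1) \<le> 1 / q + (q - 1) / q * (x powr q / \<tau> powr q)" by simp
  hence "x powr (q - 1) / \<tau> powr (q - 1) * \<tau> powr (q - 1)
      \<le> (1 / q + (q - 1) / q * (x powr q / \<tau> powr q)) * \<tau> powr (q - 1)"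
    by (intro mult_right_mono) auto
  moreover have "\<tau> powr (q - 1) = \<tau> powr q / \<tau>" using t by (simp add: powr_diff)
  moreover have "(1 / q + (q - 1) / q * (x powr q / \<tau> powr q)) * (\<tau> powr q / \<tau>)
      = (q - 1) / q * (x powr q / \<tau>) + (\<tau> powr q / \<tau>) / q"
  proof -
    have "x powr q / \<tau> powr q * (\<tau> powr q / \<tau>) = x powr q / \<tau>" using t by simp
    thus ?thesis by (simp only: distrib_right mult.assoc) simp
  qed
  ultimately show ?thesis using t by simp
qed

text \<open>The fundamental theorem of calculus tolerates finitely many exceptional points of a
  continuous function; these will be the parameters at which a sample meets a breakpoint of the
  loss.\<close>

lemma lipschitz_off_finite:
  fixes f :: "real \<Rightarrow> real"
  assumes S: "finite S" and ab: "a \<le> b" and cont: "continuous_on {a..b} f"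
    and deriv: "\<And>x. x \<in> {a<..<b} - S \<Longrightarrow> \<exists>D. (f has_real_derivative D) (at x) \<and> \<bar>D\<bar> \<le> K"
    and K: "0 \<le> K"
  shows "\<bar>f b - f a\<bar> \<le> K * (b - a)"
proof -
  obtain D where D: "\<And>x. x \<in> {a<..<b} - S \<Longrightarrow> (f has_real_derivative D x) (at x) \<and> \<bar>D x\<bar> \<le> K"
    using deriv by metis
  define D' where "D' x = (if x \<in> {a<..<b} - S then D x else 0)" for x
  have "(D' has_integral (f b - f a)) {a..b}"
    using S ab cont D
    by (intro fundamental_theorem_of_calculus_interior_strong[of S])
      (auto simp: D'_def has_real_derivative_iff_has_vector_derivative[symmetric])
  moreover have "norm (D' x) \<le> K" for x using D K by (auto simp: D'_def)
  ultimately show ?thesis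
    using has_integral_bound_real[of K "{}" D' "f b - f a" a b] K ab by simp
qed

text \<open>The hypothesis is the self-concordance inequality for the second derivative
  \<open>G\<close> along a line. It says precisely that the derivative of \<open>1 / sqrt G\<close>
  has modulus at most one.\<close>

lemma inverse_sqrt_lipschitz:
  fixes G :: "real \<Rightarrow> real"
  assumes S: "finite S" and t: "0 \<le> t" and cont: "continuous_on {0..t} G"
    and pos: "\<And>s. 0 \<le> s \<Longrightarrow> s \<le> t \<Longrightarrow> G s > 0"
    and deriv: "\<And>s. s \<in> {0<..<t} - S \<Longrightarrow> \<exists>D. (G has_real_derivative D) (at s) \<and> \<bar>D\<bar> \<le> 2 * G s * sqrt (G s)"
  shows "\<bar>1 / sqrt (G t) - 1 / sqrt (G 0)\<bar> \<le> t"
proof -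
  have "\<bar>1 / sqrt (G t) - 1 / sqrt (G 0)\<bar> \<le> 1 * (t - 0)"
  proof (rule lipschitz_off_finite[OF S t])
    show "continuous_on {0..t} (\<lambda>s. 1 / sqrt (G s))"
      using pos by (intro continuous_intros cont) force
    fix s assume s: "s \<in> {0<..<t} - S"
    then obtain D where D: "(G has_real_derivative D) (at s)" "\<bar>D\<bar> \<le> 2 * G s * sqrt (G s)"
      using deriv by blast
    have Gs: "G s > 0" using s pos by simp
    have "((\<lambda>s. sqrt (G s)) has_real_derivative (D / (sqrt (G s) * 2))) (at s)"
      using Gs by (auto intro!: derivative_eq_intros D(1) simp: field_simps)
    from DERIV_inverse_fun[OF this] have "((\<lambda>s. 1 / sqrt (G s)) has_real_derivative
        - (D / (sqrt (G s) * 2)) / (sqrt (G s) * sqrt (G s))) (at s)"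
      using Gs by (simp add: inverse_eq_divide)
    moreover have "\<bar>- (D / (sqrt (G s) * 2)) / (sqrt (G s) * sqrt (G s))\<bar> \<le> 1"
      using D(2) Gs by (simp add: abs_mult field_simps)
    ultimately show "\<exists>D. ((\<lambda>s. 1 / sqrt (G s)) has_real_derivative D) (at s) \<and> \<bar>D\<bar> \<le> 1" by blast
  qed simp
  thus ?thesis by simp
qed

text \<open>All comparisons of the objective with a model along a segment take this form, with
  \<open>E\<close> the difference of the two, normalized so that their slopes agree at 0.\<close>

lemma second_order_nonneg:
  fixes E :: "real \<Rightarrow> real"
  assumes E: "\<And>t. 0 \<le> t \<Longrightarrow> t \<le> 1 \<Longrightarrow> (E has_real_derivative E1 t) (at t)"
    and E1: "\<And>t. 0 \<le> t \<Longrightarrow> t \<le> 1 \<Longrightarrow> (E1 has_real_derivative E2 t) (at t)"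
    and E2: "\<And>t. 0 \<le> t \<Longrightarrow> t \<le> 1 \<Longrightarrow> 0 \<le> E2 t" and z: "E1 0 = 0"
  shows "E 0 \<le> E 1"
proof -
  have E1_nonneg: "0 \<le> E1 t" if "0 \<le> t" "t \<le> 1" for t
  proof -
    have "E1 0 \<le> E1 t"
    proof (rule DERIV_nonneg_imp_nondecreasing[OF that(1)])
      fix x assume "0 \<le> x" "x \<le> t"
      thus "\<exists>y. (E1 has_real_derivative y) (at x) \<and> 0 \<le> y"
        using E1[of x] E2[of x] that by auto
    qed
    thus ?thesis using z by simp
  qed
  show ?thesis
  proof (rule DERIV_nonneg_imp_nondecreasing[of 0 1 E])
    fix x :: real assume "0 \<le> x" "x \<le> 1"
    thus "\<exists>y. (E has_real_derivative y) (at x) \<and> 0 \<le> y"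
      using E[of x] E1_nonneg[of x] by auto
  qed simp
qed

text \<open>The difference of the two sides has derivative \<open>(1 - 1 / y)^2 / 2\<close>. This
  bound is sharp enough to leave a positive decrease in the damped Newton step, where
  \<open>ln x \<le> x - 1\<close> would not be.\<close>

lemma ln_le_half_diff:
  fixes x :: real
  assumes "1 \<le> x"
  shows "ln x \<le> (x - 1 / x) / 2"
proof -
  have "(1 - 1 / 1) / 2 - ln 1 \<le> (x - 1 / x) / 2 - ln x"
  proof (rule DERIV_nonneg_imp_nondecreasing[OF assms])
    fix y :: real assume y: "1 \<le> y" "y \<le> x"
    have "((\<lambda>x. (x - 1 / x) / 2 - ln x) has_real_derivative ((1 + 1 / (y * y)) / 2 - 1 / y)) (at y)"
      using y by (auto intro!: derivative_eq_intros simp: field_simps)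
    moreover have sq: "(1 + 1 / (y * y)) / 2 - 1 / y = (1 - 1 / y)\<^sup>2 / 2"
      by (simp add: power2_eq_square algebra_simps add_divide_distrib diff_divide_distrib)
    have "0 \<le> (1 + 1 / (y * y)) / 2 - 1 / y" unfolding sq by simp
    ultimately show "\<exists>z. ((\<lambda>x. (x - 1 / x) / 2 - ln x) has_real_derivative z) (at y) \<and> 0 \<le> z" by blast
  qed
  thus ?thesis by simp
qed

text \<open>The difference \<open>h\<close> of the two sides increases up to 1/2 and decreases
  afterwards, so beyond 1/2 it suffices to check one point to the right of the range. The end of the
  range is the square root of the threshold \<open>exp (- 1)\<close> for the precision.\<close>

lemma omega_conj_le:
  fixes t :: real
  assumes t: "0 \<le> t" "t \<le> exp (- 1 / 2)"
  shows "- t - ln (1 - t) \<le> t\<^sup>2"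
proof -
  define h where "h t = t\<^sup>2 + t + ln (1 - t)" for t :: real
  have "exp (1 / 2) \<ge> 1 + 1 / 2 + (1 / 2)\<^sup>2 / (2 :: real)" by (rule exp_lower_Taylor_quadratic) simp
  hence "exp (1 / 2 :: real) \<ge> 13 / 8" by (simp add: power2_eq_square)
  hence "exp (- 1 / 2 :: real) \<le> 1 / (13 / 8)" by (simp add: exp_minus field_simps)
  \<comment> \<open>A rational upper bound for \<open>exp (- 1 / 2)\<close>, close enough that
    \<open>h\<close> is still nonnegative there.\<close>
  hence t': "t \<le> 31 / 50" using t by simp
  have h: "(h has_real_derivative s * (1 - 2 * s) / (1 - s)) (at s)" if "s < 1" for s
  proof -
    have "(h has_real_derivative 2 * s + 1 - 1 / (1 - s)) (at s)"
      unfolding h_def using that by (auto intro!: derivative_eq_intros simp: field_simps)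
    moreover have "2 * s + 1 - 1 / (1 - s) = s * (1 - 2 * s) / (1 - s)"
      using that by (simp add: field_simps)
    ultimately show ?thesis by simp
  qed
  have "0 \<le> h t"
  proof (cases "t \<le> 1 / 2")
    case True
    have "h 0 \<le> h t"
    proof (rule DERIV_nonneg_imp_nondecreasing[OF t(1)])
      fix s assume s: "0 \<le> s" "s \<le> t"
      have "0 \<le> s * (1 - 2 * s) / (1 - s)" using s True by (intro divide_nonneg_nonneg mult_nonneg_nonneg) auto
      thus "\<exists>y. (h has_real_derivative y) (at s) \<and> 0 \<le> y" using h[of s] s True by auto
    qed
    thus ?thesis by (simp add: h_def)
  next
    case False
    \<comment> \<open>At 31/50 the claim reads \<open>ln (19 / 50) \<ge> - 1.0044\<close>. The value
      251/250 is just below 1.0044, and its half is small enough for the quadratic Taylor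
      bound.\<close>
    have "exp (251 / 500) \<ge> 1 + 251 / 500 + (251 / 500)\<^sup>2 / (2 :: real)" by (rule exp_lower_Taylor_quadratic) simp
    hence e: "exp (251 / 500 :: real) \<ge> 1628 / 1000" by (simp add: power2_eq_square)
    have "(1628 / 1000)\<^sup>2 \<le> (exp (251 / 500 :: real))\<^sup>2" using e by (intro power_mono) auto
    also have "\<dots> = exp (251 / 250)" by (simp add: power2_eq_square exp_add[symmetric])
    finally have "exp (251 / 250 :: real) \<ge> 2650 / 1000" by (simp add: power2_eq_square)
    hence "exp (- (251 / 250) :: real) \<le> 1 / (2650 / 1000)" by (simp add: exp_minus field_simps)
    hence "exp (- (251 / 250) :: real) \<le> 19 / 50" by simp
    hence "- (251 / 250) \<le> ln (19 / 50 :: real)" by (simp add: ln_ge_iff)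
    hence "0 \<le> h (31 / 50)" by (simp add: h_def power2_eq_square)
    also have "h (31 / 50) \<le> h t"
    proof (rule DERIV_nonpos_imp_nonincreasing[OF t'])
      fix s assume s: "t \<le> s" "s \<le> 31 / 50"
      have "s * (1 - 2 * s) / (1 - s) \<le> 0" using s False
        by (intro divide_nonpos_nonneg mult_nonneg_nonpos) auto
      thus "\<exists>y. (h has_real_derivative y) (at s) \<and> y \<le> 0" using h[of s] s by auto
    qed
    finally show ?thesis .
  qed
  thus ?thesis by (simp add: h_def)
qed

text \<open>The Fenchel-Young inequality for \<open>t - ln (1 + t)\<close> and its conjugate; it is
  \<open>ln y \<le> y - 1\<close> at \<open>y = (1 + t) * (1 - \<nu>)\<close>.\<close>

lemma omega_dual:
  fixes t \<nu> :: real
  assumes "0 \<le> t" "\<nu> < 1"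
  shows "t * \<nu> - t + ln (1 + t) \<le> - \<nu> - ln (1 - \<nu>)"
proof -
  have "ln ((1 + t) * (1 - \<nu>)) \<le> (1 + t) * (1 - \<nu>) - 1"
    using assms by (intro ln_le_minus_one) (auto intro: mult_pos_pos)
  moreover have "ln ((1 + t) * (1 - \<nu>)) = ln (1 + t) + ln (1 - \<nu>)" using assms by (simp add: ln_mult)
  ultimately show ?thesis by (simp add: algebra_simps)
qed

section \<open>The regularized empirical loss\<close>

text \<open>Labels are already multiplied into the vectors \<open>a i\<close>. The index set and the
  regularization are left open, so that the global objective, each local one and the locally
  regularized ones are all instances.\<close>

locale erm = rvec_space +
  fixes I :: "'i set" and a :: "'i \<Rightarrow> rvec" and p B \<eta> lam :: real
  assumes fin: "finite I" and ne: "I \<noteq> {}" and a_carrier [simp]: "\<And>i. i \<in> I \<Longrightarrow> a i \<in> V"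
    and a_norm: "\<And>i. i \<in> I \<Longrightarrow> norm2 (a i) \<le> B"
    and p3: "3 \<le> p" and B: "0 < B" and eta: "0 < \<eta>" and lam: "0 < lam"
begin

definition wt where "wt = \<eta> / real (card I)"
definition obj where "obj w = wt * (\<Sum>i\<in>I. smoothed_hinge p (a i \<bullet> w)) + lam / 2 * (w \<bullet> w)"
definition grd where
  "grd w = Matrix.vec d (\<lambda>k. wt * (\<Sum>i\<in>I. smoothed_hinge1 p (a i \<bullet> w) * a i $ k) + lam * w $ k)"
definition hes where
  "hes w = Matrix.mat d d (\<lambda>(k, l). wt * (\<Sum>i\<in>I. smoothed_hinge2 p (a i \<bullet> w) * (a i $ k * a i $ l))
    + (if k = l then lam else 0))"
definition Lip where "Lip = \<eta> * B\<^sup>2 + lam"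

lemma wt: "0 < wt" "wt * real (card I) = \<eta>"
  using fin ne eta by (auto simp: wt_def card_gt_0_iff)

lemma Lip: "0 < Lip" "lam \<le> Lip" "lam < Lip"
  using eta B lam by (auto simp: Lip_def intro!: add_nonneg_pos)

lemma grd_carrier [simp]: "grd w \<in> V"
  by (simp add: grd_def)

lemma hes_carrier [simp]: "hes w \<in> carrier_mat d d"
  by (simp add: hes_def)

lemma ip_grd: "u \<in> V \<Longrightarrow> w \<in> V \<Longrightarrow>
  u \<bullet> grd w = wt * (\<Sum>i\<in>I. smoothed_hinge1 p (a i \<bullet> w) * (a i \<bullet> u)) + lam * (u \<bullet> w)"
proof -
  assume u: "u \<in> V" and w: "w \<in> V"
  have "u \<bullet> grd w = (\<Sum>k<d. u $ k * (wt * (\<Sum>i\<in>I. smoothed_hinge1 p (a i \<bullet> w) * a i $ k) + lam * w $ k))"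
    using u by (simp add: ip_sum grd_def)
  also have "\<dots> = wt * (\<Sum>k<d. \<Sum>i\<in>I. smoothed_hinge1 p (a i \<bullet> w) * (a i $ k * u $ k)) + lam * (\<Sum>k<d. u $ k * w $ k)"
    by (simp add: algebra_simps sum.distrib sum_distrib_left)
  also have "(\<Sum>k<d. \<Sum>i\<in>I. smoothed_hinge1 p (a i \<bullet> w) * (a i $ k * u $ k))
      = (\<Sum>i\<in>I. smoothed_hinge1 p (a i \<bullet> w) * (\<Sum>k<d. a i $ k * u $ k))"
    by (subst sum.swap) (simp add: sum_distrib_left)
  also have "\<dots> = (\<Sum>i\<in>I. smoothed_hinge1 p (a i \<bullet> w) * (a i \<bullet> u))"
    using u by (intro sum.cong refl) (simp add: ip_sum)
  finally show ?thesis using u w by (simp add: ip_sum)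
qed

lemma ip_hes: "u \<in> V \<Longrightarrow> v \<in> V \<Longrightarrow>
  u \<bullet> (hes w *\<^sub>v v) = wt * (\<Sum>i\<in>I. smoothed_hinge2 p (a i \<bullet> w) * ((a i \<bullet> u) * (a i \<bullet> v))) + lam * (u \<bullet> v)"
proof -
  assume u: "u \<in> V" and v: "v \<in> V"
  have ent: "(hes w *\<^sub>v v) $ k = wt * (\<Sum>i\<in>I. smoothed_hinge2 p (a i \<bullet> w) * (a i $ k * (a i \<bullet> v))) + lam * v $ k"
    if k: "k < d" for k
  proof -
    have "(hes w *\<^sub>v v) $ k = (\<Sum>l<d. (wt * (\<Sum>i\<in>I. smoothed_hinge2 p (a i \<bullet> w) * (a i $ k * a i $ l))
        + (if k = l then lam else 0)) * v $ l)"
      using k v by (simp add: hes_def scalar_prod_def atLeast0LessThan)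
    also have "\<dots> = (\<Sum>l<d. wt * (\<Sum>i\<in>I. smoothed_hinge2 p (a i \<bullet> w) * (a i $ k * (a i $ l * v $ l)))
        + (if k = l then lam * v $ l else 0))"
    proof (intro sum.cong refl)
      fix l
      have "(\<Sum>i\<in>I. smoothed_hinge2 p (a i \<bullet> w) * (a i $ k * a i $ l)) * v $ l
          = (\<Sum>i\<in>I. smoothed_hinge2 p (a i \<bullet> w) * (a i $ k * (a i $ l * v $ l)))"
        by (simp add: sum_distrib_right mult.assoc)
      thus "(wt * (\<Sum>i\<in>I. smoothed_hinge2 p (a i \<bullet> w) * (a i $ k * a i $ l)) + (if k = l then lam else 0)) * v $ l
          = wt * (\<Sum>i\<in>I. smoothed_hinge2 p (a i \<bullet> w) * (a i $ k * (a i $ l * v $ l))) + (if k = l then lam * v $ l else 0)"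
        by (simp add: distrib_right mult.assoc)
    qed
    also have "\<dots> = wt * (\<Sum>l<d. \<Sum>i\<in>I. smoothed_hinge2 p (a i \<bullet> w) * (a i $ k * (a i $ l * v $ l)))
        + (\<Sum>l<d. if k = l then lam * v $ l else 0)"
      by (simp add: sum.distrib sum_distrib_left)
    also have "(\<Sum>l<d. \<Sum>i\<in>I. smoothed_hinge2 p (a i \<bullet> w) * (a i $ k * (a i $ l * v $ l)))
        = (\<Sum>i\<in>I. smoothed_hinge2 p (a i \<bullet> w) * (a i $ k * (\<Sum>l<d. a i $ l * v $ l)))"
      by (subst sum.swap) (simp add: sum_distrib_left)
    also have "\<dots> = (\<Sum>i\<in>I. smoothed_hinge2 p (a i \<bullet> w) * (a i $ k * (a i \<bullet> v)))"
      using v by (intro sum.cong refl) (simp add: ip_sum)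
    finally show ?thesis using k by simp
  qed
  have "u \<bullet> (hes w *\<^sub>v v)
      = (\<Sum>k<d. u $ k * (wt * (\<Sum>i\<in>I. smoothed_hinge2 p (a i \<bullet> w) * (a i $ k * (a i \<bullet> v))) + lam * v $ k))"
    unfolding ip_sum[OF u mv_carrier[OF hes_carrier]] by (intro sum.cong refl) (simp only: ent lessThan_iff)
  also have "\<dots> = wt * (\<Sum>k<d. \<Sum>i\<in>I. smoothed_hinge2 p (a i \<bullet> w) * ((a i $ k * u $ k) * (a i \<bullet> v)))
      + lam * (\<Sum>k<d. u $ k * v $ k)"
    by (simp add: algebra_simps sum.distrib sum_distrib_left)
  also have "(\<Sum>k<d. \<Sum>i\<in>I. smoothed_hinge2 p (a i \<bullet> w) * ((a i $ k * u $ k) * (a i \<bullet> v)))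
      = (\<Sum>i\<in>I. smoothed_hinge2 p (a i \<bullet> w) * ((\<Sum>k<d. a i $ k * u $ k) * (a i \<bullet> v)))"
    by (subst sum.swap) (simp add: sum_distrib_left sum_distrib_right mult.assoc)
  also have "\<dots> = (\<Sum>i\<in>I. smoothed_hinge2 p (a i \<bullet> w) * ((a i \<bullet> u) * (a i \<bullet> v)))"
    using u by (intro sum.cong refl) (simp add: ip_sum)
  finally show ?thesis using u v by (simp add: ip_sum)
qed

lemma hes_lower: "v \<in> V \<Longrightarrow> lam * (v \<bullet> v) \<le> v \<bullet> (hes w *\<^sub>v v)"
  using wt smoothed_hinge2_range[OF p3] by (simp add: ip_hes sum_nonneg)

lemma ip_a_sq: "i \<in> I \<Longrightarrow> v \<in> V \<Longrightarrow> (a i \<bullet> v)\<^sup>2 \<le> B\<^sup>2 * (v \<bullet> v)"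
proof -
  assume i: "i \<in> I" and v: "v \<in> V"
  have "(a i \<bullet> v)\<^sup>2 \<le> (a i \<bullet> a i) * (v \<bullet> v)" using i v by (intro cauchy_schwarz_sq) auto
  also have "a i \<bullet> a i = (norm2 (a i))\<^sup>2" using i by (simp add: norm2_sq)
  also have "\<dots> \<le> B\<^sup>2" using a_norm[OF i] i by (intro power_mono) auto
  finally show ?thesis using v by (simp add: mult_right_mono)
qed

lemma sum_sq_le:
  assumes v: "v \<in> V" and g: "\<And>i. i \<in> I \<Longrightarrow> g i \<le> 1"
  shows "wt * (\<Sum>i\<in>I. g i * (a i \<bullet> v)\<^sup>2) \<le> \<eta> * B\<^sup>2 * (v \<bullet> v)"
proof -
  have "(\<Sum>i\<in>I. g i * (a i \<bullet> v)\<^sup>2) \<le> (\<Sum>i\<in>I. 1 * (B\<^sup>2 * (v \<bullet> v)))"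
  proof (rule sum_mono)
    fix i assume i: "i \<in> I"
    have "g i * (a i \<bullet> v)\<^sup>2 \<le> 1 * (a i \<bullet> v)\<^sup>2" using g[OF i] by (intro mult_right_mono) auto
    thus "g i * (a i \<bullet> v)\<^sup>2 \<le> 1 * (B\<^sup>2 * (v \<bullet> v))" using ip_a_sq[OF i v] by simp
  qed
  hence "wt * (\<Sum>i\<in>I. g i * (a i \<bullet> v)\<^sup>2) \<le> wt * (real (card I) * (B\<^sup>2 * (v \<bullet> v)))"
    using wt by (intro mult_left_mono) auto
  also have "\<dots> = (wt * real (card I)) * B\<^sup>2 * (v \<bullet> v)" by simp
  finally show ?thesis by (simp only: wt)
qed

lemma hes_upper: "v \<in> V \<Longrightarrow> v \<bullet> (hes w *\<^sub>v v) \<le> Lip * (v \<bullet> v)"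
  using sum_sq_le[of v "\<lambda>i. smoothed_hinge2 p (a i \<bullet> w)"] smoothed_hinge2_range[OF p3]
  by (simp add: ip_hes Lip_def power2_eq_square algebra_simps)

lemma hes_sym: "u \<in> V \<Longrightarrow> v \<in> V \<Longrightarrow> u \<bullet> (hes w *\<^sub>v v) = v \<bullet> (hes w *\<^sub>v u)"
  using ip_comm[of u v] by (simp add: ip_hes mult_ac)

lemma ip_pos: "v \<in> V \<Longrightarrow> v \<noteq> 0\<^sub>v d \<Longrightarrow> 0 < v \<bullet> v"
  using ip_ge_0[of v] ip_eq_0[of v] by linarith

lemma hes_spd: "spd d (hes w)"
proof
  fix x y assume x: "x \<in> V"
  show "x \<bullet> (hes w *\<^sub>v y) = y \<bullet> (hes w *\<^sub>v x)" if "y \<in> V" using hes_sym x that .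
  assume "x \<noteq> 0\<^sub>v d"
  hence "0 < lam * (x \<bullet> x)" using lam ip_pos[OF x] by simp
  thus "0 < x \<bullet> (hes w *\<^sub>v x)" using hes_lower[OF x, of w] by linarith
qed simp

lemma obj_line_deriv:
  assumes w: "w \<in> V" and u: "u \<in> V"
  shows "((\<lambda>t. obj (w + t \<cdot>\<^sub>v u)) has_real_derivative (u \<bullet> grd (w + t \<cdot>\<^sub>v u))) (at t)"
proof -
  have eq: "obj (w + t \<cdot>\<^sub>v u) = wt * (\<Sum>i\<in>I. smoothed_hinge p (a i \<bullet> w + t * (a i \<bullet> u)))
      + lam / 2 * (w \<bullet> w + 2 * t * (w \<bullet> u) + t\<^sup>2 * (u \<bullet> u))" for t
    using w u ip_comm[OF u w] unfolding obj_def
    by (simp add: power2_eq_square algebra_simps cong: sum.cong)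
  have "((\<lambda>t. smoothed_hinge p (a i \<bullet> w + t * (a i \<bullet> u))) has_real_derivative
      smoothed_hinge1 p (a i \<bullet> w + t * (a i \<bullet> u)) * (a i \<bullet> u)) (at t)" for i
    by (rule DERIV_chain2[OF smoothed_hinge_deriv[OF p3]]) (auto intro!: derivative_eq_intros)
  hence "((\<lambda>t. wt * (\<Sum>i\<in>I. smoothed_hinge p (a i \<bullet> w + t * (a i \<bullet> u)))) has_real_derivative
      wt * (\<Sum>i\<in>I. smoothed_hinge1 p (a i \<bullet> w + t * (a i \<bullet> u)) * (a i \<bullet> u))) (at t)"
    by (intro DERIV_cmult DERIV_sum)
  moreover have "((\<lambda>t. lam / 2 * (w \<bullet> w + 2 * t * (w \<bullet> u) + t\<^sup>2 * (u \<bullet> u))) has_real_derivative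
      lam * (w \<bullet> u + t * (u \<bullet> u))) (at t)"
    by (auto intro!: derivative_eq_intros simp: algebra_simps)
  ultimately have "((\<lambda>t. obj (w + t \<cdot>\<^sub>v u)) has_real_derivative
      wt * (\<Sum>i\<in>I. smoothed_hinge1 p (a i \<bullet> w + t * (a i \<bullet> u)) * (a i \<bullet> u)) + lam * (w \<bullet> u + t * (u \<bullet> u))) (at t)"
    unfolding eq by (rule DERIV_add)
  moreover have "u \<bullet> grd (w + t \<cdot>\<^sub>v u)
      = wt * (\<Sum>i\<in>I. smoothed_hinge1 p (a i \<bullet> w + t * (a i \<bullet> u)) * (a i \<bullet> u)) + lam * (w \<bullet> u + t * (u \<bullet> u))"
    using w u ip_comm[OF u w] by (subst ip_grd) (simp_all cong: sum.cong)
  ultimately show ?thesis by simp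
qed

lemma grd_line_deriv:
  assumes w: "w \<in> V" and u: "u \<in> V" and x: "x \<in> V"
  shows "((\<lambda>t. x \<bullet> grd (w + t \<cdot>\<^sub>v u)) has_real_derivative (x \<bullet> (hes (w + t \<cdot>\<^sub>v u) *\<^sub>v u))) (at t)"
proof -
  have eq: "x \<bullet> grd (w + t \<cdot>\<^sub>v u) = wt * (\<Sum>i\<in>I. smoothed_hinge1 p (a i \<bullet> w + t * (a i \<bullet> u)) * (a i \<bullet> x))
      + lam * (x \<bullet> w + t * (x \<bullet> u))" for t
    using w u x by (subst ip_grd) (simp_all cong: sum.cong)
  have "((\<lambda>t. smoothed_hinge1 p (a i \<bullet> w + t * (a i \<bullet> u)) * (a i \<bullet> x)) has_real_derivative
      smoothed_hinge2 p (a i \<bullet> w + t * (a i \<bullet> u)) * (a i \<bullet> u) * (a i \<bullet> x)) (at t)" for i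
    by (rule DERIV_cmult_right, rule DERIV_chain2[OF smoothed_hinge1_deriv[OF p3]]) (auto intro!: derivative_eq_intros)
  hence "((\<lambda>t. wt * (\<Sum>i\<in>I. smoothed_hinge1 p (a i \<bullet> w + t * (a i \<bullet> u)) * (a i \<bullet> x))) has_real_derivative
      wt * (\<Sum>i\<in>I. smoothed_hinge2 p (a i \<bullet> w + t * (a i \<bullet> u)) * (a i \<bullet> u) * (a i \<bullet> x))) (at t)"
    by (intro DERIV_cmult DERIV_sum)
  moreover have "((\<lambda>t. lam * (x \<bullet> w + t * (x \<bullet> u))) has_real_derivative lam * (x \<bullet> u)) (at t)"
    by (auto intro!: derivative_eq_intros)
  ultimately have "((\<lambda>t. x \<bullet> grd (w + t \<cdot>\<^sub>v u)) has_real_derivative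
      wt * (\<Sum>i\<in>I. smoothed_hinge2 p (a i \<bullet> w + t * (a i \<bullet> u)) * (a i \<bullet> u) * (a i \<bullet> x)) + lam * (x \<bullet> u)) (at t)"
    unfolding eq by (rule DERIV_add)
  moreover have "x \<bullet> (hes (w + t \<cdot>\<^sub>v u) *\<^sub>v u) =
      wt * (\<Sum>i\<in>I. smoothed_hinge2 p (a i \<bullet> w + t * (a i \<bullet> u)) * (a i \<bullet> u) * (a i \<bullet> x)) + lam * (x \<bullet> u)"
    using w u x by (subst ip_hes) (simp_all add: mult_ac cong: sum.cong)
  ultimately show ?thesis by simp
qed

text \<open>Agreement on \<open>V\<close> is enough because coordinate lines stay in
  \<open>V\<close>; thus the formal derivatives used by the algorithm are identified without any
  statement about vectors of other dimensions.\<close>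

lemma gradient_eq:
  assumes F: "\<And>w. w \<in> V \<Longrightarrow> F w = obj w" and w: "w \<in> V"
  shows "gradient d F w = grd w"
proof (rule vecV_eqI)
  fix k assume k: "k < d"
  have uk: "(unit_vec d k :: rvec) \<in> V" by simp
  have F': "F (w + t \<cdot>\<^sub>v unit_vec d k) = obj (w + t \<cdot>\<^sub>v unit_vec d k)" for t using w by (intro F) simp
  have w0: "w + 0 \<cdot>\<^sub>v unit_vec d k = w" using w by (intro vecV_eqI) auto
  have "deriv (\<lambda>t. obj (w + t \<cdot>\<^sub>v unit_vec d k)) 0 = unit_vec d k \<bullet> grd w"
    using DERIV_imp_deriv[OF obj_line_deriv[OF w uk, of 0]] by (simp add: w0)
  also have "\<dots> = grd w $ k" using k by (simp add: scalar_prod_left_unit[of _ d])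
  finally show "gradient d F w $ k = grd w $ k" using k by (simp add: gradient_def F')
qed (simp_all add: gradient_def)

lemma hessian_eq:
  assumes F: "\<And>w. w \<in> V \<Longrightarrow> F w = obj w" and w: "w \<in> V"
  shows "hessian d F w = hes w"
proof (rule eq_matI)
  fix k l assume "k < dim_row (hes w)" "l < dim_col (hes w)"
  hence k: "k < d" and l: "l < d" by (auto simp: hes_def)
  have u: "(unit_vec d k :: rvec) \<in> V" "(unit_vec d l :: rvec) \<in> V" by simp_all
  have w0: "w + 0 \<cdot>\<^sub>v unit_vec d l = w" using w by (intro vecV_eqI) auto
  have F': "gradient d F (w + t \<cdot>\<^sub>v unit_vec d l) $ k = unit_vec d k \<bullet> grd (w + t \<cdot>\<^sub>v unit_vec d l)" for t
    using w k by (subst gradient_eq[OF F]) (auto simp: scalar_prod_left_unit[of _ d])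
  have "deriv (\<lambda>t. gradient d F (w + t \<cdot>\<^sub>v unit_vec d l) $ k) 0 = unit_vec d k \<bullet> (hes w *\<^sub>v unit_vec d l)"
    unfolding F' using DERIV_imp_deriv[OF grd_line_deriv[OF w u(2) u(1), of 0]] by (simp add: w0)
  also have "\<dots> = hes w $$ (k, l)"
    using k l by (subst scalar_prod_left_unit[of _ d]) (auto simp: hes_def)
  finally show "hessian d F w $$ (k, l) = hes w $$ (k, l)" using k l by (simp add: hessian_def)
qed (simp_all add: hessian_def hes_def)

lemma vec_diff_line: "w \<in> V \<Longrightarrow> u \<in> V \<Longrightarrow> w + (u - w) = (u :: rvec)"
  by (intro vecV_eqI) auto

lemma line_0: "w \<in> V \<Longrightarrow> u \<in> V \<Longrightarrow> w + 0 \<cdot>\<^sub>v u = (w :: rvec)"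
  by (intro vecV_eqI) auto

lemma strong_convexity:
  assumes w: "w \<in> V" and u: "u \<in> V"
  shows "obj w + u \<bullet> grd w + lam / 2 * (u \<bullet> u) \<le> obj (w + u)"
proof -
  define E where "E t = obj (w + t \<cdot>\<^sub>v u) - t * (u \<bullet> grd w) - lam / 2 * t\<^sup>2 * (u \<bullet> u)" for t
  have "E 0 \<le> E 1"
  proof (rule second_order_nonneg)
    show "(E has_real_derivative (u \<bullet> grd (w + t \<cdot>\<^sub>v u) - u \<bullet> grd w - lam * t * (u \<bullet> u))) (at t)" for t
      unfolding E_def by (auto intro!: derivative_eq_intros obj_line_deriv w u)
    show "((\<lambda>t. u \<bullet> grd (w + t \<cdot>\<^sub>v u) - u \<bullet> grd w - lam * t * (u \<bullet> u)) has_real_derivative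
        (u \<bullet> (hes (w + t \<cdot>\<^sub>v u) *\<^sub>v u) - lam * (u \<bullet> u))) (at t)" for t
      by (auto intro!: derivative_eq_intros grd_line_deriv w u)
    show "0 \<le> u \<bullet> (hes (w + t \<cdot>\<^sub>v u) *\<^sub>v u) - lam * (u \<bullet> u)" for t
      using hes_lower[OF u] by simp
    show "u \<bullet> grd (w + 0 \<cdot>\<^sub>v u) - u \<bullet> grd w - lam * 0 * (u \<bullet> u) = 0" using w u by (simp add: line_0)
  qed
  thus ?thesis using w u by (simp add: E_def line_0)
qed

lemma obj_nonneg: "w \<in> V \<Longrightarrow> lam / 2 * (w \<bullet> w) \<le> obj w"
  using wt smoothed_hinge_nonneg[OF p3] by (simp add: obj_def sum_nonneg)

lemma obj_zero_le: "obj (0\<^sub>v d) \<le> \<eta>"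
proof -
  have "(\<Sum>i\<in>I. smoothed_hinge p (a i \<bullet> 0\<^sub>v d)) \<le> (\<Sum>i\<in>I. 1)"
    using smoothed_hinge_0_le[OF p3] by (intro sum_mono) simp
  hence "wt * (\<Sum>i\<in>I. smoothed_hinge p (a i \<bullet> 0\<^sub>v d)) \<le> wt * real (card I)"
    using wt by (intro mult_left_mono) auto
  thus ?thesis by (simp add: obj_def wt)
qed

lemma obj_upper:
  assumes "w \<in> V"
  shows "obj w \<le> \<eta> * (1 + B * norm2 w) + lam / 2 * (w \<bullet> w)"
proof -
  have "(\<Sum>i\<in>I. smoothed_hinge p (a i \<bullet> w)) \<le> (\<Sum>i\<in>I. 1 + B * norm2 w)"
  proof (rule sum_mono)
    fix i assume i: "i \<in> I"
    have "\<bar>a i \<bullet> w\<bar> \<le> norm2 (a i) * norm2 w" using i assms by (intro cauchy_schwarz) auto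
    also have "\<dots> \<le> B * norm2 w" using a_norm[OF i] assms by (intro mult_right_mono) auto
    finally have "\<bar>a i \<bullet> w\<bar> \<le> B * norm2 w" .
    thus "smoothed_hinge p (a i \<bullet> w) \<le> 1 + B * norm2 w"
      using smoothed_hinge_lipschitz[OF p3, of "a i \<bullet> w" 0] smoothed_hinge_0_le[OF p3] by linarith
  qed
  hence "wt * (\<Sum>i\<in>I. smoothed_hinge p (a i \<bullet> w)) \<le> wt * (real (card I) * (1 + B * norm2 w))"
    using wt by (intro mult_left_mono) auto
  also have "\<dots> = \<eta> * (1 + B * norm2 w)" using wt by (simp add: mult.assoc[symmetric])
  finally show ?thesis by (simp add: obj_def)
qed

subsection \<open>The minimizer\<close>

text \<open>The minimizer is the limit of gradient descent from the origin; this representation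
  also shows that it depends measurably on the data.\<close>

primrec gd :: "nat \<Rightarrow> rvec" where
  "gd 0 = 0\<^sub>v d"
| "gd (Suc k) = gd k - (1 / (2 * Lip)) \<cdot>\<^sub>v grd (gd k)"

definition minimizer where "minimizer = Matrix.vec d (\<lambda>j. lim (\<lambda>k. gd k $ j))"

lemma gd_carrier [simp]: "gd k \<in> V"
  by (induction k) auto

lemma mv_smult_mat: "(A :: rmat) \<in> carrier_mat d d \<Longrightarrow> t \<in> V \<Longrightarrow> (c \<cdot>\<^sub>m A) *\<^sub>v t = c \<cdot>\<^sub>v (A *\<^sub>v t)"
  by (intro eq_vecI) (auto simp: scalar_prod_def sum_distrib_left mult_ac)

text \<open>The difference of the images is \<open>A u\<close>, where \<open>A\<close> is the
  identity minus a Hessian divided by \<open>2 * Lip\<close>. The factor 2 keeps \<open>A\<close>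
  above one half of the identity, hence positive definite, so Cauchy-Schwarz in its form
  applies.\<close>

lemma gd_contraction:
  assumes w: "w \<in> V" and w': "w' \<in> V"
  shows "norm2 ((w' - (1 / (2 * Lip)) \<cdot>\<^sub>v grd w') - (w - (1 / (2 * Lip)) \<cdot>\<^sub>v grd w))
    \<le> (1 - lam / (2 * Lip)) * norm2 (w' - w)"
proof -
  define u where "u = w' - w"
  define x where "x = (w' - (1 / (2 * Lip)) \<cdot>\<^sub>v grd w') - (w - (1 / (2 * Lip)) \<cdot>\<^sub>v grd w)"
  define \<rho> where "\<rho> = 1 - lam / (2 * Lip)"
  have u: "u \<in> V" and x: "x \<in> V" using w w' by (auto simp: u_def x_def)
  have \<rho>: "0 \<le> \<rho>" using Lip lam by (simp add: \<rho>_def field_simps)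
  \<comment> \<open>Testing against the fixed vector \<open>x\<close>, the difference of the images
    itself, reduces the mean value theorem for gradients to a scalar one.\<close>
  have "\<exists>z>0. z < 1 \<and> x \<bullet> grd (w + 1 \<cdot>\<^sub>v u) - x \<bullet> grd (w + 0 \<cdot>\<^sub>v u) = (1 - 0) * (x \<bullet> (hes (w + z \<cdot>\<^sub>v u) *\<^sub>v u))"
    by (rule MVT2) (auto intro: grd_line_deriv w u x)
  then obtain z where z: "x \<bullet> grd w' - x \<bullet> grd w = x \<bullet> (hes (w + z \<cdot>\<^sub>v u) *\<^sub>v u)"
    using w w' u by (auto simp: line_0 u_def vec_diff_line)
  define A where "A = 1\<^sub>m d - (1 / (2 * Lip)) \<cdot>\<^sub>m hes (w + z \<cdot>\<^sub>v u)"
  have Ac: "A \<in> carrier_mat d d" by (simp add: A_def minus_carrier_mat)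
  have Aip: "s \<bullet> (A *\<^sub>v t) = s \<bullet> t - (1 / (2 * Lip)) * (s \<bullet> (hes (w + z \<cdot>\<^sub>v u) *\<^sub>v t))"
    if s: "s \<in> V" and t: "t \<in> V" for s t
  proof -
    have "A *\<^sub>v t = t - (1 / (2 * Lip)) \<cdot>\<^sub>v (hes (w + z \<cdot>\<^sub>v u) *\<^sub>v t)"
      unfolding A_def using t
      by (subst minus_mult_distrib_mat_vec[of _ d d]) (auto simp: mv_smult_mat)
    thus ?thesis using s t by simp
  qed
  have upper: "s \<bullet> (A *\<^sub>v s) \<le> \<rho> * (s \<bullet> s)" if s: "s \<in> V" for s
    using hes_lower[OF s, of "w + z \<cdot>\<^sub>v u"] Lip by (simp add: Aip s \<rho>_def field_simps)
  have lower: "1 / 2 * (s \<bullet> s) \<le> s \<bullet> (A *\<^sub>v s)" if s: "s \<in> V" for s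
    using hes_upper[OF s, of "w + z \<cdot>\<^sub>v u"] Lip by (simp add: Aip s field_simps)
  interpret A: spd d A
  proof
    fix s t assume s: "s \<in> V"
    show "s \<bullet> (A *\<^sub>v t) = t \<bullet> (A *\<^sub>v s)" if t: "t \<in> V"
      using s t hes_sym[OF s t] ip_comm[OF s t] by (simp add: Aip)
    assume "s \<noteq> 0\<^sub>v d"
    thus "0 < s \<bullet> (A *\<^sub>v s)" using lower[OF s] ip_pos[OF s] by linarith
  qed (rule Ac)
  have "x \<bullet> x = x \<bullet> u - (1 / (2 * Lip)) * (x \<bullet> grd w' - x \<bullet> grd w)"
    using w w' x by (subst (2) x_def) (simp add: u_def algebra_simps)
  also have "\<dots> = x \<bullet> (A *\<^sub>v u)" using z Aip[OF x u] by simp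
  finally have xx: "x \<bullet> x = x \<bullet> (A *\<^sub>v u)" .
  have "(x \<bullet> x)\<^sup>2 \<le> (x \<bullet> (A *\<^sub>v x)) * (u \<bullet> (A *\<^sub>v u))" unfolding xx by (rule A.quad_cauchy_schwarz[OF x u])
  also have "\<dots> \<le> (\<rho> * (x \<bullet> x)) * (\<rho> * (u \<bullet> u))"
    using upper x u \<rho> by (intro mult_mono) auto
  finally have "(x \<bullet> x) * (x \<bullet> x) \<le> (x \<bullet> x) * (\<rho>\<^sup>2 * (u \<bullet> u))" by (simp add: power2_eq_square mult_ac)
  moreover have "0 \<le> x \<bullet> x" "0 \<le> \<rho>\<^sup>2 * (u \<bullet> u)" using x u by simp_all
  ultimately have "x \<bullet> x \<le> \<rho>\<^sup>2 * (u \<bullet> u)" by (metis mult_le_cancel_left_pos order_le_less)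
  hence "sqrt (x \<bullet> x) \<le> sqrt (\<rho>\<^sup>2 * (u \<bullet> u))" by (rule real_sqrt_le_mono)
  also have "\<dots> = \<rho> * sqrt (u \<bullet> u)" using \<rho> by (simp add: real_sqrt_mult)
  finally show ?thesis by (simp add: norm2_def x_def u_def \<rho>_def)
qed

lemma abs_entry_le: "x \<in> V \<Longrightarrow> j < d \<Longrightarrow> \<bar>x $ j\<bar> \<le> norm2 x"
proof -
  assume x: "x \<in> V" and j: "j < d"
  have "(x $ j)\<^sup>2 \<le> (\<Sum>k<d. (x $ k)\<^sup>2)" using j by (intro member_le_sum) auto
  also have "\<dots> = x \<bullet> x" using x by (simp add: ip_sum power2_eq_square)
  finally have "sqrt ((x $ j)\<^sup>2) \<le> sqrt (x \<bullet> x)" by (rule real_sqrt_le_mono)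
  thus ?thesis by (simp add: norm2_def)
qed

lemma gd_step_le: "norm2 (gd (Suc k) - gd k) \<le> (1 - lam / (2 * Lip)) ^ k * norm2 (gd 1 - gd 0)"
proof (induction k)
  case (Suc k)
  have "norm2 (gd (Suc (Suc k)) - gd (Suc k)) \<le> (1 - lam / (2 * Lip)) * norm2 (gd (Suc k) - gd k)"
    using gd_contraction[of "gd k" "gd (Suc k)"] by simp
  also have "\<dots> \<le> (1 - lam / (2 * Lip)) * ((1 - lam / (2 * Lip)) ^ k * norm2 (gd 1 - gd 0))"
    using Suc Lip lam by (intro mult_left_mono) (auto simp: field_simps simp del: gd.simps)
  finally show ?case by simp
qed simp

lemma gd_tendsto:
  assumes j: "j < d"
  shows "(\<lambda>k. gd k $ j) \<longlonglongrightarrow> minimizer $ j"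
proof -
  define \<rho> where "\<rho> = 1 - lam / (2 * Lip)"
  have \<rho>: "0 \<le> \<rho>" "\<rho> < 1" using Lip lam by (auto simp: \<rho>_def field_simps)
  have "summable (\<lambda>k. gd (Suc k) $ j - gd k $ j)"
  proof (rule summable_comparison_test)
    show "summable (\<lambda>k. \<rho> ^ k * norm2 (gd 1 - gd 0))" using \<rho> by (intro summable_mult2 summable_geometric) auto
    show "\<exists>N. \<forall>k\<ge>N. norm (gd (Suc k) $ j - gd k $ j) \<le> \<rho> ^ k * norm2 (gd 1 - gd 0)"
    proof (intro exI allI impI)
      fix k
      have "norm (gd (Suc k) $ j - gd k $ j) = \<bar>(gd (Suc k) - gd k) $ j\<bar>"
        using j gd_carrier[of k] by (simp del: gd.simps)
      also have "\<dots> \<le> norm2 (gd (Suc k) - gd k)" using j by (intro abs_entry_le minus_carrier_vec gd_carrier)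
      also have "\<dots> \<le> \<rho> ^ k * norm2 (gd 1 - gd 0)" unfolding \<rho>_def by (rule gd_step_le)
      finally show "norm (gd (Suc k) $ j - gd k $ j) \<le> \<rho> ^ k * norm2 (gd 1 - gd 0)" .
    qed
  qed
  hence "convergent (\<lambda>n. \<Sum>k<n. gd (Suc k) $ j - gd k $ j)"
    by (simp add: summable_iff_convergent)
  moreover have "(\<Sum>k<n. gd (Suc k) $ j - gd k $ j) = gd n $ j" for n
    using sum_lessThan_telescope[of "\<lambda>k. gd k $ j" n] j by simp
  ultimately have "convergent (\<lambda>n. gd n $ j)" by simp
  thus ?thesis using j by (simp add: minimizer_def convergent_LIMSEQ_iff)
qed

lemma minimizer_carrier [simp]: "minimizer \<in> V"
  by (simp add: minimizer_def)

lemma ip_gd_tendsto: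
  assumes "x \<in> V"
  shows "(\<lambda>k. x \<bullet> gd k) \<longlonglongrightarrow> x \<bullet> minimizer"
proof -
  have "(\<lambda>k. \<Sum>j<d. x $ j * gd k $ j) \<longlonglongrightarrow> (\<Sum>j<d. x $ j * minimizer $ j)"
    by (intro tendsto_intros gd_tendsto) simp
  thus ?thesis using assms by (simp add: ip_sum)
qed

text \<open>Along the descent the gradient is \<open>2 * Lip\<close> times the difference of
  consecutive iterates, which tends to zero; the gradient is continuous.\<close>

lemma grd_minimizer: "grd minimizer = 0\<^sub>v d"
proof (rule vecV_eqI)
  fix j assume j: "j < d"
  have "isCont (smoothed_hinge1 p) t" for t using smoothed_hinge1_deriv[OF p3] by (rule DERIV_isCont)
  hence "(\<lambda>k. wt * (\<Sum>i\<in>I. smoothed_hinge1 p (a i \<bullet> gd k) * a i $ j) + lam * gd k $ j)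
      \<longlonglongrightarrow> wt * (\<Sum>i\<in>I. smoothed_hinge1 p (a i \<bullet> minimizer) * a i $ j) + lam * minimizer $ j"
    by (intro tendsto_intros gd_tendsto[OF j] isCont_tendsto_compose[of _ "smoothed_hinge1 p"] ip_gd_tendsto) auto
  hence 1: "(\<lambda>k. grd (gd k) $ j) \<longlonglongrightarrow> grd minimizer $ j" using j by (simp add: grd_def)
  have "(\<lambda>k. 2 * Lip * (gd k $ j - gd (Suc k) $ j)) \<longlonglongrightarrow> 2 * Lip * (minimizer $ j - minimizer $ j)"
    by (intro tendsto_intros gd_tendsto[OF j] LIMSEQ_Suc)
  moreover have "2 * Lip * (gd k $ j - gd (Suc k) $ j) = grd (gd k) $ j" for k
    using j Lip gd_carrier[of k] by simp
  ultimately have "(\<lambda>k. grd (gd k) $ j) \<longlonglongrightarrow> 0" by simp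
  from LIMSEQ_unique[OF 1 this] show "grd minimizer $ j = 0\<^sub>v d $ j" using j by simp
qed simp_all

lemma minimizer_gap: "w \<in> V \<Longrightarrow> obj minimizer + lam / 2 * ((w - minimizer) \<bullet> (w - minimizer)) \<le> obj w"
  using strong_convexity[OF minimizer_carrier, of "w - minimizer"] by (simp add: grd_minimizer vec_diff_line del: ip_minus_left ip_minus_right)

lemma minimizer_le:
  assumes w: "w \<in> V"
  shows "obj minimizer \<le> obj w"
proof -
  have "0 \<le> lam / 2 * ((w - minimizer) \<bullet> (w - minimizer))"
    using lam w by (intro mult_nonneg_nonneg ip_ge_0) auto
  thus ?thesis using minimizer_gap[OF w] by linarith
qed

text \<open>\<open>arg_min_on\<close> is a choice, so it is determined only through uniqueness,
  which comes from the quadratic gap of strong convexity.\<close>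

lemma arg_min_on_eq:
  assumes F: "\<And>w. w \<in> V \<Longrightarrow> F w = obj w"
  shows "arg_min_on F V = minimizer"
  unfolding arg_min_on_def arg_min_def
proof (rule some_equality)
  show "is_arg_min F (\<lambda>x. x \<in> V) minimizer"
    using minimizer_le by (auto simp: is_arg_min_linorder F)
  fix w assume "is_arg_min F (\<lambda>x. x \<in> V) w"
  hence w: "w \<in> V" "obj w \<le> obj minimizer" by (auto simp: is_arg_min_linorder F)
  have wm: "w - minimizer \<in> V" using w by simp
  have "lam / 2 * ((w - minimizer) \<bullet> (w - minimizer)) \<le> 0" using minimizer_gap[OF w(1)] w(2) by linarith
  hence "(w - minimizer) \<bullet> (w - minimizer) \<le> 0" using lam by (simp add: mult_le_0_iff del: ip_minus_left ip_minus_right)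
  hence 0: "w - minimizer = 0\<^sub>v d" using ip_pos[OF wm] by fastforce
  show "w = minimizer"
  proof (rule vecV_eqI)
    fix j assume j: "j < d"
    have "(w - minimizer) $ j = 0" unfolding 0 using j by simp
    thus "w $ j = minimizer $ j" using j w by simp
  qed (use w in auto)
qed

end

subsection \<open>Self-concordance\<close>

locale erm_sc = erm +
  fixes \<gamma> :: real
  assumes gam: "0 < \<gamma>" and lam_eq: "lam = \<eta> * \<gamma>"
    and eta_eq: "\<eta> = (p - 2)\<^sup>2 * B powr (2 + 4 / (p - 2)) / (4 * \<gamma> powr (1 + 2 / (p - 2)))"
begin

definition hnorm where "hnorm w u = sqrt (u \<bullet> (hes w *\<^sub>v u))"

lemma hnorm_sq: "u \<in> V \<Longrightarrow> (hnorm w u)\<^sup>2 = u \<bullet> (hes w *\<^sub>v u)"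
  using spd.A_nonneg[OF hes_spd] by (simp add: hnorm_def)

lemma hnorm_ge_0 [simp]: "u \<in> V \<Longrightarrow> 0 \<le> hnorm w u"
  using spd.A_nonneg[OF hes_spd] by (simp add: hnorm_def)

text \<open>The sum carries the power \<open>p - 3\<close> of \<open>\<psi>\<close> and
  \<open>G\<close> the power \<open>p - 2\<close>. Young's inequality trades one for the other at
  the price \<open>G / \<tau>\<close>; the remaining inequality between \<open>\<tau>\<close> and
  the length of \<open>u\<close> is what the value of \<open>\<eta>\<close> is designed for.\<close>

lemma third_derivative_bound:
  assumes u: "u \<in> V" "u \<noteq> 0\<^sub>v d" and psi: "\<And>i. i \<in> I \<Longrightarrow> 0 \<le> \<psi> i"
    and G: "G = wt * (\<Sum>i\<in>I. \<psi> i powr (p - 2) * (a i \<bullet> u)\<^sup>2) + lam * (u \<bullet> u)"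
  shows "wt * (\<Sum>i\<in>I. (p - 2) * \<psi> i powr (p - 3) * \<bar>a i \<bullet> u\<bar> * (a i \<bullet> u)\<^sup>2) \<le> 2 * G * sqrt G"
proof -
  define q where "q = p - 2"
  have q: "1 \<le> q" "p - 3 = q - 1" using p3 by (simp_all add: q_def)
  define U where "U = u \<bullet> u"
  have U: "U > 0" using ip_pos u by (simp add: U_def)
  define A where "A = B * sqrt U"
  have A: "A > 0" "A\<^sup>2 = B\<^sup>2 * U" using B U by (simp_all add: A_def power_mult_distrib)
  have aA: "\<bar>a i \<bullet> u\<bar> \<le> A" if "i \<in> I" for i
  proof -
    have "(a i \<bullet> u)\<^sup>2 \<le> A\<^sup>2" using ip_a_sq[OF that u(1)] A by (simp add: U_def)
    thus ?thesis using A abs_le_square_iff[of "a i \<bullet> u" A] by simp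
  qed
  have Gl: "lam * U \<le> G" unfolding G U_def using wt psi by (simp add: sum_nonneg)
  have lU: "0 < lam * U" using lam U by simp
  have G0: "G > 0" using Gl lU by linarith
  \<comment> \<open>The scale that balances the two terms of Young's inequality: they then add up to
    \<open>G / \<tau>\<close>.\<close>
  define \<tau> where "\<tau> = (G / (\<eta> * A\<^sup>2)) powr (1 / q)"
  have eA: "\<eta> * A\<^sup>2 > 0" using eta A(1) by simp
  have \<tau>: "\<tau> > 0" using eta A(1) G0 eA by (simp add: \<tau>_def)
  have \<tau>q: "\<tau> powr q = G / (\<eta> * A\<^sup>2)" using q G0 eA eta A(1) by (simp add: \<tau>_def powr_powr)
  have S1: "wt * (\<Sum>i\<in>I. \<psi> i powr q * (a i \<bullet> u)\<^sup>2) \<le> G"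
    unfolding G q_def using lam U by (simp add: U_def)
  have S2: "wt * (\<Sum>i\<in>I. (a i \<bullet> u)\<^sup>2) \<le> \<eta> * A\<^sup>2"
    using sum_sq_le[OF u(1), of "\<lambda>_. 1"] A by (simp add: U_def mult_ac)
  have "(\<Sum>i\<in>I. \<psi> i powr (q - 1) * (a i \<bullet> u)\<^sup>2)
      \<le> (\<Sum>i\<in>I. ((q - 1) / q * (\<psi> i powr q / \<tau>) + \<tau> powr (q - 1) / q) * (a i \<bullet> u)\<^sup>2)"
    using young_powr[OF psi \<tau> q(1)] by (intro sum_mono mult_right_mono) auto
  also have "\<dots> = (q - 1) / (q * \<tau>) * (\<Sum>i\<in>I. \<psi> i powr q * (a i \<bullet> u)\<^sup>2) + \<tau> powr (q - 1) / q * (\<Sum>i\<in>I. (a i \<bullet> u)\<^sup>2)"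
    by (simp add: distrib_right sum.distrib sum_distrib_left mult.assoc)
  finally have "wt * (\<Sum>i\<in>I. \<psi> i powr (q - 1) * (a i \<bullet> u)\<^sup>2)
      \<le> wt * ((q - 1) / (q * \<tau>) * (\<Sum>i\<in>I. \<psi> i powr q * (a i \<bullet> u)\<^sup>2) + \<tau> powr (q - 1) / q * (\<Sum>i\<in>I. (a i \<bullet> u)\<^sup>2))"
    using wt by (intro mult_left_mono) auto
  also have "\<dots> = (q - 1) / (q * \<tau>) * (wt * (\<Sum>i\<in>I. \<psi> i powr q * (a i \<bullet> u)\<^sup>2)) + \<tau> powr (q - 1) / q * (wt * (\<Sum>i\<in>I. (a i \<bullet> u)\<^sup>2))"
    by (simp add: algebra_simps)
  also have "\<dots> \<le> (q - 1) / (q * \<tau>) * G + \<tau> powr (q - 1) / q * (\<eta> * A\<^sup>2)"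
    using S1 S2 q \<tau> by (intro add_mono mult_left_mono) auto
  also have "\<tau> powr (q - 1) / q * (\<eta> * A\<^sup>2) = G / (q * \<tau>)"
    using \<tau> eta A(1) by (simp add: powr_diff \<tau>q)
  also have "(q - 1) / (q * \<tau>) * G + G / (q * \<tau>) = G / \<tau>"
    using q \<tau> by (simp add: field_simps)
  finally have S3: "wt * (\<Sum>i\<in>I. \<psi> i powr (q - 1) * (a i \<bullet> u)\<^sup>2) \<le> G / \<tau>" .
  have "(\<Sum>i\<in>I. q * \<psi> i powr (q - 1) * \<bar>a i \<bullet> u\<bar> * (a i \<bullet> u)\<^sup>2)
      \<le> (\<Sum>i\<in>I. q * \<psi> i powr (q - 1) * A * (a i \<bullet> u)\<^sup>2)"
    using aA q by (intro sum_mono mult_right_mono mult_left_mono) auto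
  also have "\<dots> = q * A * (\<Sum>i\<in>I. \<psi> i powr (q - 1) * (a i \<bullet> u)\<^sup>2)"
    by (simp add: sum_distrib_left mult_ac)
  finally have "wt * (\<Sum>i\<in>I. q * \<psi> i powr (q - 1) * \<bar>a i \<bullet> u\<bar> * (a i \<bullet> u)\<^sup>2)
      \<le> wt * (q * A * (\<Sum>i\<in>I. \<psi> i powr (q - 1) * (a i \<bullet> u)\<^sup>2))"
    using wt by (intro mult_left_mono) auto
  also have "\<dots> = q * A * (wt * (\<Sum>i\<in>I. \<psi> i powr (q - 1) * (a i \<bullet> u)\<^sup>2))" by simp
  also have "\<dots> \<le> q * A * (G / \<tau>)" using S3 q A by (intro mult_left_mono) auto
  finally have main: "wt * (\<Sum>i\<in>I. q * \<psi> i powr (q - 1) * \<bar>a i \<bullet> u\<bar> * (a i \<bullet> u)\<^sup>2) \<le> q * A * (G / \<tau>)" .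
  \<comment> \<open>Only here does the formula for \<open>\<eta>\<close> enter. Both factors on the
    right grow with \<open>G\<close>, and at the least possible value \<open>lam * U\<close> the two
    sides are equal.\<close>
  have "q * A \<le> 2 * sqrt G * \<tau>"
  proof (rule power2_le_imp_le)
    have r: "\<gamma> / B\<^sup>2 \<le> G / (\<eta> * A\<^sup>2)"
    proof -
      have "\<gamma> / B\<^sup>2 = (lam * U) / (\<eta> * A\<^sup>2)" using eta U B A by (simp add: lam_eq field_simps)
      also have "\<dots> \<le> G / (\<eta> * A\<^sup>2)" using Gl eA by (intro divide_right_mono) auto
      finally show ?thesis .
    qed
    have "\<tau>\<^sup>2 = (G / (\<eta> * A\<^sup>2)) powr (2 / q)"
      using G0 eA by (simp add: \<tau>_def power2_eq_square powr_add[symmetric])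
    moreover have "(\<gamma> / B\<^sup>2) powr (2 / q) \<le> (G / (\<eta> * A\<^sup>2)) powr (2 / q)"
      using r gam B q by (intro powr_mono2) auto
    moreover have "(\<gamma> / B\<^sup>2) powr (2 / q) = \<gamma> powr (2 / q) / B powr (4 / q)"
    proof -
      have "B\<^sup>2 = B powr 2" using B by simp
      hence "B\<^sup>2 powr (2 / q) = B powr (4 / q)" by (simp only: powr_powr) simp
      thus ?thesis using gam B by (simp add: powr_divide)
    qed
    ultimately have t2: "\<gamma> powr (2 / q) / B powr (4 / q) \<le> \<tau>\<^sup>2" by simp
    have e: "\<eta> = q\<^sup>2 * (B\<^sup>2 * B powr (4 / q)) / (4 * (\<gamma> * \<gamma> powr (2 / q)))"
      unfolding eta_eq q_def[symmetric] using B gam by (simp add: powr_add)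
    have pos: "B powr (4 / q) > 0" "\<gamma> powr (2 / q) > 0" using B gam by auto
    define c where "c = B powr (4 / q)"
    define g where "g = \<gamma> powr (2 / q)"
    have cg: "c > 0" "g > 0" using pos by (simp_all add: c_def g_def)
    have e': "\<eta> * (4 * (\<gamma> * g)) = q\<^sup>2 * (B\<^sup>2 * c)"
      unfolding e c_def[symmetric] g_def[symmetric] using cg gam by simp
    have "4 * (lam * U) * (g / c) = (\<eta> * (4 * (\<gamma> * g))) * U / c" by (simp add: lam_eq)
    also have "\<dots> = q\<^sup>2 * (B\<^sup>2 * U)" unfolding e' using cg by simp
    also have "\<dots> = (q * A)\<^sup>2" unfolding power_mult_distrib A(2) ..
    finally have "(q * A)\<^sup>2 = 4 * (lam * U) * (\<gamma> powr (2 / q) / B powr (4 / q))"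
      by (simp only: c_def g_def)
    also have "\<dots> \<le> 4 * G * \<tau>\<^sup>2"
      using Gl t2 G0 lU pos by (intro mult_mono) auto
    also have "\<dots> = (2 * sqrt G * \<tau>)\<^sup>2" using G0 by (simp add: power_mult_distrib)
    finally show "(q * A)\<^sup>2 \<le> (2 * sqrt G * \<tau>)\<^sup>2" .
    show "0 \<le> 2 * sqrt G * \<tau>" using G0 \<tau> by simp
  qed
  hence "q * A * (G / \<tau>) \<le> 2 * sqrt G * \<tau> * (G / \<tau>)" using G0 \<tau> by (intro mult_right_mono) auto
  also have "\<dots> = 2 * G * sqrt G" using \<tau> by simp
  finally show ?thesis using main unfolding q_def[symmetric] q(2) by linarith
qed

text \<open>Self-concordance in integrated form, which survives the missing third derivative at
  breakpoints.\<close>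

lemma hes_line_lipschitz:
  assumes w: "w \<in> V" and u: "u \<in> V" "u \<noteq> 0\<^sub>v d" and t: "0 \<le> t"
  shows "\<bar>1 / hnorm (w + t \<cdot>\<^sub>v u) u - 1 / hnorm w u\<bar> \<le> t"
proof -
  define G where "G s = u \<bullet> (hes (w + s \<cdot>\<^sub>v u) *\<^sub>v u)" for s
  have G: "G s = wt * (\<Sum>i\<in>I. smoothed_hinge2 p (a i \<bullet> w + s * (a i \<bullet> u)) * (a i \<bullet> u)\<^sup>2) + lam * (u \<bullet> u)" for s
    unfolding G_def using w u by (subst ip_hes) (simp_all add: power2_eq_square cong: sum.cong)
  define K where "K = {- ((p - 3) / (p - 1)), 1 - (p - 3) / (p - 1), 1, 2}"
  \<comment> \<open>The line parameters at which some sample reaches a breakpoint. Samples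
    orthogonal to \<open>u\<close> do not move along the line and contribute derivative
    zero.\<close>
  define S where "S = (\<Union>i\<in>I. (\<lambda>k. (k - a i \<bullet> w) / (a i \<bullet> u)) ` K)"
  have S: "finite S" using fin by (auto simp: S_def K_def)
  have cont: "isCont (smoothed_hinge2 p) s" for s
    unfolding isCont_def tendsto_iff eventually_at
  proof (intro allI impI)
    fix e :: real assume e: "e > 0"
    show "\<exists>r>0. \<forall>x\<in>UNIV. x \<noteq> s \<and> dist x s < r \<longrightarrow> dist (smoothed_hinge2 p x) (smoothed_hinge2 p s) < e"
    proof (intro exI[of _ "e / (p - 2)"] conjI ballI impI)
      fix x assume x: "x \<noteq> s \<and> dist x s < e / (p - 2)"
      have "dist (smoothed_hinge2 p x) (smoothed_hinge2 p s) \<le> (p - 2) * dist x s"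
        using smoothed_hinge2_lipschitz[OF p3] by (simp add: dist_real_def)
      also have "\<dots> < (p - 2) * (e / (p - 2))" using x p3 by (intro mult_strict_left_mono) auto
      finally show "dist (smoothed_hinge2 p x) (smoothed_hinge2 p s) < e" using p3 by simp
    qed (use e p3 in auto)
  qed
  have "\<bar>1 / sqrt (G t) - 1 / sqrt (G 0)\<bar> \<le> t"
  proof (rule inverse_sqrt_lipschitz[OF S t])
    show "continuous_on {0..t} G"
      unfolding G by (intro continuous_at_imp_continuous_on ballI continuous_intros isCont_o2[OF _ cont])
    show "G s > 0" for s using spd.A_pos[OF hes_spd u] by (simp add: G_def)
    fix s assume s: "s \<in> {0<..<t} - S"
    have "\<exists>D. ((\<lambda>s. smoothed_hinge2 p (a i \<bullet> w + s * (a i \<bullet> u))) has_real_derivative D * (a i \<bullet> u)) (at s)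
        \<and> \<bar>D\<bar> \<le> (p - 2) * trapezoid p (a i \<bullet> w + s * (a i \<bullet> u)) powr (p - 3)" if i: "i \<in> I" for i
    proof (cases "a i \<bullet> u = 0")
      case True thus ?thesis using p3 by (intro exI[of _ 0]) simp
    next
      case False
      have "a i \<bullet> w + s * (a i \<bullet> u) \<notin> K"
      proof
        assume k: "a i \<bullet> w + s * (a i \<bullet> u) \<in> K"
        have "s = ((a i \<bullet> w + s * (a i \<bullet> u)) - a i \<bullet> w) / (a i \<bullet> u)" using False by simp
        hence "s \<in> S" unfolding S_def using i k by blast
        thus False using s by simp
      qed
      then obtain D where D: "(smoothed_hinge2 p has_real_derivative D) (at (a i \<bullet> w + s * (a i \<bullet> u)))"
        "\<bar>D\<bar> \<le> (p - 2) * trapezoid p (a i \<bullet> w + s * (a i \<bullet> u)) powr (p - 3)"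
        using smoothed_hinge2_deriv[OF p3] unfolding K_def by blast
      have "((\<lambda>s. smoothed_hinge2 p (a i \<bullet> w + s * (a i \<bullet> u))) has_real_derivative D * (a i \<bullet> u)) (at s)"
        by (rule DERIV_chain2[where f = "smoothed_hinge2 p" and g = "\<lambda>s. a i \<bullet> w + s * (a i \<bullet> u)", OF D(1)])
          (auto intro!: derivative_eq_intros)
      with D show ?thesis by blast
    qed
    then obtain D where D: "\<And>i. i \<in> I \<Longrightarrow> ((\<lambda>s. smoothed_hinge2 p (a i \<bullet> w + s * (a i \<bullet> u))) has_real_derivative D i * (a i \<bullet> u)) (at s)"
        "\<And>i. i \<in> I \<Longrightarrow> \<bar>D i\<bar> \<le> (p - 2) * trapezoid p (a i \<bullet> w + s * (a i \<bullet> u)) powr (p - 3)"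
      by metis
    define D' where "D' = wt * (\<Sum>i\<in>I. D i * (a i \<bullet> u) * (a i \<bullet> u)\<^sup>2)"
    have "((\<lambda>s. wt * (\<Sum>i\<in>I. smoothed_hinge2 p (a i \<bullet> w + s * (a i \<bullet> u)) * (a i \<bullet> u)\<^sup>2) + lam * (u \<bullet> u))
        has_real_derivative (D' + 0)) (at s)"
      unfolding D'_def by (intro DERIV_add DERIV_cmult DERIV_sum DERIV_cmult_right D(1) DERIV_const)
    hence "(G has_real_derivative D') (at s)" unfolding G by simp
    moreover have "\<bar>D'\<bar> \<le> 2 * G s * sqrt (G s)"
    proof -
      have "\<bar>D'\<bar> \<le> wt * (\<Sum>i\<in>I. \<bar>D i * (a i \<bullet> u) * (a i \<bullet> u)\<^sup>2\<bar>)"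
        unfolding D'_def abs_mult[of wt] using wt by (intro mult_mono sum_abs) auto
      also have "\<dots> \<le> wt * (\<Sum>i\<in>I. (p - 2) * trapezoid p (a i \<bullet> w + s * (a i \<bullet> u)) powr (p - 3) * \<bar>a i \<bullet> u\<bar> * (a i \<bullet> u)\<^sup>2)"
        using wt D(2) by (intro mult_left_mono sum_mono) (auto simp: abs_mult intro!: mult_right_mono)
      also have "\<dots> \<le> 2 * G s * sqrt (G s)"
        using u trapezoid_range(1) by (intro third_derivative_bound) (auto simp: G smoothed_hinge2_def)
      finally show ?thesis .
    qed
    ultimately show "\<exists>D. (G has_real_derivative D) (at s) \<and> \<bar>D\<bar> \<le> 2 * G s * sqrt (G s)" by blast
  qed
  thus ?thesis using w u by (simp add: G_def hnorm_def line_0)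
qed

text \<open>By \<open>hes_line_lipschitz\<close> the local norm of \<open>u\<close> at time
  \<open>t\<close> is at least \<open>\<delta> / (1 + t * \<delta>)\<close>, whose square is the
  second derivative of \<open>t * \<delta> - ln (1 + t * \<delta>)\<close>.\<close>

lemma self_concordant_lower:
  assumes w: "w \<in> V" and u: "u \<in> V"
  shows "obj w + u \<bullet> grd w + hnorm w u - ln (1 + hnorm w u) \<le> obj (w + u)"
proof (cases "u = 0\<^sub>v d")
  case True
  thus ?thesis using w by (simp add: hnorm_def)
next
  case False
  define \<delta> where "\<delta> = hnorm w u"
  have \<delta>: "\<delta> > 0" using spd.A_pos[OF hes_spd u False] by (simp add: \<delta>_def hnorm_def)
  define E where "E t = obj (w + t \<cdot>\<^sub>v u) - t * (u \<bullet> grd w) - (t * \<delta> - ln (1 + t * \<delta>))" for t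
  have pos: "0 < 1 + t * \<delta>" if "0 \<le> t" for t using \<delta> that by (simp add: add_pos_nonneg)
  have "E 0 \<le> E 1"
  proof (rule second_order_nonneg)
    fix t :: real assume t: "0 \<le> t" "t \<le> 1"
    show "(E has_real_derivative (u \<bullet> grd (w + t \<cdot>\<^sub>v u) - u \<bullet> grd w - (\<delta> - \<delta> / (1 + t * \<delta>)))) (at t)"
      unfolding E_def using pos[OF t(1)] by (auto intro!: derivative_eq_intros obj_line_deriv w u)
    show "((\<lambda>t. u \<bullet> grd (w + t \<cdot>\<^sub>v u) - u \<bullet> grd w - (\<delta> - \<delta> / (1 + t * \<delta>))) has_real_derivative
        (u \<bullet> (hes (w + t \<cdot>\<^sub>v u) *\<^sub>v u) - (\<delta> / (1 + t * \<delta>))\<^sup>2)) (at t)"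
      using pos[OF t(1)] by (auto intro!: derivative_eq_intros grd_line_deriv w u simp: power2_eq_square)
    have "1 / hnorm (w + t \<cdot>\<^sub>v u) u \<le> 1 / \<delta> + t"
      using hes_line_lipschitz[OF w u False t(1)] by (simp add: \<delta>_def)
    moreover have "0 < hnorm (w + t \<cdot>\<^sub>v u) u" using spd.A_pos[OF hes_spd u False] by (simp add: hnorm_def)
    ultimately have "\<delta> / (1 + t * \<delta>) \<le> hnorm (w + t \<cdot>\<^sub>v u) u" using \<delta> pos[OF t(1)] by (simp add: field_simps)
    hence "(\<delta> / (1 + t * \<delta>))\<^sup>2 \<le> (hnorm (w + t \<cdot>\<^sub>v u) u)\<^sup>2" using \<delta> pos[OF t(1)] by (intro power_mono) auto
    thus "0 \<le> u \<bullet> (hes (w + t \<cdot>\<^sub>v u) *\<^sub>v u) - (\<delta> / (1 + t * \<delta>))\<^sup>2" using u by (simp add: hnorm_sq)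
  next
    show "u \<bullet> grd (w + 0 \<cdot>\<^sub>v u) - u \<bullet> grd w - (\<delta> - \<delta> / (1 + 0 * \<delta>)) = 0" using w u by (simp add: line_0)
  qed
  thus ?thesis using w u by (simp add: E_def line_0 \<delta>_def)
qed

text \<open>The mirror image with \<open>1 - t * \<delta>\<close>. The reciprocal norm is bounded
  away from zero on the whole segment just because \<open>\<delta> < 1\<close>.\<close>

lemma self_concordant_upper:
  assumes w: "w \<in> V" and u: "u \<in> V" and lt: "hnorm w u < 1"
  shows "obj (w + u) \<le> obj w + u \<bullet> grd w - hnorm w u - ln (1 - hnorm w u)"
proof (cases "u = 0\<^sub>v d")
  case True
  thus ?thesis using w by (simp add: hnorm_def)
next
  case False
  define \<delta> where "\<delta> = hnorm w u"
  have \<delta>: "\<delta> > 0" "\<delta> < 1" using spd.A_pos[OF hes_spd u False] lt by (simp_all add: \<delta>_def hnorm_def)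
  define E where "E t = - obj (w + t \<cdot>\<^sub>v u) + t * (u \<bullet> grd w) - (t * \<delta> + ln (1 - t * \<delta>))" for t
  have pos: "0 < 1 - t * \<delta>" if "0 \<le> t" "t \<le> 1" for t
    using mult_left_le_one_le[of \<delta> t] \<delta> that by linarith
  have "E 0 \<le> E 1"
  proof (rule second_order_nonneg)
    fix t :: real assume t: "0 \<le> t" "t \<le> 1"
    show "(E has_real_derivative (- (u \<bullet> grd (w + t \<cdot>\<^sub>v u)) + u \<bullet> grd w - (\<delta> - \<delta> / (1 - t * \<delta>)))) (at t)"
      unfolding E_def using pos[OF t] by (auto intro!: derivative_eq_intros obj_line_deriv w u)
    show "((\<lambda>t. - (u \<bullet> grd (w + t \<cdot>\<^sub>v u)) + u \<bullet> grd w - (\<delta> - \<delta> / (1 - t * \<delta>))) has_real_derivative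
        ((\<delta> / (1 - t * \<delta>))\<^sup>2 - u \<bullet> (hes (w + t \<cdot>\<^sub>v u) *\<^sub>v u))) (at t)"
      using pos[OF t] by (auto intro!: derivative_eq_intros grd_line_deriv w u simp: power2_eq_square)
    have "1 / \<delta> - t \<le> 1 / hnorm (w + t \<cdot>\<^sub>v u) u"
      using hes_line_lipschitz[OF w u False t(1)] by (simp add: \<delta>_def)
    moreover have h: "0 < hnorm (w + t \<cdot>\<^sub>v u) u" using spd.A_pos[OF hes_spd u False] by (simp add: hnorm_def)
    ultimately have "hnorm (w + t \<cdot>\<^sub>v u) u \<le> \<delta> / (1 - t * \<delta>)" using \<delta> pos[OF t] by (simp add: field_simps)
    hence "(hnorm (w + t \<cdot>\<^sub>v u) u)\<^sup>2 \<le> (\<delta> / (1 - t * \<delta>))\<^sup>2" using h by (intro power_mono) auto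
    thus "0 \<le> (\<delta> / (1 - t * \<delta>))\<^sup>2 - u \<bullet> (hes (w + t \<cdot>\<^sub>v u) *\<^sub>v u)" using u by (simp add: hnorm_sq)
  next
    show "- (u \<bullet> grd (w + 0 \<cdot>\<^sub>v u)) + u \<bullet> grd w - (\<delta> - \<delta> / (1 - 0 * \<delta>)) = 0" using w u by (simp add: line_0)
  qed
  thus ?thesis using w u by (simp add: E_def line_0 \<delta>_def)
qed

subsection \<open>Inexact damped Newton steps\<close>

lemma hes_solution: obtains vs where "vs \<in> V" "hes w *\<^sub>v vs = grd w"
proof -
  obtain C where C: "C \<in> carrier_mat d d" "hes w * C = 1\<^sub>m d"
    using spd.inverse_some[OF hes_spd] by metis
  have "hes w *\<^sub>v (C *\<^sub>v grd w) = (hes w * C) *\<^sub>v grd w"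
    by (rule assoc_mult_mat_vec[symmetric, OF hes_carrier C(1) grd_carrier])
  thus thesis using that[of "C *\<^sub>v grd w"] C by simp
qed

text \<open>The lower bound is applied at the minimizer, whose distance \<open>t\<close> in the
  local norm is unknown; \<open>omega_dual\<close> takes the worst case over
  \<open>t\<close>.\<close>

lemma gap_le_newton:
  assumes w: "w \<in> V" and vs: "vs \<in> V" "hes w *\<^sub>v vs = grd w" and lt: "hnorm w vs < 1"
  shows "obj w - obj minimizer \<le> - hnorm w vs - ln (1 - hnorm w vs)"
proof -
  define u where "u = minimizer - w"
  have u: "u \<in> V" using w by (simp add: u_def)
  define t where "t = hnorm w u"
  have "(u \<bullet> grd w)\<^sup>2 \<le> (t * hnorm w vs)\<^sup>2"
    using spd.quad_cauchy_schwarz[OF hes_spd u vs(1), of w] u vs by (simp add: t_def power_mult_distrib hnorm_sq)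
  hence "\<bar>u \<bullet> grd w\<bar> \<le> t * hnorm w vs"
    using u vs by (intro power2_le_imp_le[of "\<bar>u \<bullet> grd w\<bar>"]) (auto simp: t_def)
  moreover have "obj w + u \<bullet> grd w + t - ln (1 + t) \<le> obj minimizer"
    using self_concordant_lower[OF w u] w by (simp add: t_def u_def vec_diff_line del: ip_minus_left)
  moreover have "t * hnorm w vs - t + ln (1 + t) \<le> - hnorm w vs - ln (1 - hnorm w vs)"
    using lt u by (intro omega_dual) (auto simp: t_def)
  ultimately show ?thesis by linarith
qed

context
  fixes w v vs
  assumes w: "w \<in> V" and v: "v \<in> V" and vs: "vs \<in> V" "hes w *\<^sub>v vs = grd w"
    and err: "hnorm w (vs - v) \<le> 1 / 20 * hnorm w vs"
begin

text \<open>Triangle inequality in the local norm; 20/19 is \<open>1 / (1 - 1 / 20)\<close>.\<close>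

lemma newton_decrement_le: "hnorm w vs \<le> 20 / 19 * hnorm w v"
proof -
  define e where "e = vs - v"
  have e: "e \<in> V" using v vs by (simp add: e_def)
  have "vs = v + e" using v vs by (intro vecV_eqI) (auto simp: e_def)
  have "v \<bullet> (hes w *\<^sub>v e) \<le> hnorm w v * hnorm w e"
  proof -
    have "\<bar>v \<bullet> (hes w *\<^sub>v e)\<bar> \<le> hnorm w v * hnorm w e"
      using spd.quad_cauchy_schwarz[OF hes_spd v e, of w] v e
      by (intro power2_le_imp_le[of "\<bar>v \<bullet> (hes w *\<^sub>v e)\<bar>"]) (auto simp: power_mult_distrib hnorm_sq)
    thus ?thesis by simp
  qed
  hence "(hnorm w vs)\<^sup>2 \<le> (hnorm w v + hnorm w e)\<^sup>2"
    unfolding \<open>vs = v + e\<close> using v e hes_sym[OF e v, of w]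
    by (simp add: hnorm_sq power2_sum)
  hence "hnorm w vs \<le> hnorm w v + hnorm w e" by (rule power2_le_imp_le) (use v e in auto)
  thus ?thesis using err by (simp add: e_def)
qed

text \<open>Damping gives the step local norm \<open>\<delta> / (1 + \<delta>)\<close>, below one
  for every \<open>\<delta>\<close>. In units of \<open>\<delta>^2 / (1 + \<delta>)\<close> the
  linear term gains at least 18/19 and curvature costs at most 1/2, which leaves more than
  2/5.\<close>

lemma newton_decrease:
  "obj (w - (1 / (1 + hnorm w v)) \<cdot>\<^sub>v v) \<le> obj w - 2 / 5 * ((hnorm w v)\<^sup>2 / (1 + hnorm w v))"
proof -
  define \<delta> where "\<delta> = hnorm w v"
  have \<delta>: "0 \<le> \<delta>" "0 < 1 + \<delta>" using v by (auto simp: \<delta>_def add_pos_nonneg)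
  define u where "u = (- (1 / (1 + \<delta>))) \<cdot>\<^sub>v v"
  have u: "u \<in> V" using v by (simp add: u_def)
  have wu: "w - (1 / (1 + hnorm w v)) \<cdot>\<^sub>v v = w + u"
    using w v by (intro vecV_eqI) (auto simp: u_def \<delta>_def)
  have hu: "hnorm w u = \<delta> / (1 + \<delta>)"
  proof -
    have "(hnorm w u)\<^sup>2 = u \<bullet> (hes w *\<^sub>v u)" by (rule hnorm_sq[OF u])
    also have "\<dots> = (1 / (1 + \<delta>))\<^sup>2 * (v \<bullet> (hes w *\<^sub>v v))"
      unfolding u_def using v by (simp add: power2_eq_square)
    also have "\<dots> = (\<delta> / (1 + \<delta>))\<^sup>2"
      unfolding hnorm_sq[OF v, symmetric] \<delta>_def[symmetric] by (simp add: power_divide)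
    finally have "(hnorm w u)\<^sup>2 = (\<delta> / (1 + \<delta>))\<^sup>2" .
    thus ?thesis using \<delta> u by (simp add: power2_eq_iff_nonneg)
  qed
  have lt: "hnorm w u < 1" using \<delta> by (simp add: hu)
  have "1 - hnorm w u = 1 / (1 + \<delta>)" using \<delta> by (simp add: hu field_simps)
  hence ln: "ln (1 - hnorm w u) = - ln (1 + \<delta>)" using \<delta> by (simp add: ln_div)
  define e where "e = vs - v"
  have e: "e \<in> V" using v vs by (simp add: e_def)
  have "\<bar>v \<bullet> (hes w *\<^sub>v e)\<bar> \<le> \<delta> * hnorm w e"
    using spd.quad_cauchy_schwarz[OF hes_spd v e, of w] v e
    by (intro power2_le_imp_le[of "\<bar>v \<bullet> (hes w *\<^sub>v e)\<bar>"]) (auto simp: power_mult_distrib hnorm_sq \<delta>_def)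
  \<comment> \<open>The error is 1/20 of the exact step, which is itself at most 20/19 of the
    computed one.\<close>
  also have "\<dots> \<le> \<delta> * (\<delta> / 19)"
    using err newton_decrement_le \<delta> by (intro mult_left_mono) (auto simp: e_def \<delta>_def)
  finally have ve: "\<bar>v \<bullet> (hes w *\<^sub>v e)\<bar> \<le> \<delta>\<^sup>2 / 19" by (simp add: power2_eq_square)
  have "v \<bullet> grd w = v \<bullet> (hes w *\<^sub>v (v + e))"
    unfolding vs(2)[symmetric] using v vs by (simp add: e_def)
  also have "\<dots> = \<delta>\<^sup>2 + v \<bullet> (hes w *\<^sub>v e)" using v e by (simp add: \<delta>_def hnorm_sq)
  finally have vg: "18 / 19 * \<delta>\<^sup>2 \<le> v \<bullet> grd w" using ve by linarith
  have "obj (w + u) \<le> obj w + u \<bullet> grd w - \<delta> / (1 + \<delta>) + ln (1 + \<delta>)"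
    using self_concordant_upper[OF w u lt] unfolding ln unfolding hu by simp
  also have "u \<bullet> grd w = - ((v \<bullet> grd w) / (1 + \<delta>))" using v by (simp add: u_def)
  also have "obj w + - ((v \<bullet> grd w) / (1 + \<delta>)) - \<delta> / (1 + \<delta>) + ln (1 + \<delta>)
      \<le> obj w + - ((18 / 19 * \<delta>\<^sup>2) / (1 + \<delta>)) - \<delta> / (1 + \<delta>) + ((1 + \<delta>) - 1 / (1 + \<delta>)) / 2"
    using divide_right_mono[OF vg, of "1 + \<delta>"] \<delta> ln_le_half_diff[of "1 + \<delta>"] by linarith
  also have "\<dots> \<le> obj w - 2 / 5 * (\<delta>\<^sup>2 / (1 + \<delta>))"
  proof -
    have "((1 + \<delta>) - 1 / (1 + \<delta>)) / 2 = \<delta> / (1 + \<delta>) + 1 / 2 * (\<delta>\<^sup>2 / (1 + \<delta>))"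
    proof -
      define X where "X = \<delta> / (1 + \<delta>)"
      define Y where "Y = \<delta>\<^sup>2 / (1 + \<delta>)"
      have e: "1 + \<delta> - 1 / (1 + \<delta>) = 2 * X + Y"
      proof -
        define y where "y = 1 + \<delta>"
        have y: "y \<noteq> 0" "\<delta> = y - 1" using \<delta> by (simp_all add: y_def)
        show ?thesis unfolding X_def Y_def y_def[symmetric]
          unfolding y(2) using y(1) by (simp add: field_simps power2_eq_square)
      qed
      show ?thesis unfolding X_def[symmetric] Y_def[symmetric] e by simp
    qed
    moreover have "0 \<le> \<delta>\<^sup>2 / (1 + \<delta>)" using \<delta> by simp
    moreover have "(18 / 19 * \<delta>\<^sup>2) / (1 + \<delta>) = 18 / 19 * (\<delta>\<^sup>2 / (1 + \<delta>))" by simp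
    moreover have "Z = X + 1 / 2 * Y \<Longrightarrow> 0 \<le> Y \<Longrightarrow> W = 18 / 19 * Y \<Longrightarrow> o' + - W - X + Z \<le> o' - 2 / 5 * Y"
      for X Y Z W o' :: real by simp
    ultimately show ?thesis by blast
  qed
  finally show ?thesis by (simp add: wu \<delta>_def)
qed

lemma gap_le_sq:
  assumes "20 / 19 * hnorm w v \<le> exp (- 1 / 2)"
  shows "obj w - obj minimizer \<le> (20 / 19 * hnorm w v)\<^sup>2"
proof -
  have le: "hnorm w vs \<le> exp (- 1 / 2)" using newton_decrement_le assms by linarith
  moreover have "exp (- 1 / 2 :: real) < 1" by simp
  ultimately have "hnorm w vs < 1" by linarith
  hence "obj w - obj minimizer \<le> - hnorm w vs - ln (1 - hnorm w vs)"
    by (rule gap_le_newton[OF w vs])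
  also have "\<dots> \<le> (hnorm w vs)\<^sup>2" using le vs by (intro omega_conj_le) auto
  also have "\<dots> \<le> (20 / 19 * hnorm w v)\<^sup>2" using newton_decrement_le vs by (intro power_mono) auto
  finally show ?thesis .
qed

end

end

section \<open>Rounds of DiSCO on a fixed data set\<close>

context pcg_system
begin

text \<open>The stopping test is evaluated only after an update, so a vanishing initial residual has
  to survive one step. It does whatever the value of \<open>al 0\<close>, because the search
  direction is zero.\<close>

lemma r_Suc_zero: "r 0 = 0\<^sub>v d \<Longrightarrow> r (Suc 0) = 0\<^sub>v d"
proof -
  assume r0: "r 0 = 0\<^sub>v d"
  hence g0: "g = 0\<^sub>v d" by (simp only: pcg_0)
  have "u 0 = 0\<^sub>v d" unfolding pcg_0(4) by (subst g0) (rule mv_zero[OF Q])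
  thus ?thesis unfolding pcg_Suc(2) r0 by (intro vecV_eqI) simp_all
qed

lemma pcg_stops_iff: "pcg_stops H Q g tol t \<longleftrightarrow> norm2 (r (Suc t)) \<le> tol"
  by (simp add: pcg_stops_def pcg_res_def r_def)

lemma stops_of_zero:
  assumes "r t = 0\<^sub>v d" "0 \<le> tol"
  shows "\<exists>t'\<le>t. pcg_stops H Q g tol t'"
proof -
  have n0: "norm2 (0\<^sub>v d) = 0" by (simp add: norm2_def)
  show ?thesis
  proof (cases t)
    case 0
    hence "pcg_stops H Q g tol 0" using r_Suc_zero assms n0 by (simp add: pcg_stops_iff)
    thus ?thesis by blast
  next
    case (Suc t')
    hence "pcg_stops H Q g tol t'" using assms n0 by (simp add: pcg_stops_iff)
    thus ?thesis using Suc by (intro exI[of _ t']) auto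
  qed
qed

lemma stops_dim: "0 \<le> tol \<Longrightarrow> \<exists>t\<le>d. pcg_stops H Q g tol t"
  using finite_termination stops_of_zero order_trans by metis

text \<open>The tolerance contains \<open>sqrt (l / L)\<close> exactly so that the two changes
  between Euclidean and energy norm cancel and a relative error of 1/20 in the energy norm
  remains.\<close>

lemma stopped_error:
  assumes l: "0 < l" and L: "0 < L"
    and Hl: "\<And>x. x \<in> V \<Longrightarrow> l * (x \<bullet> x) \<le> x \<bullet> (H *\<^sub>v x)"
    and HL: "\<And>x. x \<in> V \<Longrightarrow> x \<bullet> (H *\<^sub>v x) \<le> L * (x \<bullet> x)"
    and st: "pcg_stops H Q g (1 / 20 * sqrt (l / L) * norm2 g) t"
  shows "(vs - v (Suc t)) \<bullet> (H *\<^sub>v (vs - v (Suc t))) \<le> (1 / 20)\<^sup>2 * (vs \<bullet> (H *\<^sub>v vs))"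
proof -
  define e where "e = vs - v (Suc t)"
  define R where "R = r (Suc t)"
  have e: "e \<in> V" and R: "R \<in> V" by (simp_all add: e_def R_def)
  have He: "H *\<^sub>v e = R" by (simp add: e_def R_def r_eq H_vs)
  have "(e \<bullet> R)\<^sup>2 \<le> (e \<bullet> e) * (R \<bullet> R)" by (rule cauchy_schwarz_sq[OF e R])
  also have "\<dots> \<le> ((e \<bullet> R) / l) * (R \<bullet> R)"
    using Hl[OF e] l R by (intro mult_right_mono) (auto simp: He field_simps)
  finally have "(e \<bullet> R) * (e \<bullet> R) \<le> (e \<bullet> R) * ((R \<bullet> R) / l)" by (simp add: power2_eq_square)
  moreover have "0 \<le> e \<bullet> R" using H.A_nonneg[OF e] by (simp add: He)
  moreover have "0 \<le> R \<bullet> R / l" using l R by simp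
  ultimately have eR: "e \<bullet> R \<le> (R \<bullet> R) / l" by (cases "e \<bullet> R = 0") (auto simp del: times_divide_eq_right)
  have "norm2 R \<le> 1 / 20 * sqrt (l / L) * norm2 g" using st by (simp add: pcg_stops_iff R_def)
  hence "(norm2 R)\<^sup>2 \<le> (1 / 20 * sqrt (l / L) * norm2 g)\<^sup>2" using R by (intro power_mono) auto
  moreover have "(1 / 20 * sqrt (l / L) * norm2 g)\<^sup>2 = (1 / 20)\<^sup>2 * (l / L) * (g \<bullet> g)"
    unfolding power_mult_distrib norm2_sq[OF g] using l L by simp
  ultimately have "R \<bullet> R \<le> (1 / 20)\<^sup>2 * (l / L) * (g \<bullet> g)"
    unfolding norm2_sq[OF R] by simp
  also have "g \<bullet> g \<le> L * (vs \<bullet> (H *\<^sub>v vs))"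
    using H.norm_mv_le[OF HL vs] by (simp add: H_vs)
  hence "(1 / 20)\<^sup>2 * (l / L) * (g \<bullet> g) \<le> (1 / 20)\<^sup>2 * (l / L) * (L * (vs \<bullet> (H *\<^sub>v vs)))"
    using l L by (intro mult_left_mono) auto
  also have "\<dots> = l * ((1 / 20)\<^sup>2 * (vs \<bullet> (H *\<^sub>v vs)))" using L by simp
  finally have "R \<bullet> R / l \<le> (1 / 20)\<^sup>2 * (vs \<bullet> (H *\<^sub>v vs))" using l by (simp add: divide_le_eq mult.commute)
  with eR have "e \<bullet> R \<le> (1 / 20)\<^sup>2 * (vs \<bullet> (H *\<^sub>v vs))" by linarith
  thus ?thesis by (simp only: e_def[symmetric] He)
qed

end

context pcg_bounds
begin

text \<open>The bound on the squared residual carries \<open>2 * L / l\<close>, the squared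
  tolerance \<open>l / (400 * L)\<close>; their ratio is the argument
  \<open>800 * (L / l)\<^sup>2\<close> of the logarithm. A residual that vanishes earlier stops the
  loop by itself.\<close>

lemma stops_rate:
  assumes l: "0 < l" and L: "l \<le> L"
    and Hl: "\<And>x. x \<in> V \<Longrightarrow> l * (x \<bullet> x) \<le> x \<bullet> (H *\<^sub>v x)"
    and HL: "\<And>x. x \<in> V \<Longrightarrow> x \<bullet> (H *\<^sub>v x) \<le> L * (x \<bullet> x)"
    and T: "sqrt (b / a) * ln (800 * (L / l)\<^sup>2) \<le> real T"
  shows "\<exists>t\<le>T. pcg_stops H Q g (1 / 20 * sqrt (l / L) * norm2 g) t"
proof (cases "\<exists>j\<le>T. r j = 0\<^sub>v d")
  case True
  then obtain j where j: "j \<le> T" "r j = 0\<^sub>v d" by blast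
  have "0 \<le> 1 / 20 * sqrt (l / L) * norm2 g" using l L by simp
  from stops_of_zero[OF j(2) this] j(1) show ?thesis using order_trans by blast
next
  case False
  hence nz: "\<And>j. j < Suc T \<Longrightarrow> r j \<noteq> 0\<^sub>v d" by auto
  have L0: "0 < L" using l L by simp
  have "(1 - th) ^ Suc T \<le> exp (- th) ^ Suc T"
    using th exp_ge_add_one_self[of "- th"] by (intro power_mono) auto
  also have "\<dots> = exp (- (real (Suc T) * th))" by (simp only: exp_of_nat_mult[symmetric]) simp
  also have "\<dots> \<le> exp (- ln (800 * (L / l)\<^sup>2))"
  proof -
    have "th * (sqrt (b / a) * ln (800 * (L / l)\<^sup>2)) \<le> th * real T" using T th by (intro mult_left_mono) auto
    moreover have "th * sqrt (b / a) = 1"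
      using a ab by (simp add: th_def real_sqrt_mult[symmetric])
    ultimately have "ln (800 * (L / l)\<^sup>2) \<le> th * real T" by (simp add: mult.assoc[symmetric])
    also have "\<dots> \<le> real (Suc T) * th" using th by (simp add: algebra_simps)
    finally show ?thesis by simp
  qed
  also have "\<dots> = 1 / (800 * (L / l)\<^sup>2)" using l L0 by (simp add: exp_minus inverse_eq_divide)
  finally have pow: "(1 - th) ^ Suc T \<le> 1 / (800 * (L / l)\<^sup>2)" .
  have "r (Suc T) \<bullet> r (Suc T) \<le> 2 * L / l * (1 - th) ^ Suc T * (g \<bullet> g)"
    by (rule residual_bound[OF nz l Hl HL L0])
  also have "\<dots> \<le> 2 * L / l * (1 / (800 * (L / l)\<^sup>2)) * (g \<bullet> g)"
    using pow l L0 by (intro mult_right_mono mult_left_mono) auto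
  also have "2 * L / l * (1 / (800 * (L / l)\<^sup>2)) = (1 / 20)\<^sup>2 * (l / L)"
    using l L0 by (simp add: field_simps power2_eq_square)
  finally have "sqrt (r (Suc T) \<bullet> r (Suc T)) \<le> sqrt ((1 / 20)\<^sup>2 * (l / L) * (g \<bullet> g))" by (rule real_sqrt_le_mono)
  moreover have "sqrt ((1 / 20)\<^sup>2 * (l / L) * (g \<bullet> g)) = 1 / 20 * sqrt (l / L) * norm2 g"
    unfolding real_sqrt_mult norm2_def by simp
  ultimately have "norm2 (r (Suc T)) \<le> 1 / 20 * sqrt (l / L) * norm2 g"
    by (simp only: norm2_def)
  thus ?thesis by (auto simp: pcg_stops_iff)
qed

end

text \<open>The potential \<open>15 \<Delta> + 5 ln (25 max \<Delta> (\<epsilon> / 25) / \<epsilon>)\<close> drops by at least one in each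
  step before the stopping test holds: its first part in the damped phase \<open>\<delta> \<ge> 1/2\<close>, its
  second part in the linearly convergent phase \<open>\<delta> < 1/2\<close>.\<close>

lemma newton_iteration_count:
  fixes \<Delta> \<delta> :: "nat \<Rightarrow> real" and \<epsilon> :: real
  assumes gap: "\<And>k. 0 \<le> \<Delta> k" and pos: "\<And>k. 0 \<le> \<delta> k" and eps: "0 < \<epsilon>"
    and dec: "\<And>k. \<Delta> (Suc k) \<le> \<Delta> k - 2 / 5 * ((\<delta> k)\<^sup>2 / (1 + \<delta> k))"
    and sq: "\<And>k. 20 / 19 * \<delta> k \<le> exp (- 1 / 2) \<Longrightarrow> \<Delta> k \<le> (20 / 19 * \<delta> k)\<^sup>2"
  shows "\<exists>k. \<delta> k \<le> 19 / 20 * sqrt \<epsilon> \<and> real k \<le> 20 * \<Delta> 0 + 20 + 5 * max 1 (ln (1 / \<epsilon>))"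
proof -
  \<comment> \<open>Clipping at \<open>\<epsilon> / 25\<close> keeps the logarithm nonnegative and
    never interferes with the contraction: before stopping in the second phase the gap is at least
    \<open>\<epsilon> / 5\<close>.\<close>
  define \<Phi> where "\<Phi> x = 15 * x + 5 * ln (25 * max x (\<epsilon> / 25) / \<epsilon>)" for x
  have \<Phi>_pos: "0 \<le> \<Phi> x" if "0 \<le> x" for x
  proof -
    have "1 \<le> 25 * max x (\<epsilon> / 25) / \<epsilon>" using eps by (simp add: field_simps max_def)
    thus ?thesis using that by (simp add: \<Phi>_def)
  qed
  have \<Phi>_mono: "\<Phi> x \<le> \<Phi> y" if "0 \<le> x" "x \<le> y" for x y
  proof -
    have "ln (25 * max x (\<epsilon> / 25) / \<epsilon>) \<le> ln (25 * max y (\<epsilon> / 25) / \<epsilon>)"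
      using that eps by (intro ln_mono divide_right_mono mult_left_mono) (auto simp: max_def)
    thus ?thesis using that by (simp add: \<Phi>_def)
  qed
  have \<Phi>_0: "\<Phi> x \<le> 20 * x + 20 + 5 * max 1 (ln (1 / \<epsilon>))" if x: "0 \<le> x" for x
  proof (cases "x \<le> \<epsilon> / 25")
    case True
    hence "25 * max x (\<epsilon> / 25) / \<epsilon> = 1" using eps by (simp add: max_def)
    thus ?thesis using x by (simp add: \<Phi>_def)
  next
    case False
    hence x0: "x > 0" using eps x by (smt (verit) divide_pos_pos)
    have "ln (25 * max x (\<epsilon> / 25) / \<epsilon>) = ln (25 * x * (1 / \<epsilon>))" using False by (simp add: max_def)
    also have "\<dots> = ln 25 + ln x + ln (1 / \<epsilon>)" using x0 eps by (simp add: ln_mult ln_div)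
    also have "ln x \<le> x" using ln_le_minus_one[OF x0] by simp
    also have "ln (25 :: real) \<le> 4"
    proof -
      have "(25 :: real) \<le> (1 + 1 + 1\<^sup>2 / 2) ^ 4" by (simp add: power4_eq_xxxx)
      also have "\<dots> \<le> exp 1 ^ 4" by (intro power_mono exp_lower_Taylor_quadratic) auto
      also have "\<dots> = exp 4" by (simp add: exp_of_nat_mult[symmetric])
      finally have "ln (25::real) \<le> ln (exp 4)" by (intro ln_mono) auto
      thus ?thesis by simp
    qed
    finally have "ln (25 * max x (\<epsilon> / 25) / \<epsilon>) \<le> 4 + x + ln (1 / \<epsilon>)" by simp
    thus ?thesis by (simp add: \<Phi>_def)
  qed
  have step: "\<Phi> (\<Delta> (Suc k)) \<le> \<Phi> (\<Delta> k) - 1" if k: "\<not> \<delta> k \<le> 19 / 20 * sqrt \<epsilon>" for k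
  proof -
    have d: "0 \<le> \<delta> k" "0 < 1 + \<delta> k" using pos[of k] by auto
    show ?thesis
    proof (cases "\<delta> k < 1 / 2")
      case False
      have "1 / 2 * (1 / 2) \<le> \<delta> k * \<delta> k" using False by (intro mult_mono) auto
      moreover have "1 / 2 * \<delta> k \<le> \<delta> k * \<delta> k" using False by (intro mult_right_mono) auto
      ultimately have "1 + \<delta> k \<le> 6 * (\<delta> k)\<^sup>2" unfolding power2_eq_square by linarith
      hence "1 / 6 \<le> (\<delta> k)\<^sup>2 / (1 + \<delta> k)" using d by (simp add: field_simps)
      \<comment> \<open>The decrease 1/15 is \<open>2 / 5 * (1 / 6)\<close>; it explains the weight
        15 in the potential.\<close>
      hence "\<Delta> (Suc k) \<le> \<Delta> k - 1 / 15" using dec[of k] by linarith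
      hence "15 * \<Delta> (Suc k) \<le> 15 * \<Delta> k - 1" by simp
      moreover have "ln (25 * max (\<Delta> (Suc k)) (\<epsilon> / 25) / \<epsilon>) \<le> ln (25 * max (\<Delta> k) (\<epsilon> / 25) / \<epsilon>)"
        using \<open>\<Delta> (Suc k) \<le> \<Delta> k - 1 / 15\<close> eps
        by (intro ln_mono divide_right_mono mult_left_mono) (auto simp: max_def)
      ultimately show ?thesis by (simp add: \<Phi>_def)
    next
      case True
      have "exp (- 1 / 2 :: real) \<ge> 10 / 19"
      proof -
        have "exp (1 / 2 :: real) \<le> 19 / 10"
        proof -
          have "exp (1 / 2 :: real) \<le> 1 + 1 / 2 + (1 / 2)\<^sup>2" by (rule exp_bound) auto
          thus ?thesis by (simp add: power2_eq_square)
        qed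
        thus ?thesis by (simp add: exp_minus field_simps)
      qed
      hence D: "\<Delta> k \<le> (20 / 19 * \<delta> k)\<^sup>2" using True by (intro sq) auto
      have "(\<delta> k)\<^sup>2 / (3 / 2) \<le> (\<delta> k)\<^sup>2 / (1 + \<delta> k)" using True d by (intro divide_left_mono) auto
      moreover have "(\<delta> k)\<^sup>2 / (3 / 2) = 2 / 3 * (\<delta> k)\<^sup>2" by simp
      ultimately have low23: "2 / 3 * (\<delta> k)\<^sup>2 \<le> (\<delta> k)\<^sup>2 / (1 + \<delta> k)" by simp
      define X where "X = (\<delta> k)\<^sup>2 / (1 + \<delta> k)"
      have dec': "\<Delta> (Suc k) \<le> \<Delta> k - 4 / 15 * (\<delta> k)\<^sup>2"
        using dec[of k] low23 unfolding X_def[symmetric] by linarith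
      have "(20 / 19 * \<delta> k)\<^sup>2 = 400 / 361 * (\<delta> k)\<^sup>2" by (simp add: power2_eq_square)
      hence "1 / 5 * \<Delta> k \<le> 4 / 15 * (\<delta> k)\<^sup>2" using D zero_le_power2[of "\<delta> k"] by linarith
      \<comment> \<open>Contraction by 4/5 lowers the logarithm by at least 1/5, hence its weight
        5.\<close>
      hence dec5: "\<Delta> (Suc k) \<le> 4 / 5 * \<Delta> k" using dec' by linarith
      have "(19 / 20 * sqrt \<epsilon>)\<^sup>2 \<le> (\<delta> k)\<^sup>2" using k eps by (intro power_mono) auto
      hence "361 / 400 * \<epsilon> \<le> (\<delta> k)\<^sup>2" using eps by (simp add: power2_eq_square)
      hence low: "\<epsilon> / 5 \<le> \<Delta> k" using dec' gap[of "Suc k"] eps by linarith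
      have D0: "\<Delta> k > 0" using low eps by linarith
      have max1: "max (\<Delta> k) (\<epsilon> / 25) = \<Delta> k" using low eps by (simp add: max_def)
      have "25 * max (\<Delta> (Suc k)) (\<epsilon> / 25) / \<epsilon> \<le> 25 * (4 / 5 * \<Delta> k) / \<epsilon>"
        using dec5 low eps by (intro divide_right_mono mult_left_mono) auto
      moreover have "0 < 25 * max (\<Delta> (Suc k)) (\<epsilon> / 25) / \<epsilon>" using eps by (simp add: less_max_iff_disj)
      ultimately have "ln (25 * max (\<Delta> (Suc k)) (\<epsilon> / 25) / \<epsilon>) \<le> ln ((4 / 5) * (25 * \<Delta> k / \<epsilon>))"
        by (intro ln_mono) auto
      also have "\<dots> = ln (4 / 5) + ln (25 * \<Delta> k / \<epsilon>)" using D0 eps by (intro ln_mult_pos) auto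
      also have "ln (4 / 5 :: real) \<le> - 1 / 5" using ln_le_minus_one[of "4 / 5 :: real"] by simp
      finally have "ln (25 * max (\<Delta> (Suc k)) (\<epsilon> / 25) / \<epsilon>) \<le> ln (25 * max (\<Delta> k) (\<epsilon> / 25) / \<epsilon>) - 1 / 5"
        unfolding max1 by simp
      moreover have "\<Delta> (Suc k) \<le> \<Delta> k" using dec5 D0 by simp
      ultimately show ?thesis by (simp add: \<Phi>_def)
    qed
  qed
  have iter: "real k \<le> \<Phi> (\<Delta> 0) - \<Phi> (\<Delta> k)" if "\<And>j. j < k \<Longrightarrow> \<not> \<delta> j \<le> 19 / 20 * sqrt \<epsilon>" for k
    using that
  proof (induction k)
    case (Suc k)
    have "real k \<le> \<Phi> (\<Delta> 0) - \<Phi> (\<Delta> k)" using Suc by auto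
    moreover have "\<Phi> (\<Delta> (Suc k)) \<le> \<Phi> (\<Delta> k) - 1" by (rule step) (use Suc.prems in auto)
    ultimately show ?case by simp
  qed simp
  have ex: "\<exists>k. \<delta> k \<le> 19 / 20 * sqrt \<epsilon>"
  proof (rule ccontr)
    assume no: "\<nexists>k. \<delta> k \<le> 19 / 20 * sqrt \<epsilon>"
    obtain k :: nat where k: "\<Phi> (\<Delta> 0) < real k" using reals_Archimedean2 by blast
    have "real k \<le> \<Phi> (\<Delta> 0) - \<Phi> (\<Delta> k)" using no by (intro iter) auto
    thus False using k \<Phi>_pos[OF gap[of k]] by linarith
  qed
  define k where "k = (LEAST k. \<delta> k \<le> 19 / 20 * sqrt \<epsilon>)"
  have st: "\<delta> k \<le> 19 / 20 * sqrt \<epsilon>" unfolding k_def using ex by (rule LeastI_ex)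
  have "real k \<le> \<Phi> (\<Delta> 0) - \<Phi> (\<Delta> k)"
    by (rule iter) (use not_less_Least in \<open>auto simp: k_def\<close>)
  hence "real k \<le> 20 * \<Delta> 0 + 20 + 5 * max 1 (ln (1 / \<epsilon>))"
    using \<Phi>_pos[OF gap[of k]] \<Phi>_0[OF gap[of 0]] by linarith
  with st show ?thesis by blast
qed

section \<open>The objectives of the algorithm as regularized empirical losses\<close>

locale disco_setting = rvec_space +
  fixes m n :: nat and p B \<eta> lam \<gamma> :: real and z :: dataset
  assumes m: "0 < m" and n: "0 < n" and p3: "3 \<le> p" and B: "0 < B" and gam: "0 < \<gamma>"
    and lam_eq: "lam = \<eta> * \<gamma>"
    and eta_eq: "\<eta> = (p - 2)\<^sup>2 * B powr (2 + 4 / (p - 2)) / (4 * \<gamma> powr (1 + 2 / (p - 2)))"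
    and data: "\<And>i j. i < m \<Longrightarrow> j < n \<Longrightarrow>
      fst (z (i, j)) \<in> V \<and> norm2 (fst (z (i, j))) \<le> B \<and> snd (z (i, j)) \<in> {-1, 1}"
begin

definition feat :: "nat \<times> nat \<Rightarrow> rvec" where "feat ij = snd (z ij) \<cdot>\<^sub>v fst (z ij)"

lemma eta: "0 < \<eta>"
  unfolding eta_eq using p3 B gam by simp

lemma lam: "0 < lam"
  using eta gam by (simp add: lam_eq)

lemma feat: "i < m \<Longrightarrow> j < n \<Longrightarrow> feat (i, j) \<in> V" "i < m \<Longrightarrow> j < n \<Longrightarrow> norm2 (feat (i, j)) \<le> B"
proof -
  assume ij: "i < m" "j < n"
  show "feat (i, j) \<in> V" using data[OF ij] by (simp add: feat_def)
  have "\<bar>snd (z (i, j))\<bar> = 1" using data[OF ij] by auto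
  thus "norm2 (feat (i, j)) \<le> B" using data[OF ij] by (simp add: feat_def norm2_smult)
qed

sublocale G: erm_sc d "{..<m} \<times> {..<n}" feat p B \<eta> lam \<gamma>
proof
  show "{..<m} \<times> {..<n} \<noteq> {}" using m n by auto
qed (use p3 B gam eta lam lam_eq eta_eq feat in auto)

lemma loc: "i < m \<Longrightarrow> 0 < l \<Longrightarrow> erm d {..<n} (\<lambda>j. feat (i, j)) p B \<eta> l"
  by unfold_locales (use n p3 B eta feat in auto)

abbreviation F where "F \<equiv> local_loss n p \<eta> lam z"

lemma local_loss_eq:
  assumes i: "i < m" and w: "w \<in> V" and l: "0 < lam + \<rho>"
  shows "F i w + \<rho> / 2 * (norm2 w)\<^sup>2 = erm.obj {..<n} (\<lambda>j. feat (i, j)) p \<eta> (lam + \<rho>) w"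
proof -
  interpret erm d "{..<n}" "\<lambda>j. feat (i, j)" p B \<eta> "lam + \<rho>" by (rule loc[OF i l])
  have "snd (z (i, j)) * (w \<bullet> fst (z (i, j))) = feat (i, j) \<bullet> w" if "j < n" for j
    using data[OF i that] w by (simp add: feat_def ip_comm)
  thus ?thesis using w unfolding local_loss_def obj_def wt_def
    by (simp add: norm2_sq sum_distrib_left algebra_simps add_divide_distrib)
qed

lemma local_loss_eq0: "i < m \<Longrightarrow> w \<in> V \<Longrightarrow> F i w = erm.obj {..<n} (\<lambda>j. feat (i, j)) p \<eta> lam w"
  using local_loss_eq[of i w 0] lam by simp

lemma average_eq: "w \<in> V \<Longrightarrow> average m F w = G.obj w"
proof -
  assume w: "w \<in> V"
  have "F i w = \<eta> / real n * (\<Sum>j<n. smoothed_hinge p (feat (i, j) \<bullet> w)) + lam / 2 * (w \<bullet> w)" if i: "i < m" for i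
    unfolding local_loss_eq0[OF i w] erm.obj_def[OF loc[OF i lam]] erm.wt_def[OF loc[OF i lam]] by simp
  hence "average m F w = 1 / real m * (\<Sum>i<m. \<eta> / real n * (\<Sum>j<n. smoothed_hinge p (feat (i, j) \<bullet> w)) + lam / 2 * (w \<bullet> w))"
    by (simp add: average_def)
  also have "\<dots> = \<eta> / (real m * real n) * (\<Sum>i<m. \<Sum>j<n. smoothed_hinge p (feat (i, j) \<bullet> w)) + lam / 2 * (w \<bullet> w)"
  proof -
    have "(\<Sum>i<m. \<eta> / real n * (\<Sum>j<n. smoothed_hinge p (feat (i, j) \<bullet> w)) + lam / 2 * (w \<bullet> w))
        = \<eta> / real n * (\<Sum>i<m. \<Sum>j<n. smoothed_hinge p (feat (i, j) \<bullet> w)) + real m * (lam / 2 * (w \<bullet> w))"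
      by (simp add: sum.distrib sum_distrib_left)
    thus ?thesis using m by (simp add: distrib_left)
  qed
  finally show ?thesis by (simp add: G.obj_def G.wt_def sum.cartesian_product)
qed

lemma emp_loss_eq: "w \<in> V \<Longrightarrow> \<eta> * emp_loss m n p \<gamma> z w = G.obj w"
proof -
  assume w: "w \<in> V"
  have "snd (z (i, j)) * (w \<bullet> fst (z (i, j))) = feat (i, j) \<bullet> w" if "i < m" "j < n" for i j
    using data[OF that] w by (simp add: feat_def ip_comm)
  thus ?thesis using w unfolding emp_loss_def G.obj_def G.wt_def
    by (simp add: sum.cartesian_product' norm2_sq lam_eq algebra_simps)
qed

end

locale disco_run = disco_setting +
  fixes \<rho> \<mu> L :: real
  assumes rho: "0 \<le> \<rho>" and mu: "0 \<le> \<mu>" and L_eq: "L = \<eta> * (B\<^sup>2 + \<gamma>)"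
begin

sublocale M: erm d "{..<n}" "\<lambda>j. feat (0, j)" p B \<eta> lam
  by (rule loc[OF m lam])

definition P where "P w = M.hes w + \<mu> \<cdot>\<^sub>m 1\<^sub>m d"

lemma L_Lip: "L = G.Lip"
  unfolding G.Lip_def by (simp add: L_eq lam_eq algebra_simps)

lemma L_pos: "0 < L" "lam \<le> L"
  using G.Lip by (simp_all add: L_Lip)

lemma P_carrier [simp]: "P w \<in> carrier_mat d d"
  by (simp add: P_def)

lemma ip_P: "x \<in> V \<Longrightarrow> y \<in> V \<Longrightarrow> x \<bullet> (P w *\<^sub>v y) = x \<bullet> (M.hes w *\<^sub>v y) + \<mu> * (x \<bullet> y)"
proof -
  assume x: "x \<in> V" and y: "y \<in> V"
  have "P w *\<^sub>v y = M.hes w *\<^sub>v y + \<mu> \<cdot>\<^sub>v y"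
    unfolding P_def using y
    by (subst add_mult_distrib_mat_vec[of _ d d]) (auto simp: M.mv_smult_mat)
  thus ?thesis using x y by simp
qed

lemma P_spd: "spd d (P w)"
proof
  fix x y assume x: "x \<in> V"
  show "x \<bullet> (P w *\<^sub>v y) = y \<bullet> (P w *\<^sub>v x)" if y: "y \<in> V"
    using M.hes_sym[OF x y] ip_comm[OF x y] x y by (simp add: ip_P)
  assume nz: "x \<noteq> 0\<^sub>v d"
  have "0 < x \<bullet> (M.hes w *\<^sub>v x)" by (rule spd.A_pos[OF M.hes_spd x nz])
  moreover have "0 \<le> \<mu> * (x \<bullet> x)" using mu x by simp
  ultimately show "0 < x \<bullet> (P w *\<^sub>v x)" using x by (simp add: ip_P)
qed simp

lemma hess_eq: "w \<in> V \<Longrightarrow> disco_hess d m F w = G.hes w"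
  unfolding disco_hess_def by (rule G.hessian_eq[OF average_eq])

lemma grad_eq: "w \<in> V \<Longrightarrow> gradient d (average m F) w = G.grd w"
  by (rule G.gradient_eq[OF average_eq])

lemma precond_eq: "w \<in> V \<Longrightarrow> disco_precond_inv d F \<mu> w = the (mat_inverse (P w))"
  unfolding disco_precond_inv_def P_def
  by (subst M.hessian_eq[of "F 0"]) (use local_loss_eq0[OF m] in auto)

lemma pcg_system:
  assumes w: "w \<in> V" and vs: "vs \<in> V" "G.hes w *\<^sub>v vs = G.grd w"
  shows "pcg_system d (G.hes w) (P w) (the (mat_inverse (P w))) (G.grd w) vs"
proof -
  obtain C where C: "mat_inverse (P w) = Some C" "C \<in> carrier_mat d d" "P w * C = 1\<^sub>m d"
    using spd.inverse_some[OF P_spd] by metis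
  show ?thesis
  proof (rule pcg_system.intro)
    show "spd d (G.hes w)" by (rule G.hes_spd)
    show "spd d (P w)" by (rule P_spd)
    show "the (mat_inverse (P w)) \<in> carrier_mat d d" using C by simp
    fix x assume x: "x \<in> V"
    have "P w *\<^sub>v (C *\<^sub>v x) = (P w * C) *\<^sub>v x"
      by (rule assoc_mult_mat_vec[symmetric, OF P_carrier C(2) x])
    thus "P w *\<^sub>v (the (mat_inverse (P w)) *\<^sub>v x) = x" using C x by simp
  qed (use vs in auto)
qed

definition stp where "stp w t \<longleftrightarrow> disco_pcg_stops d m F \<mu> lam L w t"

lemma stp_eq: "w \<in> V \<Longrightarrow> stp w t \<longleftrightarrow>
  pcg_stops (G.hes w) (the (mat_inverse (P w))) (G.grd w) (1 / 20 * sqrt (lam / L) * norm2 (G.grd w)) t"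
  by (simp add: stp_def disco_pcg_stops_def hess_eq grad_eq precond_eq disco_beta_def)

lemma stp_dim: "w \<in> V \<Longrightarrow> \<exists>t\<le>d. stp w t"
proof -
  assume w: "w \<in> V"
  obtain vs where vs: "vs \<in> V" "G.hes w *\<^sub>v vs = G.grd w" by (rule G.hes_solution)
  interpret pcg_system d "G.hes w" "P w" "the (mat_inverse (P w))" "G.grd w" vs
    by (rule pcg_system[OF w vs])
  have "0 \<le> 1 / 20 * sqrt (lam / L) * norm2 (G.grd w)" using lam L_pos by simp
  thus ?thesis using stops_dim by (simp add: stp_eq[OF w])
qed

lemma stp_rate:
  assumes w: "w \<in> V" and ab: "0 < a" "a \<le> b"
    and lower: "\<And>x. x \<in> V \<Longrightarrow> a * (x \<bullet> (P w *\<^sub>v x)) \<le> x \<bullet> (G.hes w *\<^sub>v x)"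
    and upper: "\<And>x. x \<in> V \<Longrightarrow> x \<bullet> (G.hes w *\<^sub>v x) \<le> b * (x \<bullet> (P w *\<^sub>v x))"
    and T: "sqrt (b / a) * ln (800 * (L / lam)\<^sup>2) \<le> real T"
  shows "\<exists>t\<le>T. stp w t"
proof -
  obtain vs where vs: "vs \<in> V" "G.hes w *\<^sub>v vs = G.grd w" by (rule G.hes_solution)
  interpret pcg_system d "G.hes w" "P w" "the (mat_inverse (P w))" "G.grd w" vs
    by (rule pcg_system[OF w vs])
  interpret pcg_bounds d "G.hes w" "P w" "the (mat_inverse (P w))" "G.grd w" vs a b
    by unfold_locales (use ab lower upper in auto)
  show ?thesis unfolding stp_eq[OF w]
    by (rule stops_rate[OF lam L_pos(2) _ _ T]) (use G.hes_lower G.hes_upper L_Lip in auto)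
qed

lemma rounds_le:
  assumes w: "w \<in> V" and t: "\<exists>t\<le>T. stp w t"
  shows "disco_pcg_rounds d m F \<mu> lam L w \<le> enat (T + 2)"
proof -
  obtain t where "t \<le> T" "stp w t" using t by blast
  hence "(LEAST t. stp w t) \<le> T" using Least_le[of "stp w" t] by linarith
  thus ?thesis using \<open>stp w t\<close> by (auto simp: disco_pcg_rounds_def stp_def)
qed

abbreviation it where "it \<equiv> disco_iter d m F \<rho> \<mu> lam L"

text \<open>The interface between inner and outer loop: the minimum in \<open>disco_dir\<close>
  exists by finite termination, and the stopping test makes its result an inexact Newton
  direction.\<close>

lemma dir_error:
  assumes w: "w \<in> V" and vs: "vs \<in> V" "G.hes w *\<^sub>v vs = G.grd w"
  shows "disco_dir d m F \<mu> lam L w \<in> V"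
    and "disco_decr d m F \<mu> lam L w = G.hnorm w (disco_dir d m F \<mu> lam L w)"
    and "G.hnorm w (vs - disco_dir d m F \<mu> lam L w) \<le> 1 / 20 * G.hnorm w vs"
proof -
  interpret pcg_system d "G.hes w" "P w" "the (mat_inverse (P w))" "G.grd w" vs
    by (rule pcg_system[OF w vs])
  define t where "t = (LEAST t. stp w t)"
  have dir: "disco_dir d m F \<mu> lam L w = v (Suc t)"
    by (simp add: disco_dir_def stp_def[symmetric] t_def hess_eq[OF w] grad_eq[OF w] precond_eq[OF w] pcg_sol_def v_def)
  show dV: "disco_dir d m F \<mu> lam L w \<in> V" by (simp add: dir)
  show "disco_decr d m F \<mu> lam L w = G.hnorm w (disco_dir d m F \<mu> lam L w)"
    by (simp add: disco_decr_def hess_eq[OF w] G.hnorm_def)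
  have "stp w t" unfolding t_def using stp_dim[OF w] LeastI_ex[of "stp w"] by blast
  hence "(vs - v (Suc t)) \<bullet> (G.hes w *\<^sub>v (vs - v (Suc t))) \<le> (1 / 20)\<^sup>2 * (vs \<bullet> (G.hes w *\<^sub>v vs))"
    unfolding stp_eq[OF w] using G.hes_lower G.hes_upper L_Lip lam L_pos
    by (intro stopped_error[of lam L]) auto
  hence "(G.hnorm w (vs - v (Suc t)))\<^sup>2 \<le> (1 / 20 * G.hnorm w vs)\<^sup>2"
    unfolding power_mult_distrib G.hnorm_sq[OF vs(1)] by (subst G.hnorm_sq) auto
  thus "G.hnorm w (vs - disco_dir d m F \<mu> lam L w) \<le> 1 / 20 * G.hnorm w vs"
    unfolding dir by (rule power2_le_imp_le) (use vs in auto)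
qed

lemma init_carrier: "disco_init d m F \<rho> \<in> V"
  by (simp add: disco_init_def)

lemma it_carrier: "it k \<in> V"
proof (induction k)
  case (Suc k)
  obtain vs where "vs \<in> V" "G.hes (it k) *\<^sub>v vs = G.grd (it k)" by (rule G.hes_solution)
  from dir_error(1)[OF Suc this] show ?case using Suc by (simp add: Let_def)
qed (simp add: init_carrier)

definition gap where "gap k = G.obj (it k) - G.obj G.minimizer"
definition dl where "dl k = disco_decr d m F \<mu> lam L (it k)"

lemma gap_nonneg: "0 \<le> gap k"
  using G.minimizer_le[OF it_carrier] by (simp add: gap_def)

lemma newton_step:
  "0 \<le> dl k" "gap (Suc k) \<le> gap k - 2 / 5 * ((dl k)\<^sup>2 / (1 + dl k))"
  "20 / 19 * dl k \<le> exp (- 1 / 2) \<Longrightarrow> gap k \<le> (20 / 19 * dl k)\<^sup>2"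
proof -
  define w where "w = it k"
  have w: "w \<in> V" using it_carrier by (simp add: w_def)
  obtain vs where vs: "vs \<in> V" "G.hes w *\<^sub>v vs = G.grd w" by (rule G.hes_solution)
  note e = dir_error[OF w vs]
  define v where "v = disco_dir d m F \<mu> lam L w"
  have dl: "dl k = G.hnorm w v" by (simp add: dl_def w_def[symmetric] e(2) v_def)
  have v: "v \<in> V" using e(1) by (simp add: v_def)
  show "0 \<le> dl k" using v by (simp add: dl)
  have "it (Suc k) = w - (1 / (1 + G.hnorm w v)) \<cdot>\<^sub>v v"
    by (simp add: Let_def w_def[symmetric] v_def[symmetric] e(2))
  thus "gap (Suc k) \<le> gap k - 2 / 5 * ((dl k)\<^sup>2 / (1 + dl k))"
    using G.newton_decrease[OF w v vs e(3)[folded v_def]]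
    by (simp add: gap_def dl w_def[symmetric] del: disco_iter.simps)
  assume "20 / 19 * dl k \<le> exp (- 1 / 2)"
  thus "gap k \<le> (20 / 19 * dl k)\<^sup>2"
    using G.gap_le_sq[OF w v vs e(3)[folded v_def]] by (simp add: gap_def dl w_def[symmetric])
qed

lemma gap_mono: "gap (Suc k) \<le> gap k"
proof -
  have "0 \<le> 2 / 5 * ((dl k)\<^sup>2 / (1 + dl k))" using newton_step(1)[of k] by simp
  thus ?thesis using newton_step(2)[of k] by linarith
qed

lemma gap_le_initial: "gap k \<le> gap 0"
  by (induction k) (use gap_mono order_trans in auto)

context
  fixes \<epsilon> :: real
  assumes eps: "0 < \<epsilon>"
begin

lemma stops_iff: "disco_stops d m F \<rho> \<mu> lam L \<epsilon> k \<longleftrightarrow> dl k \<le> 19 / 20 * sqrt \<epsilon>"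
  by (simp add: disco_stops_def dl_def disco_beta_def)

lemma stops_bound:
  "\<exists>k. disco_stops d m F \<rho> \<mu> lam L \<epsilon> k \<and> real k \<le> 20 * gap 0 + 20 + 5 * max 1 (ln (1 / \<epsilon>))"
  unfolding stops_iff using gap_nonneg newton_step eps by (intro newton_iteration_count) auto

text \<open>The factor 19/20 in the stopping test compensates the 20/19 lost to inexactness, so the
  true decrement is at most \<open>sqrt \<epsilon>\<close>. The bound on \<open>\<epsilon>\<close>
  brings it into the range of \<open>omega_conj_le\<close>. The output is one step further, which
  does not increase the gap.\<close>

lemma output_optimal:
  assumes "\<epsilon> \<le> exp (- 1)"
  shows "G.obj (disco_output d m F \<rho> \<mu> lam L \<epsilon>) - G.obj G.minimizer \<le> \<epsilon>"
proof -
  define k where "k = (LEAST k. disco_stops d m F \<rho> \<mu> lam L \<epsilon> k)"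
  have "disco_stops d m F \<rho> \<mu> lam L \<epsilon> k" unfolding k_def
    using stops_bound LeastI_ex[of "disco_stops d m F \<rho> \<mu> lam L \<epsilon>"] by blast
  hence st: "20 / 19 * dl k \<le> sqrt \<epsilon>" by (simp add: stops_iff)
  have "sqrt \<epsilon> \<le> sqrt (exp (- 1))" using assms by (rule real_sqrt_le_mono)
  also have "sqrt (exp (- 1)) = exp (- 1 / 2 :: real)"
    by (rule real_sqrt_unique) (simp_all add: power2_eq_square exp_add[symmetric])
  finally have "gap k \<le> (20 / 19 * dl k)\<^sup>2" using st by (intro newton_step(3)) simp
  also have "\<dots> \<le> (sqrt \<epsilon>)\<^sup>2" using st newton_step(1)[of k] by (intro power_mono) auto
  finally have "gap (Suc k) \<le> \<epsilon>" using gap_mono[of k] eps by simp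
  thus ?thesis by (simp add: gap_def disco_output_def k_def del: disco_iter.simps)
qed

lemma rounds_bound:
  assumes R: "\<And>k. disco_pcg_rounds d m F \<mu> lam L (it k) \<le> enat R"
  shows "disco_rounds d m F \<rho> \<mu> lam L \<epsilon> \<noteq> \<infinity>"
    and "ennreal_of_enat (disco_rounds d m F \<rho> \<mu> lam L \<epsilon>)
      \<le> ennreal (1 + (20 * gap 0 + 21 + 5 * max 1 (ln (1 / \<epsilon>))) * real R)"
proof -
  define K where "K = (LEAST k. disco_stops d m F \<rho> \<mu> lam L \<epsilon> k)"
  obtain k where k: "disco_stops d m F \<rho> \<mu> lam L \<epsilon> k" "real k \<le> 20 * gap 0 + 20 + 5 * max 1 (ln (1 / \<epsilon>))"
    using stops_bound by blast
  have "K \<le> k" unfolding K_def by (rule Least_le[of "disco_stops d m F \<rho> \<mu> lam L \<epsilon>", OF k(1)])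
  hence K: "real K \<le> 20 * gap 0 + 20 + 5 * max 1 (ln (1 / \<epsilon>))" using k(2) by linarith
  have "disco_rounds d m F \<rho> \<mu> lam L \<epsilon> = 1 + (\<Sum>k\<le>K. disco_pcg_rounds d m F \<mu> lam L (it k))"
    using k(1) by (auto simp: disco_rounds_def K_def)
  also have "\<dots> \<le> 1 + (\<Sum>k\<le>K. enat R)" using R by (intro add_left_mono sum_mono) auto
  also have "(\<Sum>k\<le>K. enat R) = enat (Suc K * R)"
    by (induction K) (auto simp: algebra_simps)
  also have "1 + enat (Suc K * R) = enat (1 + Suc K * R)" by (simp add: one_enat_def)
  finally have le: "disco_rounds d m F \<rho> \<mu> lam L \<epsilon> \<le> enat (1 + Suc K * R)" .
  thus "disco_rounds d m F \<rho> \<mu> lam L \<epsilon> \<noteq> \<infinity>"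
    by (metis infinity_ileE)
  have "ennreal_of_enat (disco_rounds d m F \<rho> \<mu> lam L \<epsilon>) \<le> ennreal_of_enat (enat (1 + Suc K * R))"
    using le by (simp only: ennreal_of_enat_le_iff)
  also have "\<dots> = ennreal (real (1 + Suc K * R))" by (simp only: ennreal_of_enat_enat ennreal_of_nat_eq_real_of_nat)
  \<comment> \<open>One round for the initialization, and \<open>K + 1\<close> Newton steps because
    the step with index \<open>K\<close> is still carried out; hence 21 instead of 20 below.\<close>
  also have "real (1 + Suc K * R) = 1 + (real K + 1) * real R" by (simp add: algebra_simps)
  also have "\<dots> \<le> 1 + (20 * gap 0 + 21 + 5 * max 1 (ln (1 / \<epsilon>))) * real R"
    using K by (intro add_left_mono mult_right_mono) auto
  finally show "ennreal_of_enat (disco_rounds d m F \<rho> \<mu> lam L \<epsilon>)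
      \<le> ennreal (1 + (20 * gap 0 + 21 + 5 * max 1 (ln (1 / \<epsilon>))) * real R)"
    by (simp add: ennreal_leI)
qed

end

end

subsection \<open>Conditioning of the preconditioned Hessian\<close>

context disco_run
begin

text \<open>Without any closeness: \<open>H\<close> lies between \<open>lam\<close> and
  \<open>L\<close>, the preconditioner between \<open>lam\<close> and \<open>2 * L\<close>. The
  condition number is quadratic in \<open>L / lam\<close>, so the number of steps is linear in it,
  up to a logarithm.\<close>

lemma stp_general:
  assumes w: "w \<in> V" and mu_le: "\<mu> \<le> L" and T: "2 * (L / lam) * ln (800 * (L / lam)\<^sup>2) \<le> real T"
  shows "\<exists>t\<le>T. stp w t"
proof (rule stp_rate[OF w, of "lam / (2 * L)" "L / lam"])
  note pos = lam L_pos
  have one: "1 \<le> L / lam" using pos by simp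
  show "0 < lam / (2 * L)" using pos by simp
  have "lam / (2 * L) \<le> 1" using pos by (simp add: field_simps)
  thus "lam / (2 * L) \<le> L / lam" using one by linarith
  have "sqrt (L / lam / (lam / (2 * L))) = sqrt (2 * (L / lam)\<^sup>2)"
    using pos by (simp add: power2_eq_square field_simps)
  also have "\<dots> \<le> sqrt (4 * (L / lam)\<^sup>2)" by (intro real_sqrt_le_mono mult_right_mono) auto
  also have "\<dots> = 2 * (L / lam)" using pos by (simp add: real_sqrt_mult)
  finally have sq: "sqrt (L / lam / (lam / (2 * L))) \<le> 2 * (L / lam)" .
  have "1 * 1 \<le> (L / lam)\<^sup>2" unfolding power2_eq_square using one by (intro mult_mono) auto
  hence "0 \<le> ln (800 * (L / lam)\<^sup>2)" by simp
  from mult_right_mono[OF sq this] T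
  show "sqrt (L / lam / (lam / (2 * L))) * ln (800 * (L / lam)\<^sup>2) \<le> real T" by linarith
  fix x assume x: "x \<in> V"
  have P_le: "x \<bullet> (P w *\<^sub>v x) \<le> 2 * L * (x \<bullet> x)"
  proof -
    have "x \<bullet> (M.hes w *\<^sub>v x) \<le> L * (x \<bullet> x)"
      using M.hes_upper[OF x] L_Lip unfolding M.Lip_def G.Lip_def by simp
    moreover have "\<mu> * (x \<bullet> x) \<le> L * (x \<bullet> x)" using mu_le x by (intro mult_right_mono) auto
    ultimately show ?thesis using x by (simp add: ip_P)
  qed
  have "lam / (2 * L) * (x \<bullet> (P w *\<^sub>v x)) \<le> lam / (2 * L) * (2 * L * (x \<bullet> x))"
    using P_le pos by (intro mult_left_mono) auto
  also have "\<dots> = lam * (x \<bullet> x)" using pos by simp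
  also have "\<dots> \<le> x \<bullet> (G.hes w *\<^sub>v x)" by (rule G.hes_lower[OF x])
  finally show "lam / (2 * L) * (x \<bullet> (P w *\<^sub>v x)) \<le> x \<bullet> (G.hes w *\<^sub>v x)" .
  have "lam * (x \<bullet> x) \<le> x \<bullet> (P w *\<^sub>v x)"
    using M.hes_lower[OF x, of w] mu x by (simp add: ip_P add_increasing2)
  hence "L / lam * (lam * (x \<bullet> x)) \<le> L / lam * (x \<bullet> (P w *\<^sub>v x))"
    using pos by (intro mult_left_mono) auto
  moreover have "x \<bullet> (G.hes w *\<^sub>v x) \<le> L * (x \<bullet> x)" using G.hes_upper[OF x] by (simp add: L_Lip)
  ultimately show "x \<bullet> (G.hes w *\<^sub>v x) \<le> L / lam * (x \<bullet> (P w *\<^sub>v x))" using pos by simp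
qed

text \<open>If the Hessians differ by \<open>s * \<mu>\<close>, then \<open>H \<le> s * P\<close>
  because \<open>s \<ge> 1\<close>, and \<open>P \<le> A * H\<close> because the regularization
  makes \<open>\<mu>\<close> at most \<open>\<mu> / lam\<close> times \<open>H\<close>. This costs
  only the square root of \<open>1 + \<mu> / lam\<close>.\<close>

lemma stp_close:
  assumes w: "w \<in> V" and s: "1 \<le> s"
    and close: "\<And>x. x \<in> V \<Longrightarrow> \<bar>x \<bullet> (G.hes w *\<^sub>v x) - x \<bullet> (M.hes w *\<^sub>v x)\<bar> \<le> s * \<mu> * (x \<bullet> x)"
    and T: "2 * s * sqrt (1 + \<mu> / lam) * ln (800 * (L / lam)\<^sup>2) \<le> real T"
  shows "\<exists>t\<le>T. stp w t"
proof -
  note pos = lam L_pos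
  define A where "A = 1 + (s + 1) * \<mu> / lam"
  have A: "1 \<le> A" using mu s pos by (simp add: A_def)
  show ?thesis
  proof (rule stp_rate[OF w, of "1 / A" s])
    show "0 < 1 / A" using A by simp
    have "1 / A \<le> 1" using A by simp
    thus "1 / A \<le> s" using s by linarith
    have "s / (1 / A) \<le> (2 * s)\<^sup>2 * (1 + \<mu> / lam)"
    proof -
      have ml: "0 \<le> \<mu> / lam" using mu pos by simp
      have "A \<le> (s + 1) * (1 + \<mu> / lam)" using s ml by (simp add: A_def algebra_simps)
      also have "\<dots> \<le> (4 * s) * (1 + \<mu> / lam)" using s ml by (intro mult_right_mono) auto
      finally have "s * A \<le> s * ((4 * s) * (1 + \<mu> / lam))" using s by (intro mult_left_mono) auto
      thus ?thesis by (simp add: power2_eq_square mult_ac)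
    qed
    hence "sqrt (s / (1 / A)) \<le> sqrt ((2 * s)\<^sup>2 * (1 + \<mu> / lam))" by (rule real_sqrt_le_mono)
    also have "\<dots> = 2 * s * sqrt (1 + \<mu> / lam)" using s by (simp add: real_sqrt_mult)
    finally have sq: "sqrt (s / (1 / A)) \<le> 2 * s * sqrt (1 + \<mu> / lam)" .
    have one: "1 \<le> L / lam" using pos by simp
    have "1 * 1 \<le> (L / lam)\<^sup>2" unfolding power2_eq_square using one by (intro mult_mono) auto
    hence "0 \<le> ln (800 * (L / lam)\<^sup>2)" by simp
    from mult_right_mono[OF sq this] T
    show "sqrt (s / (1 / A)) * ln (800 * (L / lam)\<^sup>2) \<le> real T" by linarith
    fix x assume x: "x \<in> V"
    have xx: "0 \<le> x \<bullet> x" using x by simp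
    have c: "x \<bullet> (G.hes w *\<^sub>v x) \<le> x \<bullet> (M.hes w *\<^sub>v x) + s * \<mu> * (x \<bullet> x)"
      "x \<bullet> (M.hes w *\<^sub>v x) \<le> x \<bullet> (G.hes w *\<^sub>v x) + s * \<mu> * (x \<bullet> x)"
      using close[OF x] by linarith+
    have "x \<bullet> (P w *\<^sub>v x) \<le> x \<bullet> (G.hes w *\<^sub>v x) + (s + 1) * \<mu> * (x \<bullet> x)"
      using c(2) x by (simp add: ip_P algebra_simps)
    also have "(s + 1) * \<mu> * (x \<bullet> x) = (s + 1) * \<mu> / lam * (lam * (x \<bullet> x))" using pos by simp
    also have "\<dots> \<le> (s + 1) * \<mu> / lam * (x \<bullet> (G.hes w *\<^sub>v x))"
      using G.hes_lower[OF x, of w] mu s pos by (intro mult_left_mono) auto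
    finally have "x \<bullet> (P w *\<^sub>v x) \<le> A * (x \<bullet> (G.hes w *\<^sub>v x))" by (simp add: A_def distrib_right)
    thus "1 / A * (x \<bullet> (P w *\<^sub>v x)) \<le> x \<bullet> (G.hes w *\<^sub>v x)" using A by (simp add: divide_le_eq mult.commute)
    have "x \<bullet> (M.hes w *\<^sub>v x) \<le> s * (x \<bullet> (M.hes w *\<^sub>v x))"
      using mult_right_mono[OF s, of "x \<bullet> (M.hes w *\<^sub>v x)"] spd.A_nonneg[OF M.hes_spd x] by simp
    thus "x \<bullet> (G.hes w *\<^sub>v x) \<le> s * (x \<bullet> (P w *\<^sub>v x))"
      using c(1) x by (simp add: ip_P algebra_simps)
  qed
qed

end

section \<open>Uniform concentration of the Hessians\<close>

context rvec_space
begin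

text \<open>A cubic grid serves as a net: its cardinality is explicit, and its size matters only
  through its logarithm.\<close>

definition grid :: "nat \<Rightarrow> rvec set" where
  "grid N = (\<lambda>g. Matrix.vec d (\<lambda>k. real_of_int (g k) / real N)) ` (PiE {..<d} (\<lambda>_. {- int N..int N}))"

lemma grid_carrier: "g \<in> grid N \<Longrightarrow> g \<in> V"
  unfolding grid_def by (elim imageE) simp

lemma finite_grid: "finite (grid N)"
  unfolding grid_def by (rule finite_imageI, rule finite_PiE) auto

lemma card_grid: "card (grid N) \<le> (2 * N + 1) ^ d"
proof -
  have "card (grid N) \<le> card (PiE {..<d} (\<lambda>_. {- int N..int N}))"
    unfolding grid_def by (rule card_image_le, rule finite_PiE) auto
  also have "\<dots> = (2 * N + 1) ^ d" by (simp add: card_PiE nat_add_distrib nat_mult_distrib)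
  finally show ?thesis .
qed

text \<open>Rounding towards zero keeps the grid point in the unit ball.\<close>

lemma grid_approx:
  assumes v: "v \<in> V" "norm2 v \<le> 1" and N: "0 < N"
  obtains g where "g \<in> grid N" "norm2 g \<le> 1" "norm2 (v - g) \<le> sqrt (real d) / real N"
proof -
  define t where "t k = (if k < d then (if 0 \<le> v $ k then \<lfloor>v $ k * real N\<rfloor> else \<lceil>v $ k * real N\<rceil>) else undefined)" for k
  define g where "g = Matrix.vec d (\<lambda>k. real_of_int (t k) / real N)"
  have gV: "g \<in> V" by (simp add: g_def)
  have entry: "\<bar>v $ k\<bar> \<le> 1" if "k < d" for k
  proof -
    have "(v $ k)\<^sup>2 \<le> (\<Sum>k<d. (v $ k)\<^sup>2)" using that by (intro member_le_sum) auto
    also have "\<dots> = (norm2 v)\<^sup>2" unfolding norm2_sq[OF v(1)] using v by (simp add: ip_sum power2_eq_square)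
    also have "\<dots> \<le> 1" using v by (simp add: power_le_one)
    finally show ?thesis by (simp add: abs_square_le_1)
  qed
  have tN: "\<bar>real_of_int (t k)\<bar> \<le> \<bar>v $ k * real N\<bar>" "\<bar>v $ k * real N - real_of_int (t k)\<bar> \<le> 1" if k: "k < d" for k
  proof -
    have "\<bar>real_of_int (t k)\<bar> \<le> \<bar>v $ k * real N\<bar> \<and> \<bar>v $ k * real N - real_of_int (t k)\<bar> \<le> 1"
    proof (cases "0 \<le> v $ k")
      case True
      hence nn: "0 \<le> v $ k * real N" by simp
      hence "0 \<le> \<lfloor>v $ k * real N\<rfloor>" by simp
      hence "0 \<le> real_of_int \<lfloor>v $ k * real N\<rfloor>" by simp
      moreover have "real_of_int \<lfloor>v $ k * real N\<rfloor> \<le> v $ k * real N"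
        "v $ k * real N - real_of_int \<lfloor>v $ k * real N\<rfloor> \<le> 1" by linarith+
      ultimately show ?thesis using True nn k by (simp add: t_def)
    next
      case False
      hence np: "v $ k * real N \<le> 0" by (simp add: mult_nonpos_nonneg)
      hence "\<lceil>v $ k * real N\<rceil> \<le> 0" by simp
      hence "real_of_int \<lceil>v $ k * real N\<rceil> \<le> 0" by simp
      moreover have "v $ k * real N \<le> real_of_int \<lceil>v $ k * real N\<rceil>"
        "real_of_int \<lceil>v $ k * real N\<rceil> - v $ k * real N \<le> 1" by linarith+
      ultimately show ?thesis using False np k by (simp add: t_def)
    qed
    thus "\<bar>real_of_int (t k)\<bar> \<le> \<bar>v $ k * real N\<bar>" "\<bar>v $ k * real N - real_of_int (t k)\<bar> \<le> 1" by auto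
  qed
  have "t \<in> PiE {..<d} (\<lambda>_. {- int N..int N})"
  proof (rule PiE_I)
    fix k assume "k \<in> {..<d}"
    hence k: "k < d" by simp
    have "\<bar>v $ k * real N\<bar> \<le> 1 * real N" unfolding abs_mult using entry[OF k] by (intro mult_mono) auto
    hence "\<bar>real_of_int (t k)\<bar> \<le> real N" using tN(1)[OF k] by linarith
    thus "t k \<in> {- int N..int N}" by (simp add: abs_le_iff)
  qed (simp add: t_def)
  hence gg: "g \<in> grid N" unfolding grid_def g_def by blast
  have "(norm2 g)\<^sup>2 \<le> (norm2 v)\<^sup>2"
  proof -
    have "(\<Sum>k<d. (g $ k)\<^sup>2) \<le> (\<Sum>k<d. (v $ k)\<^sup>2)"
    proof (rule sum_mono)
      fix k assume "k \<in> {..<d}"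
      hence k: "k < d" by simp
      have "\<bar>real_of_int (t k)\<bar> / real N \<le> \<bar>v $ k\<bar>" using tN(1)[OF k] N by (simp add: abs_mult divide_le_eq)
      hence "\<bar>g $ k\<bar> \<le> \<bar>v $ k\<bar>" using k N by (simp add: g_def)
      thus "(g $ k)\<^sup>2 \<le> (v $ k)\<^sup>2" by (simp add: abs_le_square_iff)
    qed
    thus ?thesis unfolding norm2_sq[OF v(1)] norm2_sq[OF gV] using v gV by (simp add: ip_sum power2_eq_square)
  qed
  hence "norm2 g \<le> norm2 v" by (rule power2_le_imp_le) (use v in simp)
  hence g1: "norm2 g \<le> 1" using v by simp
  have "(norm2 (v - g))\<^sup>2 \<le> (sqrt (real d) / real N)\<^sup>2"
  proof -
    have "(norm2 (v - g))\<^sup>2 = (\<Sum>k<d. (v $ k - g $ k)\<^sup>2)"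
      unfolding norm2_sq[OF minus_carrier_vec[OF v(1) gV]] ip_sum[OF minus_carrier_vec[OF v(1) gV] minus_carrier_vec[OF v(1) gV]]
      using v gV by (simp add: power2_eq_square)
    also have "\<dots> \<le> (\<Sum>k<d. (1 / real N)\<^sup>2)"
    proof (rule sum_mono)
      fix k assume "k \<in> {..<d}"
      hence k: "k < d" by simp
      have "v $ k - g $ k = (v $ k * real N - real_of_int (t k)) / real N" using k N by (simp add: g_def diff_divide_distrib)
      hence "\<bar>v $ k - g $ k\<bar> \<le> 1 / real N" using tN(2)[OF k] N by (simp add: divide_right_mono)
      thus "(v $ k - g $ k)\<^sup>2 \<le> (1 / real N)\<^sup>2" using N abs_le_square_iff[of "v $ k - g $ k" "1 / real N"] by simp
    qed
    also have "\<dots> = (sqrt (real d) / real N)\<^sup>2" by (simp add: power_divide)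
    finally show ?thesis .
  qed
  hence "norm2 (v - g) \<le> sqrt (real d) / real N" by (rule power2_le_imp_le) simp
  from that[OF gg g1 this] show thesis .
qed

text \<open>The Hessian of one sample as a quadratic form, without scaling and regularization; the
  latter cancels in the comparison of local and global Hessian.\<close>

definition curv :: "real \<Rightarrow> rvec \<Rightarrow> rvec \<Rightarrow> rvec \<Rightarrow> real" where
  "curv p w u a = smoothed_hinge2 p (a \<bullet> w) * (a \<bullet> u)\<^sup>2"

lemma curv_lipschitz:
  assumes p: "3 \<le> p" and a: "a \<in> V" "norm2 a \<le> B" and V: "w \<in> V" "w' \<in> V" "u \<in> V" "u' \<in> V"
    and u1: "norm2 u \<le> 1" "norm2 u' \<le> 1"
  shows "\<bar>curv p w u a - curv p w' u' a\<bar> \<le> (p - 2) * B ^ 3 * norm2 (w - w') + 2 * B\<^sup>2 * norm2 (u - u')"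
proof -
  have B: "0 \<le> B" using a norm2_ge_0 order_trans by blast
  have aw: "\<bar>a \<bullet> x\<bar> \<le> B * norm2 x" if "x \<in> V" for x
    using cauchy_schwarz[OF a(1) that] mult_right_mono[OF a(2) norm2_ge_0[OF that]] by linarith
  have au: "\<bar>a \<bullet> x\<bar> \<le> B" if "x \<in> V" "norm2 x \<le> 1" for x
    using aw[OF that(1)] mult_left_mono[OF that(2) B] by simp
  have s1: "\<bar>smoothed_hinge2 p (a \<bullet> w) - smoothed_hinge2 p (a \<bullet> w')\<bar> \<le> (p - 2) * (B * norm2 (w - w'))"
  proof -
    have "\<bar>smoothed_hinge2 p (a \<bullet> w) - smoothed_hinge2 p (a \<bullet> w')\<bar> \<le> (p - 2) * \<bar>a \<bullet> (w - w')\<bar>"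
      using smoothed_hinge2_lipschitz[OF p] a V by simp
    also have "\<dots> \<le> (p - 2) * (B * norm2 (w - w'))"
      using aw[of "w - w'"] V p by (intro mult_left_mono) (auto simp del: ip_minus_right)
    finally show ?thesis .
  qed
  have s2: "\<bar>(a \<bullet> u)\<^sup>2 - (a \<bullet> u')\<^sup>2\<bar> \<le> (2 * B) * (B * norm2 (u - u'))"
  proof -
    have "(a \<bullet> u)\<^sup>2 - (a \<bullet> u')\<^sup>2 = (a \<bullet> u + a \<bullet> u') * (a \<bullet> (u - u'))"
      using a V by (simp add: power2_eq_square algebra_simps)
    moreover have "\<bar>a \<bullet> u + a \<bullet> u'\<bar> \<le> 2 * B" using au[OF V(3) u1(1)] au[OF V(4) u1(2)] by linarith
    moreover have "\<bar>a \<bullet> (u - u')\<bar> \<le> B * norm2 (u - u')" using V by (intro aw) simp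
    ultimately show ?thesis using B by (simp add: abs_mult mult_mono del: ip_minus_right)
  qed
  have sq: "(a \<bullet> u)\<^sup>2 \<le> B\<^sup>2" using au[OF V(3) u1(1)] B abs_le_square_iff[of "a \<bullet> u" B] by simp
  have "curv p w u a - curv p w' u' a = (smoothed_hinge2 p (a \<bullet> w) - smoothed_hinge2 p (a \<bullet> w')) * (a \<bullet> u)\<^sup>2
      + smoothed_hinge2 p (a \<bullet> w') * ((a \<bullet> u)\<^sup>2 - (a \<bullet> u')\<^sup>2)"
    by (simp add: curv_def algebra_simps)
  also have "\<bar>\<dots>\<bar> \<le> \<bar>smoothed_hinge2 p (a \<bullet> w) - smoothed_hinge2 p (a \<bullet> w')\<bar> * (a \<bullet> u)\<^sup>2
      + smoothed_hinge2 p (a \<bullet> w') * \<bar>(a \<bullet> u)\<^sup>2 - (a \<bullet> u')\<^sup>2\<bar>"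
    using smoothed_hinge2_range(1)[OF p] by (intro order_trans[OF abs_triangle_ineq]) (simp add: abs_mult)
  also have "\<dots> \<le> ((p - 2) * (B * norm2 (w - w'))) * B\<^sup>2 + 1 * ((2 * B) * (B * norm2 (u - u')))"
    using s1 s2 sq smoothed_hinge2_range[OF p] B p V
    by (intro add_mono mult_mono) auto
  also have "\<dots> = (p - 2) * B ^ 3 * norm2 (w - w') + 2 * B\<^sup>2 * norm2 (u - u')"
    by (simp add: power2_eq_square power3_eq_cube)
  finally show ?thesis .
qed

lemma curv_range:
  assumes p: "3 \<le> p" and a: "a \<in> V" "norm2 a \<le> B" and u: "u \<in> V" "norm2 u \<le> 1"
  shows "curv p w u a \<in> {0..B\<^sup>2}"
proof -
  have "\<bar>a \<bullet> u\<bar> \<le> norm2 a * norm2 u" by (rule cauchy_schwarz[OF a(1) u(1)])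
  also have "\<dots> \<le> B * 1" using a u norm2_ge_0[OF a(1)] by (intro mult_mono) (linarith | simp)+
  finally have "(a \<bullet> u)\<^sup>2 \<le> B\<^sup>2" using abs_le_square_iff[of "a \<bullet> u" B] by simp
  hence "smoothed_hinge2 p (a \<bullet> w) * (a \<bullet> u)\<^sup>2 \<le> 1 * B\<^sup>2"
    using smoothed_hinge2_range[OF p] by (intro mult_mono) auto
  thus ?thesis using smoothed_hinge2_range[OF p] by (simp add: curv_def)
qed

end

context disco_run
begin

definition curv_gap where
  "curv_gap w u = (\<Sum>ij\<in>{..<m} \<times> {..<n}. curv p w u (feat ij)) / (real m * real n)
    - (\<Sum>ij\<in>{0} \<times> {..<n}. curv p w u (feat ij)) / real n"

lemma hessian_difference:
  "w \<in> V \<Longrightarrow> x \<in> V \<Longrightarrow> x \<bullet> (G.hes w *\<^sub>v x) - x \<bullet> (M.hes w *\<^sub>v x) = \<eta> * curv_gap w x"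
  by (simp add: G.ip_hes M.ip_hes G.wt_def M.wt_def curv_gap_def curv_def power2_eq_square
      sum.cartesian_product' right_diff_distrib)

lemma curv_gap_lipschitz:
  assumes V: "w \<in> V" "w' \<in> V" "u \<in> V" "u' \<in> V" and u1: "norm2 u \<le> 1" "norm2 u' \<le> 1"
  shows "\<bar>curv_gap w u - curv_gap w' u'\<bar> \<le> 2 * ((p - 2) * B ^ 3 * norm2 (w - w') + 2 * B\<^sup>2 * norm2 (u - u'))"
proof -
  define K where "K = (p - 2) * B ^ 3 * norm2 (w - w') + 2 * B\<^sup>2 * norm2 (u - u')"
  have one: "\<bar>(\<Sum>ij\<in>J. curv p w u (feat ij)) / c - (\<Sum>ij\<in>J. curv p w' u' (feat ij)) / c\<bar> \<le> K"
    if J: "J \<subseteq> {..<m} \<times> {..<n}" and c: "c = real (card J)" "0 < c" for J c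
  proof -
    have "\<bar>\<Sum>ij\<in>J. curv p w u (feat ij) - curv p w' u' (feat ij)\<bar> \<le> (\<Sum>ij\<in>J. K)"
      unfolding K_def using J feat
      by (intro order_trans[OF sum_abs] sum_mono curv_lipschitz p3 V u1) auto
    hence "\<bar>\<Sum>ij\<in>J. curv p w u (feat ij) - curv p w' u' (feat ij)\<bar> \<le> c * K" using c by simp
    thus ?thesis using c by (simp add: sum_subtractf diff_divide_distrib[symmetric] divide_le_eq mult.commute)
  qed
  have "\<bar>(\<Sum>ij\<in>{..<m} \<times> {..<n}. curv p w u (feat ij)) / (real m * real n)
      - (\<Sum>ij\<in>{..<m} \<times> {..<n}. curv p w' u' (feat ij)) / (real m * real n)\<bar> \<le> K"
    using m n by (intro one) auto
  moreover have "\<bar>(\<Sum>ij\<in>{0} \<times> {..<n}. curv p w u (feat ij)) / real n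
      - (\<Sum>ij\<in>{0} \<times> {..<n}. curv p w' u' (feat ij)) / real n\<bar> \<le> K"
    using m n by (intro one) (auto simp: card_cartesian_product)
  ultimately show ?thesis unfolding curv_gap_def K_def[symmetric] by linarith
qed

text \<open>Both arguments are discretized on the same grid in the unit ball: the point after
  division by \<open>R\<close>, the direction after normalization. The latter is allowed since the
  form is homogeneous of degree two. The leading 2 of the error counts the global and the local
  mean.\<close>

lemma hessians_close:
  assumes N: "0 < N" and R: "0 < R"
    and net: "\<And>g h. g \<in> grid N \<Longrightarrow> h \<in> grid N \<Longrightarrow> norm2 g \<le> 1 \<Longrightarrow> norm2 h \<le> 1 \<Longrightarrow> \<bar>curv_gap (R \<cdot>\<^sub>v g) h\<bar> \<le> \<sigma>"
    and w: "w \<in> V" "norm2 w \<le> R" and x: "x \<in> V"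
  shows "\<bar>x \<bullet> (G.hes w *\<^sub>v x) - x \<bullet> (M.hes w *\<^sub>v x)\<bar>
    \<le> \<eta> * (\<sigma> + 2 * (((p - 2) * B ^ 3 * R + 2 * B\<^sup>2) * (sqrt (real d) / real N))) * (x \<bullet> x)"
proof (cases "x = 0\<^sub>v d")
  case True thus ?thesis by simp
next
  case False
  define c where "c = norm2 x"
  have c: "c > 0" "c\<^sup>2 = x \<bullet> x" using G.ip_pos[OF x False] x by (auto simp: c_def norm2_def)
  define u where "u = (1 / c) \<cdot>\<^sub>v x"
  have u: "u \<in> V" "norm2 u \<le> 1" using x c by (auto simp: u_def norm2_smult c_def)
  have xu: "x = c \<cdot>\<^sub>v u" using c x by (intro vecV_eqI) (auto simp: u_def)
  define w1 where "w1 = (1 / R) \<cdot>\<^sub>v w"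
  have w1: "w1 \<in> V" "norm2 w1 \<le> 1" using w R by (auto simp: w1_def norm2_smult)
  obtain g where g: "g \<in> grid N" "norm2 g \<le> 1" "norm2 (w1 - g) \<le> sqrt (real d) / real N"
    using grid_approx[OF w1 N] by blast
  obtain h where h: "h \<in> grid N" "norm2 h \<le> 1" "norm2 (u - h) \<le> sqrt (real d) / real N"
    using grid_approx[OF u N] by blast
  note gV = grid_carrier[OF g(1)] and hV = grid_carrier[OF h(1)]
  have "w - R \<cdot>\<^sub>v g = R \<cdot>\<^sub>v (w1 - g)" using R w gV by (intro vecV_eqI) (auto simp: w1_def algebra_simps)
  hence wn: "norm2 (w - R \<cdot>\<^sub>v g) \<le> R * (sqrt (real d) / real N)"
    using mult_left_mono[OF g(3), of R] R w1 gV by (simp add: norm2_smult)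
  have "\<bar>curv_gap w u - curv_gap (R \<cdot>\<^sub>v g) h\<bar>
      \<le> 2 * ((p - 2) * B ^ 3 * norm2 (w - R \<cdot>\<^sub>v g) + 2 * B\<^sup>2 * norm2 (u - h))"
    using w u gV hV h by (intro curv_gap_lipschitz) auto
  also have "\<dots> \<le> 2 * ((p - 2) * B ^ 3 * (R * (sqrt (real d) / real N)) + 2 * B\<^sup>2 * (sqrt (real d) / real N))"
    using wn h(3) p3 B by (intro mult_left_mono add_mono) auto
  also have "\<dots> = 2 * (((p - 2) * B ^ 3 * R + 2 * B\<^sup>2) * (sqrt (real d) / real N))"
    by (simp add: algebra_simps)
  finally have "\<bar>curv_gap w u\<bar> \<le> \<sigma> + 2 * (((p - 2) * B ^ 3 * R + 2 * B\<^sup>2) * (sqrt (real d) / real N))"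
    using net[OF g(1) h(1) g(2) h(2)] by linarith
  hence "\<eta> * \<bar>curv_gap w u\<bar> * c\<^sup>2 \<le> \<eta> * (\<sigma> + 2 * (((p - 2) * B ^ 3 * R + 2 * B\<^sup>2) * (sqrt (real d) / real N))) * c\<^sup>2"
    using eta by (intro mult_right_mono mult_left_mono) auto
  moreover have "curv_gap w x = c\<^sup>2 * curv_gap w u"
  proof -
    have "curv p w x (feat ij) = c\<^sup>2 * curv p w u (feat ij)" if "ij \<in> {..<m} \<times> {..<n}" for ij
      unfolding xu curv_def using that u feat by (cases ij) (auto simp: power_mult_distrib)
    moreover have "{0} \<times> {..<n} \<subseteq> {..<m} \<times> {..<n}" using m by auto
    ultimately show ?thesis
      unfolding curv_gap_def right_diff_distrib times_divide_eq_right sum_distrib_left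
      by (intro arg_cong2[where f = "(-)"] arg_cong2[where f = "(/)"] sum.cong refl) auto
  qed
  ultimately show ?thesis
    using eta by (simp add: hessian_difference[OF w(1) x] abs_mult c(2)[symmetric] mult_ac)
qed

end

section \<open>Stability of regularized minimizers\<close>

context erm
begin

text \<open>Add the strong convexity gaps of both objectives, each evaluated at the minimizer of the
  other. Everything cancels except the losses of the exchanged sample, which are Lipschitz in the
  displacement, and one power of the displacement can be divided out.\<close>

lemma minimizer_stable:
  assumes b: "erm d I b p B \<eta> lam" and l: "l \<in> I" and eq: "\<And>i. i \<in> I \<Longrightarrow> i \<noteq> l \<Longrightarrow> b i = a i"
  shows "norm2 (erm.minimizer d I b p B \<eta> lam - minimizer) \<le> 2 * wt * B / lam"
proof -
  interpret b: erm d I b p B \<eta> lam by (rule b)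
  define w where "w = minimizer"
  define w' where "w' = b.minimizer"
  have V: "w \<in> V" "w' \<in> V" by (simp_all add: w_def w'_def)
  define e where "e = w' - w"
  have e: "e \<in> V" using V by (simp add: e_def)
  have e': "(w - w') \<bullet> (w - w') = e \<bullet> e"
    using V ip_comm[OF V] by (simp add: e_def)
  have diff: "obj x - b.obj x = wt * (smoothed_hinge p (a l \<bullet> x) - smoothed_hinge p (b l \<bullet> x))" for x
  proof -
    have "(\<Sum>i\<in>I. smoothed_hinge p (a i \<bullet> x)) = smoothed_hinge p (a l \<bullet> x) + (\<Sum>i\<in>I - {l}. smoothed_hinge p (a i \<bullet> x))"
      by (rule sum.remove[OF fin l])
    moreover have "(\<Sum>i\<in>I. smoothed_hinge p (b i \<bullet> x)) = smoothed_hinge p (b l \<bullet> x) + (\<Sum>i\<in>I - {l}. smoothed_hinge p (a i \<bullet> x))"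
      unfolding sum.remove[OF fin l] by (simp add: eq)
    ultimately show ?thesis unfolding obj_def b.obj_def wt_def b.wt_def by (simp add: algebra_simps)
  qed
  have lip: "\<bar>smoothed_hinge p (x \<bullet> w') - smoothed_hinge p (x \<bullet> w)\<bar> \<le> B * norm2 e" if x: "x \<in> V" "norm2 x \<le> B" for x
  proof -
    have "\<bar>smoothed_hinge p (x \<bullet> w') - smoothed_hinge p (x \<bullet> w)\<bar> \<le> \<bar>x \<bullet> e\<bar>"
      using smoothed_hinge_lipschitz[OF p3] V x by (simp add: e_def)
    also have "\<dots> \<le> norm2 x * norm2 e" by (rule cauchy_schwarz[OF x(1) e])
    also have "\<dots> \<le> B * norm2 e" using x e by (intro mult_right_mono) auto
    finally show ?thesis .
  qed
  have "obj w + lam / 2 * (e \<bullet> e) \<le> obj w'"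
    using minimizer_gap[OF V(2)] by (simp only: w_def e_def)
  moreover have "b.obj w' + lam / 2 * (e \<bullet> e) \<le> b.obj w"
    using b.minimizer_gap[OF V(1)] e' by (simp only: w'_def)
  ultimately have "lam * (e \<bullet> e) \<le> (obj w' - b.obj w') - (obj w - b.obj w)" by linarith
  also have "\<dots> = wt * ((smoothed_hinge p (a l \<bullet> w') - smoothed_hinge p (a l \<bullet> w))
      - (smoothed_hinge p (b l \<bullet> w') - smoothed_hinge p (b l \<bullet> w)))"
    unfolding diff by (simp add: algebra_simps)
  also have "\<dots> \<le> wt * (2 * (B * norm2 e))"
    using lip[OF a_carrier[OF l] a_norm[OF l]] lip[OF b.a_carrier[OF l] b.a_norm[OF l]] wt
    by (intro mult_left_mono) linarith+
  finally have "lam * (norm2 e * norm2 e) \<le> (2 * wt * B) * norm2 e"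
    using norm2_sq[OF e] by (simp add: power2_eq_square mult_ac)
  hence "(lam * norm2 e) * norm2 e \<le> (2 * wt * B) * norm2 e" by (simp add: mult_ac)
  moreover have "0 \<le> norm2 e" using e by simp
  moreover have "0 \<le> 2 * wt * B" using wt B by simp
  ultimately have "lam * norm2 e \<le> 2 * wt * B"
    by (cases "norm2 e = 0") auto
  thus ?thesis using lam by (simp add: e_def w_def w'_def le_divide_eq mult.commute)
qed

lemma minimizer_norm: "minimizer \<bullet> minimizer \<le> 2 * \<eta> / lam"
proof -
  have "lam / 2 * (minimizer \<bullet> minimizer) \<le> obj minimizer" by (rule obj_nonneg) simp
  also have "\<dots> \<le> obj (0\<^sub>v d)" by (rule minimizer_le) simp
  also have "\<dots> \<le> \<eta>" by (rule obj_zero_le)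
  finally show ?thesis using lam by (simp add: field_simps)
qed

end

section \<open>The averaged local minimizers as starting point\<close>

context disco_run
begin

definition lmin where "lmin i = erm.minimizer d {..<n} (\<lambda>j. feat (i, j)) p B \<eta> (lam + \<rho>)"

lemma lrho: "0 < lam + \<rho>"
  using lam rho by simp

lemma lmin_carrier: "i < m \<Longrightarrow> lmin i \<in> V"
  unfolding lmin_def by (rule erm.minimizer_carrier[OF loc[OF _ lrho]])

lemma arg_min_local: "i < m \<Longrightarrow> arg_min_on (\<lambda>w. F i w + \<rho> / 2 * (norm2 w)\<^sup>2) V = lmin i"
  unfolding lmin_def by (rule erm.arg_min_on_eq[OF loc[OF _ lrho] local_loss_eq[OF _ _ lrho]])

lemma init_entry: "k < d \<Longrightarrow> disco_init d m F \<rho> $ k = 1 / real m * (\<Sum>i<m. lmin i $ k)"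
proof -
  assume k: "k < d"
  have "(\<Sum>i<m. arg_min_on (\<lambda>w. F i w + \<rho> / 2 * (norm2 w)\<^sup>2) V $ k) = (\<Sum>i<m. lmin i $ k)"
    by (intro sum.cong refl) (simp only: arg_min_local lessThan_iff)
  thus ?thesis unfolding disco_init_def using k by (simp only: index_vec)
qed

text \<open>Jensen's inequality through the tangent plane at the average: the linear terms sum to
  zero.\<close>

lemma obj_init_le: "G.obj (it 0) \<le> 1 / real m * (\<Sum>i<m. G.obj (lmin i))"
proof -
  define w0 where "w0 = it 0"
  have w0: "w0 \<in> V" by (simp add: w0_def init_carrier)
  define g where "g = G.grd w0"
  have g: "g \<in> V" by (simp add: g_def)
  have each: "G.obj w0 + (g \<bullet> lmin i - g \<bullet> w0) \<le> G.obj (lmin i)" if i: "i < m" for i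
  proof -
    note li = lmin_carrier[OF i]
    have "0 \<le> lam / 2 * ((lmin i - w0) \<bullet> (lmin i - w0))"
      using lam li w0 by (intro mult_nonneg_nonneg ip_ge_0) auto
    moreover have "G.obj w0 + (lmin i - w0) \<bullet> g + lam / 2 * ((lmin i - w0) \<bullet> (lmin i - w0)) \<le> G.obj (lmin i)"
      using G.strong_convexity[OF w0, of "lmin i - w0"] li w0 by (simp only: g_def G.vec_diff_line minus_carrier_vec)
    moreover have "(lmin i - w0) \<bullet> g = g \<bullet> lmin i - g \<bullet> w0"
      using li w0 g by (simp add: ip_comm[of g])
    ultimately show ?thesis by linarith
  qed
  have "(\<Sum>i<m. g \<bullet> lmin i) = (\<Sum>i<m. \<Sum>k<d. g $ k * lmin i $ k)"
    using g lmin_carrier by (intro sum.cong refl ip_sum) auto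
  also have "\<dots> = (\<Sum>k<d. g $ k * (\<Sum>i<m. lmin i $ k))"
    by (subst sum.swap) (simp add: sum_distrib_left)
  also have "\<dots> = (\<Sum>k<d. g $ k * (real m * w0 $ k))"
    using m by (intro sum.cong refl) (simp add: w0_def init_entry)
  also have "\<dots> = real m * (g \<bullet> w0)" using g w0 by (simp add: ip_sum sum_distrib_left mult_ac)
  finally have "(\<Sum>i<m. g \<bullet> lmin i - g \<bullet> w0) = 0" by (simp add: sum_subtractf)
  hence "real m * G.obj w0 = (\<Sum>i<m. G.obj w0 + (g \<bullet> lmin i - g \<bullet> w0))" by (simp add: sum.distrib)
  also have "\<dots> \<le> (\<Sum>i<m. G.obj (lmin i))" using each by (intro sum_mono) simp
  finally show ?thesis using m by (simp add: w0_def field_simps)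
qed

definition hl where "hl i j w = \<eta> * smoothed_hinge p (feat (i, j) \<bullet> w)"

lemma G_obj_hl: "G.obj w = 1 / (real m * real n) * (\<Sum>i<m. \<Sum>j<n. hl i j w) + lam / 2 * (w \<bullet> w)"
  unfolding G.obj_def G.wt_def hl_def by (simp add: sum.cartesian_product' sum_distrib_left)

lemma loc_obj_hl:
  "i < m \<Longrightarrow> erm.obj {..<n} (\<lambda>j. feat (i, j)) p \<eta> (lam + \<rho>) w = 1 / real n * (\<Sum>j<n. hl i j w) + (lam + \<rho>) / 2 * (w \<bullet> w)"
  unfolding erm.obj_def[OF loc[OF _ lrho]] erm.wt_def[OF loc[OF _ lrho]] hl_def by (simp add: sum_distrib_left)

text \<open>The generalization gap of the local minimizers is isolated in the second sum, whose
  expectation is controlled by stability under exchanging two samples.\<close>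

lemma gap_init_le:
  "gap 0 \<le> \<rho> / 2 * (G.minimizer \<bullet> G.minimizer)
    + 1 / real m * (\<Sum>i<m. 1 / (real m * real n) * (\<Sum>i'<m. \<Sum>j<n. hl i' j (lmin i) - hl i j (lmin i)))"
proof -
  have each: "G.obj (lmin i) \<le> 1 / real n * (\<Sum>j<n. hl i j G.minimizer) + (lam + \<rho>) / 2 * (G.minimizer \<bullet> G.minimizer)
      + 1 / (real m * real n) * (\<Sum>i'<m. \<Sum>j<n. hl i' j (lmin i) - hl i j (lmin i))" if i: "i < m" for i
  proof -
    define q where "q = lmin i \<bullet> lmin i"
    have q: "0 \<le> q" using lmin_carrier[OF i] by (simp add: q_def)
    \<comment> \<open>Each local minimizer competes with the global one in its own objective;
      averaging over the machines then recovers the global objective at its minimizer.\<close>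
    have "erm.obj {..<n} (\<lambda>j. feat (i, j)) p \<eta> (lam + \<rho>) (lmin i) \<le> erm.obj {..<n} (\<lambda>j. feat (i, j)) p \<eta> (lam + \<rho>) G.minimizer"
      unfolding lmin_def by (rule erm.minimizer_le[OF loc[OF i lrho]]) simp
    hence 1: "1 / real n * (\<Sum>j<n. hl i j (lmin i)) + (lam + \<rho>) / 2 * q
        \<le> 1 / real n * (\<Sum>j<n. hl i j G.minimizer) + (lam + \<rho>) / 2 * (G.minimizer \<bullet> G.minimizer)"
      unfolding loc_obj_hl[OF i] q_def .
    have 2: "1 / (real m * real n) * (\<Sum>i'<m. \<Sum>j<n. hl i' j (lmin i) - hl i j (lmin i))
        = 1 / (real m * real n) * (\<Sum>i'<m. \<Sum>j<n. hl i' j (lmin i)) - 1 / real n * (\<Sum>j<n. hl i j (lmin i))"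
      using m by (simp add: sum_subtractf right_diff_distrib)
    have 3: "(lam + \<rho>) / 2 * q = lam / 2 * q + \<rho> / 2 * q" by (simp add: algebra_simps)
    have "0 \<le> \<rho> / 2 * q" using rho q by simp
    thus ?thesis using 1 2 3 unfolding G_obj_hl[of "lmin i"] q_def[symmetric] by linarith
  qed
  have "G.obj (it 0) \<le> 1 / real m * (\<Sum>i<m. G.obj (lmin i))" by (rule obj_init_le)
  also have "\<dots> \<le> 1 / real m * (\<Sum>i<m. 1 / real n * (\<Sum>j<n. hl i j G.minimizer) + (lam + \<rho>) / 2 * (G.minimizer \<bullet> G.minimizer)
      + 1 / (real m * real n) * (\<Sum>i'<m. \<Sum>j<n. hl i' j (lmin i) - hl i j (lmin i)))"
    using each by (intro mult_left_mono sum_mono) auto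
  also have "\<dots> = (1 / (real m * real n) * (\<Sum>i<m. \<Sum>j<n. hl i j G.minimizer) + (lam + \<rho>) / 2 * (G.minimizer \<bullet> G.minimizer))
      + 1 / real m * (\<Sum>i<m. 1 / (real m * real n) * (\<Sum>i'<m. \<Sum>j<n. hl i' j (lmin i) - hl i j (lmin i)))"
  proof -
    have "(\<Sum>i<m. 1 / real n * (\<Sum>j<n. hl i j G.minimizer)) = 1 / real n * (\<Sum>i<m. \<Sum>j<n. hl i j G.minimizer)"
      by (simp add: sum_distrib_left)
    thus ?thesis using m by (simp only: sum.distrib distrib_left) simp
  qed
  finally show ?thesis
    unfolding gap_def G_obj_hl[of G.minimizer] by (simp add: algebra_simps add_divide_distrib)
qed

text \<open>Holds for every data set and is used on the exceptional event. Comparison with the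
  origin bounds the local minimizers by \<open>sqrt (2 / \<gamma>)\<close>, and
  \<open>2 x \<le> 1 + x^2\<close> keeps the result polynomial in
  \<open>B^2 / \<gamma>\<close>.\<close>

lemma gap_init_bound: "gap 0 \<le> \<eta> * (3 + 2 * (B\<^sup>2 / \<gamma>))"
proof -
  have "G.obj (lmin i) \<le> \<eta> * (3 + 2 * (B\<^sup>2 / \<gamma>))" if i: "i < m" for i
  proof -
    note li = lmin_carrier[OF i]
    have "(lam + \<rho>) / 2 * (lmin i \<bullet> lmin i) \<le> \<eta>"
    proof -
      have "(lam + \<rho>) / 2 * (lmin i \<bullet> lmin i) \<le> erm.obj {..<n} (\<lambda>j. feat (i, j)) p \<eta> (lam + \<rho>) (lmin i)"
        by (rule erm.obj_nonneg[OF loc[OF i lrho] li])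
      also have "\<dots> \<le> erm.obj {..<n} (\<lambda>j. feat (i, j)) p \<eta> (lam + \<rho>) (0\<^sub>v d)"
        unfolding lmin_def by (rule erm.minimizer_le[OF loc[OF i lrho]]) simp
      also have "\<dots> \<le> \<eta>" by (rule erm.obj_zero_le[OF loc[OF i lrho]])
      finally show ?thesis .
    qed
    moreover have "0 \<le> \<rho> / 2 * (lmin i \<bullet> lmin i)" using rho li by simp
    ultimately have l2: "lam / 2 * (lmin i \<bullet> lmin i) \<le> \<eta>" by (simp add: algebra_simps add_divide_distrib)
    have "B * norm2 (lmin i) \<le> 1 + 2 * (B\<^sup>2 / \<gamma>)"
    proof -
      have "(norm2 (lmin i))\<^sup>2 \<le> 2 / \<gamma>"
      proof -
        define q where "q = lmin i \<bullet> lmin i"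
        have "lam / 2 * q \<le> \<eta>" using l2 by (simp only: q_def)
        hence "\<eta> * (\<gamma> * q) \<le> \<eta> * 2" unfolding lam_eq by simp
        hence "\<gamma> * q \<le> 2" using eta by simp
        thus ?thesis unfolding norm2_sq[OF li] q_def[symmetric] using gam by (simp add: le_divide_eq mult.commute)
      qed
      hence "B\<^sup>2 * (norm2 (lmin i))\<^sup>2 \<le> B\<^sup>2 * (2 / \<gamma>)" by (intro mult_left_mono) auto
      hence "(B * norm2 (lmin i))\<^sup>2 \<le> 2 * (B\<^sup>2 / \<gamma>)" by (simp add: power_mult_distrib mult_ac)
      moreover have "2 * (B * norm2 (lmin i)) \<le> 1 + (B * norm2 (lmin i))\<^sup>2"
        using zero_le_power2[of "B * norm2 (lmin i) - 1"] by (simp add: power2_eq_square algebra_simps)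
      moreover have "0 \<le> B\<^sup>2 / \<gamma>" using gam by simp
      ultimately show ?thesis by linarith
    qed
    hence "\<eta> * (1 + B * norm2 (lmin i)) \<le> \<eta> * (2 + 2 * (B\<^sup>2 / \<gamma>))" using eta by (intro mult_left_mono) auto
    with G.obj_upper[OF li] l2 show ?thesis by (simp add: algebra_simps)
  qed
  hence "1 / real m * (\<Sum>i<m. G.obj (lmin i)) \<le> 1 / real m * (\<Sum>i<m. \<eta> * (3 + 2 * (B\<^sup>2 / \<gamma>)))"
    by (intro mult_left_mono sum_mono) auto
  also have "\<dots> = \<eta> * (3 + 2 * (B\<^sup>2 / \<gamma>))" using m by simp
  finally have "G.obj (it 0) \<le> \<eta> * (3 + 2 * (B\<^sup>2 / \<gamma>))" using obj_init_le by linarith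
  moreover have "0 \<le> G.obj G.minimizer"
  proof -
    have "0 \<le> lam / 2 * (G.minimizer \<bullet> G.minimizer)" using lam by simp
    thus ?thesis using G.obj_nonneg[OF G.minimizer_carrier] by linarith
  qed
  ultimately show ?thesis by (simp add: gap_def)
qed

text \<open>The gap never increases, so the iterates stay in the initial sublevel set, which strong
  convexity bounds. The scaling \<open>\<eta>\<close> cancels. This gives a data-independent ball on
  which uniform concentration is sufficient.\<close>

lemma iterate_norm: "(norm2 (it k))\<^sup>2 \<le> (8 + 4 * (B\<^sup>2 / \<gamma>)) / \<gamma>"
proof -
  have "lam / 2 * (it k \<bullet> it k) \<le> G.obj (it k)" by (rule G.obj_nonneg[OF it_carrier])
  also have "\<dots> = gap k + G.obj G.minimizer" by (simp add: gap_def)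
  also have "\<dots> \<le> \<eta> * (3 + 2 * (B\<^sup>2 / \<gamma>)) + \<eta>"
    using gap_le_initial[of k] gap_init_bound G.minimizer_le[of "0\<^sub>v d"] G.obj_zero_le by simp
  also have "\<dots> = \<eta> * (4 + 2 * (B\<^sup>2 / \<gamma>))" by (simp add: algebra_simps)
  finally have "\<eta> * (\<gamma> / 2 * (it k \<bullet> it k)) \<le> \<eta> * (4 + 2 * (B\<^sup>2 / \<gamma>))" by (simp add: lam_eq)
  hence "\<gamma> / 2 * (it k \<bullet> it k) \<le> 4 + 2 * (B\<^sup>2 / \<gamma>)" using eta by simp
  thus ?thesis unfolding norm2_sq[OF it_carrier] using gam by (simp add: le_divide_eq mult.commute)
qed

end

section \<open>Random data\<close>

text \<open>Inner products are spelled out as sums because measurability is known coordinate by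
  coordinate.\<close>

lemma (in erm) gd_entry:
  "k < d \<Longrightarrow> gd (Suc t) $ k = gd t $ k - (1 / (2 * Lip)) *
    (wt * (\<Sum>i\<in>I. smoothed_hinge1 p (\<Sum>l<d. a i $ l * gd t $ l) * a i $ k) + lam * gd t $ k)"
  by (simp add: grd_def ip_sum cong: sum.cong)

lemma smoothed_hinge_measurable:
  assumes "3 \<le> p"
  shows "smoothed_hinge p \<in> borel_measurable borel" "smoothed_hinge1 p \<in> borel_measurable borel"
    "smoothed_hinge2 p \<in> borel_measurable borel"
proof -
  show "smoothed_hinge p \<in> borel_measurable borel"
    by (intro borel_measurable_continuous_onI continuous_at_imp_continuous_on ballI DERIV_isCont[OF smoothed_hinge_deriv[OF assms]])
  show "smoothed_hinge1 p \<in> borel_measurable borel"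
    by (intro borel_measurable_continuous_onI continuous_at_imp_continuous_on ballI DERIV_isCont[OF smoothed_hinge1_deriv[OF assms]])
  show "smoothed_hinge2 p \<in> borel_measurable borel"
    unfolding smoothed_hinge2_def trapezoid_def by measurable
qed

text \<open>Every descent iterate is a measurable expression in the features, by induction on the
  number of steps; the limit inherits this.\<close>

lemma minimizer_measurable:
  assumes erm: "\<And>z. erm d I (a z) p B \<eta> lam" and p: "3 \<le> p"
    and a: "\<And>i k. i \<in> I \<Longrightarrow> k < d \<Longrightarrow> (\<lambda>z. a z i $ k) \<in> borel_measurable M"
    and k: "k < d"
  shows "(\<lambda>z. erm.minimizer d I (a z) p B \<eta> lam $ k) \<in> borel_measurable M"
proof -
  note [measurable] = smoothed_hinge_measurable[OF p] a
  have gd: "(\<lambda>z. erm.gd d I (a z) p B \<eta> lam t $ k) \<in> borel_measurable M" if "k < d" for t k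
    using that
  proof (induction t arbitrary: k)
    case 0
    have "erm.gd d I (a z) p B \<eta> lam 0 $ k = 0" for z
      using 0 by (simp add: erm.gd.simps[OF erm])
    thus ?case by simp
  next
    case (Suc t)
    note [measurable] = Suc.IH
    have "(\<lambda>z. erm.gd d I (a z) p B \<eta> lam t $ k - (1 / (2 * erm.Lip B \<eta> lam)) *
      (erm.wt I \<eta> * (\<Sum>i\<in>I. smoothed_hinge1 p (\<Sum>l<d. a z i $ l * erm.gd d I (a z) p B \<eta> lam t $ l) * a z i $ k)
        + lam * erm.gd d I (a z) p B \<eta> lam t $ k)) \<in> borel_measurable M"
      using Suc.prems by measurable
    thus ?case by (simp only: erm.gd_entry[OF erm Suc.prems])
  qed
  have "(\<lambda>z. lim (\<lambda>t. erm.gd d I (a z) p B \<eta> lam t $ k)) \<in> borel_measurable M"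
    using gd[OF k] by (rule borel_measurable_lim_metric)
  thus ?thesis using k by (simp add: erm.minimizer_def[OF erm])
qed

section \<open>The i.i.d. sample with inadmissible values replaced\<close>

locale disco_sample = rvec_space +
  fixes m n :: nat and p B \<eta> lam \<gamma> \<rho> \<mu> L :: real and P :: "(rvec \<times> real) measure"
  assumes m: "0 < m" and n: "0 < n" and p3: "3 \<le> p" and B: "0 < B" and gam: "0 < \<gamma>"
    and lam_eq: "lam = \<eta> * \<gamma>"
    and eta_eq: "\<eta> = (p - 2)\<^sup>2 * B powr (2 + 4 / (p - 2)) / (4 * \<gamma> powr (1 + 2 / (p - 2)))"
    and rho: "0 \<le> \<rho>" and mu: "0 \<le> \<mu>" and L_eq: "L = \<eta> * (B\<^sup>2 + \<gamma>)"
    and P: "prob_space P" and sets_P: "sets P = sets (borel_vec d \<Otimes>\<^sub>M borel)"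
    and data: "AE s in P. fst s \<in> V \<and> norm2 (fst s) \<le> B \<and> snd s \<in> {-1, 1}"
begin

abbreviation IJ :: "(nat \<times> nat) set" where "IJ \<equiv> {..<m} \<times> {..<n}"
abbreviation S where "S \<equiv> Pi\<^sub>M IJ (\<lambda>_. P)"

definition admissible :: "rvec \<times> real \<Rightarrow> bool" where
  "admissible s \<longleftrightarrow> fst s \<in> V \<and> norm2 (fst s) \<le> B \<and> snd s \<in> {-1, 1}"

text \<open>Replacing the null set of inadmissible samples by a fixed admissible one makes all
  statements about the algorithm hold surely, which keeps measurability arguments free of
  exceptional sets.\<close>

definition fix_sample :: "rvec \<times> real \<Rightarrow> rvec \<times> real" where
  "fix_sample s = (if admissible s then s else (0\<^sub>v d, 1))"

text \<open>Entries outside the index set are left alone, so that \<open>zc z = z\<close> can hold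
  almost surely as an equality of functions.\<close>

definition zc :: "dataset \<Rightarrow> dataset" where
  "zc z = (\<lambda>ij. if ij \<in> IJ then fix_sample (z ij) else z ij)"

definition fe :: "rvec \<times> real \<Rightarrow> rvec" where
  "fe s = snd (fix_sample s) \<cdot>\<^sub>v fst (fix_sample s)"

sublocale P: prob_space P by (rule P)
sublocale S: prob_space S by (rule prob_space_PiM) (rule P)

lemma fix_sample: "fst (fix_sample s) \<in> V" "norm2 (fst (fix_sample s)) \<le> B" "snd (fix_sample s) \<in> {-1, 1}"
proof -
  have "norm2 (0\<^sub>v d) = 0" by (simp add: norm2_def)
  thus "fst (fix_sample s) \<in> V" "norm2 (fst (fix_sample s)) \<le> B" "snd (fix_sample s) \<in> {-1, 1}"
    using B by (auto simp: fix_sample_def admissible_def)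
qed

lemma run: "disco_run d m n p B \<eta> lam \<gamma> (zc z) \<rho> \<mu> L"
proof unfold_locales
  fix i j assume "i < m" "j < n"
  thus "fst (zc z (i, j)) \<in> V \<and> norm2 (fst (zc z (i, j))) \<le> B \<and> snd (zc z (i, j)) \<in> {-1, 1}"
    using fix_sample by (simp add: zc_def)
qed (use m n p3 B gam lam_eq eta_eq rho mu L_eq in auto)

lemma setting: "disco_setting d m n p B \<eta> lam \<gamma> (zc z)"
  using run by (rule disco_run.axioms(1))

lemma feat_zc: "i < m \<Longrightarrow> j < n \<Longrightarrow> disco_setting.feat (zc z) (i, j) = fe (z (i, j))"
  unfolding disco_setting.feat_def[OF setting] by (simp add: zc_def fe_def)

lemma AE_zc: "AE z in S. zc z = z"
proof -
  have "AE z in S. \<forall>ij\<in>IJ. admissible (z ij)"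
    using data P by (intro AE_finite_allI AE_PiM_component) (auto simp: admissible_def)
  thus ?thesis by (rule AE_mp) (auto simp: zc_def fix_sample_def fun_eq_iff)
qed

lemma space_P: "space P = V \<times> UNIV"
  using sets_eq_imp_space_eq[OF sets_P] by (simp add: space_pair_measure borel_vec_def)

lemma coord_measurable [measurable]: "k < d \<Longrightarrow> (\<lambda>s. fst s $ k) \<in> borel_measurable P"
proof -
  assume k: "k < d"
  have "(\<lambda>v. \<lambda>k\<in>{..<d}. v $ k) \<in> borel_vec d \<rightarrow>\<^sub>M Pi\<^sub>M {..<d} (\<lambda>_. borel)"
    unfolding borel_vec_def by (rule measurable_vimage_algebra1) (auto simp: space_PiM)
  hence "(\<lambda>v. (\<lambda>k\<in>{..<d}. v $ k) k) \<in> borel_measurable (borel_vec d)"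
    by (rule measurable_compose) (use k in \<open>auto intro: measurable_component_singleton\<close>)
  hence 1: "(\<lambda>v. v $ k) \<in> borel_measurable (borel_vec d)" using k by simp
  have "fst \<in> P \<rightarrow>\<^sub>M borel_vec d" using measurable_fst by (subst measurable_cong_sets[OF sets_P refl])
  from measurable_compose[OF this 1] show ?thesis .
qed

lemma label_measurable [measurable]: "snd \<in> borel_measurable P"
  using measurable_snd by (subst measurable_cong_sets[OF sets_P refl])

lemma admissible_measurable [measurable]: "Measurable.pred P admissible"
proof -
  have "Measurable.pred P (\<lambda>s. sqrt (\<Sum>k<d. fst s $ k * fst s $ k) \<le> B \<and> (snd s = - 1 \<or> snd s = 1))"
    by measurable
  moreover have "admissible s \<longleftrightarrow> sqrt (\<Sum>k<d. fst s $ k * fst s $ k) \<le> B \<and> (snd s = - 1 \<or> snd s = 1)"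
    if "s \<in> space P" for s
    using that by (auto simp: space_P admissible_def norm2_def ip_sum)
  ultimately show ?thesis by (subst measurable_cong)
qed

lemma fe_carrier [simp]: "fe s \<in> V"
  using fix_sample(1) by (simp add: fe_def)

lemma fe_norm: "norm2 (fe s) \<le> B"
proof -
  have "\<bar>snd (fix_sample s)\<bar> = 1" using fix_sample(3)[of s] by auto
  thus ?thesis using fix_sample(1,2)[of s] by (simp add: fe_def norm2_smult)
qed

lemma fe_measurable [measurable]: "k < d \<Longrightarrow> (\<lambda>s. fe s $ k) \<in> borel_measurable P"
proof -
  assume k: "k < d"
  have "(\<lambda>s. if admissible s then snd s * fst s $ k else 0) \<in> borel_measurable P" using k by measurable
  moreover have "fe s $ k = (if admissible s then snd s * fst s $ k else 0)" if "s \<in> space P" for s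
    using k that by (auto simp: fe_def fix_sample_def space_P)
  ultimately show ?thesis by (subst measurable_cong)
qed

lemma component_measurable: "ij \<in> IJ \<Longrightarrow> (\<lambda>z. z ij) \<in> S \<rightarrow>\<^sub>M P"
  by (rule measurable_component_singleton)

subsection \<open>Hoeffding bound on a grid\<close>

lemma curv_measurable [measurable]:
  assumes "w \<in> V" "u \<in> V"
  shows "(\<lambda>s. curv p w u (fe s)) \<in> borel_measurable P"
proof -
  note [measurable] = smoothed_hinge_measurable[OF p3]
  have "(\<lambda>s. smoothed_hinge2 p (\<Sum>k<d. fe s $ k * w $ k) * (\<Sum>k<d. fe s $ k * u $ k)\<^sup>2) \<in> borel_measurable P"
    by measurable
  thus ?thesis using assms by (simp add: curv_def ip_sum)
qed

lemma indep_components: "S.indep_vars (\<lambda>_. P) (\<lambda>ij z. z ij) IJ"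
proof (subst S.indep_vars_iff_distr_eq_PiM')
  show "IJ \<noteq> {}" using m n by auto
  show "(\<lambda>z. z ij) \<in> S \<rightarrow>\<^sub>M P" if "ij \<in> IJ" for ij using component_measurable[OF that] .
  have "distr S (Pi\<^sub>M IJ (\<lambda>_. P)) (\<lambda>\<omega>. \<lambda>n\<in>IJ. \<omega> (id n)) = Pi\<^sub>M IJ (\<lambda>_. P)"
    using P by (intro distr_PiM_reindex) auto
  moreover have "Pi\<^sub>M IJ (\<lambda>_. P) = Pi\<^sub>M IJ (\<lambda>ij. distr S P (\<lambda>z. z ij))"
    using distr_PiM_component[of IJ "\<lambda>_. P"] P by (intro PiM_cong refl) auto
  ultimately show "distr S (Pi\<^sub>M IJ (\<lambda>_. P)) (\<lambda>x. \<lambda>i\<in>IJ. x i) = Pi\<^sub>M IJ (\<lambda>ij. distr S P (\<lambda>z. z ij))"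
    by simp
qed

definition curv_mean where "curv_mean w u = P.expectation (\<lambda>s. curv p w u (fe s))"

lemma expectation_component:
  fixes f :: "_ \<Rightarrow> real"
  assumes ij: "ij \<in> IJ" and f: "f \<in> borel_measurable P"
  shows "S.expectation (\<lambda>z. f (z ij)) = P.expectation f"
proof -
  have "distr S P (\<lambda>z. z ij) = P"
    using distr_PiM_component[of IJ "\<lambda>_. P", OF _ ij] P by simp
  thus ?thesis using integral_distr[OF component_measurable[OF ij] f] by simp
qed

definition dev where
  "dev J \<sigma> w u = {z \<in> space S. real (card J) * \<sigma> \<le> \<bar>(\<Sum>ij\<in>J. curv p w u (fe (z ij))) - real (card J) * curv_mean w u\<bar>}"

lemma dev_measurable: "J \<subseteq> IJ \<Longrightarrow> w \<in> V \<Longrightarrow> u \<in> V \<Longrightarrow> dev J \<sigma> w u \<in> sets S"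
proof -
  assume J: "J \<subseteq> IJ" and V: "w \<in> V" "u \<in> V"
  have "(\<lambda>z. curv p w u (fe (z ij))) \<in> borel_measurable S" if "ij \<in> J" for ij
    using measurable_compose[OF component_measurable curv_measurable[OF V]] J that by blast
  note [measurable] = this
  show ?thesis unfolding dev_def by measurable
qed

text \<open>Hoeffding's inequality for summands in an interval of width \<open>B\<^sup>2\<close>,
  whose squared widths add up to \<open>card J * B ^ 4\<close>.\<close>

lemma dev_prob:
  assumes J: "J \<subseteq> IJ" "J \<noteq> {}" and V: "w \<in> V" "u \<in> V" "norm2 u \<le> 1" and s: "0 \<le> \<sigma>"
  shows "S.prob (dev J \<sigma> w u) \<le> 2 * exp (- 2 * real (card J) * \<sigma>\<^sup>2 / B ^ 4)"
proof -
  have fJ: "finite J" using J(1) finite_subset[of J IJ] by auto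
  hence cJ: "0 < real (card J)" using J by (simp add: card_gt_0_iff)
  interpret H: Hoeffding_ineq S J "\<lambda>ij z. curv p w u (fe (z ij))" "\<lambda>_. 0" "\<lambda>_. B\<^sup>2"
    "\<Sum>ij\<in>J. S.expectation (\<lambda>z. curv p w u (fe (z ij)))"
  proof unfold_locales
    show "S.indep_vars (\<lambda>_. borel) (\<lambda>ij z. curv p w u (fe (z ij))) J"
      by (rule S.indep_vars_compose2[OF S.indep_vars_subset[OF indep_components J(1)]]) (rule curv_measurable[OF V(1,2)])
    show "AE z in S. curv p w u (fe (z ij)) \<in> {0..B\<^sup>2}" for ij
      using curv_range[OF p3 fe_carrier fe_norm V(2,3)] by (intro AE_I2) auto
  qed (use fJ in auto)
  have mean: "(\<Sum>ij\<in>J. S.expectation (\<lambda>z. curv p w u (fe (z ij)))) = real (card J) * curv_mean w u"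
    using J(1) V by (subst sum.cong[OF refl expectation_component]) (auto simp: curv_mean_def)
  have width: "(\<Sum>i\<in>J. (B\<^sup>2 - 0)\<^sup>2) = real (card J) * B ^ 4"
    by (simp add: power_mult[symmetric])
  have "S.prob {z \<in> space S. \<bar>(\<Sum>ij\<in>J. curv p w u (fe (z ij))) - real (card J) * curv_mean w u\<bar> \<ge> real (card J) * \<sigma>}
      \<le> 2 * exp (- 2 * (real (card J) * \<sigma>)\<^sup>2 / (real (card J) * B ^ 4))"
    using H.Hoeffding_ineq_abs_ge[of "real (card J) * \<sigma>"] cJ s B unfolding mean width by simp
  also have "- 2 * (real (card J) * \<sigma>)\<^sup>2 / (real (card J) * B ^ 4) = - 2 * real (card J) * \<sigma>\<^sup>2 / B ^ 4"
    using cJ by (simp add: power2_eq_square)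
  finally show ?thesis by (simp only: dev_def)
qed

text \<open>Deviation from the common mean is excluded for the whole sample and for the master's
  sample separately; the two sums are dependent, so they are compared through their mean.\<close>

definition bad where
  "bad N R \<sigma> = (\<Union>(g, h)\<in>{g \<in> grid N. norm2 g \<le> 1} \<times> {h \<in> grid N. norm2 h \<le> 1}.
    dev IJ \<sigma> (R \<cdot>\<^sub>v g) h \<union> dev ({0} \<times> {..<n}) \<sigma> (R \<cdot>\<^sub>v g) h)"

lemma J0: "{0} \<times> {..<n} \<subseteq> IJ" "{0} \<times> {..<n} \<noteq> {}" "card ({0 :: nat} \<times> {..<n}) = n"
  using m n by (auto simp: card_cartesian_product)

lemma bad_measurable: "bad N R \<sigma> \<in> sets S"
  unfolding bad_def using finite_grid[of N] J0(1)
  by (intro sets.finite_UN) (auto intro!: sets.Un dev_measurable dest: grid_carrier)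

text \<open>Union bound over pairs of grid points, one for the iterate and one for the direction.
  The 4 is a two-sided tail for each of two samples; the larger sample concentrates at least as
  well.\<close>

lemma bad_prob:
  assumes s: "0 \<le> \<sigma>"
  shows "S.prob (bad N R \<sigma>) \<le> 4 * real (2 * N + 1) ^ (2 * d) * exp (- 2 * real n * \<sigma>\<^sup>2 / B ^ 4)"
proof -
  define K where "K = {g \<in> grid N. norm2 g \<le> 1} \<times> {h \<in> grid N. norm2 h \<le> 1}"
  define E where "E = exp (- 2 * real n * \<sigma>\<^sup>2 / B ^ 4)"
  have fK: "finite K" using finite_grid[of N] by (auto simp: K_def)
  have cK: "real (card K) \<le> real (2 * N + 1) ^ (2 * d)"
  proof -
    have "card {g \<in> grid N. norm2 g \<le> 1} \<le> (2 * N + 1) ^ d"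
      using card_mono[of "grid N" "{g \<in> grid N. norm2 g \<le> 1}"] finite_grid[of N] card_grid[of N] by auto
    hence "card K \<le> (2 * N + 1) ^ d * (2 * N + 1) ^ d"
      unfolding K_def card_cartesian_product by (intro mult_mono) auto
    also have "\<dots> = (2 * N + 1) ^ (2 * d)" by (simp add: power_add[symmetric] mult_2)
    finally show ?thesis by (metis of_nat_le_iff of_nat_power)
  qed
  have each: "S.prob (dev IJ \<sigma> (R \<cdot>\<^sub>v fst gh) (snd gh) \<union> dev ({0} \<times> {..<n}) \<sigma> (R \<cdot>\<^sub>v fst gh) (snd gh)) \<le> 4 * E"
    if gh: "gh \<in> K" for gh
  proof -
    have V: "R \<cdot>\<^sub>v fst gh \<in> V" "snd gh \<in> V" "norm2 (snd gh) \<le> 1"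
      using gh grid_carrier by (auto simp: K_def)
    have "S.prob (dev IJ \<sigma> (R \<cdot>\<^sub>v fst gh) (snd gh)) \<le> 2 * exp (- 2 * real (card IJ) * \<sigma>\<^sup>2 / B ^ 4)"
      using m n by (intro dev_prob V s) auto
    also have "\<dots> \<le> 2 * E"
    proof -
      have "real n \<le> real (card IJ)" using mult_right_mono[of 1 "real m" "real n"] m by (simp add: card_cartesian_product)
      hence "real n * (\<sigma>\<^sup>2 / B ^ 4) \<le> real (card IJ) * (\<sigma>\<^sup>2 / B ^ 4)" by (intro mult_right_mono) auto
      thus ?thesis by (simp add: E_def)
    qed
    finally have 1: "S.prob (dev IJ \<sigma> (R \<cdot>\<^sub>v fst gh) (snd gh)) \<le> 2 * E" .
    have 2: "S.prob (dev ({0} \<times> {..<n}) \<sigma> (R \<cdot>\<^sub>v fst gh) (snd gh)) \<le> 2 * E"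
      using dev_prob[OF J0(1,2) V s] by (simp only: J0(3) E_def)
    have "S.prob (dev IJ \<sigma> (R \<cdot>\<^sub>v fst gh) (snd gh) \<union> dev ({0} \<times> {..<n}) \<sigma> (R \<cdot>\<^sub>v fst gh) (snd gh))
        \<le> S.prob (dev IJ \<sigma> (R \<cdot>\<^sub>v fst gh) (snd gh)) + S.prob (dev ({0} \<times> {..<n}) \<sigma> (R \<cdot>\<^sub>v fst gh) (snd gh))"
      using V J0(1) by (intro measure_Un_le dev_measurable) auto
    with 1 2 show ?thesis by linarith
  qed
  have "S.prob (bad N R \<sigma>) = S.prob (\<Union>gh\<in>K. dev IJ \<sigma> (R \<cdot>\<^sub>v fst gh) (snd gh) \<union> dev ({0} \<times> {..<n}) \<sigma> (R \<cdot>\<^sub>v fst gh) (snd gh))"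
    by (rule arg_cong[where f = S.prob]) (auto simp: bad_def K_def)
  also have "\<dots> \<le> (\<Sum>gh\<in>K. S.prob (dev IJ \<sigma> (R \<cdot>\<^sub>v fst gh) (snd gh) \<union> dev ({0} \<times> {..<n}) \<sigma> (R \<cdot>\<^sub>v fst gh) (snd gh)))"
    using fK J0(1) by (intro measure_UNION_le) (auto simp: K_def intro!: sets.Un dev_measurable dest: grid_carrier)
  also have "\<dots> \<le> (\<Sum>gh\<in>K. 4 * E)" by (intro sum_mono each)
  also have "\<dots> = real (card K) * (4 * E)" by simp
  also have "\<dots> \<le> real (2 * N + 1) ^ (2 * d) * (4 * E)" using cK by (intro mult_right_mono) (auto simp: E_def)
  finally show ?thesis by (simp add: E_def mult_ac)
qed

lemma curv_gap_off_bad: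
  assumes z: "z \<in> space S" "z \<notin> bad N R \<sigma>" and gh: "g \<in> grid N" "h \<in> grid N" "norm2 g \<le> 1" "norm2 h \<le> 1"
  shows "\<bar>disco_run.curv_gap m n p (zc z) (R \<cdot>\<^sub>v g) h\<bar> \<le> 2 * \<sigma>"
proof -
  define w where "w = R \<cdot>\<^sub>v g"
  have nd: "z \<notin> dev IJ \<sigma> w h" "z \<notin> dev ({0} \<times> {..<n}) \<sigma> w h" using z gh unfolding bad_def w_def by blast+
  define c where "c = real m * real n"
  have c: "c > 0" "real (card IJ) = c" using m n by (auto simp: c_def card_cartesian_product)
  have "\<not> real (card IJ) * \<sigma> \<le> \<bar>(\<Sum>ij\<in>IJ. curv p w h (fe (z ij))) - real (card IJ) * curv_mean w h\<bar>"
    using nd(1) z(1) unfolding dev_def by blast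
  hence "\<bar>(\<Sum>ij\<in>IJ. curv p w h (fe (z ij))) - c * curv_mean w h\<bar> \<le> c * \<sigma>"
    unfolding c(2) by linarith
  hence "\<bar>(\<Sum>ij\<in>IJ. curv p w h (fe (z ij))) / c - curv_mean w h\<bar> \<le> \<sigma>"
    using c(1) by (simp add: abs_le_iff field_simps)
  moreover have "\<bar>(\<Sum>ij\<in>{0} \<times> {..<n}. curv p w h (fe (z ij))) - real n * curv_mean w h\<bar> \<le> real n * \<sigma>"
    using nd(2) z(1) J0(3) by (simp add: dev_def)
  hence "\<bar>(\<Sum>ij\<in>{0} \<times> {..<n}. curv p w h (fe (z ij))) / real n - curv_mean w h\<bar> \<le> \<sigma>"
    using n by (simp add: abs_le_iff field_simps)
  moreover have "disco_run.curv_gap m n p (zc z) w h = (\<Sum>ij\<in>IJ. curv p w h (fe (z ij))) / c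
      - (\<Sum>ij\<in>{0} \<times> {..<n}. curv p w h (fe (z ij))) / real n"
    unfolding disco_run.curv_gap_def[OF run] c_def using m
    by (intro arg_cong2[where f = "(-)"] arg_cong2[where f = "(/)"] sum.cong refl) (auto simp: feat_zc)
  ultimately show ?thesis unfolding w_def[symmetric] by linarith
qed

end

subsection \<open>Expected suboptimality of the initial point\<close>

lemma (in disco_setting) G_erm: "erm d ({..<m} \<times> {..<n}) feat p B \<eta> lam"
  by (rule G.erm_axioms)

context disco_sample
begin

abbreviation gap0 where "gap0 z \<equiv> disco_run.gap d m n p B \<eta> lam (zc z) \<rho> \<mu> L 0"

definition lm where "lm z i = disco_run.lmin d n p B \<eta> lam (zc z) \<rho> i"
definition gm where "gm z = erm.minimizer d IJ (disco_setting.feat (zc z)) p B \<eta> lam"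
definition sl where "sl z i' i j = \<eta> * smoothed_hinge p (fe (z (i', j)) \<bullet> lm z i)"

lemma lrho: "0 < lam + \<rho>"
  by (rule disco_run.lrho[OF run])

lemma eta: "0 < \<eta>"
  by (rule disco_setting.eta[OF setting])

lemma loc: "i < m \<Longrightarrow> erm d {..<n} (\<lambda>j. disco_setting.feat (zc z) (i, j)) p B \<eta> (lam + \<rho>)"
  by (rule disco_setting.loc[OF setting _ lrho])

lemma glob: "erm d IJ (disco_setting.feat (zc z)) p B \<eta> lam"
  by (rule disco_setting.G_erm[OF setting])

lemma lm_eq: "lm z i = erm.minimizer d {..<n} (\<lambda>j. disco_setting.feat (zc z) (i, j)) p B \<eta> (lam + \<rho>)"
  unfolding lm_def by (rule disco_run.lmin_def[OF run])

lemma lm_carrier [simp]: "i < m \<Longrightarrow> lm z i \<in> V"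
  unfolding lm_eq by (rule erm.minimizer_carrier[OF loc])

lemma gm_carrier [simp]: "gm z \<in> V"
  unfolding gm_def by (rule erm.minimizer_carrier[OF glob])

lemma feat_measurable: "i < m \<Longrightarrow> j < n \<Longrightarrow> k < d \<Longrightarrow> (\<lambda>z. disco_setting.feat (zc z) (i, j) $ k) \<in> borel_measurable S"
  using measurable_compose[OF component_measurable fe_measurable, of "(i, j)" k] by (simp add: feat_zc)

lemma lm_measurable [measurable]: "i < m \<Longrightarrow> k < d \<Longrightarrow> (\<lambda>z. lm z i $ k) \<in> borel_measurable S"
  unfolding lm_eq by (rule minimizer_measurable[OF loc p3]) (auto intro: feat_measurable)

lemma gm_measurable [measurable]: "k < d \<Longrightarrow> (\<lambda>z. gm z $ k) \<in> borel_measurable S"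
  unfolding gm_def by (rule minimizer_measurable[OF glob p3]) (auto intro: feat_measurable)

lemma sl_measurable [measurable]:
  assumes "i' < m" "i < m" "j < n"
  shows "(\<lambda>z. sl z i' i j) \<in> borel_measurable S"
proof -
  note [measurable] = smoothed_hinge_measurable[OF p3]
  have [measurable]: "(\<lambda>z. fe (z (i', j)) $ k) \<in> borel_measurable S" if "k < d" for k
    using measurable_compose[OF component_measurable fe_measurable, of "(i', j)" k] assms that by simp
  note [measurable] = lm_measurable[OF assms(2)]
  have "(\<lambda>z. \<eta> * smoothed_hinge p (\<Sum>k<d. fe (z (i', j)) $ k * lm z i $ k)) \<in> borel_measurable S"
    by measurable
  thus ?thesis using assms by (simp add: sl_def ip_sum)
qed

lemma sl_bounded:
  assumes "i < m"
  shows "0 \<le> sl z i' i j" "sl z i' i j \<le> \<eta> * (1 + B * sqrt (2 * \<eta> / (lam + \<rho>)))"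
proof -
  show "0 \<le> sl z i' i j" using eta smoothed_hinge_nonneg[OF p3] by (simp add: sl_def)
  have "lm z i \<bullet> lm z i \<le> 2 * \<eta> / (lam + \<rho>)"
    unfolding lm_eq by (rule erm.minimizer_norm[OF loc[OF assms]])
  hence n1: "norm2 (lm z i) \<le> sqrt (2 * \<eta> / (lam + \<rho>))" unfolding norm2_def by (rule real_sqrt_le_mono)
  have "\<bar>fe (z (i', j)) \<bullet> lm z i\<bar> \<le> norm2 (fe (z (i', j))) * norm2 (lm z i)"
    using assms by (intro cauchy_schwarz) auto
  also have "\<dots> \<le> B * sqrt (2 * \<eta> / (lam + \<rho>))" using n1 fe_norm B assms by (intro mult_mono) auto
  finally have "smoothed_hinge p (fe (z (i', j)) \<bullet> lm z i) \<le> 1 + B * sqrt (2 * \<eta> / (lam + \<rho>))"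
    using smoothed_hinge_lipschitz[OF p3, of "fe (z (i', j)) \<bullet> lm z i" 0] smoothed_hinge_0_le[OF p3] by linarith
  thus "sl z i' i j \<le> \<eta> * (1 + B * sqrt (2 * \<eta> / (lam + \<rho>)))"
    unfolding sl_def using eta by (intro mult_left_mono) auto
qed

lemma sl_integrable:
  assumes "i' < m" "i < m" "j < n"
  shows "integrable S (\<lambda>z. sl z i' i j)"
  using sl_bounded[OF assms(2), of _ i' j]
  by (intro S.integrable_const_bound[of _ "\<eta> * (1 + B * sqrt (2 * \<eta> / (lam + \<rho>)))"] sl_measurable assms) auto

text \<open>The displacement from \<open>minimizer_stable\<close>, times the Lipschitz constant
  \<open>\<eta> * B\<close> of the scaled loss.\<close>

definition stab where "stab = 2 * \<eta>\<^sup>2 * B\<^sup>2 / (real n * (lam + \<rho>))"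

text \<open>Swapping the samples \<open>(i, j)\<close> and \<open>(i', j)\<close> preserves the
  product measure. Afterwards the test sample of machine \<open>i'\<close> is the original training
  sample of machine \<open>i\<close>, and the minimizer of machine \<open>i\<close> has seen only
  one changed sample, so stability applies.\<close>

lemma sl_exchange:
  assumes ij: "i' < m" "i < m" "j < n"
  shows "S.expectation (\<lambda>z. sl z i' i j) \<le> S.expectation (\<lambda>z. sl z i i j) + stab"
proof (cases "i' = i")
  case True
  have "0 \<le> stab" using lrho by (simp add: stab_def)
  thus ?thesis using True by simp
next
  case False
  define f where "f = Transposition.transpose (i, j) (i', j)"
  have fIJ: "f \<in> IJ \<rightarrow> IJ" using ij by (auto simp: f_def Transposition.transpose_def)
  have inj: "inj_on f IJ" by (simp add: f_def)
  have fi: "f (i', j) = (i, j)" "f (i, j) = (i', j)" by (simp_all add: f_def)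
  have fo: "f (i, j') = (i, j')" if "j' \<noteq> j" for j' using that by (simp add: f_def Transposition.transpose_def)
  define \<tau> where "\<tau> z = (\<lambda>ij\<in>IJ. z (f ij))" for z :: dataset
  have "distr S (Pi\<^sub>M IJ (\<lambda>_. P)) (\<lambda>\<omega>. \<lambda>n\<in>IJ. \<omega> (f n)) = Pi\<^sub>M IJ (\<lambda>_. P)"
    using P by (intro distr_PiM_reindex inj fIJ) auto
  hence distr: "distr S S \<tau> = S" unfolding \<tau>_def .
  have \<tau>m: "\<tau> \<in> S \<rightarrow>\<^sub>M S"
    unfolding \<tau>_def using fIJ by (intro measurable_restrict component_measurable) auto
  have "S.expectation (\<lambda>z. sl z i' i j) = integral\<^sup>L (distr S S \<tau>) (\<lambda>z. sl z i' i j)" by (simp only: distr)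
  also have "\<dots> = S.expectation (\<lambda>z. sl (\<tau> z) i' i j)"
    by (rule integral_distr[OF \<tau>m sl_measurable[OF ij]])
  also have "\<dots> \<le> S.expectation (\<lambda>z. sl z i i j + stab)"
  proof (rule integral_mono)
    have "integrable (distr S S \<tau>) (\<lambda>z. sl z i' i j)" using sl_integrable[OF ij] by (simp only: distr)
    thus "integrable S (\<lambda>z. sl (\<tau> z) i' i j)" by (rule integrable_distr[OF \<tau>m])
    show "integrable S (\<lambda>z. sl z i i j + stab)" using sl_integrable[of i i j] ij by simp
    fix z
    have "norm2 (lm (\<tau> z) i - lm z i) \<le> 2 * erm.wt {..<n} \<eta> * B / (lam + \<rho>)"
      unfolding lm_eq
    proof (rule erm.minimizer_stable[OF loc[OF ij(2)] loc[OF ij(2)]])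
      show "j \<in> {..<n}" using ij by simp
      fix j' assume "j' \<in> {..<n}" "j' \<noteq> j"
      thus "disco_setting.feat (zc (\<tau> z)) (i, j') = disco_setting.feat (zc z) (i, j')"
        using ij by (simp add: feat_zc \<tau>_def fo)
    qed
    also have "erm.wt {..<n} \<eta> = \<eta> / real n" using erm.wt_def[OF loc[OF ij(2)]] by simp
    finally have st: "norm2 (lm (\<tau> z) i - lm z i) \<le> 2 * (\<eta> / real n) * B / (lam + \<rho>)" .
    have \<tau>z: "(\<tau> z) (i', j) = z (i, j)" using ij by (simp add: \<tau>_def fi)
    define x where "x = fe (z (i, j))"
    have x: "x \<in> V" "norm2 x \<le> B" using fe_norm by (simp_all add: x_def)
    have "\<bar>smoothed_hinge p (x \<bullet> lm (\<tau> z) i) - smoothed_hinge p (x \<bullet> lm z i)\<bar> \<le> \<bar>x \<bullet> (lm (\<tau> z) i - lm z i)\<bar>"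
      using smoothed_hinge_lipschitz[OF p3] x ij by simp
    also have "\<dots> \<le> norm2 x * norm2 (lm (\<tau> z) i - lm z i)" using x ij by (intro cauchy_schwarz) auto
    also have "\<dots> \<le> B * (2 * (\<eta> / real n) * B / (lam + \<rho>))"
      using x st B ij by (intro mult_mono norm2_ge_0) auto
    finally have "smoothed_hinge p (x \<bullet> lm (\<tau> z) i) \<le> smoothed_hinge p (x \<bullet> lm z i) + B * (2 * (\<eta> / real n) * B / (lam + \<rho>))"
      by linarith
    hence "\<eta> * smoothed_hinge p (x \<bullet> lm (\<tau> z) i) \<le> \<eta> * (smoothed_hinge p (x \<bullet> lm z i) + B * (2 * (\<eta> / real n) * B / (lam + \<rho>)))"
      using eta by (intro mult_left_mono) auto
    also have "\<dots> = \<eta> * smoothed_hinge p (x \<bullet> lm z i) + stab"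
      by (simp add: stab_def power2_eq_square distrib_left)
    finally show "sl (\<tau> z) i' i j \<le> sl z i i j + stab" by (simp add: sl_def \<tau>z x_def)
  qed
  also have "\<dots> = S.expectation (\<lambda>z. sl z i i j) + stab" using sl_integrable[of i i j] ij by (simp add: S.prob_space)
  finally show ?thesis .
qed

text \<open>An integrable majorant of \<open>gap0\<close>; with it the measurability of the starting
  point and the iterates never has to be discussed.\<close>

definition gap0_bound where
  "gap0_bound z = \<rho> / 2 * (gm z \<bullet> gm z)
    + 1 / real m * (\<Sum>i<m. 1 / (real m * real n) * (\<Sum>i'<m. \<Sum>j<n. sl z i' i j - sl z i i j))"

lemma gap0_le: "gap0 z \<le> gap0_bound z"
proof -
  have e: "disco_run.hl p \<eta> (zc z) i' j (disco_run.lmin d n p B \<eta> lam (zc z) \<rho> i) = sl z i' i j"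
    if "i' < m" "j < n" for i i' j
    using that by (simp add: disco_run.hl_def[OF run] sl_def lm_def feat_zc)
  have "(\<Sum>i<m. 1 / (real m * real n) * (\<Sum>i'<m. \<Sum>j<n.
        disco_run.hl p \<eta> (zc z) i' j (disco_run.lmin d n p B \<eta> lam (zc z) \<rho> i)
        - disco_run.hl p \<eta> (zc z) i j (disco_run.lmin d n p B \<eta> lam (zc z) \<rho> i)))
      = (\<Sum>i<m. 1 / (real m * real n) * (\<Sum>i'<m. \<Sum>j<n. sl z i' i j - sl z i i j))"
    by (rule sum.cong[OF refl], rule arg_cong[where f = "(*) (1 / (real m * real n))"],
        rule sum.cong[OF refl], rule sum.cong[OF refl]) (simp add: e)
  thus ?thesis
    using disco_run.gap_init_le[OF run, of z] unfolding gap0_bound_def gm_def by (simp only:)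
qed

lemma gm_sq_measurable: "(\<lambda>z. gm z \<bullet> gm z) \<in> borel_measurable S"
  by (simp add: ip_sum)

lemma gm_sq_integrable: "integrable S (\<lambda>z. gm z \<bullet> gm z)"
  using erm.minimizer_norm[OF glob] unfolding gm_def[symmetric]
  by (intro S.integrable_const_bound[of _ "2 * \<eta> / lam"] gm_sq_measurable) auto

definition sd where "sd i i' j z = sl z i' i j - sl z i i j"

lemma sd_integrable: "i < m \<Longrightarrow> i' < m \<Longrightarrow> j < n \<Longrightarrow> integrable S (sd i i' j)"
  unfolding sd_def by (intro Bochner_Integration.integrable_diff sl_integrable)

lemma sd_expectation:
  "i < m \<Longrightarrow> i' < m \<Longrightarrow> j < n \<Longrightarrow> S.expectation (sd i i' j) \<le> stab"
  unfolding sd_def using sl_exchange[of i' i j]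
  by (subst Bochner_Integration.integral_diff) (auto intro: sl_integrable)

lemma sd_sum_integrable: "i < m \<Longrightarrow> integrable S (\<lambda>z. \<Sum>i'<m. \<Sum>j<n. sd i i' j z)"
  by (intro Bochner_Integration.integrable_sum sd_integrable) auto

lemma sd_sum_expectation: "i < m \<Longrightarrow> S.expectation (\<lambda>z. \<Sum>i'<m. \<Sum>j<n. sd i i' j z) \<le> real m * real n * stab"
proof -
  assume i: "i < m"
  have "S.expectation (\<lambda>z. \<Sum>i'<m. \<Sum>j<n. sd i i' j z) = (\<Sum>i'<m. S.expectation (\<lambda>z. \<Sum>j<n. sd i i' j z))"
    using i by (intro Bochner_Integration.integral_sum Bochner_Integration.integrable_sum sd_integrable) auto
  also have "\<dots> = (\<Sum>i'<m. \<Sum>j<n. S.expectation (sd i i' j))"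
    using i by (intro sum.cong refl Bochner_Integration.integral_sum sd_integrable) auto
  also have "\<dots> \<le> (\<Sum>i'<m. \<Sum>j<n. stab)" using i by (intro sum_mono sd_expectation) auto
  finally show ?thesis by simp
qed

lemma gap0_bound_eq: "gap0_bound = (\<lambda>z. \<rho> / 2 * (gm z \<bullet> gm z)
    + 1 / real m * (\<Sum>i<m. 1 / (real m * real n) * (\<Sum>i'<m. \<Sum>j<n. sd i i' j z)))"
  by (simp only: fun_eq_iff gap0_bound_def sd_def simp_thms)

lemma scaled_sum_integrable: "integrable S (\<lambda>z. \<Sum>i<m. 1 / (real m * real n) * (\<Sum>i'<m. \<Sum>j<n. sd i i' j z))"
  by (intro Bochner_Integration.integrable_sum integrable_mult_right sd_sum_integrable) auto

lemma gap0_bound_integrable: "integrable S gap0_bound"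
  unfolding gap0_bound_eq
  by (intro Bochner_Integration.integrable_add integrable_mult_right gm_sq_integrable scaled_sum_integrable)

lemma gap0_nonneg: "0 \<le> gap0 z"
  by (rule disco_run.gap_nonneg[OF run])

lemma gap0_bound_expectation:
  assumes D: "0 \<le> D" and h: "(\<integral>\<^sup>+ z. ennreal (gm z \<bullet> gm z) \<partial>S) \<le> ennreal (D\<^sup>2)"
  shows "S.expectation gap0_bound \<le> \<rho> / 2 * D\<^sup>2 + stab"
proof -
  have "ennreal (S.expectation (\<lambda>z. gm z \<bullet> gm z)) = (\<integral>\<^sup>+ z. ennreal (gm z \<bullet> gm z) \<partial>S)"
    by (rule nn_integral_eq_integral[symmetric, OF gm_sq_integrable]) simp
  hence "ennreal (S.expectation (\<lambda>z. gm z \<bullet> gm z)) \<le> ennreal (D\<^sup>2)" using h by simp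
  hence gD: "S.expectation (\<lambda>z. gm z \<bullet> gm z) \<le> D\<^sup>2" by (simp add: ennreal_le_iff)
  have "S.expectation gap0_bound = \<rho> / 2 * S.expectation (\<lambda>z. gm z \<bullet> gm z)
      + 1 / real m * S.expectation (\<lambda>z. \<Sum>i<m. 1 / (real m * real n) * (\<Sum>i'<m. \<Sum>j<n. sd i i' j z))"
    unfolding gap0_bound_eq
    by (subst Bochner_Integration.integral_add[OF integrable_mult_right[OF gm_sq_integrable] integrable_mult_right[OF scaled_sum_integrable]])
      (simp only: integral_mult_right_zero)
  also have "S.expectation (\<lambda>z. \<Sum>i<m. 1 / (real m * real n) * (\<Sum>i'<m. \<Sum>j<n. sd i i' j z))
      = (\<Sum>i<m. 1 / (real m * real n) * S.expectation (\<lambda>z. \<Sum>i'<m. \<Sum>j<n. sd i i' j z))"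
    by (subst Bochner_Integration.integral_sum) (simp_all only: integral_mult_right_zero integrable_mult_right sd_sum_integrable lessThan_iff)
  also have "\<rho> / 2 * S.expectation (\<lambda>z. gm z \<bullet> gm z)
      + 1 / real m * (\<Sum>i<m. 1 / (real m * real n) * S.expectation (\<lambda>z. \<Sum>i'<m. \<Sum>j<n. sd i i' j z))
    \<le> \<rho> / 2 * D\<^sup>2 + 1 / real m * (\<Sum>i<m. 1 / (real m * real n) * (real m * real n * stab))"
    using gD rho sd_sum_expectation by (intro add_mono mult_left_mono sum_mono) auto
  also have "\<dots> = \<rho> / 2 * D\<^sup>2 + stab" using m n by simp
  finally show ?thesis .
qed

subsection \<open>Expected number of rounds\<close>

text \<open>The random gap is multiplied by a deterministic bound on the rounds per Newton step, so
  only its expectation matters. On \<open>A\<close> both factors are replaced by deterministic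
  bounds.\<close>

lemma expected_rounds:
  assumes D: "0 \<le> D" and h: "(\<integral>\<^sup>+ z. ennreal (gm z \<bullet> gm z) \<partial>S) \<le> ennreal (D\<^sup>2)" and eps: "0 < \<epsilon>"
    and A: "A \<in> sets S"
    and Rg: "\<And>z k. z \<in> space S - A \<Longrightarrow>
      disco_pcg_rounds d m (local_loss n p \<eta> lam (zc z)) \<mu> lam L
        (disco_iter d m (local_loss n p \<eta> lam (zc z)) \<rho> \<mu> lam L k) \<le> enat Rg"
    and Rb: "\<And>z k. disco_pcg_rounds d m (local_loss n p \<eta> lam (zc z)) \<mu> lam L
        (disco_iter d m (local_loss n p \<eta> lam (zc z)) \<rho> \<mu> lam L k) \<le> enat Rb"
    and g: "\<And>z. gap0 z \<le> g"
  shows "(\<integral>\<^sup>+ z. ennreal_of_enat (disco_rounds d m (local_loss n p \<eta> lam z) \<rho> \<mu> lam L \<epsilon>) \<partial>S)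
    \<le> ennreal (1 + (20 * (\<rho> / 2 * D\<^sup>2 + stab) + 21 + 5 * max 1 (ln (1 / \<epsilon>))) * real Rg
        + (20 * g + 21 + 5 * max 1 (ln (1 / \<epsilon>))) * real Rb * S.prob A)"
proof -
  define c where "c = 21 + 5 * max 1 (ln (1 / \<epsilon>))"
  have c: "0 \<le> c" by (simp add: c_def)
  \<comment> \<open>Monotonicity of the nonnegative integral needs no measurability of the smaller
    function, so it is enough that this majorant is integrable.\<close>
  define U where "U z = 1 + (20 * gap0_bound z + c) * real Rg + (20 * g + c) * real Rb * indicator A z" for z
  have g0: "0 \<le> g" using gap0_nonneg g order_trans by blast
  have "(\<integral>\<^sup>+ z. ennreal_of_enat (disco_rounds d m (local_loss n p \<eta> lam z) \<rho> \<mu> lam L \<epsilon>) \<partial>S)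
      \<le> (\<integral>\<^sup>+ z. ennreal (U z) \<partial>S)"
  proof (rule nn_integral_mono_AE)
    show "AE z in S. ennreal_of_enat (disco_rounds d m (local_loss n p \<eta> lam z) \<rho> \<mu> lam L \<epsilon>) \<le> ennreal (U z)"
      using AE_zc
    proof (rule AE_mp, intro AE_I2 impI)
      fix z assume z: "z \<in> space S" and zz: "zc z = z"
      have gb: "0 \<le> gap0_bound z" "gap0 z \<le> gap0_bound z" using gap0_le[of z] gap0_nonneg[of z] by auto
      show "ennreal_of_enat (disco_rounds d m (local_loss n p \<eta> lam z) \<rho> \<mu> lam L \<epsilon>) \<le> ennreal (U z)"
      proof (cases "z \<in> A")
        case False
        have "ennreal_of_enat (disco_rounds d m (local_loss n p \<eta> lam z) \<rho> \<mu> lam L \<epsilon>)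
            \<le> ennreal (1 + (20 * gap0 z + 21 + 5 * max 1 (ln (1 / \<epsilon>))) * real Rg)"
          using disco_run.rounds_bound(2)[OF run eps Rg, of z] z False by (simp only: zz Diff_iff) simp
        also have "\<dots> \<le> ennreal (U z)"
        proof (rule ennreal_leI)
          have "(20 * gap0 z + c) * real Rg \<le> (20 * gap0_bound z + c) * real Rg"
            using gb by (intro mult_right_mono) auto
          thus "1 + (20 * gap0 z + 21 + 5 * max 1 (ln (1 / \<epsilon>))) * real Rg \<le> U z"
            using False unfolding U_def c_def by (simp add: add.assoc)
        qed
        finally show ?thesis .
      next
        case True
        have "ennreal_of_enat (disco_rounds d m (local_loss n p \<eta> lam z) \<rho> \<mu> lam L \<epsilon>)
            \<le> ennreal (1 + (20 * gap0 z + 21 + 5 * max 1 (ln (1 / \<epsilon>))) * real Rb)"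
          using disco_run.rounds_bound(2)[OF run eps Rb, of z] by (simp only: zz)
        also have "\<dots> \<le> ennreal (U z)"
        proof (rule ennreal_leI)
          have "(20 * gap0 z + c) * real Rb \<le> (20 * g + c) * real Rb"
            using g[of z] by (intro mult_right_mono) auto
          moreover have "0 \<le> (20 * gap0_bound z + c) * real Rg" using gb c by simp
          ultimately show "1 + (20 * gap0 z + 21 + 5 * max 1 (ln (1 / \<epsilon>))) * real Rb \<le> U z"
            using True unfolding U_def c_def by (simp add: add.assoc)
        qed
        finally show ?thesis .
      qed
    qed
  qed
  also have "\<dots> = ennreal (S.expectation U)"
  proof (rule nn_integral_eq_integral)
    show "integrable S U"
      unfolding U_def using A gap0_bound_integrable
      by (intro Bochner_Integration.integrable_add integrable_mult_right integrable_mult_left) (auto simp: S.emeasure_eq_measure)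
    show "AE z in S. 0 \<le> U z"
    proof (rule AE_I2)
      fix z
      have "0 \<le> gap0_bound z" using gap0_le[of z] gap0_nonneg[of z] by linarith
      thus "0 \<le> U z" unfolding U_def using c g0 by simp
    qed
  qed
  also have "S.expectation U = 1 + (20 * S.expectation gap0_bound + c) * real Rg + (20 * g + c) * real Rb * S.prob A"
  proof -
    have "S.expectation U = S.expectation (\<lambda>z. (1 + c * real Rg) + 20 * real Rg * gap0_bound z + (20 * g + c) * real Rb * indicator A z)"
      by (intro Bochner_Integration.integral_cong) (auto simp: U_def algebra_simps)
    also have "\<dots> = (1 + c * real Rg) + 20 * real Rg * S.expectation gap0_bound + (20 * g + c) * real Rb * S.prob A"
    proof -
      have "integrable S (\<lambda>z. (20 * g + c) * real Rb * (indicator A z :: real))"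
        using A by (intro integrable_mult_right) (auto simp: S.emeasure_eq_measure)
      thus ?thesis using gap0_bound_integrable A by (simp add: S.prob_space)
    qed
    finally show ?thesis by (simp add: algebra_simps)
  qed
  also have "ennreal \<dots> \<le> ennreal (1 + (20 * (\<rho> / 2 * D\<^sup>2 + stab) + c) * real Rg + (20 * g + c) * real Rb * S.prob A)"
    using gap0_bound_expectation[OF D h] by (intro ennreal_leI add_mono mult_right_mono mult_left_mono) auto
  finally show ?thesis by (simp add: c_def add.assoc)
qed

end

section \<open>Choice of the parameters\<close>

lemma ln_2_le_1: "ln (2 :: real) \<le> 1"
  using ln_le_minus_one[of "2 :: real"] by simp

lemma ln_le_of_power2: "0 < x \<Longrightarrow> x \<le> 2 ^ k \<Longrightarrow> ln (x :: real) \<le> real k"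
proof -
  assume x: "0 < x" "x \<le> 2 ^ k"
  have "ln x \<le> ln (2 ^ k)" using x by (intro ln_mono) auto
  also have "\<dots> = real k * ln 2" by (simp add: ln_realpow)
  also have "\<dots> \<le> real k * 1" using ln_2_le_1 by (intro mult_left_mono) auto
  finally show ?thesis by simp
qed

lemma real_nat_ceiling_le: "0 \<le> x \<Longrightarrow> real (nat \<lceil>x\<rceil>) \<le> x + 1"
  using of_int_ceiling_le_add_one[of x] by simp

locale parameters =
  fixes d m n :: nat and B \<gamma> D :: real
  assumes d: "0 < d" and m: "0 < m" and n: "0 < n" and B: "0 < B" and gam: "0 < \<gamma>" and D: "0 < D"
    and p3': "3 \<le> 2 + ln (1 / \<gamma>)"
begin

definition "q = ln (1 / \<gamma>)"
definition "p = 2 + ln (1 / \<gamma>)"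
definition "\<eta> = (p - 2)\<^sup>2 * B powr (2 + 4 / (p - 2)) / (4 * \<gamma> powr (1 + 2 / (p - 2)))"
definition "lam = \<eta> * \<gamma>"
definition "L = \<eta> * (B\<^sup>2 + \<gamma>)"
definition "\<rho> = disco_rho n (\<eta> * B) D"
definition "radius = disco_radius \<eta> (\<eta> * B) lam"
definition "\<delta> = disco_delta n \<eta> (\<eta> * B) L lam D"
definition "\<mu> = disco_mu d m n L (\<eta> * (p - 2) * B ^ 3) radius \<delta>"
definition "\<kappa> = B\<^sup>2 / \<gamma>"
definition "\<Lambda> = log_terms d m n B \<gamma> D"
definition "A = ln (1 + radius * (\<eta> * (p - 2) * B ^ 3) * sqrt (2 * real n) / L) + ln (real m * real d / \<delta>) / real d"
definition "W = 1 + B * real d powr (1/4) / (\<gamma> powr (1/2) * real n powr (1/4))"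

lemma p3: "3 \<le> p" and q1: "1 \<le> q" and pq: "p - 2 = q"
  using p3' by (simp_all add: p_def q_def)

lemma q_ln: "q = \<bar>ln \<gamma>\<bar>" "ln \<gamma> = - q"
proof -
  have "q = - ln \<gamma>" using gam by (simp add: q_def ln_div)
  thus "q = \<bar>ln \<gamma>\<bar>" "ln \<gamma> = - q" using q1 by auto
qed

lemma kappa: "0 < \<kappa>"
  using B gam by (simp add: \<kappa>_def)

lemma eta_pos: "0 < \<eta>"
  unfolding \<eta>_def using p3 B gam by simp

lemma lam_pos: "0 < lam"
  using eta_pos gam by (simp add: lam_def)

lemma L_lam: "L / lam = 1 + \<kappa>" "L = lam * (1 + \<kappa>)"
  using eta_pos gam by (simp_all add: L_def lam_def \<kappa>_def field_simps)

lemma L_pos: "0 < L"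
  using L_lam(2) lam_pos kappa by simp

text \<open>The choice \<open>p = 2 + ln (1 / \<gamma>)\<close> makes \<open>\<gamma> powr (2 / (p - 2))\<close> the constant \<open>exp (- 2)\<close>.\<close>

lemma eta_le:
  assumes "B powr (4 / (p - 2)) \<le> b"
  shows "\<eta> \<le> 3 * q\<^sup>2 * b * \<kappa>"
proof -
  have g2: "\<gamma> powr (2 / q) = exp (- 2)"
    using gam q1 q_ln(2) by (simp add: powr_def)
  have "exp 1 * exp 1 \<le> 3 * (3 :: real)" by (intro mult_mono exp_le) auto
  hence e2: "exp (2 :: real) \<le> 9" by (simp add: exp_add[symmetric])
  have "\<eta> = q\<^sup>2 * (B\<^sup>2 * B powr (4 / q)) / (4 * (\<gamma> * exp (- 2)))"
    unfolding \<eta>_def pq using B gam by (simp add: powr_add g2)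
  also have "\<dots> = (exp 2 / 4) * q\<^sup>2 * B powr (4 / q) * \<kappa>"
    using gam by (simp add: \<kappa>_def exp_minus field_simps)
  also have "\<dots> \<le> 3 * q\<^sup>2 * b * \<kappa>"
    using e2 assms kappa unfolding pq by (intro mult_mono mult_right_mono) auto
  finally show ?thesis .
qed

lemma Lam_parts:
  "1 \<le> \<Lambda>" "0 \<le> ln (real d)" "0 \<le> ln (real m)" "0 \<le> ln (real n)"
  "\<Lambda> = 1 + ln (real d) + ln (real m) + ln (real n) + \<bar>ln B\<bar> + q + \<bar>ln D\<bar>"
proof -
  show nn: "0 \<le> ln (real d)" "0 \<le> ln (real m)" "0 \<le> ln (real n)" using d m n by auto
  show "\<Lambda> = 1 + ln (real d) + ln (real m) + ln (real n) + \<bar>ln B\<bar> + q + \<bar>ln D\<bar>"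
    by (simp add: \<Lambda>_def log_terms_def q_ln(1))
  thus "1 \<le> \<Lambda>" using nn q1 by linarith
qed

lemma Lam_ge: "ln (real d) + ln (real n) \<le> \<Lambda>" "ln (real n) \<le> \<Lambda>" "ln B + ln D \<le> \<Lambda>" "- ln B - ln D \<le> \<Lambda>"
proof -
  define b a where "b = \<bar>ln B\<bar>" and "a = \<bar>ln D\<bar>"
  have "0 \<le> a" "0 \<le> b" "ln B \<le> b" "- ln B \<le> b" "ln D \<le> a" "- ln D \<le> a" by (auto simp: a_def b_def)
  thus "ln (real d) + ln (real n) \<le> \<Lambda>" "ln (real n) \<le> \<Lambda>" "ln B + ln D \<le> \<Lambda>" "- ln B - ln D \<le> \<Lambda>"
    using Lam_parts(2-4) q1 unfolding Lam_parts(5) a_def[symmetric] b_def[symmetric] by linarith+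
qed

lemma q_le: "q \<le> \<Lambda>"
  using Lam_parts by linarith

lemma ln_kappa: "ln (1 + \<kappa>) \<le> 3 * \<Lambda>" "0 \<le> ln (1 + \<kappa>)"
proof -
  show "0 \<le> ln (1 + \<kappa>)" using kappa by simp
  show "ln (1 + \<kappa>) \<le> 3 * \<Lambda>"
  proof (cases "\<kappa> \<le> 1")
    case True
    hence "ln (1 + \<kappa>) \<le> ln 2" using kappa by (intro ln_mono) auto
    thus ?thesis using ln_2_le_1 Lam_parts by linarith
  next
    case False
    hence "ln (1 + \<kappa>) \<le> ln (2 * \<kappa>)" using kappa by (intro ln_mono) auto
    also have "\<dots> = ln 2 + ln \<kappa>" using kappa by (simp add: ln_mult)
    also have "ln \<kappa> = 2 * ln B + q" using B gam q_ln(2) by (simp add: \<kappa>_def ln_div ln_realpow)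
    finally show ?thesis using ln_2_le_1 Lam_parts q1 abs_ge_self[of "ln B"] abs_ge_zero[of "ln D"] by linarith
  qed
qed

lemma ln_condition: "ln (800 * (L / lam)\<^sup>2) \<le> 16 * \<Lambda>" "0 \<le> ln (800 * (L / lam)\<^sup>2)"
proof -
  have "ln (800 * (L / lam)\<^sup>2) = ln 800 + 2 * ln (1 + \<kappa>)"
    unfolding L_lam(1) using kappa by (simp add: ln_mult ln_realpow)
  moreover have "ln (800 :: real) \<le> real 10" by (rule ln_le_of_power2) auto
  moreover have "0 \<le> ln (800 :: real)" by simp
  ultimately show "ln (800 * (L / lam)\<^sup>2) \<le> 16 * \<Lambda>" "0 \<le> ln (800 * (L / lam)\<^sup>2)"
    using ln_kappa Lam_parts(1) by linarith+
qed

lemma rho_pos: "0 < \<rho>"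
  unfolding \<rho>_def disco_rho_def using eta_pos B D n by simp

lemma mu_nonneg: "0 \<le> \<mu>" and mu_le: "\<mu> \<le> L"
proof -
  show "\<mu> \<le> L" by (simp add: \<mu>_def disco_mu_def)
  have "0 \<le> sqrt (32 * L\<^sup>2 * real d / real n) * sqrt (max 0 x)" for x by simp
  thus "0 \<le> \<mu>" unfolding \<mu>_def disco_mu_def using L_pos by simp
qed

text \<open>The scaling \<open>\<eta>\<close> cancels, so the logarithm of \<open>\<delta>\<close>
  is controlled by the logarithms of the problem parameters. The same happens in
  \<open>ratio_eq\<close>.\<close>

lemma delta_eq: "\<delta> = B * D / (sqrt (real n) * sqrt (4 * (1 + \<kappa>)) * (4 + 2 * \<kappa>))"
proof -
  have "4 * \<eta> + 2 * (\<eta> * B)\<^sup>2 / lam = \<eta> * (4 + 2 * \<kappa>)"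
    using eta_pos gam by (simp add: lam_def \<kappa>_def power2_eq_square distrib_left)
  moreover have "sqrt (lam / (4 * L)) = 1 / sqrt (4 * (1 + \<kappa>))"
  proof -
    have "lam / (4 * L) = 1 / (4 * (1 + \<kappa>))" unfolding L_lam(2) using lam_pos by simp
    thus ?thesis by (simp only: real_sqrt_divide real_sqrt_one)
  qed
  ultimately have "\<delta> = \<eta> * B * D / sqrt (real n) * (1 / sqrt (4 * (1 + \<kappa>)) / (\<eta> * (4 + 2 * \<kappa>)))"
    unfolding \<delta>_def disco_delta_def by (simp only:)
  also have "\<dots> = (\<eta> / \<eta>) * (B * D / (sqrt (real n) * sqrt (4 * (1 + \<kappa>)) * (4 + 2 * \<kappa>)))"
    by (simp only: times_divide_times_eq times_divide_eq_right times_divide_eq_left divide_divide_eq_left mult_1_right mult_ac)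
  finally show ?thesis using eta_pos by simp
qed

lemma delta_pos: "0 < \<delta>"
  unfolding delta_eq using B D n kappa by simp

lemma abs_ln_delta: "\<bar>ln \<delta>\<bar> \<le> 9 * \<Lambda>"
proof -
  have "ln \<delta> = ln (B * D) - ln (sqrt (real n) * sqrt (4 * (1 + \<kappa>)) * (4 + 2 * \<kappa>))"
    unfolding delta_eq using B D n kappa by (intro ln_divide_pos) auto
  also have "ln (B * D) = ln B + ln D" using B D by (simp add: ln_mult)
  also have "ln (sqrt (real n) * sqrt (4 * (1 + \<kappa>)) * (4 + 2 * \<kappa>)) = ln (sqrt (real n)) + ln (sqrt (4 * (1 + \<kappa>))) + ln (4 + 2 * \<kappa>)"
    using n kappa by (simp add: ln_mult_pos)
  also have "ln (sqrt (real n)) = ln (real n) / 2" using n by (simp add: ln_sqrt)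
  also have "ln (sqrt (4 * (1 + \<kappa>))) = ln (4 * (1 + \<kappa>)) / 2" using kappa by (intro ln_sqrt) auto
  also have ln4k: "ln (4 * (1 + \<kappa>)) = ln 4 + ln (1 + \<kappa>)" using kappa by (intro ln_mult_pos) auto
  finally have ld: "ln \<delta> = ln B + ln D - (ln (real n) / 2 + (ln 4 + ln (1 + \<kappa>)) / 2 + ln (4 + 2 * \<kappa>))" .
  have l4: "ln (4 :: real) \<le> real 2" "0 \<le> ln (4 :: real)" by (rule ln_le_of_power2) auto
  have "ln (4 + 2 * \<kappa>) \<le> ln (4 * (1 + \<kappa>))" using kappa by (intro ln_mono) auto
  also have "\<dots> = ln 4 + ln (1 + \<kappa>)" by (rule ln4k)
  finally have lk: "ln (4 + 2 * \<kappa>) \<le> ln 4 + ln (1 + \<kappa>)" "0 \<le> ln (4 + 2 * \<kappa>)" using kappa by auto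
  have l4': "ln (4 :: real) \<le> 2" using l4 by simp
  have "x - (c / 2 + (a + b) / 2 + e) \<le> x" if "0 \<le> a" "0 \<le> b" "0 \<le> c" "0 \<le> e" for x a b c e :: real
    using that by argo
  hence "ln \<delta> \<le> ln B + ln D" unfolding ld using l4(2) lk(2) ln_kappa(2) Lam_parts(4) by blast
  hence "ln \<delta> \<le> 9 * \<Lambda>" using Lam_ge(3) Lam_parts(1) by linarith
  moreover have "- ln \<delta> \<le> 9 * \<Lambda>" using ld l4' lk ln_kappa Lam_parts(1) Lam_ge by argo
  ultimately show ?thesis by (intro abs_leI)
qed

lemma radius_ge_0: "0 \<le> radius"
  unfolding radius_def disco_radius_def using eta_pos lam_pos B by simp

lemma radius_B: "(radius * B)\<^sup>2 = 2 * \<kappa> + 2 * \<kappa> * sqrt (2 * \<kappa>)"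
proof -
  have s: "sqrt (2 * \<eta> / lam) = sqrt (2 / \<gamma>)" using eta_pos by (simp add: lam_def)
  have "radius\<^sup>2 = 2 * \<eta> / lam + 2 * (\<eta> * B) / lam * sqrt (2 * \<eta> / lam)"
    unfolding radius_def disco_radius_def using eta_pos lam_pos B by simp
  also have "\<dots> = 2 / \<gamma> + 2 * B / \<gamma> * sqrt (2 / \<gamma>)"
    unfolding s using eta_pos by (simp add: lam_def)
  finally have "(radius * B)\<^sup>2 = (2 / \<gamma> + 2 * B / \<gamma> * sqrt (2 / \<gamma>)) * B\<^sup>2" by (simp add: power_mult_distrib)
  also have "\<dots> = 2 * \<kappa> + 2 * \<kappa> * (B * sqrt (2 / \<gamma>))"
    unfolding distrib_right by (simp add: \<kappa>_def power2_eq_square)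
  also have "B * sqrt (2 / \<gamma>) = sqrt (2 * \<kappa>)"
  proof -
    have "sqrt (2 * \<kappa>) = sqrt (B\<^sup>2 * (2 / \<gamma>))" by (simp add: \<kappa>_def mult_ac)
    thus ?thesis using B by (simp only: real_sqrt_mult) simp
  qed
  finally show ?thesis .
qed

definition "ratio = radius * (\<eta> * (p - 2) * B ^ 3) * sqrt (2 * real n) / L"

lemma ratio_eq: "ratio = (radius * B) * q * (B\<^sup>2 / (B\<^sup>2 + \<gamma>)) * sqrt (2 * real n)"
  unfolding ratio_def L_def pq using eta_pos by (simp add: power2_eq_square power3_eq_cube mult_ac)

lemma A_eq: "A = ln (1 + ratio) + ln (real m * real d / \<delta>) / real d"
  by (simp add: A_def ratio_def)

lemma ratio_le: "0 \<le> ratio" "ratio \<le> 4 * q * (1 + \<kappa>) * real n"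
proof -
  have rB: "0 \<le> radius * B" using radius_ge_0 B by simp
  have f: "0 \<le> B\<^sup>2 / (B\<^sup>2 + \<gamma>)" "B\<^sup>2 / (B\<^sup>2 + \<gamma>) \<le> 1" using B gam by (auto simp: field_simps add_pos_pos)
  have n1: "1 \<le> real n" using n by simp
  show "0 \<le> ratio" unfolding ratio_eq using radius_ge_0 B q1 f by (intro mult_nonneg_nonneg) auto
  have "sqrt (2 * \<kappa>) \<le> 1 + 2 * \<kappa>"
    using kappa by (intro real_le_lsqrt) (auto simp: power2_eq_square algebra_simps)
  hence "2 * \<kappa> * sqrt (2 * \<kappa>) \<le> 2 * \<kappa> * (1 + 2 * \<kappa>)" using kappa by (intro mult_left_mono) auto
  hence "(radius * B)\<^sup>2 \<le> (2 * (1 + \<kappa>))\<^sup>2"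
    unfolding radius_B using kappa by (simp add: power2_eq_square algebra_simps)
  hence r: "radius * B \<le> 2 * (1 + \<kappa>)" by (rule power2_le_imp_le) (use kappa in simp)
  have "sqrt (2 * real n) \<le> 2 * real n"
    using n1 by (intro real_le_lsqrt) (auto simp: power2_eq_square)
  moreover have "radius * B * q \<le> 2 * (1 + \<kappa>) * q" using r q1 by (intro mult_right_mono) auto
  moreover have "0 \<le> 2 * (1 + \<kappa>) * q" using kappa q1 by simp
  ultimately have "ratio \<le> (2 * (1 + \<kappa>)) * q * 1 * (2 * real n)"
    unfolding ratio_eq using f by (intro mult_mono[of "_ * _ * _" "_ * _ * _" "sqrt _"] mult_mono[of "_ * _" _ "_ / _"]) auto
  thus "ratio \<le> 4 * q * (1 + \<kappa>) * real n" by (simp add: mult_ac)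
qed

lemma ln_q: "0 \<le> ln q" "ln q \<le> \<Lambda>"
  using q1 ln_le_minus_one[of q] q_le by auto

lemma A_le: "A \<le> 18 * \<Lambda>"
proof -
  have n1: "1 \<le> real n" using n by simp
  have "1 * 1 * 1 \<le> q * (1 + \<kappa>) * real n" using q1 kappa n1 by (intro mult_mono) auto
  hence "1 + ratio \<le> 8 * (q * (1 + \<kappa>) * real n)" using ratio_le by simp
  hence "ln (1 + ratio) \<le> ln (8 * (q * (1 + \<kappa>) * real n))" using ratio_le(1) by (intro ln_mono) auto
  also have "\<dots> = ln 8 + (ln q + ln (1 + \<kappa>) + ln (real n))"
    using q1 kappa n by (simp add: ln_mult_pos)
  also have "ln (8 :: real) \<le> real 3" by (rule ln_le_of_power2) auto
  finally have 1: "ln (1 + ratio) \<le> 3 + ln q + ln (1 + \<kappa>) + ln (real n)" by simp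
  have "ln (real m * real d / \<delta>) = ln (real m) + ln (real d) - ln \<delta>"
    using m d delta_pos by (simp add: ln_divide_pos ln_mult_pos)
  moreover have "ln (real m * real d / \<delta>) / real d \<le> \<bar>ln (real m * real d / \<delta>)\<bar>"
  proof -
    have "ln (real m * real d / \<delta>) / real d \<le> \<bar>ln (real m * real d / \<delta>)\<bar> / real d" by (simp add: divide_right_mono)
    also have "\<dots> \<le> \<bar>ln (real m * real d / \<delta>)\<bar> / 1" using d by (intro divide_left_mono) auto
    finally show ?thesis by simp
  qed
  ultimately have 2: "ln (real m * real d / \<delta>) / real d \<le> ln (real m) + ln (real d) + 9 * \<Lambda>"
    using abs_ln_delta Lam_parts by linarith
  show ?thesis unfolding A_eq using 1 2 ln_kappa ln_q q_le Lam_parts q1 by linarith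
qed

text \<open>If the argument of the square root in \<open>\<mu>\<close> is small, then \<open>D\<close> is exponentially large in \<open>d\<close>,
  and the bound \<open>d\<close> on the number of conjugate gradient steps is logarithmic in the parameters.\<close>

lemma dim_le:
  assumes k1: "1 \<le> \<kappa>" and A: "A < 1 / 4"
  shows "real d \<le> 36 * \<Lambda>"
proof -
  \<comment> \<open>A large \<open>\<kappa>\<close> keeps the first logarithm above 1/2, so a small
    \<open>A\<close> can only be due to the second one, which involves \<open>D\<close>.\<close>
  have "1 \<le> ratio"
  proof -
    have "(sqrt 2)\<^sup>2 \<le> (radius * B)\<^sup>2" unfolding radius_B using k1 by (simp add: add_increasing2)
    hence r: "sqrt 2 \<le> radius * B" by (rule power2_le_imp_le) (use radius_ge_0 B in simp)
    have "\<gamma> \<le> B\<^sup>2" using k1 gam by (simp add: \<kappa>_def)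
    hence f: "1 / 2 \<le> B\<^sup>2 / (B\<^sup>2 + \<gamma>)" using B gam by (simp add: field_simps add_pos_pos)
    have f0: "0 \<le> B\<^sup>2 / (B\<^sup>2 + \<gamma>)" using f by linarith
    have s: "sqrt 2 \<le> sqrt (2 * real n)" using n by simp
    have "sqrt 2 * 1 * (1 / 2) * sqrt 2 \<le> ratio"
      unfolding ratio_eq using r q1 f f0 s radius_ge_0 B by (intro mult_mono mult_nonneg_nonneg) auto
    thus ?thesis by simp
  qed
  hence "ln 2 \<le> ln (1 + ratio)" by (intro ln_mono) auto
  moreover have "1 / 2 \<le> ln (2 :: real)"
  proof -
    have "ln (1 / 2 :: real) \<le> 1 / 2 - 1" by (rule ln_le_minus_one) simp
    thus ?thesis by (simp add: ln_div)
  qed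
  ultimately have "ln (real m * real d / \<delta>) / real d < - (1 / 4)" using A unfolding A_eq by linarith
  hence "ln (real m * real d / \<delta>) < - (real d / 4)" using d by (simp add: divide_less_eq)
  moreover have "ln (real m * real d / \<delta>) = ln (real m) + ln (real d) - ln \<delta>"
    using m d delta_pos by (simp add: ln_divide_pos ln_mult_pos)
  ultimately show ?thesis using abs_ln_delta Lam_parts by linarith
qed

definition "\<theta> = sqrt (real d / real n)"

lemma theta_pos: "0 < \<theta>"
  using d n by (simp add: \<theta>_def)

lemma mu_eq: "\<mu> = min L (L * \<theta> * sqrt (32 * max 0 A))"
proof -
  have "sqrt (32 * L\<^sup>2 * real d / real n) * sqrt (max 0 A) = sqrt (L\<^sup>2 * (real d / real n) * (32 * max 0 A))"
    by (simp only: real_sqrt_mult[symmetric]) (simp add: mult_ac)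
  also have "\<dots> = L * \<theta> * sqrt (32 * max 0 A)"
    unfolding real_sqrt_mult[of _ "32 * max 0 A"] real_sqrt_mult[of "L\<^sup>2"] \<theta>_def using L_pos by simp
  finally show ?thesis by (simp add: \<mu>_def disco_mu_def A_def)
qed

text \<open>The threshold 1/4 fits both regimes: times 32 it exceeds 1, as needed here, and it is
  below the 1/2 used in \<open>dim_le\<close>.\<close>

lemma mu_ge: "1 / 4 \<le> A \<Longrightarrow> L * min 1 \<theta> \<le> \<mu>"
proof -
  assume A: "1 / 4 \<le> A"
  have "1 \<le> sqrt (32 * max 0 A)" using A by simp
  hence "L * \<theta> * 1 \<le> L * \<theta> * sqrt (32 * max 0 A)" using L_pos theta_pos by (intro mult_left_mono) auto
  moreover have "L * min 1 \<theta> \<le> L * 1" "L * min 1 \<theta> \<le> L * \<theta>" using L_pos by (auto intro!: mult_left_mono)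
  ultimately show ?thesis unfolding mu_eq by simp
qed

lemma W_eq: "W = 1 + sqrt \<kappa> * sqrt \<theta>"
proof -
  have "sqrt \<theta> = (real d / real n) powr (1/4)"
    unfolding \<theta>_def using d n by (simp add: powr_half_sqrt[symmetric] powr_powr)
  also have "\<dots> = real d powr (1/4) / real n powr (1/4)" using d n by (simp add: powr_divide)
  finally have 1: "sqrt \<theta> = real d powr (1/4) / real n powr (1/4)" .
  have 2: "sqrt \<kappa> = B / \<gamma> powr (1/2)" using B gam by (simp add: \<kappa>_def real_sqrt_divide powr_half_sqrt)
  show ?thesis unfolding W_def 1 2 by simp
qed

lemma W_ge_1: "1 \<le> W"
  unfolding W_eq using kappa theta_pos by simp

text \<open>For \<open>\<kappa> \<ge> 1\<close> the factor \<open>1 + \<kappa>\<close> from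
  \<open>L / lam\<close> is at most \<open>2 * \<kappa>\<close>, so \<open>\<mu> / lam\<close> is
  \<open>\<kappa> * \<theta>\<close> up to logarithms, and its root is the nontrivial part of
  \<open>W\<close>.\<close>

lemma condition_le:
  assumes k1: "1 \<le> \<kappa>" and A: "1 / 4 \<le> A"
  shows "sqrt (1 + \<mu> / lam) \<le> 7 * \<Lambda> * W"
proof -
  have L1: "1 \<le> \<Lambda>" by (rule Lam_parts)
  have LL: "\<Lambda> * 1 \<le> \<Lambda> * \<Lambda>" using L1 by (intro mult_left_mono) auto
  have "sqrt (32 * max 0 A) \<le> 24 * \<Lambda>"
  proof (rule real_le_lsqrt)
    have "32 * max 0 A \<le> 576 * \<Lambda>" using A_le A by simp
    also have "\<dots> \<le> (24 * \<Lambda>)\<^sup>2" using LL by (simp add: power2_eq_square)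
    finally show "32 * max 0 A \<le> (24 * \<Lambda>)\<^sup>2" .
  qed (use L1 in auto)
  hence "L * \<theta> * sqrt (32 * max 0 A) \<le> L * \<theta> * (24 * \<Lambda>)" using L_pos theta_pos by (intro mult_left_mono) auto
  hence "\<mu> \<le> lam * ((1 + \<kappa>) * \<theta> * (24 * \<Lambda>))" unfolding mu_eq L_lam(2) by (simp add: mult_ac)
  hence "\<mu> / lam \<le> (1 + \<kappa>) * \<theta> * (24 * \<Lambda>)" using lam_pos by (simp add: divide_le_eq mult.commute)
  also have "\<dots> \<le> (2 * \<kappa>) * \<theta> * (24 * \<Lambda>)" using k1 theta_pos L1 by (intro mult_right_mono) auto
  also have "\<dots> \<le> \<kappa> * \<theta> * (7 * \<Lambda>)\<^sup>2"
  proof -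
    have "48 * \<Lambda> \<le> (7 * \<Lambda>)\<^sup>2" using LL L1 by (simp add: power2_eq_square)
    hence "\<kappa> * \<theta> * (48 * \<Lambda>) \<le> \<kappa> * \<theta> * (7 * \<Lambda>)\<^sup>2" using kappa theta_pos by (intro mult_left_mono) auto
    thus ?thesis by (simp add: mult_ac)
  qed
  finally have ml: "\<mu> / lam \<le> (sqrt \<kappa> * sqrt \<theta> * (7 * \<Lambda>))\<^sup>2"
    using kappa theta_pos by (simp add: power_mult_distrib)
  define x where "x = sqrt \<kappa> * sqrt \<theta> * (7 * \<Lambda>)"
  have x: "0 \<le> x" using kappa theta_pos L1 by (simp add: x_def)
  have "1 + \<mu> / lam \<le> (1 + x)\<^sup>2" using ml x unfolding x_def[symmetric] by (simp add: power2_eq_square algebra_simps)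
  hence "sqrt (1 + \<mu> / lam) \<le> 1 + x" using x by (intro real_le_lsqrt) (auto intro: add_nonneg_nonneg divide_nonneg_nonneg mu_nonneg lam_pos[THEN less_imp_le])
  also have "\<dots> \<le> 7 * \<Lambda> * W" using L1 unfolding W_eq x_def by (simp add: distrib_left mult_ac)
  finally show ?thesis .
qed

section \<open>Grid resolution and deviation level\<close>

definition "wrad = sqrt ((8 + 4 * \<kappa>) / \<gamma>)"
text \<open>The factor \<open>1 + q * (B * wrad)\<close> offsets the Lipschitz constants in point
  and direction, so that the discretization error is of the order of
  \<open>B\<^sup>2 * \<theta>\<close>.\<close>

definition "N = nat \<lceil>sqrt (real d * real n) * (1 + q * (B * wrad))\<rceil>"
text \<open>The first summand pays for the union bound over the grid, the second leaves a failure
  probability polynomial in \<open>1 + \<kappa>\<close>.\<close>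

definition "t = sqrt (ln (real (2 * N + 1)) + 2 * ln (1 + \<kappa>))"
definition "\<sigma> = B\<^sup>2 * \<theta> * t"

lemma wrad_pos: "0 < wrad"
  using kappa gam by (simp add: wrad_def add_pos_pos)

lemma B_wrad: "B * wrad \<le> 3 * (1 + \<kappa>)"
proof (rule power2_le_imp_le)
  have "(B * wrad)\<^sup>2 = \<kappa> * (8 + 4 * \<kappa>)"
    using kappa gam by (simp add: power_mult_distrib wrad_def \<kappa>_def)
  also have "\<dots> \<le> (3 * (1 + \<kappa>))\<^sup>2" using kappa by (simp add: power2_eq_square algebra_simps)
  finally show "(B * wrad)\<^sup>2 \<le> (3 * (1 + \<kappa>))\<^sup>2" .
qed (use kappa in simp)

lemma N_ge: "sqrt (real d * real n) * (1 + q * (B * wrad)) \<le> real N"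
  unfolding N_def by (rule real_nat_ceiling_ge)

lemma dn1: "1 \<le> sqrt (real d * real n)"
proof -
  have "1 * 1 \<le> real d * real n" using d n by (intro mult_mono) auto
  thus ?thesis by simp
qed

lemma qBb: "0 \<le> q * (B * wrad)"
  using q1 B wrad_pos by simp

lemma N_pos: "0 < N"
proof -
  have "1 * 1 \<le> sqrt (real d * real n) * (1 + q * (B * wrad))" using dn1 qBb by (intro mult_mono) auto
  hence "0 < real N" using N_ge by linarith
  thus ?thesis by simp
qed

lemma ln_N: "ln (real (2 * N + 1)) \<le> 10 * \<Lambda>" "0 \<le> ln (real (2 * N + 1))"
proof -
  show "0 \<le> ln (real (2 * N + 1))" by simp
  define s where "s = sqrt (real d * real n)"
  have s1: "1 \<le> s" using dn1 by (simp add: s_def)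
  have "1 * 1 \<le> q * (1 + \<kappa>)" using q1 kappa by (intro mult_mono) auto
  moreover have "q * (B * wrad) \<le> q * (3 * (1 + \<kappa>))" using B_wrad q1 by (intro mult_left_mono) auto
  moreover have "q * (3 * (1 + \<kappa>)) = 3 * (q * (1 + \<kappa>))" by simp
  ultimately have "1 + q * (B * wrad) \<le> 4 * (q * (1 + \<kappa>))" by linarith
  hence "s * (1 + q * (B * wrad)) \<le> s * (4 * (q * (1 + \<kappa>)))" using s1 by (intro mult_left_mono) auto
  moreover have "real N \<le> s * (1 + q * (B * wrad)) + 1"
  proof -
    have "0 \<le> s * (1 + q * (B * wrad))" using s1 qBb by simp
    thus ?thesis unfolding N_def s_def by (rule real_nat_ceiling_le)
  qed
  moreover have "1 * 1 \<le> s * (q * (1 + \<kappa>))" using s1 \<open>1 * 1 \<le> q * (1 + \<kappa>)\<close> by (intro mult_mono) auto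
  moreover have "s * (4 * (q * (1 + \<kappa>))) = 4 * (s * (q * (1 + \<kappa>)))" by simp
  moreover have "real (2 * N + 1) = 2 * real N + 1" by simp
  ultimately have "real (2 * N + 1) \<le> 16 * (s * (q * (1 + \<kappa>)))" by linarith
  hence "ln (real (2 * N + 1)) \<le> ln (16 * (s * (q * (1 + \<kappa>))))" by (intro ln_mono) auto
  also have "\<dots> = ln 16 + (ln s + (ln q + ln (1 + \<kappa>)))" using s1 q1 kappa by (simp add: ln_mult_pos)
  also have "ln s = (ln (real d) + ln (real n)) / 2" using d n by (simp add: s_def ln_sqrt ln_mult_pos)
  also have "ln (16 :: real) \<le> real 4" by (rule ln_le_of_power2) auto
  finally have "ln (real (2 * N + 1)) \<le> 4 + ((ln (real d) + ln (real n)) / 2 + (ln q + ln (1 + \<kappa>)))"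
    by (simp only: of_nat_numeral)
  moreover have "4 + (x / 2 + (y + u)) \<le> 10 * \<Lambda>" if "x \<le> \<Lambda>" "y \<le> \<Lambda>" "u \<le> 3 * \<Lambda>" for x y u
    using that Lam_parts(1) by linarith
  ultimately show "ln (real (2 * N + 1)) \<le> 10 * \<Lambda>" using ln_q(2) ln_kappa(1) Lam_ge(1) order_trans by blast
qed

lemma t: "0 \<le> t" "t \<le> 4 * \<Lambda>" "t\<^sup>2 = ln (real (2 * N + 1)) + 2 * ln (1 + \<kappa>)"
proof -
  have nn: "0 \<le> ln (real (2 * N + 1)) + 2 * ln (1 + \<kappa>)" using ln_N ln_kappa by simp
  show "0 \<le> t" "t\<^sup>2 = ln (real (2 * N + 1)) + 2 * ln (1 + \<kappa>)" using nn by (simp_all add: t_def)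
  have L1: "1 \<le> \<Lambda>" by (rule Lam_parts)
  have "\<Lambda> * 1 \<le> \<Lambda> * \<Lambda>" using L1 by (intro mult_left_mono) auto
  hence "ln (real (2 * N + 1)) + 2 * ln (1 + \<kappa>) \<le> (4 * \<Lambda>)\<^sup>2"
    using ln_N ln_kappa by (simp add: power2_eq_square)
  thus "t \<le> 4 * \<Lambda>" unfolding t_def using L1 nn by (intro real_le_lsqrt) auto
qed

text \<open>Four powers of \<open>1 + \<kappa>\<close> are more than enough: on the exceptional
  event the gap costs two of them, apart from logarithms and \<open>b\<close>, and the number of
  rounds per step costs one.\<close>

lemma bad_prob_le: "4 * real (2 * N + 1) ^ (2 * d) * exp (- 2 * real n * \<sigma>\<^sup>2 / B ^ 4) \<le> 4 / (1 + \<kappa>) ^ 4"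
proof -
  have "real n * \<sigma>\<^sup>2 = B ^ 4 * (real d * t\<^sup>2)"
  proof -
    have "\<theta>\<^sup>2 = real d / real n" by (simp add: \<theta>_def)
    thus ?thesis using n by (simp add: \<sigma>_def power_mult_distrib power_mult[symmetric])
  qed
  moreover have "- 2 * real n * \<sigma>\<^sup>2 / B ^ 4 = - 2 * (real n * \<sigma>\<^sup>2) / B ^ 4" by simp
  ultimately have "- 2 * real n * \<sigma>\<^sup>2 / B ^ 4 = - 2 * (B ^ 4 * (real d * t\<^sup>2)) / B ^ 4" by (simp only:)
  also have "\<dots> = - 2 * real d * t\<^sup>2" using B by simp
  also have "\<dots> = - (real (2 * d) * ln (real (2 * N + 1))) + - (real (4 * d) * ln (1 + \<kappa>))"
    unfolding t(3) by (simp add: algebra_simps)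
  finally have "exp (- 2 * real n * \<sigma>\<^sup>2 / B ^ 4) = exp (- (real (2 * d) * ln (real (2 * N + 1)))) * exp (- (real (4 * d) * ln (1 + \<kappa>)))"
    by (simp only: exp_add)
  also have "exp (- (real (2 * d) * ln (real (2 * N + 1)))) = 1 / real (2 * N + 1) ^ (2 * d)"
    by (simp only: exp_minus exp_of_nat_mult exp_ln inverse_eq_divide of_nat_0_less_iff)
  also have "exp (- (real (4 * d) * ln (1 + \<kappa>))) = 1 / (1 + \<kappa>) ^ (4 * d)"
    using kappa by (simp only: exp_minus exp_of_nat_mult inverse_eq_divide) simp
  finally have "exp (- 2 * real n * \<sigma>\<^sup>2 / B ^ 4) = 1 / real (2 * N + 1) ^ (2 * d) * (1 / (1 + \<kappa>) ^ (4 * d))" .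
  moreover have "1 / (1 + \<kappa>) ^ (4 * d) \<le> 1 / (1 + \<kappa>) ^ 4"
    using kappa d by (intro divide_left_mono power_increasing mult_pos_pos zero_less_power) auto
  ultimately have e: "exp (- 2 * real n * \<sigma>\<^sup>2 / B ^ 4) \<le> 1 / real (2 * N + 1) ^ (2 * d) * (1 / (1 + \<kappa>) ^ 4)"
    by (simp only:) (intro mult_left_mono, auto)
  have "4 * real (2 * N + 1) ^ (2 * d) * exp (- 2 * real n * \<sigma>\<^sup>2 / B ^ 4)
      \<le> 4 * real (2 * N + 1) ^ (2 * d) * (1 / real (2 * N + 1) ^ (2 * d) * (1 / (1 + \<kappa>) ^ 4))"
    by (rule mult_left_mono[OF e]) simp
  also have "\<dots> = 4 / (1 + \<kappa>) ^ 4" by (simp del: of_nat_add of_nat_mult)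
  finally show ?thesis .
qed

lemma net_error: "2 * (((p - 2) * B ^ 3 * wrad + 2 * B\<^sup>2) * (sqrt (real d) / real N)) \<le> 4 * (B\<^sup>2 * \<theta>)"
proof -
  define c where "c = 1 + q * (B * wrad)"
  have c: "0 < c" using qBb by (simp add: c_def)
  have "sqrt (real d) / real N \<le> sqrt (real d) / (sqrt (real d * real n) * c)"
    using N_ge c dn1 N_pos by (intro divide_left_mono) (auto simp: c_def)
  also have "\<dots> = 1 / (sqrt (real n) * c)" using d by (simp add: real_sqrt_mult)
  also have "\<dots> \<le> \<theta> / c"
  proof -
    have "1 \<le> sqrt (real d)" using d by simp
    hence "1 / sqrt (real n) \<le> \<theta>" using n by (simp add: \<theta>_def real_sqrt_divide divide_right_mono)
    hence "1 / sqrt (real n) / c \<le> \<theta> / c" using c by (intro divide_right_mono) auto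
    thus ?thesis by simp
  qed
  finally have N: "sqrt (real d) / real N \<le> \<theta> / c" .
  have "0 \<le> q * B ^ 3 * wrad" using q1 B wrad_pos by simp
  moreover have "2 * B\<^sup>2 * c = 2 * B\<^sup>2 + 2 * (q * B ^ 3 * wrad)"
    by (simp add: c_def power2_eq_square power3_eq_cube algebra_simps)
  ultimately have "(p - 2) * B ^ 3 * wrad + 2 * B\<^sup>2 \<le> 2 * B\<^sup>2 * c" unfolding pq by linarith
  hence "((p - 2) * B ^ 3 * wrad + 2 * B\<^sup>2) * (sqrt (real d) / real N) \<le> (2 * B\<^sup>2 * c) * (\<theta> / c)"
    using N c B by (intro mult_mono) auto
  also have "\<dots> = 2 * (B\<^sup>2 * \<theta>)" using c by simp
  finally show ?thesis by simp
qed

definition "Rb = nat \<lceil>2 * (L / lam) * ln (800 * (L / lam)\<^sup>2)\<rceil> + 2"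
text \<open>In \<open>2 * t + 4\<close> the first part is the deviation of two means from their
  expectation, the second the discretization error. The final 2 is the gradient round and the
  iteration with index 0.\<close>

definition "Rg = nat \<lceil>2 * (2 * t + 4) * sqrt (1 + \<mu> / lam) * ln (800 * (L / lam)\<^sup>2)\<rceil> + 2"

lemma Rb_le: "real Rb \<le> 35 * (1 + \<kappa>) * \<Lambda>"
proof -
  have nn: "0 \<le> 2 * (L / lam) * ln (800 * (L / lam)\<^sup>2)"
    using ln_condition L_pos lam_pos by (intro mult_nonneg_nonneg) auto
  have "real (nat \<lceil>2 * (L / lam) * ln (800 * (L / lam)\<^sup>2)\<rceil>) \<le> 2 * (L / lam) * ln (800 * (L / lam)\<^sup>2) + 1"
    using nn by (rule real_nat_ceiling_le)
  also have "2 * (L / lam) * ln (800 * (L / lam)\<^sup>2) \<le> 2 * (L / lam) * (16 * \<Lambda>)"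
    using ln_condition L_pos lam_pos by (intro mult_left_mono) auto
  finally have "real (nat \<lceil>2 * (L / lam) * ln (800 * (L / lam)\<^sup>2)\<rceil>) \<le> 2 * (L / lam) * (16 * \<Lambda>) + 1" by simp
  moreover have "2 * (L / lam) * (16 * \<Lambda>) = 32 * ((1 + \<kappa>) * \<Lambda>)" unfolding L_lam(1) by simp
  moreover have "real Rb = real (nat \<lceil>2 * (L / lam) * ln (800 * (L / lam)\<^sup>2)\<rceil>) + 2" by (simp add: Rb_def)
  ultimately have "real Rb \<le> 32 * ((1 + \<kappa>) * \<Lambda>) + 3" by linarith
  moreover have "1 * 1 \<le> (1 + \<kappa>) * \<Lambda>" using kappa Lam_parts(1) by (intro mult_mono) auto
  ultimately show ?thesis unfolding mult.assoc by linarith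
qed

lemma Rg_le:
  assumes k1: "1 \<le> \<kappa>" and A: "1 / 4 \<le> A"
  shows "real Rg \<le> 2700 * \<Lambda> ^ 3 * W"
proof -
  have L1: "1 \<le> \<Lambda>" by (rule Lam_parts)
  have sq: "0 \<le> sqrt (1 + \<mu> / lam)" using mu_nonneg lam_pos by simp
  have nn: "0 \<le> 2 * (2 * t + 4) * sqrt (1 + \<mu> / lam) * ln (800 * (L / lam)\<^sup>2)"
    using ln_condition t sq by (intro mult_nonneg_nonneg) auto
  have "real (nat \<lceil>2 * (2 * t + 4) * sqrt (1 + \<mu> / lam) * ln (800 * (L / lam)\<^sup>2)\<rceil>)
      \<le> 2 * (2 * t + 4) * sqrt (1 + \<mu> / lam) * ln (800 * (L / lam)\<^sup>2) + 1"
    using nn by (rule real_nat_ceiling_le)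
  also have "2 * (2 * t + 4) * sqrt (1 + \<mu> / lam) * ln (800 * (L / lam)\<^sup>2)
      \<le> 2 * (12 * \<Lambda>) * (7 * \<Lambda> * W) * (16 * \<Lambda>)"
    using t L1 condition_le[OF k1 A] ln_condition sq W_ge_1
    by (intro mult_mono mult_nonneg_nonneg) auto
  also have "\<dots> = 2688 * (\<Lambda> ^ 3 * W)" by (simp add: power3_eq_cube)
  finally have "real Rg \<le> 2688 * (\<Lambda> ^ 3 * W) + 3" by (simp add: Rg_def)
  moreover have "1 * 1 \<le> \<Lambda> ^ 3 * W" using L1 W_ge_1 by (intro mult_mono) auto
  ultimately show ?thesis by simp
qed

text \<open>The choice of \<open>\<rho>\<close> balances bias and stability: both terms are constant
  multiples of \<open>\<eta> * B * D / sqrt (real n)\<close>.\<close>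

lemma initial_gap_le:
  assumes "B powr (4 / (p - 2)) \<le> b"
  shows "\<rho> / 2 * D\<^sup>2 + 2 * \<eta>\<^sup>2 * B\<^sup>2 / (real n * (lam + \<rho>)) \<le> 9 * q\<^sup>2 * b * (B ^ 3 * D / (\<gamma> * sqrt (real n)))"
proof -
  define X where "X = \<eta> * B * D / sqrt (real n)"
  have X: "0 < X" using eta_pos B D n by (simp add: X_def)
  have s6: "2 \<le> sqrt (6 :: real)" "sqrt (6 :: real) \<le> 3" by (auto intro: real_le_rsqrt real_le_lsqrt)
  have rX: "\<rho> * D\<^sup>2 = sqrt 6 * X"
    unfolding \<rho>_def disco_rho_def X_def using D by (simp add: power2_eq_square)
  hence "\<rho> / 2 * D\<^sup>2 \<le> 3 / 2 * X" using s6 X by simp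
  moreover have "2 * \<eta>\<^sup>2 * B\<^sup>2 / (real n * (lam + \<rho>)) \<le> X"
  proof -
    have "2 * \<eta>\<^sup>2 * B\<^sup>2 / (real n * (lam + \<rho>)) \<le> 2 * \<eta>\<^sup>2 * B\<^sup>2 / (real n * \<rho>)"
      using rho_pos lam_pos n by (intro divide_left_mono mult_left_mono mult_pos_pos) auto
    also have "real n * \<rho> = sqrt 6 * (\<eta> * B) * sqrt (real n) / D"
    proof -
      define s where "s = sqrt (real n)"
      have s: "0 < s" "real n = s * s" using n by (simp_all add: s_def)
      show ?thesis unfolding \<rho>_def disco_rho_def s_def[symmetric] using s by (simp add: s(2))
    qed
    also have "2 * \<eta>\<^sup>2 * B\<^sup>2 / (sqrt 6 * (\<eta> * B) * sqrt (real n) / D) = 2 / sqrt 6 * X"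
      unfolding X_def using eta_pos B by (simp add: power2_eq_square)
    also have "\<dots> \<le> 1 * X" using s6 X by (intro mult_right_mono) auto
    finally show ?thesis by simp
  qed
  ultimately have "\<rho> / 2 * D\<^sup>2 + 2 * \<eta>\<^sup>2 * B\<^sup>2 / (real n * (lam + \<rho>)) \<le> 3 * X" using X by linarith
  also have "X = \<eta> * (B * D / sqrt (real n))" by (simp add: X_def)
  also have "3 * (\<eta> * (B * D / sqrt (real n))) \<le> 3 * ((3 * q\<^sup>2 * b * \<kappa>) * (B * D / sqrt (real n)))"
    using eta_le[OF assms] B D by (intro mult_left_mono mult_right_mono) auto
  also have "\<dots> = 9 * q\<^sup>2 * b * (B ^ 3 * D / (\<gamma> * sqrt (real n)))"
    by (simp add: \<kappa>_def power2_eq_square power3_eq_cube)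
  finally show ?thesis .
qed

end

section \<open>Expected number of communication rounds\<close>

text \<open>The factor 520000 covers \<open>180 * 2700\<close> from the good event,
  \<open>206 * 35 * 4\<close> from the exceptional one and the initialization round. In the second
  contribution the powers of \<open>1 + \<kappa>\<close> cancel.\<close>

lemma smallness_combination:
  fixes \<Lambda> W l Y b R0 Rb \<kappa> Q g \<pi> :: real
  assumes L1: "1 \<le> \<Lambda>" and W1: "1 \<le> W" and l1: "1 \<le> l" and b1: "1 \<le> b" and Y: "0 \<le> Y" and k: "0 < \<kappa>"
    and R0: "0 \<le> R0" "R0 \<le> 2700 * \<Lambda> ^ 3 * W" and Rb: "0 \<le> Rb" "Rb \<le> 35 * (1 + \<kappa>) * \<Lambda>"
    and Q: "0 \<le> Q" "Q \<le> 9 * \<Lambda>\<^sup>2 * b * Y" and g: "0 \<le> g" "g \<le> 3 * \<Lambda>\<^sup>2 * b * \<kappa> * (3 + 2 * \<kappa>)"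
    and pi: "0 \<le> \<pi>" "\<pi> \<le> 4 / (1 + \<kappa>) ^ 4"
  shows "1 + (20 * Q + 21 + 5 * l) * R0 + (20 * g + 21 + 5 * l) * Rb * \<pi> \<le> 520000 * b * \<Lambda> ^ 5 * (l + Y) * W"
proof -
  define E where "E = b * \<Lambda>\<^sup>2"
  have "1 * 1 \<le> \<Lambda>\<^sup>2" unfolding power2_eq_square using L1 by (intro mult_mono) auto
  hence L2: "1 \<le> \<Lambda>\<^sup>2" by simp
  have "1 * 1 \<le> b * \<Lambda>\<^sup>2" using b1 L2 by (intro mult_mono) auto
  hence E1: "1 \<le> E" by (simp add: E_def)
  have "1 * l \<le> E * l" using E1 l1 by (intro mult_right_mono) auto
  hence El: "l \<le> E * l" by simp
  have L3: "1 \<le> \<Lambda> ^ 3" using one_le_power[OF L1] by simp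
  have E5: "b * \<Lambda> ^ 5 = E * \<Lambda> ^ 3" by (simp add: E_def power2_eq_square eval_nat_numeral)
  define T where "T = E * (l + Y) * (\<Lambda> ^ 3 * W)"
  have "1 * 1 \<le> \<Lambda> ^ 3 * W" using L1 L3 W1 by (intro mult_mono) auto
  hence LW: "1 \<le> \<Lambda> ^ 3 * W" by simp
  have ElY: "E * l \<le> E * (l + Y)" using E1 Y by (intro mult_left_mono) auto
  have "E * l * 1 \<le> T" unfolding T_def using ElY LW E1 l1 Y by (intro mult_mono) auto
  hence T1: "E * l \<le> T" by simp
  have "20 * Q + 21 + 5 * l \<le> 180 * (E * (l + Y))"
  proof -
    have "Q \<le> 9 * (E * Y)" using Q by (simp add: E_def mult_ac)
    thus ?thesis using El l1 unfolding distrib_left by linarith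
  qed
  hence "(20 * Q + 21 + 5 * l) * R0 \<le> (180 * (E * (l + Y))) * (2700 * \<Lambda> ^ 3 * W)"
    using R0 E1 l1 Y by (intro mult_mono) auto
  also have "\<dots> = 486000 * T" by (simp add: T_def)
  finally have 1: "(20 * Q + 21 + 5 * l) * R0 \<le> 486000 * T" .
  have "\<kappa> * (3 + 2 * \<kappa>) \<le> 3 * (1 + \<kappa>)\<^sup>2" using k by (simp add: power2_eq_square algebra_simps)
  hence "3 * E * (\<kappa> * (3 + 2 * \<kappa>)) \<le> 3 * E * (3 * (1 + \<kappa>)\<^sup>2)" using E1 by (intro mult_left_mono) auto
  hence g': "g \<le> 9 * (E * (1 + \<kappa>)\<^sup>2)" using g by (simp add: E_def mult_ac)
  have k2: "1 \<le> (1 + \<kappa>)\<^sup>2" using k by simp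
  have "1 * 1 \<le> E * (1 + \<kappa>)\<^sup>2" using E1 k2 by (intro mult_mono) auto
  hence Ek: "1 \<le> E * (1 + \<kappa>)\<^sup>2" by simp
  have "20 * g + 21 + 5 * l \<le> 206 * (E * (1 + \<kappa>)\<^sup>2) * l"
  proof -
    define F where "F = E * (1 + \<kappa>)\<^sup>2"
    have "F * 1 \<le> F * l" using Ek l1 by (intro mult_left_mono) (auto simp: F_def)
    moreover have "1 * l \<le> F * l" using Ek l1 by (intro mult_right_mono) (auto simp: F_def)
    moreover have "206 * F * l = 206 * (F * l)" by simp
    ultimately show ?thesis using g' l1 unfolding F_def[symmetric] by linarith
  qed
  hence "(20 * g + 21 + 5 * l) * Rb * \<pi> \<le> (206 * (E * (1 + \<kappa>)\<^sup>2) * l) * (35 * (1 + \<kappa>) * \<Lambda>) * (4 / (1 + \<kappa>) ^ 4)"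
    using Rb pi g l1 E1 k L1 by (intro mult_mono mult_nonneg_nonneg) auto
  also have "\<dots> = 28840 * (E * l) * \<Lambda> * ((1 + \<kappa>) ^ 3 / (1 + \<kappa>) ^ 4)"
    by (simp add: power2_eq_square power3_eq_cube)
  also have "\<dots> \<le> 28840 * (E * l) * \<Lambda> * 1"
  proof (rule mult_left_mono)
    have "(1 + \<kappa>) ^ 3 \<le> (1 + \<kappa>) ^ 4" using k by (intro power_increasing) auto
    thus "(1 + \<kappa>) ^ 3 / (1 + \<kappa>) ^ 4 \<le> 1" using k by simp
  qed (use E1 l1 L1 in simp)
  also have "\<dots> \<le> 28840 * T"
  proof -
    have "\<Lambda> ^ 1 \<le> \<Lambda> ^ 3" using L1 by (intro power_increasing) auto
    hence "\<Lambda> * 1 \<le> \<Lambda> ^ 3 * W" using W1 L1 by (intro mult_mono) auto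
    hence "(E * l) * \<Lambda> \<le> E * (l + Y) * (\<Lambda> ^ 3 * W)" using ElY E1 l1 Y L1 by (intro mult_mono) auto
    thus ?thesis by (simp add: T_def)
  qed
  finally have 2: "(20 * g + 21 + 5 * l) * Rb * \<pi> \<le> 28840 * T" .
  have "1 \<le> E * l" using El l1 by linarith
  hence "1 + (20 * Q + 21 + 5 * l) * R0 + (20 * g + 21 + 5 * l) * Rb * \<pi> \<le> 520000 * T"
    using 1 2 T1 by linarith
  also have "520000 * T = 520000 * (b * \<Lambda> ^ 5) * (l + Y) * W" unfolding E5 T_def by (simp add: mult_ac)
  finally show ?thesis by (simp add: mult_ac)
qed

section \<open>Combination for the prescribed parameters\<close>

locale corollary_data = parameters +
  fixes X :: "rvec set" and P :: "(rvec \<times> real) measure"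
  assumes X: "X \<subseteq> carrier_vec d" "\<And>x. x \<in> X \<Longrightarrow> norm2 x \<le> B"
    and P: "prob_space P" "sets P = sets (borel_vec d \<Otimes>\<^sub>M borel)"
    and supp: "AE s in P. fst s \<in> X \<and> snd s \<in> {-1, 1}"
begin

sublocale S: disco_sample d m n p B \<eta> lam \<gamma> \<rho> \<mu> L P
proof -
  have ae: "AE s in P. fst s \<in> carrier_vec d \<and> norm2 (fst s) \<le> B \<and> snd s \<in> {-1, 1}"
    using supp by (rule AE_mp) (use X in auto)
  have rho0: "0 \<le> \<rho>" using rho_pos by simp
  show "disco_sample d m n p B \<eta> lam \<gamma> \<rho> \<mu> L P"
    by (intro disco_sample.intro m n p3 B gam lam_def \<eta>_def rho0 mu_nonneg L_def P ae)
qed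

lemma rounds_general:
  "disco_pcg_rounds d m (local_loss n p \<eta> lam (S.zc z)) \<mu> lam L
    (disco_iter d m (local_loss n p \<eta> lam (S.zc z)) \<rho> \<mu> lam L k) \<le> enat Rb"
proof -
  interpret r: disco_run d m n p B \<eta> lam \<gamma> "S.zc z" \<rho> \<mu> L by (rule S.run)
  show ?thesis
    unfolding Rb_def by (intro r.rounds_le r.it_carrier r.stp_general mu_le real_nat_ceiling_ge)
qed

lemma rounds_dim:
  "disco_pcg_rounds d m (local_loss n p \<eta> lam (S.zc z)) \<mu> lam L
    (disco_iter d m (local_loss n p \<eta> lam (S.zc z)) \<rho> \<mu> lam L k) \<le> enat (d + 2)"
proof -
  interpret r: disco_run d m n p B \<eta> lam \<gamma> "S.zc z" \<rho> \<mu> L by (rule S.run)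
  show ?thesis by (intro r.rounds_le r.it_carrier r.stp_dim)
qed

lemma rounds_good:
  assumes A: "1 / 4 \<le> A" and z: "z \<in> space S.S" "z \<notin> S.bad N wrad \<sigma>"
  shows "disco_pcg_rounds d m (local_loss n p \<eta> lam (S.zc z)) \<mu> lam L
    (disco_iter d m (local_loss n p \<eta> lam (S.zc z)) \<rho> \<mu> lam L k) \<le> enat Rg"
proof -
  interpret r: disco_run d m n p B \<eta> lam \<gamma> "S.zc z" \<rho> \<mu> L by (rule S.run)
  define w where "w = r.it k"
  have w: "w \<in> carrier_vec d" unfolding w_def by (rule r.it_carrier)
  have "norm2 w \<le> wrad"
    unfolding wrad_def \<kappa>_def using r.iterate_norm[of k] by (intro real_le_rsqrt) (simp add: w_def)
  have "\<exists>t'\<le>nat \<lceil>2 * (2 * t + 4) * sqrt (1 + \<mu> / lam) * ln (800 * (L / lam)\<^sup>2)\<rceil>. r.stp w t'"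
  proof (rule r.stp_close[OF w, of "2 * t + 4"])
    show "1 \<le> 2 * t + 4" using t(1) by simp
    fix x :: rvec assume x: "x \<in> carrier_vec d"
    have xx: "0 \<le> x \<bullet> x" using x by (rule S.ip_ge_0)
    show "\<bar>x \<bullet> (r.G.hes w *\<^sub>v x) - x \<bullet> (r.M.hes w *\<^sub>v x)\<bar> \<le> (2 * t + 4) * \<mu> * (x \<bullet> x)"
    proof (cases "\<theta> \<le> 1")
      case True
      have "\<bar>x \<bullet> (r.G.hes w *\<^sub>v x) - x \<bullet> (r.M.hes w *\<^sub>v x)\<bar>
          \<le> \<eta> * (2 * \<sigma> + 2 * (((p - 2) * B ^ 3 * wrad + 2 * B\<^sup>2) * (sqrt (real d) / real N))) * (x \<bullet> x)"
        using S.curv_gap_off_bad[OF z]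
        by (intro r.hessians_close N_pos wrad_pos w \<open>norm2 w \<le> wrad\<close> x) auto
      also have "\<dots> \<le> \<eta> * (2 * \<sigma> + 4 * (B\<^sup>2 * \<theta>)) * (x \<bullet> x)"
        using net_error eta_pos xx by (intro mult_right_mono mult_left_mono add_left_mono) auto
      also have "\<dots> = (2 * t + 4) * (\<eta> * B\<^sup>2 * \<theta>) * (x \<bullet> x)" by (simp add: \<sigma>_def algebra_simps)
      also have "\<dots> \<le> (2 * t + 4) * \<mu> * (x \<bullet> x)"
      proof (intro mult_right_mono mult_left_mono)
        have "\<eta> * B\<^sup>2 * \<theta> \<le> L * \<theta>"
          unfolding L_def using eta_pos gam theta_pos by (intro mult_right_mono mult_left_mono) auto
        also have "\<dots> \<le> \<mu>" using mu_ge[OF A] True by simp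
        finally show "\<eta> * B\<^sup>2 * \<theta> \<le> \<mu>" .
      qed (use t xx in auto)
      finally show ?thesis .
    next
      case False
      \<comment> \<open>For \<open>d > n\<close> the sample says nothing, but then
        \<open>\<mu>\<close> has reached its cap \<open>L\<close>, and two forms between
        \<open>lam\<close> and \<open>L\<close> differ by at most \<open>L\<close> anyway.\<close>
      hence Lmu: "L \<le> \<mu>" using mu_ge[OF A] by simp
      have "0 \<le> lam * (x \<bullet> x)" using lam_pos xx by simp
      moreover have "r.G.Lip = r.M.Lip" unfolding r.G.Lip_def r.M.Lip_def ..
      ultimately have "\<bar>x \<bullet> (r.G.hes w *\<^sub>v x) - x \<bullet> (r.M.hes w *\<^sub>v x)\<bar> \<le> L * (x \<bullet> x)"
        using r.G.hes_lower[OF x, of w] r.G.hes_upper[OF x, of w] r.M.hes_lower[OF x, of w] r.M.hes_upper[OF x, of w] r.L_Lip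
        by (simp add: abs_le_iff)
      also have "\<dots> \<le> \<mu> * (x \<bullet> x)" using Lmu xx by (intro mult_right_mono)
      also have "\<dots> \<le> (2 * t + 4) * \<mu> * (x \<bullet> x)"
        using mult_right_mono[of 1 "2 * t + 4" \<mu>] t mu_nonneg xx by (intro mult_right_mono) auto
      finally show ?thesis .
    qed
  qed (rule real_nat_ceiling_ge)
  thus ?thesis unfolding Rg_def w_def by (intro r.rounds_le r.it_carrier)
qed

text \<open>The three regimes are united behind one interface. In the first two the bound on the
  rounds is deterministic, and the exceptional event is empty.\<close>

lemma good_event:
  obtains A0 R0 where "A0 \<in> sets S.S" "S.S.prob A0 \<le> 4 / (1 + \<kappa>) ^ 4" "real R0 \<le> 2700 * \<Lambda> ^ 3 * W"
    "\<And>z k. z \<in> space S.S - A0 \<Longrightarrow> disco_pcg_rounds d m (local_loss n p \<eta> lam (S.zc z)) \<mu> lam L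
      (disco_iter d m (local_loss n p \<eta> lam (S.zc z)) \<rho> \<mu> lam L k) \<le> enat R0"
proof -
  have L1: "1 \<le> \<Lambda>" by (rule Lam_parts)
  have LW: "\<Lambda> \<le> \<Lambda> ^ 3 * W"
  proof -
    have "\<Lambda> ^ 1 \<le> \<Lambda> ^ 3" using L1 by (intro power_increasing) auto
    hence "\<Lambda> * 1 \<le> \<Lambda> ^ 3 * W" using W_ge_1 L1 by (intro mult_mono) auto
    thus ?thesis by simp
  qed
  have e0: "S.S.prob {} \<le> 4 / (1 + \<kappa>) ^ 4" using kappa by simp
  consider "\<kappa> < 1" | "1 \<le> \<kappa>" "A < 1 / 4" | "1 \<le> \<kappa>" "1 / 4 \<le> A" by linarith
  thus thesis
  proof cases
    case 1
    have "(1 + \<kappa>) * \<Lambda> \<le> 2 * \<Lambda>" using 1 L1 by (intro mult_right_mono) auto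
    hence "real Rb \<le> 2700 * \<Lambda> ^ 3 * W" using Rb_le LW L1 by linarith
    thus thesis using that[of "{}" Rb] e0 rounds_general by simp
  next
    case 2
    have "real (d + 2) \<le> 2700 * \<Lambda> ^ 3 * W" using dim_le[OF 2] LW L1 by simp
    thus thesis using that[of "{}" "d + 2"] e0 rounds_dim by simp
  next
    case 3
    have s0: "0 \<le> \<sigma>" using t(1) theta_pos by (simp add: \<sigma>_def)
    have "S.S.prob (S.bad N wrad \<sigma>) \<le> 4 / (1 + \<kappa>) ^ 4"
      using S.bad_prob[OF s0, of N wrad] bad_prob_le by linarith
    thus thesis
      using that[of "S.bad N wrad \<sigma>" Rg] S.bad_measurable Rg_le[OF 3] rounds_good[OF 3(2)] by simp
  qed
qed

abbreviation "f z w \<equiv> \<eta> * emp_loss m n p \<gamma> z w"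
abbreviation "w_star z \<equiv> arg_min_on (f z) (carrier_vec d)"
abbreviation "rounds \<epsilon> z \<equiv> disco_rounds d m (local_loss n p \<eta> lam z) \<rho> \<mu> lam L \<epsilon>"
abbreviation "w_hat \<epsilon> z \<equiv> disco_output d m (local_loss n p \<eta> lam z) \<rho> \<mu> lam L \<epsilon>"

lemma w_star_eq: "w_star (S.zc z) = S.gm z"
proof -
  interpret r: disco_run d m n p B \<eta> lam \<gamma> "S.zc z" \<rho> \<mu> L by (rule S.run)
  show ?thesis unfolding S.gm_def by (rule r.G.arg_min_on_eq[OF r.emp_loss_eq])
qed

lemma terminates_optimal:
  assumes eps: "0 < \<epsilon>"
  shows "AE z in S.S. rounds \<epsilon> z \<noteq> \<infinity> \<and> (\<epsilon> \<le> exp (- 1) \<longrightarrow> f z (w_hat \<epsilon> z) - f z (w_star z) \<le> \<epsilon>)"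
  using S.AE_zc
proof (rule AE_mp, intro AE_I2 impI)
  fix z assume zz: "S.zc z = z"
  interpret r: disco_run d m n p B \<eta> lam \<gamma> "S.zc z" \<rho> \<mu> L by (rule S.run)
  have "rounds \<epsilon> (S.zc z) \<noteq> \<infinity>" by (rule r.rounds_bound(1)[OF eps rounds_general])
  moreover have "f (S.zc z) (w_hat \<epsilon> (S.zc z)) - f (S.zc z) (w_star (S.zc z)) \<le> \<epsilon>" if "\<epsilon> \<le> exp (- 1)"
  proof -
    have out: "w_hat \<epsilon> (S.zc z) \<in> carrier_vec d" unfolding disco_output_def by (rule r.it_carrier)
    have star: "w_star (S.zc z) = r.G.minimizer" by (rule r.G.arg_min_on_eq[OF r.emp_loss_eq])
    show ?thesis
      unfolding star r.emp_loss_eq[OF out] r.emp_loss_eq[OF r.G.minimizer_carrier]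
      by (rule r.output_optimal[OF eps that])
  qed
  ultimately show "rounds \<epsilon> z \<noteq> \<infinity> \<and> (\<epsilon> \<le> exp (- 1) \<longrightarrow> f z (w_hat \<epsilon> z) - f z (w_star z) \<le> \<epsilon>)"
    unfolding zz by blast
qed

lemma expected_rounds_le:
  assumes eps: "0 < \<epsilon>" and h: "(\<integral>\<^sup>+ z. ennreal ((norm2 (w_star z))\<^sup>2) \<partial>S.S) \<le> ennreal (D\<^sup>2)"
    and b: "B powr (4 / (p - 2)) \<le> b"
  shows "(\<integral>\<^sup>+ z. ennreal_of_enat (rounds \<epsilon> z) \<partial>S.S)
    \<le> ennreal (520000 * max b 1 * \<Lambda> ^ 5 * (max 1 (ln (1 / \<epsilon>)) + B ^ 3 * D / (\<gamma> * sqrt (real n))) * W)"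
proof -
  define b' where "b' = max b 1"
  have b': "B powr (4 / (p - 2)) \<le> b'" "1 \<le> b'" using b by (auto simp: b'_def)
  have "(\<integral>\<^sup>+ z. ennreal (S.gm z \<bullet> S.gm z) \<partial>S.S) = (\<integral>\<^sup>+ z. ennreal ((norm2 (w_star z))\<^sup>2) \<partial>S.S)"
  proof (rule nn_integral_cong_AE, rule AE_mp[OF S.AE_zc], intro AE_I2 impI)
    fix z assume "S.zc z = z"
    hence "w_star z = S.gm z" using w_star_eq[of z] by simp
    thus "ennreal (S.gm z \<bullet> S.gm z) = ennreal ((norm2 (w_star z))\<^sup>2)" by (simp add: S.norm2_sq)
  qed
  hence h': "(\<integral>\<^sup>+ z. ennreal (S.gm z \<bullet> S.gm z) \<partial>S.S) \<le> ennreal (D\<^sup>2)" using h by simp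
  obtain A0 R0 where A0: "A0 \<in> sets S.S" "S.S.prob A0 \<le> 4 / (1 + \<kappa>) ^ 4" "real R0 \<le> 2700 * \<Lambda> ^ 3 * W"
    "\<And>z k. z \<in> space S.S - A0 \<Longrightarrow> disco_pcg_rounds d m (local_loss n p \<eta> lam (S.zc z)) \<mu> lam L
      (disco_iter d m (local_loss n p \<eta> lam (S.zc z)) \<rho> \<mu> lam L k) \<le> enat R0"
    by (rule good_event) blast
  define g where "g = \<eta> * (3 + 2 * \<kappa>)"
  have gap: "S.gap0 z \<le> g" for z
    unfolding g_def \<kappa>_def by (rule disco_run.gap_init_bound[OF S.run])
  have q2: "q\<^sup>2 \<le> \<Lambda>\<^sup>2" using q_le q1 by (intro power_mono) auto
  have Y: "0 \<le> B ^ 3 * D / (\<gamma> * sqrt (real n))" using B D gam by simp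
  have "(\<integral>\<^sup>+ z. ennreal_of_enat (rounds \<epsilon> z) \<partial>S.S)
    \<le> ennreal (1 + (20 * (\<rho> / 2 * D\<^sup>2 + S.stab) + 21 + 5 * max 1 (ln (1 / \<epsilon>))) * real R0
        + (20 * g + 21 + 5 * max 1 (ln (1 / \<epsilon>))) * real Rb * S.S.prob A0)"
    using D by (intro S.expected_rounds[OF _ h' eps A0(1) A0(4) rounds_general gap]) auto
  also have "\<dots> \<le> ennreal (520000 * b' * \<Lambda> ^ 5 * (max 1 (ln (1 / \<epsilon>)) + B ^ 3 * D / (\<gamma> * sqrt (real n))) * W)"
  proof (intro ennreal_leI smallness_combination)
    show "0 \<le> \<rho> / 2 * D\<^sup>2 + S.stab"
      unfolding S.stab_def using rho_pos lam_pos by simp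
    have "\<rho> / 2 * D\<^sup>2 + S.stab \<le> 9 * q\<^sup>2 * b' * (B ^ 3 * D / (\<gamma> * sqrt (real n)))"
      unfolding S.stab_def by (rule initial_gap_le[OF b'(1)])
    also have "\<dots> \<le> 9 * \<Lambda>\<^sup>2 * b' * (B ^ 3 * D / (\<gamma> * sqrt (real n)))"
      using q2 b' Y by (intro mult_right_mono mult_left_mono) auto
    finally show "\<rho> / 2 * D\<^sup>2 + S.stab \<le> 9 * \<Lambda>\<^sup>2 * b' * (B ^ 3 * D / (\<gamma> * sqrt (real n)))" .
    show "0 \<le> g" unfolding g_def using eta_pos kappa by simp
    have "\<eta> \<le> 3 * \<Lambda>\<^sup>2 * b' * \<kappa>"
    proof -
      have "3 * q\<^sup>2 * b' * \<kappa> \<le> 3 * \<Lambda>\<^sup>2 * b' * \<kappa>"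
        using q2 b' kappa by (intro mult_right_mono mult_left_mono) auto
      thus ?thesis using eta_le[OF b'(1)] by linarith
    qed
    thus "g \<le> 3 * \<Lambda>\<^sup>2 * b' * \<kappa> * (3 + 2 * \<kappa>)"
      unfolding g_def using kappa by (intro mult_right_mono) auto
  qed (use Lam_parts(1) W_ge_1 b'(2) Y kappa A0(2,3) Rb_le in auto)
  finally show ?thesis by (simp only: b'_def)
qed

lemma conclusion:
  assumes "0 < \<epsilon>" "(\<integral>\<^sup>+ z. ennreal ((norm2 (w_star z))\<^sup>2) \<partial>S.S) \<le> ennreal (D\<^sup>2)"
  shows "(AE z in S.S. rounds \<epsilon> z \<noteq> \<infinity> \<and> (\<epsilon> \<le> exp (- 1) \<longrightarrow> f z (w_hat \<epsilon> z) - f z (w_star z) \<le> \<epsilon>)) \<and>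
    (B powr (4 / (p - 2)) \<le> b \<longrightarrow> (\<integral>\<^sup>+ z. ennreal_of_enat (rounds \<epsilon> z) \<partial>S.S)
      \<le> ennreal (520000 * max b 1 * \<Lambda> ^ 5 * (max 1 (ln (1 / \<epsilon>)) + B ^ 3 * D / (\<gamma> * sqrt (real n))) * W))"
  using terminates_optimal[OF assms(1)] expected_rounds_le[OF assms] by blast

lemmas conclusion_expanded = conclusion[unfolded \<mu>_def radius_def \<delta>_def \<rho>_def L_def lam_def \<eta>_def p_def \<Lambda>_def W_def]

end

lemma corollary_dataI:
  assumes "0 < d" "0 < m" "0 < n" "0 < B" "0 < \<gamma>" "0 < D" "3 \<le> 2 + ln (1 / \<gamma>)"
    and "X \<subseteq> carrier_vec d" "\<forall>x\<in>X. norm2 x \<le> B" "prob_space P" "sets P = sets (borel_vec d \<Otimes>\<^sub>M borel)"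
    and "AE s in P. fst s \<in> X \<and> snd s \<in> {-1, 1}"
  shows "corollary_data d m n B \<gamma> D X P"
  using assms by (intro corollary_data.intro parameters.intro corollary_data_axioms.intro) auto

lemmas communication_bound = corollary_data.conclusion_expanded[OF corollary_dataI]

theorem corollary6:
  shows "\<exists>q::nat. \<forall>b::real. \<exists>C>0.
    \<forall>(d::nat) (m::nat) (n::nat) (B::real) (\<gamma>::real) (D::real) (\<epsilon>::real)
      (X :: rvec set) (P :: (rvec \<times> real) measure).
      0 < d \<longrightarrow> 0 < m \<longrightarrow> 0 < n \<longrightarrow> 0 < B \<longrightarrow> 0 < \<gamma> \<longrightarrow> 0 < D \<longrightarrow> 0 < \<epsilon> \<longrightarrow>
      X \<subseteq> carrier_vec d \<longrightarrow> (\<forall>x\<in>X. norm2 x \<le> B) \<longrightarrow>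
      prob_space P \<longrightarrow> sets P = sets (borel_vec d \<Otimes>\<^sub>M borel) \<longrightarrow>
      (AE s in P. fst s \<in> X \<and> snd s \<in> {-1, 1}) \<longrightarrow>
      (let p = 2 + ln (1 / \<gamma>);
           \<eta> = (p - 2)\<^sup>2 * B powr (2 + 4 / (p - 2)) / (4 * \<gamma> powr (1 + 2 / (p - 2)));
           lam = \<eta> * \<gamma>;
           V0 = \<eta>;
           G = \<eta> * B;
           L = \<eta> * (B\<^sup>2 + \<gamma>);
           M = \<eta> * (p - 2) * B ^ 3;
           \<rho> = disco_rho n G D;
           \<mu> = disco_mu d m n L M (disco_radius V0 G lam) (disco_delta n V0 G L lam D);
           S = Pi\<^sub>M ({..<m} \<times> {..<n}) (\<lambda>_. P);
           f = (\<lambda>z w. \<eta> * emp_loss m n p \<gamma> z w);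
           w_star = (\<lambda>z. arg_min_on (f z) (carrier_vec d));
           T = (\<lambda>z. disco_rounds d m (local_loss n p \<eta> lam z) \<rho> \<mu> lam L \<epsilon>);
           w_hat = (\<lambda>z. disco_output d m (local_loss n p \<eta> lam z) \<rho> \<mu> lam L \<epsilon>)
       in 3 \<le> p \<longrightarrow>
          (\<integral>\<^sup>+ z. ennreal ((norm2 (w_star z))\<^sup>2) \<partial>S) \<le> ennreal (D\<^sup>2) \<longrightarrow>
          (AE z in S. T z \<noteq> \<infinity> \<and> (\<epsilon> \<le> exp (-1) \<longrightarrow> f z (w_hat z) - f z (w_star z) \<le> \<epsilon>)) \<and>
          (B powr (4 / (p - 2)) \<le> b \<longrightarrow>
            (\<integral>\<^sup>+ z. ennreal_of_enat (T z) \<partial>S) \<le>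
              ennreal (C * log_terms d m n B \<gamma> D ^ q *
                (max 1 (ln (1 / \<epsilon>)) + B ^ 3 * D / (\<gamma> * sqrt (real n))) *
                (1 + B * real d powr (1/4) / (\<gamma> powr (1/2) * real n powr (1/4))))))"
  \<comment> \<open>The exponent 5: two from \<open>q\<^sup>2\<close> in \<open>\<eta>\<close>,
    three from the rounds per Newton step, namely the condition number, the deviation factor and the
    logarithmic accuracy.\<close>
  apply (rule exI[of _ 5], rule allI)
  subgoal for b
    apply (rule exI[of _ "520000 * max b 1"], rule conjI, simp)
    apply (intro allI impI)
    apply (unfold Let_def)
    apply (intro impI)
    apply (rule communication_bound)
                 apply assumption+
    done
  done

end
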